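(* Let $(W,\mathcal{L})$ be the classical Enriques-Fano threefold $W\subset\mathbb{P}^{13}$, with $\mathcal{L}$ the linear system of its hyperplane sections. Let $\mathcal{L}_{\bullet}\subset \mathcal{L}$ be the sublinear system of the hyperplane sections of $W$ having a triple point at a general point $w \in W$. Then (i) a general $S_{\bullet}\in \mathcal{L}_{\bullet}$ is birational to an elliptic ruled surface; (ii) the image of $W$ via the rational map defined by $\mathcal{L}_{\bullet}$ is a Cayley cubic surface, that is a cubic Del Pezzo surface in $\mathbb{P}^{3}$ (where $3=13-10$) with four singular points.
   Context: We work over $\mathbb{C}$. Classical Enriques-Fano threefold: let $T\subset\mathbb{P}^3$ be a tetrahedron (up to a change of coordinates, $T=\{s_0s_1s_2s_3=0\}$ in $\mathbb{P}^3_{[s_0:s_1:s_2:s_3]}$), and let $\mathcal{S}$ be the linear system of the sextic surfaces of $\mathbb{P}^3$ having double points along the six edges of $T$, i.e. the surfaces $$\lambda_0s_1^2s_2^2s_3^2+ \lambda_1s_0^2s_2^2s_3^2+\lambda_2s_0^2s_1^2s_3^2+\lambda_3s_0^2s_1^2s_2^2+ s_0s_1s_2s_3Q(s_0,s_1,s_2,s_3)=0,$$ with $\lambda_0,\dots,\lambda_3\in\mathbb{C}$ and $Q$ a quadratic form. One has $\dim\mathcal{S}=13$, and the rational map $\nu_{\mathcal{S}}:\mathbb{P}^3\dashrightarrow\mathbb{P}^{13}$ defined by $\mathcal{S}$ is birational onto its image. The classical Enriques-Fano threefold is (the closure of) this image $W=W_F^{13}\subset\mathbb{P}^{13}$, endowed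 with the linear system $\mathcal{L}$ of its hyperplane sections (whose general element is an Enriques surface). "Having a triple point at $w$" is understood as a linear condition, i.e. multiplicity at least $3$ at $w$. A ruled surface over a smooth irreducible curve $\Gamma$ is a smooth surface $R$ with a surjective morphism $R\to\Gamma$ whose general fibre is isomorphic to $\mathbb{P}^1$ (equivalently, $R$ is birational to $\Gamma\times\mathbb{P}^1$); it is an elliptic ruled surface if $\Gamma$ has genus $1$. The Cayley cubic surface is the image of $\mathbb{P}^2$ in $\mathbb{P}^3$ via the rational map defined by the linear system of the plane cubics passing through the six vertices of a complete quadrilateral; its four singular points are nodes (double points whose tangent cone is a quadric cone). *)

theory Defs
  imports
    Complex_Main
    "HOL-Library.Poly_Mapping"
    "HOL-Computational_Algebra.Factorial_Ring"
begin

section \<open>Polynomials\<close>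

text \<open>
  Complex polynomials in countably many variables: a monomial is a finitely supported exponent
  vector, a polynomial a finitely supported family of coefficients.
\<close>

type_synonym mpoly = "(nat \<Rightarrow>\<^sub>0 nat) \<Rightarrow>\<^sub>0 complex"

definition cst :: "complex \<Rightarrow> mpoly" where
  "cst c = Poly_Mapping.single 0 c"

definition var :: "nat \<Rightarrow> mpoly" where
  "var i = Poly_Mapping.single (Poly_Mapping.single i 1) 1"

definition mpeval :: "mpoly \<Rightarrow> (nat \<Rightarrow> complex) \<Rightarrow> complex" where
  "mpeval p x = (\<Sum>m\<in>Poly_Mapping.keys p. Poly_Mapping.lookup p m *
      (\<Prod>i\<in>Poly_Mapping.keys m. x i ^ Poly_Mapping.lookup m i))"

definition pdiff :: "nat \<Rightarrow> mpoly \<Rightarrow> mpoly" where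
  "pdiff i p = (\<Sum>m\<in>Poly_Mapping.keys p.
      Poly_Mapping.single (m - Poly_Mapping.single i 1)
        (of_nat (Poly_Mapping.lookup m i) * Poly_Mapping.lookup p m))"

text \<open>The polynomial ring \<open>\<complex>[x\<^sub>0,\<dots>,x\<^sub>n]\<close> and its homogeneous part of degree \<open>d\<close> (with \<open>0\<close>).\<close>

definition polys :: "nat \<Rightarrow> mpoly set" where
  "polys n = {p. \<forall>m\<in>Poly_Mapping.keys p. Poly_Mapping.keys m \<subseteq> {..n}}"

definition forms :: "nat \<Rightarrow> nat \<Rightarrow> mpoly set" where
  "forms n d = {p \<in> polys n. \<forall>m\<in>Poly_Mapping.keys p.
      (\<Sum>i\<in>Poly_Mapping.keys m. Poly_Mapping.lookup m i) = d}"

definition scale :: "complex \<Rightarrow> mpoly \<Rightarrow> mpoly" where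
  "scale c p = cst c * p"

global_interpretation mp: vector_space scale
  by standard
    (simp_all add: scale_def cst_def algebra_simps single_add mult_single flip: mult.assoc)

definition is_basis :: "(nat \<Rightarrow> mpoly) \<Rightarrow> nat \<Rightarrow> mpoly set \<Rightarrow> bool" where
  "is_basis b r V \<longleftrightarrow>
     inj_on b {..r} \<and> mp.independent (b ` {..r}) \<and> mp.span (b ` {..r}) = V"


section \<open>Projective varieties\<close>

text \<open>A point is the set of all its homogeneous coordinate vectors.\<close>

type_synonym point = "(nat \<Rightarrow> complex) set"

definition pt :: "(nat \<Rightarrow> complex) \<Rightarrow> point" where
  "pt x = {\<lambda>i. c * x i | c. c \<noteq> 0}"

definition proj :: "nat \<Rightarrow> point set" where
  "proj n = {pt x | x. x \<noteq> (\<lambda>_. 0) \<and> (\<forall>i>n. x i = 0)}"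

definition vanishes :: "mpoly \<Rightarrow> point \<Rightarrow> bool" where
  "vanishes f P \<longleftrightarrow> (\<forall>x\<in>P. mpeval f x = 0)"

definition zero_locus :: "nat \<Rightarrow> mpoly set \<Rightarrow> point set" where
  "zero_locus n F = {P \<in> proj n. \<forall>f\<in>F. vanishes f P}"

text \<open>
  This is the homogeneous ideal of \<open>X\<close>: vanishing on all coordinate vectors of a point forces
  each homogeneous component to vanish there.
\<close>

definition ideal_of :: "nat \<Rightarrow> point set \<Rightarrow> mpoly set" where
  "ideal_of n X = {f \<in> polys n. \<forall>P\<in>X. vanishes f P}"

definition zclosed :: "nat \<Rightarrow> point set \<Rightarrow> bool" where
  "zclosed n Z \<longleftrightarrow> (\<exists>F \<subseteq> (\<Union>d. forms n d). Z = zero_locus n F)"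

definition zclosure :: "nat \<Rightarrow> point set \<Rightarrow> point set" where
  "zclosure n A = \<Inter>{Z. zclosed n Z \<and> A \<subseteq> Z}"

definition variety :: "nat \<Rightarrow> point set \<Rightarrow> bool" where
  "variety n X \<longleftrightarrow> zclosed n X \<and> X \<noteq> {} \<and>
     (\<forall>A B. zclosed n A \<and> zclosed n B \<and> X \<subseteq> A \<union> B \<longrightarrow> X \<subseteq> A \<or> X \<subseteq> B)"

text \<open>A general point of an irreducible set \<open>X\<close> satisfies \<open>\<Phi>\<close>.\<close>

definition generally :: "nat \<Rightarrow> point set \<Rightarrow> (point \<Rightarrow> bool) \<Rightarrow> bool" where
  "generally n X \<Phi> \<longleftrightarrow> (\<exists>Z. zclosed n Z \<and> \<not> X \<subseteq> Z \<and> (\<forall>P\<in>X - Z. \<Phi> P))"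

text \<open>
  \<open>X\<close> is smooth of dimension \<open>d\<close> at \<open>P\<close>: in a neighbourhood of \<open>P\<close> it is cut out by \<open>n - d\<close> forms
  whose differentials at \<open>P\<close> are linearly independent (Jacobian criterion).
\<close>

definition smooth_at :: "nat \<Rightarrow> nat \<Rightarrow> point set \<Rightarrow> point \<Rightarrow> bool" where
  "smooth_at n d X P \<longleftrightarrow> P \<in> X \<and> d \<le> n \<and>
     (\<exists>f Z. (\<forall>i<n - d. f i \<in> ideal_of n X \<and> (\<exists>e. f i \<in> forms n e)) \<and>
        zclosed n Z \<and> P \<notin> Z \<and>
        (\<forall>Q\<in>proj n - Z. (\<forall>i<n - d. vanishes (f i) Q) \<longrightarrow> Q \<in> X) \<and>
        (\<forall>x\<in>P. \<forall>c :: nat \<Rightarrow> complex.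
           (\<forall>j\<le>n. (\<Sum>i<n - d. c i * mpeval (pdiff j (f i)) x) = 0) \<longrightarrow> (\<forall>i<n - d. c i = 0)))"

definition smooth :: "nat \<Rightarrow> nat \<Rightarrow> point set \<Rightarrow> bool" where
  "smooth n d X \<longleftrightarrow> (\<forall>P\<in>X. smooth_at n d X P)"

definition sing :: "nat \<Rightarrow> nat \<Rightarrow> point set \<Rightarrow> point set" where
  "sing n d X = {P \<in> X. \<not> smooth_at n d X P}"


section \<open>Regular and rational maps\<close>

definition hvec :: "nat \<Rightarrow> (nat \<Rightarrow> mpoly) \<Rightarrow> (nat \<Rightarrow> complex) \<Rightarrow> nat \<Rightarrow> complex" where
  "hvec m F x = (\<lambda>i. if i \<le> m then mpeval (F i) x else 0)"

text \<open>
  \<open>U\<close> and \<open>V\<close> below are locally closed subsets of projective spaces; \<open>f\<close> is regular if it is locally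
  given by forms of equal degree without common zeros.
\<close>

definition regular :: "nat \<Rightarrow> point set \<Rightarrow> nat \<Rightarrow> (point \<Rightarrow> point) \<Rightarrow> bool" where
  "regular n U m f \<longleftrightarrow>
     (\<forall>P\<in>U. \<exists>F d Z. (\<forall>i\<le>m. F i \<in> forms n d) \<and> zclosed n Z \<and> P \<notin> Z \<and>
        (\<forall>Q\<in>U - Z. \<forall>x\<in>Q. hvec m F x \<noteq> (\<lambda>_. 0) \<and> f Q = pt (hvec m F x)))"

definition isomorphic :: "nat \<Rightarrow> point set \<Rightarrow> nat \<Rightarrow> point set \<Rightarrow> bool" where
  "isomorphic n U m V \<longleftrightarrow>
     (\<exists>f g. regular n U m f \<and> regular m V n g \<and> f ` U \<subseteq> V \<and> g ` V \<subseteq> U \<and>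
        (\<forall>P\<in>U. g (f P) = P) \<and> (\<forall>Q\<in>V. f (g Q) = Q))"

definition birational :: "nat \<Rightarrow> point set \<Rightarrow> nat \<Rightarrow> point set \<Rightarrow> bool" where
  "birational n X m Y \<longleftrightarrow> variety n X \<and> variety m Y \<and>
     (\<exists>Z Z'. zclosed n Z \<and> zclosed m Z' \<and> \<not> X \<subseteq> Z \<and> \<not> Y \<subseteq> Z' \<and>
        isomorphic n (X - Z) m (Y - Z'))"

text \<open>
  The image (as a closed subset of \<open>\<PP>\<^sup>m\<close>) of \<open>X\<close> under the rational map
  \<open>[F\<^sub>0 : \<dots> : F\<^sub>m]\<close>; for a linear system, \<open>F\<close> is one of its bases.
\<close>

definition rational_image :: "nat \<Rightarrow> nat \<Rightarrow> point set \<Rightarrow> (nat \<Rightarrow> mpoly) \<Rightarrow> point set" where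
  "rational_image n m X F =
     zclosure m {pt (hvec m F x) | x P. P \<in> X \<and> x \<in> P \<and> hvec m F x \<noteq> (\<lambda>_. 0)}"


section \<open>Hyperplane sections and multiplicities\<close>

definition hyp_section :: "nat \<Rightarrow> point set \<Rightarrow> mpoly \<Rightarrow> point set" where
  "hyp_section n X l = {P \<in> X. vanishes l P}"

text \<open>For an ideal \<open>I\<close> and \<open>k > 0\<close>, the sums of products of \<open>k\<close> elements of \<open>I\<close> form the ideal \<open>I\<^sup>k\<close>.\<close>

definition ideal_power :: "mpoly set \<Rightarrow> nat \<Rightarrow> mpoly set" where
  "ideal_power I k = {(\<Sum>i<r. \<Prod>j<k. B i j) | (r :: nat) (B :: nat \<Rightarrow> nat \<Rightarrow> mpoly).
      \<forall>i<r. \<forall>j<k. B i j \<in> I}"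

text \<open>
  The divisor cut out by the form \<open>F\<close> on \<open>X\<close> has multiplicity at least \<open>k > 0\<close> at \<open>P \<in> X\<close>, i.e. its
  local equation is in the \<open>k\<close>-th power of the maximal ideal of \<open>\<O>\<^bsub>X,P\<^esub>\<close>.  As this local ring is the
  degree 0 part of the localization of \<open>\<complex>[x\<^sub>0,\<dots>,x\<^sub>n] / I(X)\<close> at \<open>I(P)\<close>, this means that
  \<open>G F \<in> I(P)\<^sup>k + I(X)\<close> for some form \<open>G\<close> not vanishing at \<open>P\<close>.
\<close>

definition mult_ge :: "nat \<Rightarrow> point set \<Rightarrow> point \<Rightarrow> nat \<Rightarrow> mpoly \<Rightarrow> bool" where
  "mult_ge n X P k F \<longleftrightarrow>
     (\<exists>G e. G \<in> forms n e \<and> \<not> vanishes G P \<and>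
        (\<exists>A \<in> ideal_power (ideal_of n {P}) k. G * F - A \<in> ideal_of n X))"

text \<open>The linear forms cutting out the hyperplane sections of \<open>X\<close> with a triple point at \<open>w\<close>.\<close>

definition triple_point_system :: "nat \<Rightarrow> point set \<Rightarrow> point \<Rightarrow> mpoly set" where
  "triple_point_system n X w = {l \<in> forms n 1. mult_ge n X w 3 l}"


section \<open>Elliptic ruled surfaces\<close>

text \<open>Dimension of the degree \<open>t\<close> part of the homogeneous coordinate ring.\<close>

definition hilbert_fun :: "nat \<Rightarrow> point set \<Rightarrow> nat \<Rightarrow> int" where
  "hilbert_fun n X t =
     int (mp.dim (forms n t)) - int (mp.dim (forms n t \<inter> ideal_of n X))"

text \<open>
  The genus of a smooth projective curve, read off from its Hilbert polynomial
  \<open>deg \<cdot> t + 1 - g\<close>.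
\<close>

definition has_genus :: "nat \<Rightarrow> point set \<Rightarrow> nat \<Rightarrow> bool" where
  "has_genus n C g \<longleftrightarrow> (\<exists>e t0. \<forall>t\<ge>t0. hilbert_fun n C t = e * int t + 1 - int g)"

definition ruled_surface :: "nat \<Rightarrow> point set \<Rightarrow> nat \<Rightarrow> point set \<Rightarrow> bool" where
  "ruled_surface n R m C \<longleftrightarrow>
     variety m C \<and> smooth m 1 C \<and> variety n R \<and> smooth n 2 R \<and>
     (\<exists>f. regular n R m f \<and> f ` R = C \<and>
        generally m C (\<lambda>c. isomorphic n {P \<in> R. f P = c} 1 (proj 1)))"

definition elliptic_ruled_surface :: "nat \<Rightarrow> point set \<Rightarrow> bool" where
  "elliptic_ruled_surface n R \<longleftrightarrow> (\<exists>m C. ruled_surface n R m C \<and> has_genus m C 1)"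


section \<open>Cayley cubic surfaces\<close>

text \<open>Four lines in the plane, no three of which are concurrent.\<close>

definition complete_quadrilateral :: "(nat \<Rightarrow> mpoly) \<Rightarrow> bool" where
  "complete_quadrilateral l \<longleftrightarrow> (\<forall>i<4. l i \<in> forms 2 1) \<and>
     (\<forall>i j k. i < j \<and> j < k \<and> k < 4 \<longrightarrow> zero_locus 2 {l i, l j, l k} = {})"

definition quadrilateral_vertices :: "(nat \<Rightarrow> mpoly) \<Rightarrow> point set" where
  "quadrilateral_vertices l = (\<Union>j<4. \<Union>i<j. zero_locus 2 {l i, l j})"

definition cayley_cubic :: "point set \<Rightarrow> bool" where
  "cayley_cubic Y \<longleftrightarrow>
     (\<exists>l b. complete_quadrilateral l \<and>
        is_basis b 3 (forms 2 3 \<inter> ideal_of 2 (quadrilateral_vertices l)) \<and>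
        Y = rational_image 2 3 (proj 2) b)"

text \<open>
  The surface \<open>F = 0\<close> in \<open>\<PP>\<^sup>3\<close> has a node at \<open>P\<close>: the gradient vanishes, and the Hessian quadratic
  form, which defines the tangent cone, has as kernel only the line of \<open>P\<close> itself (it is in the
  kernel by Euler's formula), so the tangent cone is a quadric cone with vertex \<open>P\<close>.
\<close>

definition node :: "mpoly \<Rightarrow> point \<Rightarrow> bool" where
  "node F P \<longleftrightarrow> (\<forall>x\<in>P. (\<forall>i\<le>3. mpeval (pdiff i F) x = 0) \<and>
     (\<forall>v. (\<forall>i>3. v i = 0) \<and> (\<forall>i\<le>3. (\<Sum>j\<le>3. mpeval (pdiff i (pdiff j F)) x * v j) = 0)
        \<longrightarrow> (\<exists>c. v = (\<lambda>i. c * x i))))"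

text \<open>
  Such a surface is a cubic Del Pezzo surface: it is normal and Gorenstein (its singularities are
  isolated rational double points of type \<open>A\<^sub>1\<close>), with ample anticanonical class \<open>\<O>(1)\<close>.
\<close>

definition four_nodal_cubic_surface :: "point set \<Rightarrow> bool" where
  "four_nodal_cubic_surface Y \<longleftrightarrow>
     (\<exists>F \<in> forms 3 3. irreducible F \<and> Y = zero_locus 3 {F} \<and>
        card (sing 3 2 Y) = 4 \<and> (\<forall>P\<in>sing 3 2 Y. node F P))"


section \<open>The classical Enriques-Fano threefold\<close>

text \<open>
  The sextics with double points along the edges of the tetrahedron \<open>s\<^sub>0 s\<^sub>1 s\<^sub>2 s\<^sub>3 = 0\<close>.
\<close>

definition enriques_sextics :: "mpoly set" where
  "enriques_sextics =
     {(\<Sum>i\<le>3. scale (a i) (\<Prod>j\<in>{..3} - {i}. var j ^ 2)) + (\<Prod>j\<le>3. var j) * Q | a Q.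
        Q \<in> forms 3 2}"

definition classical_enriques_fano :: "point set \<Rightarrow> bool" where
  "classical_enriques_fano W \<longleftrightarrow>
     (\<exists>b. is_basis b 13 enriques_sextics \<and> W = rational_image 3 13 (proj 3) b)"

end

theory Submission
  imports Defs "HOL-Computational_Algebra.Fundamental_Theorem_Algebra"
begin

text \<open>
  In the coordinates \<open>U\<^sub>i = s\<^sub>0s\<^sub>1s\<^sub>2s\<^sub>3 / s\<^sub>i\<^sup>2\<close> and \<open>Q\<^sub>i\<^sub>j = s\<^sub>i s\<^sub>j\<close> the threefold is toric, and its torus moves a
  general point to \<open>w = [1 : 1 : 1 : 1]\<close>.  Restricting a linear form to the curves through \<open>w\<close> on
  which one or two of the \<open>s\<^sub>i\<close> vary shows that the sections with a triple point at \<open>w\<close> are spanned by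
  \<open>\<ell>\<^sub>a = \<Prod>\<^sub>j\<^sub>\<noteq>\<^sub>a (s\<^sub>a - s\<^sub>j) / s\<^sub>a\<close>.  These satisfy \<open>\<Sum>\<^sub>a 1 / \<ell>\<^sub>a = 0\<close>, the equation of the Cayley cubic,
  and together with \<open>v = (s\<^sub>0 - s\<^sub>1) / (s\<^sub>2 - s\<^sub>3)\<close> they determine \<open>[s]\<close>.

  So a section \<open>\<Sum>\<^sub>a c\<^sub>a \<ell>\<^sub>a = 0\<close> is birational to the product of the line with the plane section
  \<open>\<Sum>\<^sub>a c\<^sub>a y\<^sub>a = 0\<close> of the cubic.  For \<open>k = y\<^sub>0 / y\<^sub>1\<close> and \<open>r = y\<^sub>2 / y\<^sub>3\<close> that curve is quadratic in \<open>r\<close>, with a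
  discriminant of degree four in \<open>k\<close>, and sending a root of the discriminant to infinity gives a smooth
  Weierstrass cubic.  The section is irreducible because its points on the toric boundary, as well
  as those where the parametrization is undefined, are limits of general points, by continuity of
  the roots of polynomials with constant degree.
\<close>

section \<open>Evaluation of polynomials\<close>

text \<open>The identity \<open>\<Sum>\<^sub>a 1 / \<ell>\<^sub>a = 0\<close> says that the divided
  difference of the function t at the nodes \<open>s\<^sub>0, \<dots>, s\<^sub>3\<close> vanishes,
  as it does for every polynomial of degree below three. The section \<open>\<ell>\<^sub>a\<close>
  pulls back to six planes, the faces \<open>s\<^sub>j = 0\<close> and the planes
  \<open>s\<^sub>a = s\<^sub>j\<close> with j \<noteq> a; the latter three contain w, whence the
  triple point. The obstacle is irreducibility, since a hyperplane section could have a component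
  inside the toric boundary. Away from eight fixed points of the torus, W is covered by charts in
  which the section with coefficients c is a cubic in one coordinate with leading coefficient
  \<open>- c\<^sub>i\<close>, so its roots cannot escape when the other two coordinates are moved
  off the boundary; at the eight points the section takes a nonzero multiple of some
  \<open>c\<^sub>a\<close> as its value. Forms are continuous, so Zariski closures contain limits of
  sequences, and these replace dimension arguments. Both W and the triple point system are given
  through arbitrary bases; invertible matrices carry them to the monomials and to the
  \<open>\<ell>\<^sub>a\<close>.\<close>

abbreviation (input) expo :: "(nat \<Rightarrow>\<^sub>0 nat) \<Rightarrow> nat \<Rightarrow> nat" where
  "expo \<equiv> Poly_Mapping.lookup"

abbreviation (input) coef :: "mpoly \<Rightarrow> (nat \<Rightarrow>\<^sub>0 nat) \<Rightarrow> complex" where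
  "coef \<equiv> Poly_Mapping.lookup"

definition mono_eval :: "(nat \<Rightarrow>\<^sub>0 nat) \<Rightarrow> (nat \<Rightarrow> complex) \<Rightarrow> complex" where
  "mono_eval m x = (\<Prod>i\<in>Poly_Mapping.keys m. x i ^ expo m i)"

definition mono_deg :: "(nat \<Rightarrow>\<^sub>0 nat) \<Rightarrow> nat" where
  "mono_deg m = (\<Sum>i\<in>Poly_Mapping.keys m. expo m i)"

lemma mono_eval_superset:
  assumes "finite A" "Poly_Mapping.keys m \<subseteq> A"
  shows "mono_eval m x = (\<Prod>i\<in>A. x i ^ expo m i)"
  unfolding mono_eval_def
  by (rule prod.mono_neutral_left) (use assms in \<open>auto simp: in_keys_iff\<close>)

lemma mono_deg_superset:
  assumes "finite A" "Poly_Mapping.keys m \<subseteq> A"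
  shows "mono_deg m = (\<Sum>i\<in>A. expo m i)"
  unfolding mono_deg_def
  by (rule sum.mono_neutral_left) (use assms in \<open>auto simp: in_keys_iff\<close>)

lemma mono_eval_add: "mono_eval (m + m') x = mono_eval m x * mono_eval m' x"
proof -
  let ?A = "Poly_Mapping.keys m \<union> Poly_Mapping.keys m'"
  have "mono_eval (m + m') x = (\<Prod>i\<in>?A. x i ^ expo (m + m') i)"
    by (rule mono_eval_superset) (use keys_add[of m m'] in auto)
  also have "\<dots> = (\<Prod>i\<in>?A. x i ^ expo m i) * (\<Prod>i\<in>?A. x i ^ expo m' i)"
    by (simp add: lookup_add power_add prod.distrib)
  also have "\<dots> = mono_eval m x * mono_eval m' x"
    by (simp add: mono_eval_superset[of ?A])
  finally show ?thesis .
qed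

lemma mono_deg_add: "mono_deg (m + m') = mono_deg m + mono_deg m'"
proof -
  let ?A = "Poly_Mapping.keys m \<union> Poly_Mapping.keys m'"
  have "mono_deg (m + m') = (\<Sum>i\<in>?A. expo (m + m') i)"
    by (rule mono_deg_superset) (use keys_add[of m m'] in auto)
  also have "\<dots> = (\<Sum>i\<in>?A. expo m i) + (\<Sum>i\<in>?A. expo m' i)"
    by (simp add: lookup_add sum.distrib)
  also have "\<dots> = mono_deg m + mono_deg m'"
    by (simp add: mono_deg_superset[of ?A])
  finally show ?thesis .
qed

lemma mono_eval_0 [simp]: "mono_eval 0 x = 1"
  by (simp add: mono_eval_def)

lemma mono_deg_0 [simp]: "mono_deg 0 = 0"
  by (simp add: mono_deg_def)

lemma mono_eval_single [simp]: "mono_eval (Poly_Mapping.single i k) x = x i ^ k"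
  by (cases "k = 0") (simp_all add: mono_eval_def)

lemma mono_deg_single [simp]: "mono_deg (Poly_Mapping.single i k) = k"
  by (cases "k = 0") (simp_all add: mono_deg_def)

lemma mono_eval_mult: "mono_eval m (\<lambda>i. x i * y i) = mono_eval m x * mono_eval m y"
  by (simp add: mono_eval_def power_mult_distrib prod.distrib)

lemma mono_eval_scale: "mono_eval m (\<lambda>i. c * x i) = c ^ mono_deg m * mono_eval m x"
  by (simp add: mono_eval_def mono_deg_def power_mult_distrib prod.distrib power_sum)

lemma mpeval_superset:
  assumes "finite A" "Poly_Mapping.keys p \<subseteq> A"
  shows "mpeval p x = (\<Sum>m\<in>A. coef p m * mono_eval m x)"
  unfolding mpeval_def mono_eval_def
  by (rule sum.mono_neutral_left) (use assms in \<open>auto simp: in_keys_iff\<close>)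

lemma mpeval_add [simp]: "mpeval (p + q) x = mpeval p x + mpeval q x"
proof -
  let ?A = "Poly_Mapping.keys p \<union> Poly_Mapping.keys q"
  have "mpeval (p + q) x = (\<Sum>m\<in>?A. coef (p + q) m * mono_eval m x)"
    by (rule mpeval_superset) (use keys_add[of p q] in auto)
  then show ?thesis
    by (simp add: mpeval_superset[of ?A] lookup_add sum.distrib distrib_right)
qed

lemma mpeval_0 [simp]: "mpeval 0 x = 0"
  by (simp add: mpeval_def)

lemma mpeval_sum: "mpeval (sum f A) x = (\<Sum>a\<in>A. mpeval (f a) x)"
  by (induction A rule: infinite_finite_induct) simp_all

lemma mpeval_single [simp]: "mpeval (Poly_Mapping.single m c) x = c * mono_eval m x"
  by (cases "c = 0") (simp_all add: mpeval_def mono_eval_def)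

lemma mpoly_eq_sum_single: "p = (\<Sum>m\<in>Poly_Mapping.keys p. Poly_Mapping.single m (coef p m))"
  for p :: mpoly
proof (rule poly_mapping_eqI)
  fix k
  show "coef p k = coef (\<Sum>m\<in>Poly_Mapping.keys p. Poly_Mapping.single m (coef p m)) k"
    by (simp add: lookup_sum lookup_single when_def sum.delta in_keys_iff)
qed

lemma mpeval_mult [simp]: "mpeval (p * q) x = mpeval p x * mpeval q x"
proof -
  have 1: "mpeval (Poly_Mapping.single m c * Poly_Mapping.single m' c') x =
      mpeval (Poly_Mapping.single m c) x * mpeval (Poly_Mapping.single m' c') x" for m m' c c'
    by (simp add: mult_single mono_eval_add)
  have "mpeval (p * q) x = mpeval ((\<Sum>m\<in>Poly_Mapping.keys p. Poly_Mapping.single m (coef p m)) *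
      (\<Sum>m\<in>Poly_Mapping.keys q. Poly_Mapping.single m (coef q m))) x"
    by (simp flip: mpoly_eq_sum_single)
  also have "\<dots> = mpeval (\<Sum>m\<in>Poly_Mapping.keys p. Poly_Mapping.single m (coef p m)) x *
      mpeval (\<Sum>m\<in>Poly_Mapping.keys q. Poly_Mapping.single m (coef q m)) x"
    by (simp only: sum_product mpeval_sum 1)
  finally show ?thesis by (simp flip: mpoly_eq_sum_single)
qed

lemma mpeval_cst [simp]: "mpeval (cst c) x = c"
  by (simp add: cst_def)

lemma mpeval_var [simp]: "mpeval (var i) x = x i"
  by (simp add: var_def)

lemma mpeval_scale [simp]: "mpeval (scale c p) x = c * mpeval p x"
  by (simp add: scale_def)

lemma mpeval_1 [simp]: "mpeval 1 x = 1"
  using mpeval_cst[of 1] by (simp add: cst_def)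

lemma mpeval_uminus [simp]: "mpeval (- p) x = - mpeval p x"
  using mpeval_add[of p "- p" x] by (simp add: add_eq_0_iff del: mpeval_add)

lemma mpeval_diff [simp]: "mpeval (p - q) x = mpeval p x - mpeval q x"
  using mpeval_add[of p "- q"] by simp

lemma mpeval_power [simp]: "mpeval (p ^ k) x = mpeval p x ^ k"
  by (induction k) simp_all

lemma mpeval_numeral [simp]: "mpeval (numeral k) x = numeral k"
  by (induction k) (simp_all only: numeral.simps mpeval_add mpeval_1)

lemma mpeval_prod: "mpeval (prod f A) x = (\<Prod>a\<in>A. mpeval (f a) x)"
  by (induction A rule: infinite_finite_induct) simp_all

lemma cst_0 [simp]: "cst 0 = 0"
  by (simp add: cst_def)

lemma cst_1 [simp]: "cst 1 = 1"
  by (simp add: cst_def)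

lemma expo_sum_single: "m = (\<Sum>i\<in>Poly_Mapping.keys m. Poly_Mapping.single i (expo m i))"
  by (rule poly_mapping_eqI)
    (simp add: lookup_sum lookup_single when_def sum.delta in_keys_iff)

lemma var_power: "var i ^ k = Poly_Mapping.single (Poly_Mapping.single i k) 1"
proof (induction k)
  case (Suc k)
  have "Poly_Mapping.single i 1 + Poly_Mapping.single i k = Poly_Mapping.single i (Suc k)"
    by (metis plus_1_eq_Suc single_add)
  with Suc show ?case by (simp add: var_def mult_single)
qed simp

lemma prod_single_one:
  "(\<Prod>i\<in>A. Poly_Mapping.single (g i) (1 :: complex)) = Poly_Mapping.single (\<Sum>i\<in>A. g i) 1"
  for g :: "'a \<Rightarrow> nat \<Rightarrow>\<^sub>0 nat"
  by (induction A rule: infinite_finite_induct) (simp_all add: mult_single)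

lemma single_eq_prod_var:
  "Poly_Mapping.single m c = cst c * (\<Prod>i\<in>Poly_Mapping.keys m. var i ^ expo m i)"
proof -
  have "(\<Prod>i\<in>Poly_Mapping.keys m. var i ^ expo m i) =
      Poly_Mapping.single (\<Sum>i\<in>Poly_Mapping.keys m. Poly_Mapping.single i (expo m i)) 1"
    by (simp add: var_power prod_single_one)
  also have "\<dots> = Poly_Mapping.single m 1"
    by (simp flip: expo_sum_single)
  finally show ?thesis by (simp add: cst_def mult_single)
qed

lemma polys_induct [consumes 1, case_names cst var add mult]:
  assumes p: "p \<in> polys n"
    and cst: "\<And>c. P (cst c)"
    and var: "\<And>i. i \<le> n \<Longrightarrow> P (var i)"
    and add: "\<And>p q. P p \<Longrightarrow> P q \<Longrightarrow> P (p + q)"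
    and mult: "\<And>p q. P p \<Longrightarrow> P q \<Longrightarrow> P (p * q)"
  shows "P p"
proof -
  have P0: "P 0" and P1: "P 1" using cst[of 0] cst[of 1] by simp_all
  have pow: "P (q ^ k)" if "P q" for q k
    by (induction k) (use that P1 mult in auto)
  have prod: "P (prod f A)" if "finite A" "\<And>a. a \<in> A \<Longrightarrow> P (f a)" for f and A :: "nat set"
    using that by (induction A rule: finite_induct) (use P1 mult in auto)
  have sum: "P (sum f A)" if "finite A" "\<And>a. a \<in> A \<Longrightarrow> P (f a)" for f and A :: "(nat \<Rightarrow>\<^sub>0 nat) set"
    using that by (induction A rule: finite_induct) (use P0 add in auto)
  have "P (\<Sum>m\<in>Poly_Mapping.keys p. Poly_Mapping.single m (coef p m))"
  proof (rule sum)
    fix m assume m: "m \<in> Poly_Mapping.keys p"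
    have "P (\<Prod>i\<in>Poly_Mapping.keys m. var i ^ expo m i)"
      by (rule prod) (use m p in \<open>auto simp: polys_def intro!: var pow\<close>)
    then show "P (Poly_Mapping.single m (coef p m))"
      by (subst single_eq_prod_var) (intro mult cst)
  qed simp
  then show ?thesis by (simp flip: mpoly_eq_sum_single)
qed

lemma mpoly_in_polys: "\<exists>n. p \<in> polys n"
proof -
  have "finite (\<Union>m\<in>Poly_Mapping.keys p. Poly_Mapping.keys m)" by simp
  then obtain n where "\<forall>i\<in>(\<Union>m\<in>Poly_Mapping.keys p. Poly_Mapping.keys m). i \<le> n"
    using finite_nat_set_iff_bounded_le by blast
  then have "p \<in> polys n" by (auto simp: polys_def)
  then show ?thesis ..
qed

lemma polys_add: "p \<in> polys n \<Longrightarrow> q \<in> polys n \<Longrightarrow> p + q \<in> polys n"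
  using keys_add[of p q] by (auto simp: polys_def)

lemma polys_mult: "p \<in> polys n \<Longrightarrow> q \<in> polys n \<Longrightarrow> p * q \<in> polys n"
proof -
  assume pq: "p \<in> polys n" "q \<in> polys n"
  have "Poly_Mapping.keys m \<subseteq> {..n}" if m: "m \<in> Poly_Mapping.keys (p * q)" for m
  proof -
    obtain a b where ab: "m = a + b" "a \<in> Poly_Mapping.keys p" "b \<in> Poly_Mapping.keys q"
      using keys_mult[of p q] m by blast
    have "Poly_Mapping.keys m \<subseteq> Poly_Mapping.keys a \<union> Poly_Mapping.keys b"
      unfolding ab by (rule keys_add)
    also have "\<dots> \<subseteq> {..n}" using ab pq by (simp add: polys_def)
    finally show ?thesis .
  qed
  then show ?thesis by (simp add: polys_def)
qed

lemma polys_cst [simp]: "cst c \<in> polys n"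
  by (simp add: polys_def cst_def)

lemma polys_0 [simp]: "0 \<in> polys n"
  by (simp add: polys_def)

lemma polys_uminus: "p \<in> polys n \<Longrightarrow> - p \<in> polys n"
  by (simp add: polys_def in_keys_iff)

lemma forms_altdef: "forms n d = {p \<in> polys n. \<forall>m\<in>Poly_Mapping.keys p. mono_deg m = d}"
  by (simp add: forms_def mono_deg_def)

lemma forms_polys: "p \<in> forms n d \<Longrightarrow> p \<in> polys n"
  by (simp add: forms_def)

lemma forms_0 [simp]: "0 \<in> forms n d"
  by (simp add: forms_def)

lemma forms_add: "p \<in> forms n d \<Longrightarrow> q \<in> forms n d \<Longrightarrow> p + q \<in> forms n d"
  using keys_add[of p q] by (auto simp: forms_altdef polys_add)

lemma forms_mult: "p \<in> forms n d \<Longrightarrow> q \<in> forms n e \<Longrightarrow> p * q \<in> forms n (d + e)"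
  using keys_mult[of p q] by (fastforce simp: forms_altdef polys_mult mono_deg_add)

lemma forms_cst [simp]: "cst c \<in> forms n 0"
  by (simp add: forms_altdef cst_def polys_def)

lemma forms_var: "i \<le> n \<Longrightarrow> var i \<in> forms n 1"
  by (simp add: forms_altdef var_def polys_def)

lemma forms_scale: "p \<in> forms n d \<Longrightarrow> scale c p \<in> forms n d"
  using forms_mult[of "cst c" n 0 p d] by (simp add: scale_def)

lemma forms_uminus: "p \<in> forms n d \<Longrightarrow> - p \<in> forms n d"
  by (simp add: forms_altdef polys_uminus in_keys_iff)

lemma forms_diff: "p \<in> forms n d \<Longrightarrow> q \<in> forms n d \<Longrightarrow> p - q \<in> forms n d"
  using forms_add[of p n d "- q"] forms_uminus[of q n d] by simp

lemma forms_sum: "(\<And>a. a \<in> A \<Longrightarrow> f a \<in> forms n d) \<Longrightarrow> sum f A \<in> forms n d"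
  by (induction A rule: infinite_finite_induct) (simp_all add: forms_add)

lemma forms_power: "p \<in> forms n d \<Longrightarrow> p ^ k \<in> forms n (d * k)"
proof (induction k)
  case 0
  then show ?case using forms_cst[of 1 n] by simp
next
  case (Suc k)
  then show ?case using forms_mult[of p n d "p ^ k" "d * k"] by simp
qed

lemma forms_subspace: "mp.subspace (forms n d)"
  by (rule mp.subspaceI) (simp_all add: forms_add forms_scale)

lemma forms_homogeneous:
  assumes "f \<in> forms n d"
  shows "mpeval f (\<lambda>i. c * x i) = c ^ d * mpeval f x"
  using assms
  by (simp add: mpeval_superset[OF finite_keys order_refl] mono_eval_scale forms_altdef
      sum_distrib_left algebra_simps)

lemma polys_cong:
  assumes "f \<in> polys n" "\<And>i. i \<le> n \<Longrightarrow> x i = y i"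
  shows "mpeval f x = mpeval f y"
  using assms(1) by (induction rule: polys_induct) (simp_all add: assms(2))

lemma mpeval_tendsto:
  assumes "\<And>i. ((\<lambda>n. y n i) \<longlongrightarrow> x i) F"
  shows "((\<lambda>n. mpeval f (y n)) \<longlongrightarrow> mpeval f x) F"
  unfolding mpeval_def by (intro tendsto_intros assms)

text \<open>Restriction to a polynomial curve brings in degrees, finiteness of roots and orders of
  vanishing of univariate polynomials.\<close>

lemma mpeval_along_poly: "\<exists>P. \<forall>t. mpeval f (\<lambda>i. poly (q i) t) = poly P t"
proof -
  obtain n where "f \<in> polys n" using mpoly_in_polys by blast
  then show ?thesis
  proof (induction rule: polys_induct)
    case (cst c)
    show ?case by (rule exI[of _ "[:c:]"]) simp
  next
    case (var i)
    show ?case by (rule exI[of _ "q i"]) simp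
  next
    case (add f g)
    then obtain P Q where "\<forall>t. mpeval f (\<lambda>i. poly (q i) t) = poly P t"
      "\<forall>t. mpeval g (\<lambda>i. poly (q i) t) = poly Q t" by blast
    then show ?case by (intro exI[of _ "P + Q"]) simp
  next
    case (mult f g)
    then obtain P Q where "\<forall>t. mpeval f (\<lambda>i. poly (q i) t) = poly P t"
      "\<forall>t. mpeval g (\<lambda>i. poly (q i) t) = poly Q t" by blast
    then show ?case by (intro exI[of _ "P * Q"]) simp
  qed
qed

lemma mpeval_along_line:
  "\<exists>P. \<forall>t. mpeval f (\<lambda>i. x i + t * v i) = poly P t"
  using mpeval_along_poly[of f "\<lambda>i. [:x i, v i:]"] by simp

text \<open>Distinct monomials are distinct characters of the torus, hence linearly independent.\<close>

lemma mono_eval_independent: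
  assumes "finite M"
    and "\<And>x. (\<And>i. x i \<noteq> 0) \<Longrightarrow> (\<Sum>m\<in>M. a m * mono_eval m x) = 0"
  shows "\<forall>m\<in>M. a m = (0 :: complex)"
  using assms
proof (induction M arbitrary: a rule: finite_induct)
  case empty
  show ?case by simp
next
  case (insert m0 M)
  have zero: "a m = 0" if m: "m \<in> M" for m
  proof -
    have "m \<noteq> m0" using m insert.hyps by auto
    then obtain i where i: "expo m i \<noteq> expo m0 i" by (meson poly_mapping_eqI)
    define y :: "nat \<Rightarrow> complex" where "y = (\<lambda>j. if j = i then 2 else 1)"
    have y0: "y j \<noteq> 0" for j by (simp add: y_def)
    have ev: "mono_eval m' y = 2 ^ expo m' i" for m'
    proof -
      have "mono_eval m' y = (\<Prod>j\<in>insert i (Poly_Mapping.keys m'). y j ^ expo m' j)"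
        by (rule mono_eval_superset) auto
      also have "\<dots> = (\<Prod>j\<in>insert i (Poly_Mapping.keys m'). if j = i then 2 ^ expo m' j else 1)"
        by (rule prod.cong) (auto simp: y_def)
      also have "\<dots> = 2 ^ expo m' i" by simp
      finally show ?thesis .
    qed
    have "(\<Sum>m\<in>M. (a m * (mono_eval m y - mono_eval m0 y)) * mono_eval m x) = 0"
      if x: "\<And>i. x i \<noteq> 0" for x
    proof -
      have "(\<Sum>m\<in>insert m0 M. a m * mono_eval m (\<lambda>i. x i * y i)) = 0"
        by (rule insert.prems) (use x y0 in simp)
      moreover have "(\<Sum>m\<in>insert m0 M. a m * mono_eval m x) * mono_eval m0 y = 0"
        using insert.prems[OF x] by simp
      ultimately have "a m0 * (mono_eval m0 x * mono_eval m0 y) +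
            (\<Sum>m\<in>M. a m * (mono_eval m x * mono_eval m y)) =
          a m0 * (mono_eval m0 x * mono_eval m0 y) +
            (\<Sum>m\<in>M. a m * (mono_eval m x * mono_eval m0 y))"
        using insert.hyps
        by (simp add: mono_eval_mult algebra_simps sum_distrib_left)
      then show ?thesis by (simp add: algebra_simps sum_subtractf)
    qed
    from insert.IH[OF this] m have "a m * (mono_eval m y - mono_eval m0 y) = 0" by blast
    moreover have "(2 :: complex) ^ expo m i \<noteq> 2 ^ expo m0 i"
    proof
      assume "(2 :: complex) ^ expo m i = 2 ^ expo m0 i"
      then have "norm ((2 :: complex) ^ expo m i) = norm ((2 :: complex) ^ expo m0 i)" by simp
      then have "(2 :: real) ^ expo m i = 2 ^ expo m0 i" by (simp add: norm_power)
      with i show False by simp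
    qed
    ultimately show ?thesis by (simp add: ev)
  qed
  moreover have "a m0 = 0"
    using insert.prems[of "\<lambda>_. 1"] insert.hyps zero by (simp add: mono_eval_def)
  ultimately show ?case by simp
qed

lemma mpoly_eq_0_torus:
  assumes "\<And>x. (\<And>i. x i \<noteq> 0) \<Longrightarrow> mpeval f x = 0"
  shows "f = 0"
proof -
  have "\<forall>m\<in>Poly_Mapping.keys f. coef f m = 0"
    by (rule mono_eval_independent)
      (use assms in \<open>simp_all add: mpeval_superset[OF finite_keys order_refl]\<close>)
  then show ?thesis by (intro poly_mapping_eqI) (auto simp: in_keys_iff)
qed

lemma mpoly_eqI:
  assumes "\<And>x. mpeval f x = mpeval g x"
  shows "f = g"
  using mpoly_eq_0_torus[of "f - g"] assms by simp

lemma mpeval_product_zero: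
  assumes "\<And>x. mpeval f x * mpeval g x = 0"
  shows "(\<forall>x. mpeval f x = 0) \<or> (\<forall>x. mpeval g x = 0)"
proof -
  have "f * g = 0" by (rule mpoly_eqI) (simp add: assms)
  then have "f = 0 \<or> g = 0" by simp
  then show ?thesis by auto
qed

subsection \<open>Partial derivatives\<close>

text \<open>The formal derivative is the analytic one, so the rules for \<open>pdiff\<close> and its
  values on explicit forms follow from uniqueness of derivatives instead of manipulation of
  coefficients.\<close>

lemma mpeval_pdiff:
  "((\<lambda>t. mpeval f (x(i := t))) has_field_derivative mpeval (pdiff i f) x) (at (x i))"
proof -
  have mono: "((\<lambda>t. mono_eval m (x(i := t))) has_field_derivative
      of_nat (expo m i) * mono_eval (m - Poly_Mapping.single i 1) x) (at (x i))" for m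
  proof -
    let ?A = "Poly_Mapping.keys m - {i}"
    define c where "c = (\<Prod>j\<in>?A. x j ^ expo m j)"
    have 1: "mono_eval m (x(i := t)) = t ^ expo m i * c" for t
    proof -
      have "mono_eval m (x(i := t)) = (\<Prod>j\<in>insert i ?A. (x(i := t)) j ^ expo m j)"
        by (rule mono_eval_superset) auto
      also have "\<dots> = t ^ expo m i * (\<Prod>j\<in>?A. (x(i := t)) j ^ expo m j)"
        by (subst prod.insert) auto
      also have "(\<Prod>j\<in>?A. (x(i := t)) j ^ expo m j) = c"
        unfolding c_def by (rule prod.cong) auto
      finally show ?thesis .
    qed
    have 2: "mono_eval (m - Poly_Mapping.single i 1) x = x i ^ (expo m i - 1) * c"
    proof -
      have sub: "Poly_Mapping.keys (m - Poly_Mapping.single i 1) \<subseteq> insert i ?A"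
        by (auto simp: in_keys_iff lookup_minus)
      have "mono_eval (m - Poly_Mapping.single i 1) x =
          (\<Prod>j\<in>insert i ?A. x j ^ expo (m - Poly_Mapping.single i 1) j)"
        by (rule mono_eval_superset) (use sub in auto)
      also have "\<dots> = x i ^ (expo m i - 1) *
          (\<Prod>j\<in>?A. x j ^ expo (m - Poly_Mapping.single i 1) j)"
        by (subst prod.insert) (auto simp: lookup_minus)
      also have "(\<Prod>j\<in>?A. x j ^ expo (m - Poly_Mapping.single i 1) j) = c"
        unfolding c_def by (rule prod.cong) (auto simp: lookup_minus lookup_single when_def)
      finally show ?thesis .
    qed
    show ?thesis unfolding 1 2 by (auto intro!: derivative_eq_intros)
  qed
  have "((\<lambda>t. \<Sum>m\<in>Poly_Mapping.keys f. coef f m * mono_eval m (x(i := t))) has_field_derivative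
     (\<Sum>m\<in>Poly_Mapping.keys f. coef f m *
       (of_nat (expo m i) * mono_eval (m - Poly_Mapping.single i 1) x))) (at (x i))"
    by (intro DERIV_sum DERIV_cmult mono)
  moreover have "mpeval (pdiff i f) x = (\<Sum>m\<in>Poly_Mapping.keys f. coef f m *
       (of_nat (expo m i) * mono_eval (m - Poly_Mapping.single i 1) x))"
    by (simp add: pdiff_def mpeval_sum algebra_simps)
  ultimately show ?thesis by (simp add: mpeval_superset[OF finite_keys order_refl])
qed

lemma mpeval_pdiff_eq:
  assumes "((\<lambda>t. mpeval f (x(i := t))) has_field_derivative D) (at (x i))"
  shows "mpeval (pdiff i f) x = D"
  using DERIV_unique[OF mpeval_pdiff assms] .

lemma pdiff_cst [simp]: "pdiff i (cst c) = 0"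
  by (rule mpoly_eqI) (simp add: mpeval_pdiff_eq[where D = 0])

lemma pdiff_var: "pdiff i (var j) = (if i = j then 1 else 0)"
  by (rule mpoly_eqI, rule mpeval_pdiff_eq) (auto intro!: derivative_eq_intros)

lemma pdiff_add: "pdiff i (f + g) = pdiff i f + pdiff i g"
  by (rule mpoly_eqI, rule mpeval_pdiff_eq) (auto intro!: derivative_eq_intros mpeval_pdiff)

lemma pdiff_mult: "pdiff i (f * g) = pdiff i f * g + f * pdiff i g"
  by (rule mpoly_eqI, rule mpeval_pdiff_eq)
    (auto intro!: derivative_eq_intros mpeval_pdiff simp: algebra_simps)

section \<open>Functions given by forms\<close>

text \<open>Forms are handled as functions: an explicit formula is recognised as a form of a given
  degree by closure rules, and a polynomial is extracted only where \<open>vanishes\<close> or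
  \<open>regular\<close> asks for one.\<close>

definition hform :: "nat \<Rightarrow> nat \<Rightarrow> ((nat \<Rightarrow> complex) \<Rightarrow> complex) \<Rightarrow> bool" where
  "hform n d \<phi> \<longleftrightarrow> (\<exists>f\<in>forms n d. \<forall>x. mpeval f x = \<phi> x)"

lemma hformE:
  assumes "hform n d \<phi>"
  obtains f where "f \<in> forms n d" "\<And>x. mpeval f x = \<phi> x"
  using assms by (auto simp: hform_def)

lemma hform_mpeval: "f \<in> forms n d \<Longrightarrow> hform n d (mpeval f)"
  by (auto simp: hform_def)

lemma hform_add: "hform n d \<phi> \<Longrightarrow> hform n d \<psi> \<Longrightarrow> hform n d (\<lambda>x. \<phi> x + \<psi> x)"
  unfolding hform_def by (metis forms_add mpeval_add)

lemma hform_diff: "hform n d \<phi> \<Longrightarrow> hform n d \<psi> \<Longrightarrow> hform n d (\<lambda>x. \<phi> x - \<psi> x)"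
  unfolding hform_def by (metis forms_diff mpeval_diff)

lemma hform_uminus: "hform n d \<phi> \<Longrightarrow> hform n d (\<lambda>x. - \<phi> x)"
  unfolding hform_def by (metis forms_uminus mpeval_uminus)

lemma hform_mult:
  "hform n d \<phi> \<Longrightarrow> hform n e \<psi> \<Longrightarrow> d + e = k \<Longrightarrow> hform n k (\<lambda>x. \<phi> x * \<psi> x)"
  unfolding hform_def by (metis forms_mult mpeval_mult)

lemma hform_cmult: "hform n d \<phi> \<Longrightarrow> hform n d (\<lambda>x. c * \<phi> x)"
  unfolding hform_def by (metis forms_scale mpeval_scale)

lemma hform_const: "hform n 0 (\<lambda>x. c)"
  unfolding hform_def by (metis forms_cst mpeval_cst)

lemma hform_zero: "hform n d (\<lambda>x. 0)"
  unfolding hform_def by (metis forms_0 mpeval_0)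

lemma hform_var: "i \<le> n \<Longrightarrow> hform n 1 (\<lambda>x. x i)"
  unfolding hform_def by (metis forms_var mpeval_var)

lemma hform_power: "hform n d \<phi> \<Longrightarrow> d * k = e \<Longrightarrow> hform n e (\<lambda>x. \<phi> x ^ k)"
proof (induction k arbitrary: e)
  case 0
  then show ?case using hform_const[of n 1] by simp
next
  case (Suc k)
  have "hform n e (\<lambda>x. \<phi> x * \<phi> x ^ k)"
    by (rule hform_mult[where d = d and e = "d * k"]) (use Suc in auto)
  then show ?case by simp
qed

lemma hform_sum: "(\<And>a. a \<in> A \<Longrightarrow> hform n d (\<lambda>x. \<phi> a x)) \<Longrightarrow> hform n d (\<lambda>x. \<Sum>a\<in>A. \<phi> a x)"
  by (induction A rule: infinite_finite_induct) (simp_all add: hform_zero hform_add)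

lemma hform_prod:
  "(\<And>a. a \<in> A \<Longrightarrow> hform n (d a) (\<lambda>x. \<phi> a x)) \<Longrightarrow> hform n (\<Sum>a\<in>A. d a) (\<lambda>x. \<Prod>a\<in>A. \<phi> a x)"
proof (induction A rule: infinite_finite_induct)
  case (insert a A)
  have "hform n (d a + sum d A) (\<lambda>x. \<phi> a x * (\<Prod>a\<in>A. \<phi> a x))"
    by (rule hform_mult[OF _ _ refl]) (use insert in auto)
  with insert show ?case by simp
qed (simp_all add: hform_const)

lemma hform_homogeneous: "hform n d \<phi> \<Longrightarrow> \<phi> (\<lambda>i. c * x i) = c ^ d * \<phi> x"
  by (metis hformE forms_homogeneous)

text \<open>Components beyond m are zero, the convention of \<open>hvec\<close> and of the
  coordinate vectors of \<open>proj m\<close>, so that equalities of vectors hold literally.\<close>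

definition hmap :: "nat \<Rightarrow> nat \<Rightarrow> nat \<Rightarrow> ((nat \<Rightarrow> complex) \<Rightarrow> (nat \<Rightarrow> complex)) \<Rightarrow> bool" where
  "hmap n m d \<phi> \<longleftrightarrow> (\<forall>i\<le>m. hform n d (\<lambda>x. \<phi> x i)) \<and> (\<forall>x. \<forall>i>m. \<phi> x i = 0)"

lemma hmapE:
  assumes "hmap n m d \<phi>"
  obtains F where "\<And>i. i \<le> m \<Longrightarrow> F i \<in> forms n d" "hvec m F = \<phi>"
proof -
  have "\<forall>i. \<exists>f. i \<le> m \<longrightarrow> f \<in> forms n d \<and> (\<forall>x. mpeval f x = \<phi> x i)"
    using assms unfolding hmap_def hform_def by blast
  then obtain F where "\<forall>i. i \<le> m \<longrightarrow> F i \<in> forms n d \<and> (\<forall>x. mpeval (F i) x = \<phi> x i)" by metis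
  moreover from this have "hvec m F = \<phi>"
    using assms by (auto simp: hvec_def hmap_def fun_eq_iff)
  ultimately show ?thesis using that by blast
qed

lemma hmap_homogeneous: "hmap n m d \<phi> \<Longrightarrow> \<phi> (\<lambda>i. c * x i) = (\<lambda>i. c ^ d * \<phi> x i)"
  unfolding hmap_def by (metis hform_homogeneous linorder_le_less_linear mult_zero_right)

lemma hform_compose:
  assumes f: "hform m e \<psi>" and \<phi>: "hmap n m d \<phi>"
  shows "hform n (d * e) (\<lambda>x. \<psi> (\<phi> x))"
proof -
  obtain f where f: "f \<in> forms m e" and ev: "\<And>x. mpeval f x = \<psi> x" using f hformE by blast
  have "hform n (d * e) (\<lambda>x. \<Sum>k\<in>Poly_Mapping.keys f. coef f k * mono_eval k (\<phi> x))"
  proof (intro hform_sum hform_cmult)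
    fix k assume k: "k \<in> Poly_Mapping.keys f"
    have sub: "i \<le> m" if "i \<in> Poly_Mapping.keys k" for i
      using f k that by (auto simp: forms_def polys_def)
    have deg: "mono_deg k = e" using f k by (auto simp: forms_altdef)
    have "hform n (\<Sum>i\<in>Poly_Mapping.keys k. d * expo k i) (\<lambda>x. mono_eval k (\<phi> x))"
      unfolding mono_eval_def
      by (intro hform_prod hform_power[OF _ refl]) (use \<phi> sub in \<open>auto simp: hmap_def\<close>)
    then show "hform n (d * e) (\<lambda>x. mono_eval k (\<phi> x))"
      using deg by (simp add: mono_deg_def flip: sum_distrib_left)
  qed
  then show ?thesis
    by (simp add: mpeval_superset[OF finite_keys order_refl] flip: ev)
qed

section \<open>Points and closed sets\<close>

definition vec :: "nat \<Rightarrow> (nat \<Rightarrow> complex) \<Rightarrow> bool" where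
  "vec n x \<longleftrightarrow> x \<noteq> (\<lambda>_. 0) \<and> (\<forall>i>n. x i = 0)"

lemma pt_self [simp]: "x \<in> pt x"
  unfolding pt_def by (auto intro!: exI[of _ 1])

lemma mem_pt_iff: "y \<in> pt x \<longleftrightarrow> (\<exists>c. c \<noteq> 0 \<and> y = (\<lambda>i. c * x i))"
  by (auto simp: pt_def)

lemma pt_scale [simp]: "c \<noteq> 0 \<Longrightarrow> pt (\<lambda>i. c * x i) = pt x"
proof -
  assume c: "c \<noteq> 0"
  have "(\<lambda>i. d * (c * x i)) \<in> pt x" if "d \<noteq> 0" for d
    using c that by (auto simp: mem_pt_iff intro!: exI[of _ "d * c"])
  moreover have "(\<lambda>i. d * x i) \<in> pt (\<lambda>i. c * x i)" if "d \<noteq> 0" for d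
    using c that by (auto simp: mem_pt_iff intro!: exI[of _ "d / c"])
  ultimately show ?thesis by (auto simp: mem_pt_iff)
qed

lemma pt_mem: "y \<in> pt x \<Longrightarrow> pt y = pt x"
  by (auto simp: mem_pt_iff)

lemma proj_iff: "P \<in> proj n \<longleftrightarrow> (\<exists>x. vec n x \<and> P = pt x)"
  by (auto simp: proj_def vec_def)

lemma pt_in_proj [simp]: "pt x \<in> proj n \<longleftrightarrow> vec n x"
proof
  assume "pt x \<in> proj n"
  then obtain y where y: "vec n y" "pt x = pt y" by (auto simp: proj_iff)
  then have "x \<in> pt y" by (metis pt_self)
  then obtain c where "c \<noteq> 0" "x = (\<lambda>i. c * y i)" by (auto simp: mem_pt_iff)
  with y(1) show "vec n x" by (simp add: vec_def fun_eq_iff)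
qed (auto simp: proj_iff)

lemma proj_mem:
  assumes "P \<in> proj n" "x \<in> P"
  shows "P = pt x" "vec n x"
proof -
  obtain y where y: "vec n y" "P = pt y" using assms by (auto simp: proj_iff)
  show "P = pt x" using assms y pt_mem by simp
  then show "vec n x" using assms by simp
qed

lemma subset_projE:
  assumes "X \<subseteq> proj n" "P \<in> X"
  obtains x where "P = pt x" "vec n x"
  using assms proj_iff[of P n] by blast

lemma vanishes_pt [simp]: "f \<in> forms n d \<Longrightarrow> vanishes f (pt x) \<longleftrightarrow> mpeval f x = 0"
proof
  assume f: "f \<in> forms n d"
  show "vanishes f (pt x) \<Longrightarrow> mpeval f x = 0" unfolding vanishes_def using pt_self by blast
  show "mpeval f x = 0 \<Longrightarrow> vanishes f (pt x)"
    using forms_homogeneous[OF f] by (auto simp: vanishes_def mem_pt_iff)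
qed

text \<open>Agrees with \<open>zclosure\<close> on subsets of \<open>proj n\<close>; quantifying
  over forms instead of closed sets makes membership directly testable.\<close>

definition clo :: "nat \<Rightarrow> point set \<Rightarrow> point set" where
  "clo n A = {P \<in> proj n. \<forall>d. \<forall>f\<in>forms n d. (\<forall>Q\<in>A. vanishes f Q) \<longrightarrow> vanishes f P}"

lemma zclosed_subset_proj: "zclosed n Z \<Longrightarrow> Z \<subseteq> proj n"
  by (auto simp: zclosed_def zero_locus_def)

lemma zclosed_clo: "zclosed n (clo n A)"
  unfolding zclosed_def
  by (rule exI[of _ "{f \<in> (\<Union>d. forms n d). \<forall>Q\<in>A. vanishes f Q}"])
    (auto simp: clo_def zero_locus_def)

lemma clo_minimal: "zclosed n Z \<Longrightarrow> A \<subseteq> Z \<Longrightarrow> clo n A \<subseteq> Z"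
proof
  fix P assume Z: "zclosed n Z" "A \<subseteq> Z" and P: "P \<in> clo n A"
  obtain F where F: "F \<subseteq> (\<Union>d. forms n d)" "Z = zero_locus n F" using Z by (auto simp: zclosed_def)
  have "vanishes f P" if "f \<in> F" for f
  proof -
    obtain d where "f \<in> forms n d" using F \<open>f \<in> F\<close> by blast
    moreover have "\<forall>Q\<in>A. vanishes f Q" using Z F \<open>f \<in> F\<close> by (auto simp: zero_locus_def)
    ultimately show ?thesis using P by (auto simp: clo_def)
  qed
  then show "P \<in> Z" using P F by (auto simp: zero_locus_def clo_def)
qed

lemma subset_clo: "A \<subseteq> proj n \<Longrightarrow> A \<subseteq> clo n A"
  by (auto simp: clo_def)

lemma clo_subset_proj: "clo n A \<subseteq> proj n"
  by (auto simp: clo_def)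

lemma clo_trans: "A \<subseteq> clo n B \<Longrightarrow> clo n A \<subseteq> clo n B"
  by (rule clo_minimal[OF zclosed_clo])

lemma clo_mono: "A \<subseteq> B \<Longrightarrow> clo n A \<subseteq> clo n B"
  unfolding clo_def by blast

lemma zclosure_eq_clo: "A \<subseteq> proj n \<Longrightarrow> zclosure n A = clo n A"
proof
  assume "A \<subseteq> proj n"
  then show "zclosure n A \<subseteq> clo n A"
    using zclosed_clo[of n A] subset_clo[of A n] unfolding zclosure_def by blast
  show "clo n A \<subseteq> zclosure n A"
    using clo_minimal[of n _ A] unfolding zclosure_def by blast
qed

text \<open>A form that vanishes along the sequence vanishes at its limit by continuity. The
  condition \<open>vec n x\<close> excludes convergence to the zero vector.\<close>

lemma clo_limit:
  assumes A: "\<And>j. pt (y j) \<in> A" and lim: "\<And>i. (\<lambda>j. y j i) \<longlonglongrightarrow> x i" and x: "vec n x"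
  shows "pt x \<in> clo n A"
proof -
  have "vanishes f (pt x)" if f: "f \<in> forms n d" "\<forall>Q\<in>A. vanishes f Q" for f d
  proof -
    have "mpeval f (y j) = 0" for j using f A by (metis vanishes_pt)
    moreover have "(\<lambda>j. mpeval f (y j)) \<longlonglongrightarrow> mpeval f x" by (rule mpeval_tendsto) (rule lim)
    ultimately have "mpeval f x = 0" by (simp add: LIMSEQ_const_iff)
    then show ?thesis using f by simp
  qed
  then show ?thesis using x by (auto simp: clo_def)
qed

lemma zclosed_form: "f \<in> forms n d \<Longrightarrow> zclosed n {P \<in> proj n. vanishes f P}"
  unfolding zclosed_def by (rule exI[of _ "{f}"]) (auto simp: zero_locus_def)

lemma zclosed_Int: "zclosed n A \<Longrightarrow> zclosed n B \<Longrightarrow> zclosed n (A \<inter> B)"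
proof -
  assume "zclosed n A" "zclosed n B"
  then obtain F G where "F \<subseteq> (\<Union>d. forms n d)" "A = zero_locus n F"
    "G \<subseteq> (\<Union>d. forms n d)" "B = zero_locus n G" by (auto simp: zclosed_def)
  then show ?thesis
    unfolding zclosed_def by (intro exI[of _ "F \<union> G"]) (auto simp: zero_locus_def)
qed

lemma zclosed_empty: "zclosed n {}"
proof -
  have "zclosed n {P \<in> proj n. vanishes (cst 1) P}" by (rule zclosed_form) (rule forms_cst)
  moreover have "{P \<in> proj n. vanishes (cst 1) P} = {}"
    using vanishes_pt[OF forms_cst[of 1 n]] by (auto simp: proj_iff)
  ultimately show ?thesis by metis
qed

text \<open>A closed set that does not contain X misses some point of X because of a single defining
  form, so irreducibility can be tested on pairs of forms.\<close>

lemma varietyI: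
  assumes cl: "zclosed n X" and ne: "X \<noteq> {}"
    and irr: "\<And>f d g e. f \<in> forms n d \<Longrightarrow> g \<in> forms n e \<Longrightarrow>
      (\<And>P. P \<in> X \<Longrightarrow> vanishes f P \<or> vanishes g P) \<Longrightarrow>
      (\<forall>P\<in>X. vanishes f P) \<or> (\<forall>P\<in>X. vanishes g P)"
  shows "variety n X"
  unfolding variety_def
proof (intro conjI allI impI cl ne)
  fix A B assume AB: "zclosed n A \<and> zclosed n B \<and> X \<subseteq> A \<union> B"
  then obtain F G where F: "F \<subseteq> (\<Union>d. forms n d)" "A = zero_locus n F"
    and G: "G \<subseteq> (\<Union>d. forms n d)" "B = zero_locus n G" by (auto simp: zclosed_def)
  have Xp: "X \<subseteq> proj n" using cl by (rule zclosed_subset_proj)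
  show "X \<subseteq> A \<or> X \<subseteq> B"
  proof (rule ccontr)
    assume "\<not> ?thesis"
    then obtain P Q where P: "P \<in> X" "P \<notin> A" and Q: "Q \<in> X" "Q \<notin> B" by blast
    obtain f where f: "f \<in> F" "\<not> vanishes f P" using P F Xp by (auto simp: zero_locus_def)
    obtain g where g: "g \<in> G" "\<not> vanishes g Q" using Q G Xp by (auto simp: zero_locus_def)
    obtain d e where d: "f \<in> forms n d" "g \<in> forms n e" using F G f g by blast
    have "(\<forall>P\<in>X. vanishes f P) \<or> (\<forall>P\<in>X. vanishes g P)"
      by (rule irr[OF d]) (use AB F G f g in \<open>auto simp: zero_locus_def\<close>)
    with P Q f g show False by blast
  qed
qed

lemma variety_zclosed: "variety n X \<Longrightarrow> zclosed n X"
  by (simp add: variety_def)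

lemma varietyD:
  assumes X: "variety n X" and f: "f \<in> forms n d" and g: "g \<in> forms n e"
    and fg: "\<And>P. P \<in> X \<Longrightarrow> vanishes f P \<or> vanishes g P"
  shows "(\<forall>P\<in>X. vanishes f P) \<or> (\<forall>P\<in>X. vanishes g P)"
proof -
  have "X \<subseteq> proj n" using X by (intro zclosed_subset_proj variety_zclosed)
  with fg have "X \<subseteq> {P \<in> proj n. vanishes f P} \<union> {P \<in> proj n. vanishes g P}" by blast
  then have "X \<subseteq> {P \<in> proj n. vanishes f P} \<or> X \<subseteq> {P \<in> proj n. vanishes g P}"
    using X zclosed_form[OF f] zclosed_form[OF g] unfolding variety_def by blast
  then show ?thesis by blast
qed

lemma variety_hformD:
  assumes X: "variety n X" and \<phi>: "hform n d \<phi>" and \<psi>: "hform n e \<psi>"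
    and 0: "\<And>x. pt x \<in> X \<Longrightarrow> \<phi> x * \<psi> x = 0"
  shows "(\<forall>x. pt x \<in> X \<longrightarrow> \<phi> x = 0) \<or> (\<forall>x. pt x \<in> X \<longrightarrow> \<psi> x = 0)"
proof -
  obtain f where f: "f \<in> forms n d" "\<And>x. mpeval f x = \<phi> x" using \<phi> hformE by blast
  obtain g where g: "g \<in> forms n e" "\<And>x. mpeval g x = \<psi> x" using \<psi> hformE by blast
  have Xp: "X \<subseteq> proj n" using X by (intro zclosed_subset_proj variety_zclosed)
  have "vanishes f P \<or> vanishes g P" if P: "P \<in> X" for P
  proof -
    obtain x where x: "P = pt x" using subset_projE[OF Xp P] by blast
    show ?thesis using 0[of x] P f g by (simp add: x)
  qed
  from varietyD[OF X f(1) g(1) this] show ?thesis using f g by (metis vanishes_pt)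
qed

lemma generallyI:
  assumes h: "hform n d h" and x: "pt x \<in> X" "h x \<noteq> 0" and X: "X \<subseteq> proj n"
    and \<Phi>: "\<And>x. pt x \<in> X \<Longrightarrow> h x \<noteq> 0 \<Longrightarrow> \<Phi> (pt x)"
  shows "generally n X \<Phi>"
proof -
  obtain f where f: "f \<in> forms n d" "\<And>x. mpeval f x = h x" using h hformE by blast
  show ?thesis unfolding generally_def
  proof (intro exI conjI ballI)
    show "zclosed n {P \<in> proj n. vanishes f P}" using f by (intro zclosed_form)
    show "\<not> X \<subseteq> {P \<in> proj n. vanishes f P}" using f x by auto
    fix P assume P: "P \<in> X - {P \<in> proj n. vanishes f P}"
    then obtain y where "P = pt y" using subset_projE[OF X, of P] by blast
    with P \<Phi> f X show "\<Phi> P" by auto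
  qed
qed

section \<open>Rational maps\<close>

text \<open>The chosen representative is immaterial once \<phi> is homogeneous, which
  \<open>hmap\<close> guarantees.\<close>

definition pt_map :: "((nat \<Rightarrow> complex) \<Rightarrow> nat \<Rightarrow> complex) \<Rightarrow> point \<Rightarrow> point" where
  "pt_map \<phi> P = pt (\<phi> (SOME x. x \<in> P))"

lemma pt_map_pt: "hmap n m d \<phi> \<Longrightarrow> pt_map \<phi> (pt x) = pt (\<phi> x)"
proof -
  assume \<phi>: "hmap n m d \<phi>"
  have "(SOME y. y \<in> pt x) \<in> pt x" using someI[of "\<lambda>y. y \<in> pt x" x] by simp
  then obtain c where c: "c \<noteq> 0" "(SOME y. y \<in> pt x) = (\<lambda>i. c * x i)" by (auto simp: mem_pt_iff)
  then show ?thesis by (simp add: pt_map_def hmap_homogeneous[OF \<phi>])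
qed

lemma regularI:
  assumes \<phi>: "hmap n m d \<phi>" and U: "U \<subseteq> proj n" and ne: "\<And>x. pt x \<in> U \<Longrightarrow> \<phi> x \<noteq> (\<lambda>_. 0)"
  shows "regular n U m (pt_map \<phi>)"
  unfolding regular_def
proof
  fix P assume "P \<in> U"
  obtain F where F: "\<And>i. i \<le> m \<Longrightarrow> F i \<in> forms n d" "hvec m F = \<phi>" using hmapE[OF \<phi>] by metis
  show "\<exists>F d Z. (\<forall>i\<le>m. F i \<in> forms n d) \<and> zclosed n Z \<and> P \<notin> Z \<and>
        (\<forall>Q\<in>U - Z. \<forall>x\<in>Q. hvec m F x \<noteq> (\<lambda>_. 0) \<and> pt_map \<phi> Q = pt (hvec m F x))"
  proof (intro exI conjI ballI allI impI)
    show "zclosed n {}" by (rule zclosed_empty)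
    fix Q x assume Q: "Q \<in> U - {}" "x \<in> Q"
    then have "Q = pt x" using U proj_mem by blast
    with Q show "hvec m F x \<noteq> (\<lambda>_. 0)" "pt_map \<phi> Q = pt (hvec m F x)"
      using ne by (auto simp: F pt_map_pt[OF \<phi>])
  qed (use F in auto)
qed

text \<open>The open sets are given by \<open>h\<close> on X and by
  \<open>h' y * h (\<psi> y)\<close> on Y. The second factor is there because \<psi> is known to
  land in X but not where \<open>h\<close> is nonzero; it does not vanish at
  \<open>\<phi> x\<close>, since \<psi> returns a multiple of x.\<close>

lemma birationalI:
  assumes X: "variety n X" and Y: "variety m Y"
    and \<phi>: "hmap n m d \<phi>" and \<psi>: "hmap m n e \<psi>" and h: "hform n k h" and h': "hform m k' h'"
    and XY: "\<And>x. pt x \<in> X \<Longrightarrow> h x \<noteq> 0 \<Longrightarrow> pt (\<phi> x) \<in> Y \<and> h' (\<phi> x) \<noteq> 0 \<and>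
      (\<exists>c. c \<noteq> 0 \<and> \<psi> (\<phi> x) = (\<lambda>i. c * x i))"
    and YX: "\<And>y. pt y \<in> Y \<Longrightarrow> h' y \<noteq> 0 \<Longrightarrow> pt (\<psi> y) \<in> X"
      "\<And>y. pt y \<in> Y \<Longrightarrow> h' y \<noteq> 0 \<Longrightarrow> h (\<psi> y) \<noteq> 0 \<Longrightarrow> (\<exists>c. c \<noteq> 0 \<and> \<phi> (\<psi> y) = (\<lambda>i. c * y i))"
    and x0: "pt x0 \<in> X" "h x0 \<noteq> 0"
  shows "birational n X m Y"
proof -
  have h'': "hform m (k' + e * k) (\<lambda>y. h' y * h (\<psi> y))"
    by (rule hform_mult[OF h' hform_compose[OF h \<psi>] refl])
  obtain f where f: "f \<in> forms n k" "\<And>x. mpeval f x = h x" using h hformE by blast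
  obtain g where g: "g \<in> forms m (k' + e * k)" "\<And>x. mpeval g x = h' x * h (\<psi> x)"
    using h'' hformE by blast
  let ?Z = "{P \<in> proj n. vanishes f P}" and ?Z' = "{P \<in> proj m. vanishes g P}"
  have Xp: "X \<subseteq> proj n" and Yp: "Y \<subseteq> proj m"
    using X Y by (auto intro!: zclosed_subset_proj variety_zclosed)
  have inX: "pt x \<in> X - ?Z \<longleftrightarrow> pt x \<in> X \<and> h x \<noteq> 0" for x using f Xp by auto
  have inY: "pt y \<in> Y - ?Z' \<longleftrightarrow> pt y \<in> Y \<and> h' y \<noteq> 0 \<and> h (\<psi> y) \<noteq> 0" for y using g Yp by auto
  have XY': "pt (\<phi> x) \<in> Y - ?Z'" if "pt x \<in> X - ?Z" for x
  proof -
    have x: "pt x \<in> X" "h x \<noteq> 0" using that inX by auto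
    obtain c where "c \<noteq> 0" "\<psi> (\<phi> x) = (\<lambda>i. c * x i)" using XY[OF x] by blast
    then have "h (\<psi> (\<phi> x)) \<noteq> 0" using x by (simp add: hform_homogeneous[OF h])
    then show ?thesis unfolding inY using XY[OF x] by blast
  qed
  have YX': "pt (\<psi> y) \<in> X - ?Z" if "pt y \<in> Y - ?Z'" for y
    using that YX(1) unfolding inX inY by blast
  have iso: "isomorphic n (X - ?Z) m (Y - ?Z')"
    unfolding isomorphic_def
  proof (intro exI conjI ballI)
    show "regular n (X - ?Z) m (pt_map \<phi>)"
    proof (rule regularI[OF \<phi>])
      fix x assume "pt x \<in> X - ?Z"
      then have "pt (\<phi> x) \<in> proj m" using XY' Yp by blast
      then show "\<phi> x \<noteq> (\<lambda>_. 0)" by (simp add: vec_def)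
    qed (use Xp in blast)
    show "regular m (Y - ?Z') n (pt_map \<psi>)"
    proof (rule regularI[OF \<psi>])
      fix y assume "pt y \<in> Y - ?Z'"
      then have "pt (\<psi> y) \<in> proj n" using YX' Xp by blast
      then show "\<psi> y \<noteq> (\<lambda>_. 0)" by (simp add: vec_def)
    qed (use Yp in blast)
    show "pt_map \<phi> ` (X - ?Z) \<subseteq> Y - ?Z'"
    proof (rule image_subsetI)
      fix P assume P: "P \<in> X - ?Z"
      then obtain x where "P = pt x" using subset_projE[OF Xp, of P] by blast
      with P XY'[of x] show "pt_map \<phi> P \<in> Y - ?Z'" by (simp only: pt_map_pt[OF \<phi>])
    qed
    show "pt_map \<psi> ` (Y - ?Z') \<subseteq> X - ?Z"
    proof (rule image_subsetI)
      fix P assume P: "P \<in> Y - ?Z'"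
      then obtain y where "P = pt y" using subset_projE[OF Yp, of P] by blast
      with P YX'[of y] show "pt_map \<psi> P \<in> X - ?Z" by (simp only: pt_map_pt[OF \<psi>])
    qed
    fix P assume P: "P \<in> X - ?Z"
    then obtain x where x: "P = pt x" using subset_projE[OF Xp, of P] by blast
    then obtain c where "c \<noteq> 0" "\<psi> (\<phi> x) = (\<lambda>i. c * x i)" using P XY inX by blast
    then show "pt_map \<psi> (pt_map \<phi> P) = P" by (simp add: x pt_map_pt[OF \<phi>] pt_map_pt[OF \<psi>])
  next
    fix P assume P: "P \<in> Y - ?Z'"
    then obtain y where y: "P = pt y" using subset_projE[OF Yp, of P] by blast
    then obtain c where "c \<noteq> 0" "\<phi> (\<psi> y) = (\<lambda>i. c * y i)" using P YX inY by blast
    then show "pt_map \<phi> (pt_map \<psi> P) = P" by (simp add: y pt_map_pt[OF \<phi>] pt_map_pt[OF \<psi>])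
  qed
  have x0': "pt x0 \<in> X - ?Z" using x0 inX by blast
  show ?thesis unfolding birational_def
  proof (intro conjI X Y exI)
    show "zclosed n ?Z" "zclosed m ?Z'" using f g by (auto intro: zclosed_form)
    show "\<not> X \<subseteq> ?Z" using x0' by blast
    show "\<not> Y \<subseteq> ?Z'" using XY'[OF x0'] by blast
  qed (rule iso)
qed

text \<open>Irreducibility passes from Y to the closure of an image. The two forms are pulled back
  and multiplied by \<open>h'\<close>, so that their product vanishes on all of Y, also where
  nothing is known about \<psi>.\<close>

lemma variety_imageI:
  assumes Y: "variety m Y" and \<psi>: "hmap m n e \<psi>" and h': "hform m k' h'"
    and X: "zclosed n X" "X \<subseteq> clo n {pt (\<psi> y) | y. pt y \<in> Y \<and> h' y \<noteq> 0}"
    and YX: "\<And>y. pt y \<in> Y \<Longrightarrow> h' y \<noteq> 0 \<Longrightarrow> pt (\<psi> y) \<in> X"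
    and y0: "pt y0 \<in> Y" "h' y0 \<noteq> 0"
  shows "variety n X"
proof (rule varietyI)
  show "X \<noteq> {}" using YX[OF y0] by blast
  fix f d g e' assume f: "f \<in> forms n d" and g: "g \<in> forms n e'"
    and fg: "\<And>P. P \<in> X \<Longrightarrow> vanishes f P \<or> vanishes g P"
  have hf: "hform m (k' + e * d) (\<lambda>y. h' y * mpeval f (\<psi> y))"
    by (rule hform_mult[OF h' hform_compose[OF hform_mpeval[OF f] \<psi>] refl])
  have hg: "hform m (k' + e * e') (\<lambda>y. h' y * mpeval g (\<psi> y))"
    by (rule hform_mult[OF h' hform_compose[OF hform_mpeval[OF g] \<psi>] refl])
  have "(\<forall>y. pt y \<in> Y \<longrightarrow> h' y * mpeval f (\<psi> y) = 0) \<or>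
      (\<forall>y. pt y \<in> Y \<longrightarrow> h' y * mpeval g (\<psi> y) = 0)"
  proof (rule variety_hformD[OF Y hf hg])
    fix y assume y: "pt y \<in> Y"
    show "h' y * mpeval f (\<psi> y) * (h' y * mpeval g (\<psi> y)) = 0"
    proof (cases "h' y = 0")
      case False
      from fg[OF YX[OF y False]] show ?thesis using f g by auto
    qed simp
  qed
  then have "(\<forall>P\<in>{pt (\<psi> y) | y. pt y \<in> Y \<and> h' y \<noteq> 0}. vanishes f P) \<or>
      (\<forall>P\<in>{pt (\<psi> y) | y. pt y \<in> Y \<and> h' y \<noteq> 0}. vanishes g P)"
    using f g by (smt (verit) mem_Collect_eq mult_eq_0_iff vanishes_pt)
  then show "(\<forall>P\<in>X. vanishes f P) \<or> (\<forall>P\<in>X. vanishes g P)"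
    using X(2) f g unfolding clo_def by blast
qed (rule X(1))

section \<open>The product of a plane curve and a line\<close>

lemma pdiff_diff: "pdiff i (f - g) = pdiff i f - pdiff i g"
  by (rule mpoly_eqI, rule mpeval_pdiff_eq) (auto intro!: derivative_eq_intros mpeval_pdiff)

definition seg :: "complex \<Rightarrow> complex \<Rightarrow> (nat \<Rightarrow> complex) \<Rightarrow> nat \<Rightarrow> complex" where
  "seg a b y = (\<lambda>i. if i \<le> 2 then a * y i else if i \<le> 5 then b * y (i - 3) else 0)"

definition part :: "nat \<Rightarrow> (nat \<Rightarrow> complex) \<Rightarrow> nat \<Rightarrow> complex" where
  "part s z = (\<lambda>i. if i \<le> 2 then z (i + s) else 0)"

text \<open>\<open>C \<times> \<PP>\<^sup>1\<close> in the Segre embedding; \<open>part 0\<close> and \<open>part 3\<close> are two proportional copies of the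
  coordinates on \<open>C\<close>.\<close>

definition scroll :: "point set \<Rightarrow> point set" where
  "scroll C = {pt (seg a b y) | a b y. pt y \<in> C \<and> (a \<noteq> 0 \<or> b \<noteq> 0)}"

lemma part_0_seg: "vec 2 y \<Longrightarrow> part 0 (seg a b y) = (\<lambda>i. a * y i)"
  by (auto simp: part_def seg_def vec_def fun_eq_iff)

lemma part_3_seg: "vec 2 y \<Longrightarrow> part 3 (seg a b y) = (\<lambda>i. b * y i)"
  by (auto simp: part_def seg_def vec_def fun_eq_iff)

lemma hmap_part: "s = 0 \<or> s = 3 \<Longrightarrow> hmap 5 2 1 (part s)"
  by (auto simp: hmap_def part_def intro!: hform_var[unfolded One_nat_def])

lemma vec_nonzero: "vec 2 y \<Longrightarrow> \<exists>i\<le>2. y i \<noteq> 0"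
  unfolding vec_def by (metis linorder_not_le)

lemma vec_seg:
  assumes y: "vec 2 y" and ab: "a \<noteq> 0 \<or> b \<noteq> 0"
  shows "vec 5 (seg a b y)"
proof -
  obtain i where i: "i \<le> 2" "y i \<noteq> 0" using vec_nonzero[OF y] by blast
  have "seg a b y i = a * y i" "seg a b y (i + 3) = b * y i" using i by (auto simp: seg_def)
  then have "seg a b y i \<noteq> 0 \<or> seg a b y (i + 3) \<noteq> 0" using i ab by simp
  then have "seg a b y \<noteq> (\<lambda>_. 0)" by (auto simp: fun_eq_iff)
  then show ?thesis by (auto simp: vec_def seg_def)
qed

lemma scrollE:
  assumes C: "C \<subseteq> proj 2" and z: "pt z \<in> scroll C"
  obtains a b y where "z = seg a b y" "pt y \<in> C" "vec 2 y" "a \<noteq> 0 \<or> b \<noteq> 0"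
proof -
  obtain a b y where y: "pt z = pt (seg a b y)" "pt y \<in> C" "a \<noteq> 0 \<or> b \<noteq> 0"
    using z by (auto simp: scroll_def)
  then have vy: "vec 2 y" using C by (metis pt_in_proj subsetD)
  have "z \<in> pt (seg a b y)" using y by (metis pt_self)
  then obtain c where c: "c \<noteq> 0" "z = (\<lambda>i. c * seg a b y i)" by (auto simp: mem_pt_iff)
  then have "z = seg (c * a) (c * b) y" by (auto simp: seg_def)
  then show ?thesis by (rule that) (use c y vy in auto)
qed

lemma scroll_minors:
  assumes "C \<subseteq> proj 2" "pt z \<in> scroll C" "i \<le> 2" "j \<le> 2" "s = 0 \<and> s' = 3 \<or> s = 3 \<and> s' = 0"
  shows "z (i + s) * z (j + s') = z (j + s) * z (i + s')"
proof -
  obtain a b y where "z = seg a b y" using scrollE[OF assms(1,2)] by metis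
  then show ?thesis using assms(3-) by (auto simp: seg_def)
qed

lemma scroll_part:
  assumes "C \<subseteq> proj 2" "pt z \<in> scroll C" "s = 0 \<or> s = 3" "part s z \<noteq> (\<lambda>_. 0)"
  shows "pt (part s z) \<in> C"
proof -
  obtain a b y where y: "z = seg a b y" "pt y \<in> C" "vec 2 y" "a \<noteq> 0 \<or> b \<noteq> 0"
    using scrollE[OF assms(1,2)] by metis
  from assms(3) show ?thesis
  proof
    assume s: "s = 0"
    then have "a \<noteq> 0" using assms(4) y by (auto simp: part_0_seg)
    then show ?thesis using y s by (simp add: part_0_seg)
  next
    assume s: "s = 3"
    then have "b \<noteq> 0" using assms(4) y by (auto simp: part_3_seg)
    then show ?thesis using y s by (simp add: part_3_seg)
  qed
qed

text \<open>At a nonzero pivot \<open>z (i0 + s)\<close> the minors make the block at s' a multiple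
  of the block at s. The pair (s, s') is (0, 3) or (3, 0), so both halves of the Segre coordinates
  are treated at once.\<close>

lemma scrollI:
  fixes s s' i0 :: nat
  assumes s: "s = 0 \<and> s' = 3 \<or> s = 3 \<and> s' = 0" and z: "vec 5 z"
    and i0: "i0 \<le> 2" "z (i0 + s) \<noteq> 0" and C: "pt (part s z) \<in> C"
    and minors: "\<And>j. j \<le> 2 \<Longrightarrow> z (i0 + s) * z (j + s') = z (j + s) * z (i0 + s')"
  shows "pt z \<in> scroll C"
proof -
  define l where "l = z (i0 + s') / z (i0 + s)"
  have l: "z (j + s') = l * z (j + s)" if "j \<le> 2" for j
    using minors[OF that] i0 by (simp add: l_def field_simps)
  have z6: "z i = 0" if "i > 5" for i using z that by (simp add: vec_def)
  from s show ?thesis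
  proof
    assume s: "s = 0 \<and> s' = 3"
    have "z = seg 1 l (part s z)"
    proof
      fix i :: nat
      consider "i \<le> 2" | "i > 2" "i \<le> 5" | "i > 5" by linarith
      then show "z i = seg 1 l (part s z) i"
      proof cases
        case 2
        then have "i - 3 \<le> 2" "i = (i - 3) + 3" by auto
        then show ?thesis using l[of "i - 3"] 2 s by (simp add: seg_def part_def)
      qed (use s z6 in \<open>auto simp: seg_def part_def\<close>)
    qed
    then show ?thesis using C unfolding scroll_def by (metis (mono_tags, lifting) mem_Collect_eq one_neq_zero)
  next
    assume s: "s = 3 \<and> s' = 0"
    have "z = seg l 1 (part s z)"
    proof
      fix i :: nat
      consider "i \<le> 2" | "i > 2" "i \<le> 5" | "i > 5" by linarith
      then show "z i = seg l 1 (part s z) i"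
      proof cases
        case 1
        then show ?thesis using l[of i] s by (simp add: seg_def part_def)
      next
        case 2
        then have "i - 3 \<le> 2" "i = (i - 3) + 3" by auto
        then show ?thesis using 2 s by (simp add: seg_def part_def)
      qed (use s z6 in \<open>auto simp: seg_def part_def\<close>)
    qed
    then show ?thesis using C unfolding scroll_def by (metis (mono_tags, lifting) mem_Collect_eq one_neq_zero)
  qed
qed

lemma scroll_subset_proj: "C \<subseteq> proj 2 \<Longrightarrow> scroll C \<subseteq> proj 5"
  by (auto simp: scroll_def intro!: vec_seg)

lemma clo_hform:
  assumes "pt z \<in> clo n A" "hform n d \<phi>" "\<And>x. pt x \<in> A \<Longrightarrow> \<phi> x = 0" "A \<subseteq> proj n"
  shows "\<phi> z = 0"
proof -
  obtain f where f: "f \<in> forms n d" "\<And>x. mpeval f x = \<phi> x" using assms hformE by blast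
  have "vanishes f Q" if Q: "Q \<in> A" for Q
  proof -
    obtain x where "Q = pt x" using subset_projE[OF assms(4) Q] by blast
    then show ?thesis using f Q assms(3) by auto
  qed
  then have "vanishes f (pt z)" using assms(1) f unfolding clo_def by blast
  then show ?thesis using f by simp
qed

lemma nonzero_part:
  assumes "vec 5 z"
  obtains s s' i0 :: nat where "s = 0 \<and> s' = 3 \<or> s = 3 \<and> s' = 0" "i0 \<le> 2" "z (i0 + s) \<noteq> 0"
proof -
  obtain i where i: "z i \<noteq> 0" "i \<le> 5" using assms unfolding vec_def by (metis linorder_not_le)
  show ?thesis
  proof (cases "i \<le> 2")
    case True
    show ?thesis by (rule that[of 0 3 i]) (use i True in auto)
  next
    case False
    show ?thesis by (rule that[of 3 0 "i - 3"]) (use i False in auto)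
  qed
qed

lemma hform_minor:
  "i \<le> n \<Longrightarrow> j \<le> n \<Longrightarrow> k \<le> n \<Longrightarrow> l \<le> n \<Longrightarrow> hform n 2 (\<lambda>x. x i * x j - x k * x l)"
  by (rule hform_diff; rule hform_mult[OF hform_var hform_var]) auto

lemma zclosed_scroll:
  assumes C: "zclosed 2 C"
  shows "zclosed 5 (scroll C)"
proof -
  have Cp: "C \<subseteq> proj 2" using C by (rule zclosed_subset_proj)
  have "clo 5 (scroll C) \<subseteq> scroll C"
  proof
    fix P assume P: "P \<in> clo 5 (scroll C)"
    obtain z where z: "P = pt z" "vec 5 z" using subset_projE[OF clo_subset_proj P] by blast
    obtain s s' i0 :: nat where s: "s = 0 \<and> s' = 3 \<or> s = 3 \<and> s' = 0" and i0: "i0 \<le> 2" "z (i0 + s) \<noteq> 0"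
      using nonzero_part[OF z(2)] by blast
    have s03: "s = 0 \<or> s = 3" using s by blast
    note cl = clo_hform[OF P[unfolded z(1)] _ _ scroll_subset_proj[OF Cp]]
    have minors: "z (i0 + s) * z (j + s') = z (j + s) * z (i0 + s')" if j: "j \<le> 2" for j
    proof -
      have "z (i0 + s) * z (j + s') - z (j + s) * z (i0 + s') = 0"
        by (rule cl[OF hform_minor]) (use s i0 j scroll_minors[OF Cp _ i0(1) j s] in auto)
      then show ?thesis by simp
    qed
    have "pt (part s z) \<in> clo 2 C"
    proof -
      have nz: "vec 2 (part s z)" using i0 by (auto simp: vec_def part_def fun_eq_iff)
      have "mpeval f (part s z) = 0" if f: "f \<in> forms 2 d" "\<forall>Q\<in>C. vanishes f Q" for f d
      proof -
        \<comment> \<open>A form on C is pulled back through block s and multiplied by the pivot,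
          because block s is zero at some points of the scroll; at z the pivot can be
          cancelled.\<close>
        have hf: "hform 5 (Suc 0 + d) (\<lambda>z. z (i0 + s) * mpeval f (part s z))"
          by (rule hform_mult[OF hform_var[unfolded One_nat_def]
                hform_compose[OF hform_mpeval[OF f(1)] hmap_part[OF s03]]])
            (use s i0 in auto)
        have "z (i0 + s) * mpeval f (part s z) = 0"
        proof (rule cl[OF hf])
          fix x assume x: "pt x \<in> scroll C"
          show "x (i0 + s) * mpeval f (part s x) = 0"
          proof (cases "x (i0 + s) = 0")
            case False
            then have "part s x \<noteq> (\<lambda>_. 0)" using i0 by (auto simp: part_def fun_eq_iff)
            then have "pt (part s x) \<in> C" using scroll_part[OF Cp x s03] by blast
            then show ?thesis using f by (metis mult_zero_right vanishes_pt)
          qed simp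
        qed
        then show ?thesis using i0 by simp
      qed
      then show ?thesis using nz by (auto simp: clo_def)
    qed
    then have "pt (part s z) \<in> C" using clo_minimal[OF C order_refl] by blast
    from scrollI[OF s z(2) i0 this minors] show "P \<in> scroll C" by (simp add: z)
  qed
  then have "clo 5 (scroll C) = scroll C" using subset_clo[OF scroll_subset_proj[OF Cp]] by blast
  then show ?thesis by (metis zclosed_clo)
qed

lemma mpeval_seg_line:
  "\<exists>P. \<forall>b. mpeval f (seg a b y) = poly P b" "\<exists>P. \<forall>a. mpeval f (seg a b y) = poly P a"
proof -
  have 1: "seg a b y = (\<lambda>i. seg a 0 y i + b * seg 0 1 y i)" for a b
    by (auto simp: seg_def)
  show "\<exists>P. \<forall>b. mpeval f (seg a b y) = poly P b"
    using mpeval_along_line[of f "seg a 0 y" "seg 0 1 y"] by (simp flip: 1)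
  have 2: "seg a b y = (\<lambda>i. seg 0 b y i + a * seg 1 0 y i)" for a b
    by (auto simp: seg_def)
  show "\<exists>P. \<forall>a. mpeval f (seg a b y) = poly P a"
    using mpeval_along_line[of f "seg 0 b y" "seg 1 0 y"] by (simp flip: 2)
qed

lemma hmap_seg: "hmap 2 5 1 (seg a b)"
proof -
  have "hform 2 1 (\<lambda>y. seg a b y i)" if "i \<le> 5" for i
    using that by (cases "i \<le> 2") (auto simp: seg_def intro!: hform_cmult hform_var[unfolded One_nat_def])
  then show ?thesis by (auto simp: hmap_def seg_def)
qed

lemma seg_scale: "seg (c * a) (c * b) y = (\<lambda>i. c * seg a b y i)"
  by (auto simp: seg_def)

text \<open>On each slice b = const the scroll is a copy of C, so f or g vanishes there. One of them
  does so for infinitely many b, hence for all b, being polynomial in b; the slice a = 0 follows by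
  polynomiality in a.\<close>

lemma variety_scroll:
  assumes C: "variety 2 C"
  shows "variety 5 (scroll C)"
proof (rule varietyI)
  have Cp: "C \<subseteq> proj 2" using C by (intro zclosed_subset_proj variety_zclosed)
  show "zclosed 5 (scroll C)" using C by (intro zclosed_scroll variety_zclosed)
  obtain P where "P \<in> C" using C by (auto simp: variety_def)
  then obtain y where "pt y \<in> C" using subset_projE[OF Cp] by metis
  then show "scroll C \<noteq> {}" unfolding scroll_def by (auto intro!: exI[of _ 1])
  fix f d g e assume f: "f \<in> forms 5 d" and g: "g \<in> forms 5 e"
    and fg: "\<And>P. P \<in> scroll C \<Longrightarrow> vanishes f P \<or> vanishes g P"
  define V where "V h = {b. \<forall>y. pt y \<in> C \<longrightarrow> mpeval h (seg 1 b y) = 0}" for h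
  have "b \<in> V f \<or> b \<in> V g" for b
  proof -
    have "(\<forall>y. pt y \<in> C \<longrightarrow> mpeval f (seg 1 b y) = 0) \<or> (\<forall>y. pt y \<in> C \<longrightarrow> mpeval g (seg 1 b y) = 0)"
    proof (rule variety_hformD[OF C])
      show "hform 2 (1 * d) (\<lambda>y. mpeval f (seg 1 b y))"
        by (rule hform_compose[OF hform_mpeval[OF f] hmap_seg])
      show "hform 2 (1 * e) (\<lambda>y. mpeval g (seg 1 b y))"
        by (rule hform_compose[OF hform_mpeval[OF g] hmap_seg])
      fix y assume y: "pt y \<in> C"
      have "pt (seg 1 b y) \<in> scroll C" unfolding scroll_def using y one_neq_zero by blast
      from fg[OF this] show "mpeval f (seg 1 b y) * mpeval g (seg 1 b y) = 0"
        using f g by auto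
    qed
    then show ?thesis by (simp add: V_def)
  qed
  then have "V f \<union> V g = UNIV" by blast
  then have "infinite (V f) \<or> infinite (V g)"
    by (metis finite_UnI infinite_UNIV_char_0)
  moreover have van: "\<forall>P\<in>scroll C. vanishes h P" if h: "h \<in> forms 5 k" and inf: "infinite (V h)" for h k
  proof
    fix P assume "P \<in> scroll C"
    then obtain a b y where y: "P = pt (seg a b y)" "pt y \<in> C" "a \<noteq> 0 \<or> b \<noteq> 0"
      by (auto simp: scroll_def)
    have one: "mpeval h (seg 1 b y) = 0" for b
    proof -
      obtain p where p: "\<forall>b. mpeval h (seg 1 b y) = poly p b" using mpeval_seg_line(1) by blast
      have "V h \<subseteq> {b. poly p b = 0}" using p y by (auto simp: V_def)
      then have "infinite {b. poly p b = 0}" using inf finite_subset by blast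
      then have "p = 0" using poly_roots_finite by blast
      then show ?thesis using p by simp
    qed
    have "mpeval h (seg a b y) = 0" if "a \<noteq> 0" for a b
    proof -
      have "seg a b y = (\<lambda>i. a * seg 1 (b / a) y i)"
        using seg_scale[of a 1 "b / a" y] that by simp
      then show ?thesis using forms_homogeneous[OF h] one by simp
    qed note nz = this
    obtain p where p: "\<forall>a. mpeval h (seg a b y) = poly p a" using mpeval_seg_line(2) by blast
    have "UNIV - {0} \<subseteq> {a. poly p a = 0}" using nz[of _ b] by (simp add: p subset_eq)
    then have "infinite {a. poly p a = 0}"
      using infinite_UNIV_char_0 by (metis finite.emptyI finite_Diff_insert finite_subset Diff_empty)
    then have "p = 0" using poly_roots_finite by blast
    then show "vanishes h P" using p y h by simp
  qed
  ultimately show "(\<forall>P\<in>scroll C. vanishes f P) \<or> (\<forall>P\<in>scroll C. vanishes g P)"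
    using van[OF f] van[OF g] by blast
qed

text \<open>The codimension is three. Near a point with a nonzero pivot the equations are F on the
  pivot block and two minors through the pivot. Derivatives in the other block see only the minors
  and isolate them one by one; the gradient of F then settles the remaining coefficient.\<close>

lemma smooth_scroll:
  assumes C: "C = {P \<in> proj 2. vanishes F P}" and F: "F \<in> forms 2 d"
    and grad: "\<And>y. pt y \<in> C \<Longrightarrow> \<exists>k\<le>2. mpeval (pdiff k F) y \<noteq> 0"
  shows "smooth 5 2 (scroll C)"
  unfolding smooth_def
proof
  have Cp: "C \<subseteq> proj 2" using C by blast
  fix P assume P: "P \<in> scroll C"
  obtain z where z: "P = pt z" "vec 5 z" using subset_projE[OF scroll_subset_proj[OF Cp] P] by blast
  obtain s s' i0 :: nat where s: "s = 0 \<and> s' = 3 \<or> s = 3 \<and> s' = 0" and i0: "i0 \<le> 2" "z (i0 + s) \<noteq> 0"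
    using nonzero_part[OF z(2)] by blast
  have s03: "s = 0 \<or> s = 3" using s by blast
  obtain k1 k2 :: nat where k: "k1 \<le> 2" "k2 \<le> 2" "k1 \<noteq> k2" "k1 \<noteq> i0" "k2 \<noteq> i0"
    and all: "\<And>j. j \<le> 2 \<Longrightarrow> j = i0 \<or> j = k1 \<or> j = k2"
  proof -
    consider "i0 = 0" | "i0 = 1" | "i0 = 2" using i0 by linarith
    then show ?thesis
    proof cases
      case 1 show ?thesis by (rule that[of 1 2]) (use 1 in auto)
    next
      case 2 show ?thesis by (rule that[of 0 2]) (use 2 in auto)
    next
      case 3 show ?thesis by (rule that[of 0 1]) (use 3 in auto)
    qed
  qed
  define q where "q j = var (i0 + s) * var (j + s') - var (j + s) * var (i0 + s')" for j
  have q: "q j \<in> forms 5 2" if "j \<le> 2" for j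
    unfolding q_def using forms_mult[OF forms_var forms_var, of _ 5] s i0 that
    by (auto intro!: forms_diff simp: numeral_2_eq_2)
  have qev: "mpeval (q j) x = x (i0 + s) * x (j + s') - x (j + s) * x (i0 + s')" for j x
    by (simp add: q_def)
  obtain G where G: "G \<in> forms 5 (1 * d)" "\<And>x. mpeval G x = mpeval F (part s x)"
    using hform_compose[OF hform_mpeval[OF F] hmap_part[OF s03]] hformE by blast
  define f where "f i = (if i = 0 then G else if i = Suc 0 then q k1 else q k2)" for i :: nat
  have sum3: "(\<Sum>i<5 - 2. g i) = g 0 + g (Suc 0) + g (Suc (Suc 0))" for g :: "nat \<Rightarrow> complex"
    by (simp add: numeral_eq_Suc)
  have all3: "(\<forall>i<5 - 2. Q i) \<longleftrightarrow> Q 0 \<and> Q (Suc 0) \<and> Q (Suc (Suc 0))" for Q :: "nat \<Rightarrow> bool"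
    by (auto simp: numeral_eq_Suc less_Suc_eq)
  define Z where "Z = {P \<in> proj 5. vanishes (var (i0 + s)) P}"
  have vf: "var (i0 + s) \<in> forms 5 1" by (rule forms_var) (use s i0 in auto)
  show "smooth_at 5 2 (scroll C) P"
    unfolding smooth_at_def
  proof (intro conjI exI[of _ f] exI[of _ Z] P)
    have GC: "vanishes G Q" if "Q \<in> scroll C" for Q
    proof -
      obtain x where x: "Q = pt x" "vec 5 x"
        using subset_projE[OF scroll_subset_proj[OF Cp] \<open>Q \<in> scroll C\<close>] by blast
      have "mpeval F (part s x) = 0"
      proof (cases "part s x = (\<lambda>_. 0)")
        case True
        \<comment> \<open>If block s is zero, membership in C gives nothing and F has to be
          evaluated at the zero vector. In degree 0 the form is constant, and it is zero because C
          has a point.\<close>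
        have F0: "mpeval F (\<lambda>_. 0) = 0"
        proof -
          obtain y where y: "pt y \<in> C" using P by (auto simp: scroll_def)
          then have "mpeval F y = 0" using C F by auto
          show ?thesis
          proof (cases "d = 0")
            case True
            then show ?thesis using forms_homogeneous[OF F, of 0 y] \<open>mpeval F y = 0\<close> by simp
          next
            case False
            then show ?thesis using forms_homogeneous[OF F, of 0 y] by simp
          qed
        qed
        then show ?thesis using True by simp
      next
        case False
        then have "pt (part s x) \<in> C" using scroll_part[OF Cp _ s03] that x by blast
        then show ?thesis using C F by auto
      qed
      then show ?thesis using x G by simp
    qed
    have qC: "vanishes (q j) Q" if "Q \<in> scroll C" "j \<le> 2" for Q j
    proof -
      obtain x where x: "Q = pt x"
        using subset_projE[OF scroll_subset_proj[OF Cp] \<open>Q \<in> scroll C\<close>] by blast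
      have "mpeval (q j) x = 0"
        using scroll_minors[OF Cp _ i0(1) \<open>j \<le> 2\<close> s] that x by (simp add: qev)
      then show ?thesis using q[OF that(2)] x by simp
    qed
    show "\<forall>i<5 - 2. f i \<in> ideal_of 5 (scroll C) \<and> (\<exists>e. f i \<in> forms 5 e)"
      unfolding all3 using G(1) q k GC qC
      by (auto simp: f_def ideal_of_def intro: forms_polys)
    show "zclosed 5 Z" unfolding Z_def by (rule zclosed_form[OF vf])
    show "P \<notin> Z" using vf i0 z by (simp add: Z_def)
    show "\<forall>Q\<in>proj 5 - Z. (\<forall>i<5 - 2. vanishes (f i) Q) \<longrightarrow> Q \<in> scroll C"
    proof (intro ballI impI)
      fix Q assume Q: "Q \<in> proj 5 - Z" and van: "\<forall>i<5 - 2. vanishes (f i) Q"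
      obtain x where x: "Q = pt x" "vec 5 x" using Q by (auto simp: proj_iff)
      have x0: "x (i0 + s) \<noteq> 0" using Q x vf by (simp add: Z_def)
      have "mpeval G x = 0" "mpeval (q k1) x = 0" "mpeval (q k2) x = 0"
        using van G(1) q[OF k(1)] q[OF k(2)] x unfolding all3 by (auto simp: f_def)
      then have m: "x (i0 + s) * x (j + s') = x (j + s) * x (i0 + s')" if "j \<le> 2" for j
        using all[OF that] by (auto simp: qev)
      have "vec 2 (part s x)" using i0 x0 by (auto simp: vec_def part_def fun_eq_iff)
      moreover have "mpeval F (part s x) = 0" using \<open>mpeval G x = 0\<close> G by simp
      ultimately have "pt (part s x) \<in> C" using C F by simp
      from scrollI[OF s x(2) i0(1) x0 this m] show "Q \<in> scroll C" by (simp add: x)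
    qed
    show "\<forall>x\<in>P. \<forall>c. (\<forall>j\<le>5. (\<Sum>i<5 - 2. c i * mpeval (pdiff j (f i)) x) = 0) \<longrightarrow> (\<forall>i<5 - 2. c i = 0)"
    proof (rule ballI, rule allI, rule impI)
      fix x and c :: "nat \<Rightarrow> complex"
      assume x: "x \<in> P" and c0: "\<forall>j\<le>5. (\<Sum>i<5 - 2. c i * mpeval (pdiff j (f i)) x) = 0"
      have Px: "P = pt x" using x z pt_mem by simp
      have x0: "x (i0 + s) \<noteq> 0" using x i0 z by (auto simp: mem_pt_iff)
      have c: "c 0 * mpeval (pdiff j G) x + c (Suc 0) * mpeval (pdiff j (q k1)) x
          + c (Suc (Suc 0)) * mpeval (pdiff j (q k2)) x = 0" if "j \<le> 5" for j
        using c0 that by (simp only: sum3) (simp add: f_def)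
      have dG': "mpeval (pdiff (j + s') G) x = 0" if "j \<le> 2" for j
      proof (rule mpeval_pdiff_eq)
        have "part s (x(j + s' := t)) = part s x" for t
          using s that by (auto simp: part_def fun_eq_iff)
        then show "((\<lambda>t. mpeval G (x(j + s' := t))) has_field_derivative 0) (at (x (j + s')))"
          by (simp add: G)
      qed
      have dG: "mpeval (pdiff (j + s) G) x = mpeval (pdiff j F) (part s x)" if "j \<le> 2" for j
      proof (rule mpeval_pdiff_eq)
        have "part s (x(j + s := t)) = (part s x)(j := t)" for t
          using that by (auto simp: part_def fun_eq_iff)
        moreover have "part s x j = x (j + s)" using that by (simp add: part_def)
        ultimately show "((\<lambda>t. mpeval G (x(j + s := t))) has_field_derivative
            mpeval (pdiff j F) (part s x)) (at (x (j + s)))"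
          using mpeval_pdiff[of F "part s x" j] by (simp add: G)
      qed
      have dq: "mpeval (pdiff (k + s') (q j)) x = (if j = k then x (i0 + s) else 0)"
        if "k \<le> 2" "j \<le> 2" "k \<noteq> i0" for j k
        using s i0 that by (auto simp: q_def pdiff_diff pdiff_mult pdiff_var)
      have c1: "c (Suc 0) = 0" using c[of "k1 + s'"] dG' dq k x0 s by auto
      have c2: "c (Suc (Suc 0)) = 0" using c[of "k2 + s'"] dG' dq k x0 s by auto
      have "part s x \<noteq> (\<lambda>_. 0)" using x0 i0 by (auto simp: part_def fun_eq_iff)
      then have "pt (part s x) \<in> C" using scroll_part[OF Cp _ s03] P Px by blast
      then obtain j where j: "j \<le> 2" "mpeval (pdiff j F) (part s x) \<noteq> 0" using grad by blast
      then have "c 0 = 0" using c[of "j + s"] dG[OF j(1)] c1 c2 s by auto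
      with c1 c2 show "\<forall>i<5 - 2. c i = 0" unfolding all3 by simp
    qed
  qed simp
qed

lemma smooth_plane_curve:
  assumes C: "C = {P \<in> proj 2. vanishes F P}" and F: "F \<in> forms 2 d"
    and grad: "\<And>y. pt y \<in> C \<Longrightarrow> \<exists>k\<le>2. mpeval (pdiff k F) y \<noteq> 0"
  shows "smooth 2 1 C"
  unfolding smooth_def
proof
  fix P assume P: "P \<in> C"
  show "smooth_at 2 1 C P"
    unfolding smooth_at_def
  proof (intro conjI exI[of _ "\<lambda>_. F"] exI[of _ "{}"] P ballI allI impI)
    fix x and c :: "nat \<Rightarrow> complex" and i :: nat
    assume x: "x \<in> P" and c: "\<forall>j\<le>2. (\<Sum>i<2 - 1. c i * mpeval (pdiff j F) x) = 0" and i: "i < 2 - 1"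
    have "P = pt x" using x P C proj_mem by blast
    then obtain k where k: "k \<le> 2" "mpeval (pdiff k F) x \<noteq> 0" using grad P by blast
    with c have "(\<Sum>i<2 - 1. c i * mpeval (pdiff k F) x) = 0" by blast
    then show "c i = 0" using i k by simp
  qed (use F C in \<open>auto simp: ideal_of_def zclosed_empty intro: forms_polys\<close>)
qed

text \<open>The projection reads off a nonzero block; the blocks are proportional, so it is regular.
  Each fibre is a line on which the coordinates i and i + 3 serve as homogeneous coordinates, for an
  index i with \<open>y i \<noteq> 0\<close>.\<close>

lemma ruled_scroll:
  assumes var: "variety 2 C" and C: "C = {P \<in> proj 2. vanishes F P}" and F: "F \<in> forms 2 d"
    and grad: "\<And>y. pt y \<in> C \<Longrightarrow> \<exists>k\<le>2. mpeval (pdiff k F) y \<noteq> 0"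
  shows "ruled_surface 5 (scroll C) 2 C"
proof -
  have Cp: "C \<subseteq> proj 2" using C by blast
  define f where "f P = (let x = SOME x. x \<in> P in
    if part 0 x = (\<lambda>_. 0) then pt (part 3 x) else pt (part 0 x))" for P
  have f: "f (pt (seg a b y)) = pt y" if y: "vec 2 y" and ab: "a \<noteq> 0 \<or> b \<noteq> 0" for a b y
  proof -
    have "(SOME x. x \<in> pt (seg a b y)) \<in> pt (seg a b y)"
      using someI[of "\<lambda>x. x \<in> pt (seg a b y)" "seg a b y"] by simp
    then obtain c where c: "c \<noteq> 0" "(SOME x. x \<in> pt (seg a b y)) = seg (c * a) (c * b) y"
      by (auto simp: mem_pt_iff seg_scale)
    show ?thesis
      using y ab c(1) by (auto simp: f_def Let_def c(2) part_0_seg part_3_seg vec_def fun_eq_iff)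
  qed
  have reg: "regular 5 (scroll C) 2 f"
    unfolding regular_def
  proof
    fix P assume P: "P \<in> scroll C"
    obtain z where z: "P = pt z" "vec 5 z" using subset_projE[OF scroll_subset_proj[OF Cp] P] by blast
    obtain s s' i0 :: nat where s: "s = 0 \<and> s' = 3 \<or> s = 3 \<and> s' = 0" and i0: "i0 \<le> 2" "z (i0 + s) \<noteq> 0"
      using nonzero_part[OF z(2)] by blast
    have vf: "var (i0 + s) \<in> forms 5 1" by (rule forms_var) (use s i0 in auto)
    show "\<exists>F d Z. (\<forall>i\<le>2. F i \<in> forms 5 d) \<and> zclosed 5 Z \<and> P \<notin> Z \<and>
       (\<forall>Q\<in>scroll C - Z. \<forall>x\<in>Q. hvec 2 F x \<noteq> (\<lambda>_. 0) \<and> f Q = pt (hvec 2 F x))"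
    proof (intro exI conjI ballI)
      show "\<forall>i\<le>2. var (i + s) \<in> forms 5 1" using s by (auto intro!: forms_var[unfolded One_nat_def])
      show "zclosed 5 {P \<in> proj 5. vanishes (var (i0 + s)) P}" by (rule zclosed_form[OF vf])
      show "P \<notin> {P \<in> proj 5. vanishes (var (i0 + s)) P}" using vf i0 z by simp
      fix Q x assume Q: "Q \<in> scroll C - {P \<in> proj 5. vanishes (var (i0 + s)) P}" and x: "x \<in> Q"
      have hv: "hvec 2 (\<lambda>i. var (i + s)) x = part s x" by (auto simp: hvec_def part_def)
      have Qx: "Q = pt x" "vec 5 x" using Q x scroll_subset_proj[OF Cp] proj_mem by blast+
      then have "x (i0 + s) \<noteq> 0" using Q vf by simp
      then show nz: "hvec 2 (\<lambda>i. var (i + s)) x \<noteq> (\<lambda>_. 0)"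
        unfolding hv using i0 by (auto simp: part_def fun_eq_iff)
      have "pt x \<in> scroll C" using Q Qx by simp
      then obtain a b y where y: "x = seg a b y" "vec 2 y" "a \<noteq> 0 \<or> b \<noteq> 0"
        using scrollE[OF Cp] by metis
      have "f Q = pt y" using f y Qx by simp
      also have "pt y = pt (part s x)"
      proof -
        define k where "k = (if s = 0 then a else b)"
        have k: "part s x = (\<lambda>i. k * y i)"
          using s by (auto simp: y(1) part_0_seg part_3_seg y(2) k_def)
        then have "k \<noteq> 0" using nz by (auto simp: hv)
        then show ?thesis unfolding k by (rule pt_scale[symmetric])
      qed
      finally show "f Q = pt (hvec 2 (\<lambda>i. var (i + s)) x)" unfolding hv .
    qed
  qed
  have img: "f ` scroll C = C"
  proof (intro set_eqI iffI)
    fix P assume "P \<in> f ` scroll C"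
    then obtain a b y where "P = f (pt (seg a b y))" "pt y \<in> C" "a \<noteq> 0 \<or> b \<noteq> 0"
      by (auto simp: scroll_def)
    then show "P \<in> C" using f Cp by (metis pt_in_proj subsetD)
  next
    fix P assume P: "P \<in> C"
    then obtain y where y: "P = pt y" "vec 2 y" using subset_projE[OF Cp] by metis
    then have "P = f (pt (seg 1 0 y))" using f by simp
    moreover have "pt (seg 1 0 y) \<in> scroll C" using P y one_neq_zero unfolding scroll_def by blast
    ultimately show "P \<in> f ` scroll C" by blast
  qed
  have fibre: "isomorphic 5 {P \<in> scroll C. f P = c} 1 (proj 1)" if c: "c \<in> C" for c
  proof -
    obtain y where y: "c = pt y" "vec 2 y" using subset_projE[OF Cp c] by metis
    obtain i where i: "i \<le> 2" "y i \<noteq> 0" using vec_nonzero[OF y(2)] by blast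
    have seg_i: "seg a b y i = a * y i" "seg a b y (i + 3) = b * y i" for a b
      using i by (auto simp: seg_def)
    let ?U = "{P \<in> scroll C. f P = c}"
    have U: "\<exists>a b. z = seg a b y \<and> (a \<noteq> 0 \<or> b \<noteq> 0)" if z: "pt z \<in> ?U" for z
    proof -
      have "pt z \<in> scroll C" using z by simp
      then obtain a b y' where y': "z = seg a b y'" "vec 2 y'" "a \<noteq> 0 \<or> b \<noteq> 0"
        using scrollE[OF Cp] by metis
      then have "pt y' = pt y" using z f y by simp
      then have "y' \<in> pt y" by (metis pt_self)
      then obtain k where k: "k \<noteq> 0" "y' = (\<lambda>i. k * y i)" by (auto simp: mem_pt_iff)
      have "z = seg (a * k) (b * k) y" by (auto simp: y' k seg_def)
      then show ?thesis using k(1) y'(3) by (metis mult_eq_0_iff)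
    qed
    have U': "pt (seg a b y) \<in> ?U" if "a \<noteq> 0 \<or> b \<noteq> 0" for a b
      using f[OF y(2) that] c y that unfolding scroll_def by blast
    have Up: "?U \<subseteq> proj 5" using scroll_subset_proj[OF Cp] by blast
    define \<phi> where "\<phi> z = (\<lambda>j. if j = 0 then z i else if j = Suc 0 then z (i + 3) else 0)"
      for z :: "nat \<Rightarrow> complex"
    define \<psi> where "\<psi> t = seg (t 0) (t (Suc 0)) y" for t :: "nat \<Rightarrow> complex"
    have \<phi>: "hmap 5 1 1 \<phi>"
    proof -
      have "hform 5 1 (\<lambda>z. \<phi> z j)" if "j \<le> 1" for j
        using that i by (cases "j = 0") (auto simp: \<phi>_def intro!: hform_var[unfolded One_nat_def])
      then show ?thesis by (auto simp: hmap_def \<phi>_def)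
    qed
    have \<psi>: "hmap 1 5 1 \<psi>"
    proof -
      have "hform 1 1 (\<lambda>t. t 0 * y k)" "hform 1 1 (\<lambda>t. t (Suc 0) * y k)" for k
        by (subst mult.commute, intro hform_cmult hform_var, simp)+
      then have "hform 1 1 (\<lambda>t. \<psi> t j)" if "j \<le> 5" for j
        using that by (cases "j \<le> 2") (auto simp: \<psi>_def seg_def)
      then show ?thesis by (auto simp: hmap_def \<psi>_def seg_def)
    qed
    have vec1: "vec 1 t \<Longrightarrow> t 0 \<noteq> 0 \<or> t (Suc 0) \<noteq> 0" for t
      unfolding vec_def by (metis One_nat_def fun_eq_iff less_one linorder_neqE_nat nat_neq_iff)
    have \<phi>\<psi>: "\<phi> (\<psi> t) = (\<lambda>j. y i * t j)" if "vec 1 t" for t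
      using that by (auto simp: \<phi>_def \<psi>_def seg_i vec_def fun_eq_iff)
    have \<phi>ne: "vec 1 (\<phi> z)" and \<psi>\<phi>: "\<psi> (\<phi> z) = (\<lambda>j. y i * z j)" if z: "pt z \<in> ?U" for z
    proof -
      obtain a b where ab: "z = seg a b y" "a \<noteq> 0 \<or> b \<noteq> 0" using U[OF z] by blast
      have "\<phi> z 0 = a * y i" "\<phi> z (Suc 0) = b * y i" by (auto simp: \<phi>_def ab seg_i)
      then show "vec 1 (\<phi> z)" using ab(2) i by (auto simp: vec_def fun_eq_iff \<phi>_def)
      show "\<psi> (\<phi> z) = (\<lambda>j. y i * z j)"
        using ab(1) \<open>\<phi> z 0 = a * y i\<close> \<open>\<phi> z (Suc 0) = b * y i\<close>
        by (auto simp: \<psi>_def seg_def)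
    qed
    show ?thesis unfolding isomorphic_def
    proof (intro exI conjI ballI)
      show "regular 5 ?U 1 (pt_map \<phi>)"
        by (rule regularI[OF \<phi> Up]) (use \<phi>ne in \<open>auto simp: vec_def\<close>)
      show "regular 1 (proj 1) 5 (pt_map \<psi>)"
      proof (rule regularI[OF \<psi>])
        fix t assume "pt t \<in> proj 1"
        then have "vec 5 (\<psi> t)" unfolding \<psi>_def using vec1 by (intro vec_seg y) auto
        then show "\<psi> t \<noteq> (\<lambda>_. 0)" by (simp add: vec_def)
      qed simp
      show "pt_map \<phi> ` ?U \<subseteq> proj 1"
      proof (rule image_subsetI)
        fix P assume P: "P \<in> ?U"
        then obtain z where "P = pt z" using subset_projE[OF Up P] by blast
        then show "pt_map \<phi> P \<in> proj 1" using P \<phi>ne[of z] by (simp only: pt_map_pt[OF \<phi>] pt_in_proj)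
      qed
      show "pt_map \<psi> ` proj 1 \<subseteq> ?U"
      proof (rule image_subsetI)
        fix P assume P: "P \<in> proj 1"
        then obtain t where t: "P = pt t" "vec 1 t" by (auto simp: proj_iff)
        then show "pt_map \<psi> P \<in> ?U" using U'[OF vec1[OF t(2)]] by (simp only: pt_map_pt[OF \<psi>] \<psi>_def)
      qed
      fix P assume P: "P \<in> ?U"
      then obtain z where z: "P = pt z" using subset_projE[OF Up P] by blast
      then show "pt_map \<psi> (pt_map \<phi> P) = P"
        using \<psi>\<phi>[of z] P i by (simp add: pt_map_pt[OF \<phi>] pt_map_pt[OF \<psi>])
    next
      fix P assume P: "P \<in> proj 1"
      then obtain t where t: "P = pt t" "vec 1 t" by (auto simp: proj_iff)
      then show "pt_map \<phi> (pt_map \<psi> P) = P"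
        using \<phi>\<psi>[of t] i by (simp add: pt_map_pt[OF \<phi>] pt_map_pt[OF \<psi>])
    qed
  qed
  have "generally 2 C (\<lambda>c. isomorphic 5 {P \<in> scroll C. f P = c} 1 (proj 1))"
    unfolding generally_def
    by (rule exI[of _ "{}"]) (use fibre zclosed_empty var in \<open>auto simp: variety_def\<close>)
  then show ?thesis
    unfolding ruled_surface_def
    using var smooth_plane_curve[OF C F grad] variety_scroll[OF var] smooth_scroll[OF C F grad] reg img
    by blast
qed

section \<open>Weierstrass cubics\<close>

text \<open>The vectors u i form a basis of V modulo K. This stands in for a quotient space when the
  Hilbert function is computed.\<close>

lemma (in vector_space) dim_complement:
  assumes V: "subspace V" "V \<subseteq> span T" "finite T" and K: "subspace K" "K \<subseteq> V"
    and I: "finite I" "\<And>i. i \<in> I \<Longrightarrow> u i \<in> V" and sp: "V \<subseteq> span (u ` I \<union> K)"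
    and indep: "\<And>a. (\<Sum>i\<in>I. scale (a i) (u i)) \<in> K \<Longrightarrow> \<forall>i\<in>I. a i = 0"
  shows "dim V = card I + dim K"
proof -
  obtain B where B: "B \<subseteq> K" "independent B" "K \<subseteq> span B" "card B = dim K" by (rule basis_exists)
  have finB: "finite B" using independent_span_bound[OF V(3) B(2)] B(1) K V by auto
  have single: "(\<Sum>j\<in>I. scale (if j = i then 1 else 0) (u j)) = u i" if i: "i \<in> I" for i
  proof -
    have "(\<Sum>j\<in>I. scale (if j = i then 1 else 0) (u j)) = (\<Sum>j\<in>I. if j = i then u j else 0)"
      by (rule sum.cong) auto
    then show ?thesis using i I(1) by simp
  qed
  have uK: "u i \<notin> K" if i: "i \<in> I" for i
  proof
    assume "u i \<in> K"
    then have "(\<Sum>j\<in>I. scale (if j = i then 1 else 0) (u j)) \<in> K" by (simp only: single[OF i])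
    from indep[OF this] i show False by auto
  qed
  have inj: "inj_on u I"
  proof (rule inj_onI, rule ccontr)
    fix i j assume ij: "i \<in> I" "j \<in> I" "u i = u j" "i \<noteq> j"
    let ?a = "\<lambda>k. (if k = i then 1 else 0) - (if k = j then 1 else 0)"
    have "(\<Sum>k\<in>I. scale (?a k) (u k)) = u i - u j"
      by (simp only: scale_left_diff_distrib sum_subtractf single[OF ij(1)] single[OF ij(2)])
    also have "\<dots> \<in> K" using ij(3) subspace_0[OF K(1)] by simp
    finally have "(\<Sum>k\<in>I. scale (?a k) (u k)) \<in> K" .
    from bspec[OF indep[OF this] ij(1)] show False using ij(4) by simp
  qed
  have disj: "u ` I \<inter> B = {}" using uK B(1) by auto
  have "independent (u ` I \<union> B)"
  proof
    assume "dependent (u ` I \<union> B)"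
    then obtain g v where v: "v \<in> u ` I \<union> B" "g v \<noteq> 0" and g: "(\<Sum>v\<in>u ` I \<union> B. scale (g v) v) = 0"
      using I(1) finB by (auto simp: dependent_finite)
    have split: "(\<Sum>i\<in>I. scale (g (u i)) (u i)) + (\<Sum>v\<in>B. scale (g v) v) = 0"
      using g I(1) finB disj inj by (simp add: sum.union_disjoint sum.reindex)
    have "(\<Sum>v\<in>B. scale (g v) v) \<in> K"
      using B(1) K(1) by (auto intro!: subspace_sum subspace_scale)
    then have "(\<Sum>i\<in>I. scale (g (u i)) (u i)) \<in> K"
      using split subspace_neg[OF K(1), of "\<Sum>v\<in>B. scale (g v) v"] by (simp add: eq_neg_iff_add_eq_0[symmetric])
    from indep[OF this] have g0: "\<forall>i\<in>I. g (u i) = 0" .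
    then have "(\<Sum>v\<in>B. scale (g v) v) = 0" using split by simp
    then have "\<forall>v\<in>B. g v = 0" using B(2) finB by (auto simp: dependent_finite)
    with v g0 show False by auto
  qed
  moreover have "u ` I \<union> B \<subseteq> V" using I(2) B(1) K(2) by blast
  moreover have "V \<subseteq> span (u ` I \<union> B)"
  proof -
    have "u ` I \<union> K \<subseteq> span (u ` I \<union> B)"
      using B(3) span_mono[of B "u ` I \<union> B"] span_superset[of "u ` I \<union> B"] by blast
    then show ?thesis using sp span_minimal[OF _ subspace_span] by blast
  qed
  ultimately have "dim V = card (u ` I \<union> B)" using basis_card_eq_dim by metis
  then show ?thesis using I(1) finB disj inj B(4) by (simp add: card_Un_disjoint card_image)
qed

definition wv :: "complex \<Rightarrow> complex \<Rightarrow> complex \<Rightarrow> nat \<Rightarrow> complex" where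
  "wv x y z = (\<lambda>i. if i = 0 then x else if i = 1 then y else if i = 2 then z else 0)"

lemma wv_simps [simp]: "wv x y z 0 = x" "wv x y z (Suc 0) = y" "wv x y z 2 = z"
  by (simp_all add: wv_def)

lemma vec_2_wv: "vec 2 v \<longleftrightarrow> (\<exists>x y z. v = wv x y z \<and> (x \<noteq> 0 \<or> y \<noteq> 0 \<or> z \<noteq> 0))"
proof
  assume v: "vec 2 v"
  then have "v = wv (v 0) (v (Suc 0)) (v 2)"
    by (intro ext) (auto simp: vec_def wv_def le_Suc_eq numeral_2_eq_2)
  moreover obtain i where "i \<le> 2" "v i \<noteq> 0" using vec_nonzero[OF v] by blast
  then have "v 0 \<noteq> 0 \<or> v (Suc 0) \<noteq> 0 \<or> v 2 \<noteq> 0"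
    by (metis One_nat_def Suc_1 le_SucE le_zero_eq)
  ultimately show "\<exists>x y z. v = wv x y z \<and> (x \<noteq> 0 \<or> y \<noteq> 0 \<or> z \<noteq> 0)" by blast
next
  assume "\<exists>x y z. v = wv x y z \<and> (x \<noteq> 0 \<or> y \<noteq> 0 \<or> z \<noteq> 0)"
  then obtain x y z where v: "v = wv x y z" "x \<noteq> 0 \<or> y \<noteq> 0 \<or> z \<noteq> 0" by blast
  then have "v 0 \<noteq> 0 \<or> v (Suc 0) \<noteq> 0 \<or> v 2 \<noteq> 0" by simp
  then have "v \<noteq> (\<lambda>_. 0)" by auto
  then show "vec 2 v" by (simp add: vec_def v(1) wv_def)
qed

lemma vec_wv: "vec 2 (wv x y 1)"
  unfolding vec_2_wv using one_neq_zero by blast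

lemma wv_scale: "(\<lambda>i. c * wv x y z i) = wv (c * x) (c * y) (c * z)"
  by (auto simp: wv_def)

text \<open>The affine curve is y^2 = D(x), with D a cubic with distinct roots e0, e1, e2. Leading
  coefficient and roots are left free, because they will come from a quartic by a change of
  variable.\<close>

locale weierstrass =
  fixes A e0 e1 e2 :: complex
  assumes A: "A \<noteq> 0" and e: "e0 \<noteq> e1" "e0 \<noteq> e2" "e1 \<noteq> e2"
begin

definition F :: mpoly where
  "F = var 1 ^ 2 * var 2 - cst A * ((var 0 - cst e0 * var 2) *
     ((var 0 - cst e1 * var 2) * (var 0 - cst e2 * var 2)))"

definition C :: "point set" where
  "C = {P \<in> proj 2. vanishes F P}"

definition D :: "complex poly" where
  "D = smult A ([:- e0, 1:] * [:- e1, 1:] * [:- e2, 1:])"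

lemma D_eval: "poly D x = A * (x - e0) * (x - e1) * (x - e2)"
  by (simp add: D_def algebra_simps)

lemma D_degree: "degree D = 3"
  using A by (simp add: D_def degree_mult_eq)

lemma F_form: "F \<in> forms 2 3"
proof -
  have v: "var i \<in> forms 2 1" if "i \<le> 2" for i by (rule forms_var[OF that])
  have "cst c * var 2 \<in> forms 2 1" for c using forms_mult[OF forms_cst v[of 2]] by simp
  then have l: "var 0 - cst c * var 2 \<in> forms 2 1" for c using v by (intro forms_diff) auto
  have "cst A * ((var 0 - cst e0 * var 2) *
     ((var 0 - cst e1 * var 2) * (var 0 - cst e2 * var 2))) \<in> forms 2 (0 + (1 + (1 + 1)))"
    by (intro forms_mult forms_cst l)
  moreover have "var 1 * var 1 * var 2 \<in> forms 2 (1 + 1 + 1)" by (intro forms_mult v) auto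
  ultimately show ?thesis
    unfolding F_def by (intro forms_diff) (simp_all add: power2_eq_square numeral_3_eq_3)
qed

lemma F_eval: "mpeval F v = v 1 ^ 2 * v 2 - A * (v 0 - e0 * v 2) * (v 0 - e1 * v 2) * (v 0 - e2 * v 2)"
  by (simp add: F_def algebra_simps)

lemma F_affine: "mpeval F (wv x y 1) = y ^ 2 - poly D x"
  by (simp add: F_eval D_eval)

lemma mem_C: "pt v \<in> C \<longleftrightarrow> vec 2 v \<and> mpeval F v = 0"
  using F_form by (auto simp: C_def)

lemma C_subset: "C \<subseteq> proj 2"
  by (auto simp: C_def)

lemma affine_mem: "y ^ 2 = poly D x \<Longrightarrow> pt (wv x y 1) \<in> C"
  by (simp add: mem_C F_affine vec_wv)

lemma C_cases:
  assumes "P \<in> C"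
  obtains (affine) x y where "P = pt (wv x y 1)" "y ^ 2 = poly D x" | (infinity) "P = pt (wv 0 1 0)"
proof -
  obtain v where v: "P = pt v" using subset_projE[OF C_subset assms] by metis
  then have "vec 2 v" "mpeval F v = 0" using assms mem_C by auto
  then obtain x y z where xyz: "v = wv x y z" "x \<noteq> 0 \<or> y \<noteq> 0 \<or> z \<noteq> 0" by (auto simp: vec_2_wv)
  show ?thesis
  proof (cases "z = 0")
    case True
    then have "x = 0" using \<open>mpeval F v = 0\<close> A by (simp add: xyz F_eval)
    with True have y: "y \<noteq> 0" using xyz by simp
    have "pt (wv 0 1 0) = pt (\<lambda>i. y * wv 0 1 0 i)" using y by simp
    also have "\<dots> = P" unfolding wv_scale by (simp add: v xyz True \<open>x = 0\<close>)
    finally show ?thesis using infinity by blast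
  next
    case False
    have "pt (wv (x / z) (y / z) 1) = pt (\<lambda>i. z * wv (x / z) (y / z) 1 i)" using False by simp
    also have "\<dots> = P" unfolding wv_scale using False by (simp add: v xyz)
    finally have P: "P = pt (wv (x / z) (y / z) 1)" by simp
    then have "mpeval F (wv (x / z) (y / z) 1) = 0" using assms mem_C by blast
    then show ?thesis using affine[OF P] by (simp add: F_affine)
  qed
qed

text \<open>The point at infinity is the limit of the affine points with x = 1/h and y = 1/(h u),
  where u^2 = h/G forces y^2 = D(x). Multiplied by h u, their coordinates are (u : 1 : h u).\<close>

lemma infinity_limit:
  assumes f: "f \<in> forms 2 d" and 0: "\<And>x y. y ^ 2 = poly D x \<Longrightarrow> mpeval f (wv x y 1) = 0"
  shows "mpeval f (wv 0 1 0) = 0"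
proof -
  define h :: "nat \<Rightarrow> complex" where "h n = 1 / of_nat (Suc n)" for n
  have h: "h \<longlonglongrightarrow> 0" unfolding h_def by (rule LIMSEQ_Suc[OF lim_1_over_n])
  define G where "G n = A * (1 - e0 * h n) * (1 - e1 * h n) * (1 - e2 * h n)" for n
  have G: "G \<longlonglongrightarrow> A * (1 - e0 * 0) * (1 - e1 * 0) * (1 - e2 * 0)"
    unfolding G_def by (intro tendsto_intros h)
  then have GA: "G \<longlonglongrightarrow> A" by simp
  define u where "u n = csqrt (h n / G n)" for n
  have "(\<lambda>n. h n / G n) \<longlonglongrightarrow> 0 / A" using A by (intro tendsto_divide h GA)
  then have "(\<lambda>n. sqrt (norm (h n / G n))) \<longlonglongrightarrow> sqrt (norm (0 / A))"
    by (intro tendsto_real_sqrt tendsto_norm)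
  then have "(\<lambda>n. norm (u n)) \<longlonglongrightarrow> 0" by (simp add: u_def)
  then have u: "u \<longlonglongrightarrow> 0" by (rule tendsto_norm_zero_cancel)
  have ev: "eventually (\<lambda>n. mpeval f (wv (u n) 1 (h n * u n)) = 0) sequentially"
  proof -
    have "eventually (\<lambda>n. G n \<noteq> 0) sequentially"
      using tendsto_imp_eventually_ne[OF GA A] .
    then show ?thesis
    proof eventually_elim
      case (elim n)
      have hn: "h n \<noteq> 0" by (simp add: h_def del: of_nat_Suc)
      have un2: "u n ^ 2 = h n / G n" by (simp add: u_def)
      then have un: "u n \<noteq> 0" using hn elim by auto
      define c where "c = h n * u n"
      have c: "c \<noteq> 0" using hn un by (simp add: c_def)
      have "poly D (u n / c) = A * (1 / h n - e0) * (1 / h n - e1) * (1 / h n - e2)"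
        using un by (simp add: D_eval c_def)
      also have "\<dots> = G n / h n ^ 3"
      proof -
        have "1 / h n - t = (1 - t * h n) / h n" for t using hn by (simp add: diff_divide_distrib)
        then show ?thesis by (simp add: G_def power3_eq_cube)
      qed
      also have "\<dots> = 1 / (h n ^ 2 * u n ^ 2)"
        unfolding un2 by (simp add: power2_eq_square power3_eq_cube)
      also have "\<dots> = (1 / c) ^ 2" by (simp add: c_def power_mult_distrib power_divide)
      finally have "mpeval f (wv (u n / c) (1 / c) 1) = 0" by (intro 0) simp
      moreover have "wv (u n) 1 (h n * u n) = (\<lambda>i. c * wv (u n / c) (1 / c) 1 i)"
        unfolding wv_scale using c by (simp add: c_def[symmetric])
      ultimately show ?case using forms_homogeneous[OF f] by simp
    qed
  qed
  have "(\<lambda>n. mpeval f (wv (u n) 1 (h n * u n))) \<longlonglongrightarrow> mpeval f (wv 0 1 (0 * 0))"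
  proof (rule mpeval_tendsto)
    fix i
    show "(\<lambda>n. wv (u n) 1 (h n * u n) i) \<longlonglongrightarrow> wv 0 1 (0 * 0) i"
      using u tendsto_mult[OF h u] by (cases "i = 2") (auto simp: wv_def)
  qed
  moreover have "(\<lambda>n. mpeval f (wv (u n) 1 (h n * u n))) \<longlonglongrightarrow> 0"
    using tendsto_eventually[OF ev] .
  ultimately show ?thesis using LIMSEQ_unique by (metis mult_zero_left)
qed

lemma vanishes_on_C:
  assumes f: "f \<in> forms 2 d"
  shows "(\<forall>P\<in>C. vanishes f P) \<longleftrightarrow> (\<forall>x y. y ^ 2 = poly D x \<longrightarrow> mpeval f (wv x y 1) = 0)"
    (is "?l \<longleftrightarrow> ?r")
proof
  show "?l \<Longrightarrow> ?r" using affine_mem vanishes_pt[OF f] by blast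
  assume r: ?r
  show ?l
  proof
    fix P assume "P \<in> C"
    then show "vanishes f P"
      by (cases rule: C_cases) (use r infinity_limit[OF f] vanishes_pt[OF f] in auto)
  qed
qed

text \<open>The affine coordinate ring is spanned by 1 and y over the polynomials in x, as y^2 =
  D.\<close>

lemma affine_function:
  "\<exists>a b. \<forall>x y. y ^ 2 = poly D x \<longrightarrow> mpeval f (wv x y 1) = poly a x + y * poly b x"
proof -
  obtain n where "f \<in> polys n" using mpoly_in_polys by blast
  then show ?thesis
  proof (induction rule: polys_induct)
    case (cst c)
    show ?case by (rule exI[of _ "[:c:]"], rule exI[of _ 0]) simp
  next
    case (var i)
    consider "i = 0" | "i = 1" | "i = 2" | "i > 2" by linarith
    then show ?case
    proof cases
      case 1
      show ?thesis by (rule exI[of _ "[:0, 1:]"], rule exI[of _ 0]) (simp add: 1)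
    next
      case 2
      show ?thesis by (rule exI[of _ 0], rule exI[of _ 1]) (simp add: 2)
    next
      case 3
      show ?thesis by (rule exI[of _ 1], rule exI[of _ 0]) (simp add: 3)
    next
      case 4
      show ?thesis by (rule exI[of _ 0], rule exI[of _ 0]) (use 4 in \<open>simp add: wv_def\<close>)
    qed
  next
    case (add f g)
    then obtain a b a' b' where
      "\<forall>x y. y ^ 2 = poly D x \<longrightarrow> mpeval f (wv x y 1) = poly a x + y * poly b x"
      "\<forall>x y. y ^ 2 = poly D x \<longrightarrow> mpeval g (wv x y 1) = poly a' x + y * poly b' x" by blast
    then show ?case
      by (intro exI[of _ "a + a'"] exI[of _ "b + b'"]) (simp add: algebra_simps)
  next
    case (mult f g)
    then obtain a b a' b' where
      f: "\<forall>x y. y ^ 2 = poly D x \<longrightarrow> mpeval f (wv x y 1) = poly a x + y * poly b x" and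
      g: "\<forall>x y. y ^ 2 = poly D x \<longrightarrow> mpeval g (wv x y 1) = poly a' x + y * poly b' x" by blast
    have "mpeval (f * g) (wv x y 1) =
        poly (a * a' + D * b * b') x + y * poly (a * b' + a' * b) x" if y: "y ^ 2 = poly D x" for x y
    proof -
      have "mpeval (f * g) (wv x y 1) = (poly a x + y * poly b x) * (poly a' x + y * poly b' x)"
        using f g y by simp
      then show ?thesis by (simp add: algebra_simps power2_eq_square flip: y)
    qed
    then show ?case by blast
  qed
qed

text \<open>The degree of the norm \<open>a\<^sup>2 - b\<^sup>2 D\<close> of a function \<open>a + b y\<close> cannot cancel, by parity.\<close>

lemma norm_zero:
  assumes "a * a = b * b * D"
  shows "a = 0" "b = 0"
proof -
  show b: "b = 0"
  proof (rule ccontr)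
    assume b: "b \<noteq> 0"
    have "D \<noteq> 0" using D_degree by auto
    then have "a \<noteq> 0" using assms b by auto
    have "degree (a * a) = degree (b * b * D)" using assms by simp
    then have "2 * degree a = 2 * degree b + 3"
      using \<open>a \<noteq> 0\<close> b \<open>D \<noteq> 0\<close> D_degree by (simp add: degree_mult_eq)
    then show False by presburger
  qed
  then show "a = 0" using assms by simp
qed

text \<open>Multiplying f g by its conjugate under the sign change of y gives the product of the
  norms of f and g, a polynomial in x that is identically zero. So one norm is zero, and
  \<open>norm_zero\<close> makes that function vanish on the curve.\<close>

lemma variety_C: "variety 2 C"
proof (rule varietyI)
  show "zclosed 2 C" unfolding C_def by (rule zclosed_form[OF F_form])
  show "C \<noteq> {}" using affine_mem[of "csqrt (poly D 0)" 0] by auto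
  fix f d g e assume f: "f \<in> forms 2 d" and g: "g \<in> forms 2 e"
    and fg: "\<And>P. P \<in> C \<Longrightarrow> vanishes f P \<or> vanishes g P"
  obtain a b where ab: "\<And>x y. y ^ 2 = poly D x \<Longrightarrow> mpeval f (wv x y 1) = poly a x + y * poly b x"
    using affine_function by blast
  obtain a' b' where ab': "\<And>x y. y ^ 2 = poly D x \<Longrightarrow> mpeval g (wv x y 1) = poly a' x + y * poly b' x"
    using affine_function by blast
  have prod0: "(poly a x + y * poly b x) * (poly a' x + y * poly b' x) = 0" if y: "y ^ 2 = poly D x" for x y
    using fg[OF affine_mem[OF y]] ab[OF y] ab'[OF y] f g by auto
  have "poly ((a * a - b * b * D) * (a' * a' - b' * b' * D)) x = 0" for x
  proof -
    define y where "y = csqrt (poly D x)"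
    have y: "y ^ 2 = poly D x" "(- y) ^ 2 = poly D x" by (simp_all add: y_def)
    have "poly ((a * a - b * b * D) * (a' * a' - b' * b' * D)) x =
      ((poly a x + y * poly b x) * (poly a' x + y * poly b' x)) *
      ((poly a x + (- y) * poly b x) * (poly a' x + (- y) * poly b' x))"
      by (simp add: algebra_simps power2_eq_square flip: y(1))
    then show ?thesis using prod0[OF y(1)] by simp
  qed
  then have "(a * a - b * b * D) * (a' * a' - b' * b' * D) = 0" using poly_all_0_iff_0 by blast
  then have "a * a = b * b * D \<or> a' * a' = b' * b' * D" by auto
  then show "(\<forall>P\<in>C. vanishes f P) \<or> (\<forall>P\<in>C. vanishes g P)"
    unfolding vanishes_on_C[OF f] vanishes_on_C[OF g] using norm_zero ab ab' by fastforce
qed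

lemma pdiff_F:
  "mpeval (pdiff 1 F) v = 2 * v 1 * v 2"
  "mpeval (pdiff 0 F) v = - A * ((v 0 - e1 * v 2) * (v 0 - e2 * v 2) +
     (v 0 - e0 * v 2) * (v 0 - e2 * v 2) + (v 0 - e0 * v 2) * (v 0 - e1 * v 2))"
proof -
  show "mpeval (pdiff 1 F) v = 2 * v 1 * v 2"
    by (simp add: F_def pdiff_diff pdiff_mult pdiff_var power2_eq_square)
  have "mpeval (pdiff 0 F) v = - (A * ((v 0 - e1 * v 2) * (v 0 - e2 * v 2) +
     (v 0 - e0 * v 2) * ((v 0 - e2 * v 2) + (v 0 - e1 * v 2))))"
    by (simp add: F_def pdiff_diff pdiff_mult pdiff_var power2_eq_square)
  then show "mpeval (pdiff 0 F) v = - A * ((v 0 - e1 * v 2) * (v 0 - e2 * v 2) +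
     (v 0 - e0 * v 2) * (v 0 - e2 * v 2) + (v 0 - e0 * v 2) * (v 0 - e1 * v 2))"
    by (simp add: algebra_simps)
qed

text \<open>The derivative in z works at infinity, the one in y where y \<noteq> 0, and the one in x
  at the three branch points, by distinctness of the roots.\<close>

lemma gradient_F:
  assumes "pt v \<in> C"
  shows "\<exists>k\<le>2. mpeval (pdiff k F) v \<noteq> 0"
proof -
  have v: "vec 2 v" "mpeval F v = 0" using assms mem_C by auto
  obtain x y z where xyz: "v = wv x y z" "x \<noteq> 0 \<or> y \<noteq> 0 \<or> z \<noteq> 0" using v by (auto simp: vec_2_wv)
  have Fv: "y ^ 2 * z = A * (x - e0 * z) * (x - e1 * z) * (x - e2 * z)"
    using v(2) by (simp add: F_eval xyz)
  show ?thesis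
  proof (cases "z = 0")
    case True
    then have "x = 0" "y \<noteq> 0" using Fv A xyz by auto
    then have "mpeval (pdiff 2 F) v \<noteq> 0"
      by (simp add: F_def pdiff_diff pdiff_mult pdiff_var power2_eq_square xyz True)
    then show ?thesis by blast
  next
    case False
    show ?thesis
    proof (cases "y = 0")
      case True
      then have "x = e0 * z \<or> x = e1 * z \<or> x = e2 * z" using Fv A by auto
      then have "mpeval (pdiff 0 F) v \<noteq> 0"
      proof (elim disjE)
        assume "x = e0 * z"
        then have "mpeval (pdiff 0 F) v = - (A * (e0 - e1) * (e0 - e2) * z ^ 2)"
          by (simp add: pdiff_F xyz algebra_simps power2_eq_square)
        then show ?thesis using A e False by simp
      next
        assume "x = e1 * z"
        then have "mpeval (pdiff 0 F) v = - (A * (e1 - e0) * (e1 - e2) * z ^ 2)"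
          by (simp add: pdiff_F xyz algebra_simps power2_eq_square)
        then show ?thesis using A e False by simp
      next
        assume "x = e2 * z"
        then have "mpeval (pdiff 0 F) v = - (A * (e2 - e0) * (e2 - e1) * z ^ 2)"
          by (simp add: pdiff_F xyz algebra_simps power2_eq_square)
        then show ?thesis using A e False by simp
      qed
      then show ?thesis by blast
    next
      case y: False
      then have "mpeval (pdiff 1 F) v \<noteq> 0" unfolding pdiff_F using False by (simp add: xyz)
      then show ?thesis by (metis one_le_numeral)
    qed
  qed
qed

end

section \<open>The Hilbert function of the plane cubic\<close>

context weierstrass
begin

definition mn :: "nat \<Rightarrow> nat \<times> nat \<Rightarrow> mpoly" where
  "mn t = (\<lambda>(a, b). var 0 ^ a * var 1 ^ b * var 2 ^ (t - a - b))"

lemma mn_form: "a + b \<le> t \<Longrightarrow> mn t (a, b) \<in> forms 2 t"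
proof -
  assume t: "a + b \<le> t"
  have "var 0 ^ a * var 1 ^ b * var 2 ^ (t - a - b) \<in> forms 2 (1 * a + 1 * b + 1 * (t - a - b))"
    by (intro forms_mult forms_power forms_var) auto
  then show ?thesis using t by (simp add: mn_def)
qed

lemma mn_eval: "mpeval (mn t (a, b)) v = v 0 ^ a * v 1 ^ b * v 2 ^ (t - a - b)"
  by (simp add: mn_def)

lemma forms_span_mn: "forms 2 t \<subseteq> mp.span (mn t ` {(a, b). a + b \<le> t})"
proof
  fix f assume f: "f \<in> forms 2 t"
  have "Poly_Mapping.single m (coef f m) \<in> mp.span (mn t ` {(a, b). a + b \<le> t})"
    if m: "m \<in> Poly_Mapping.keys f" for m
  proof -
    have sub: "Poly_Mapping.keys m \<subseteq> {..2}" using f m by (auto simp: forms_def polys_def)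
    have s3: "{..2 :: nat} = {0, 1, 2}" by auto
    have deg: "expo m 0 + expo m 1 + expo m 2 = t"
      using f m mono_deg_superset[OF _ sub] by (auto simp: forms_altdef s3)
    have "Poly_Mapping.single m (coef f m) = scale (coef f m) (mn t (expo m 0, expo m 1))"
    proof (rule mpoly_eqI)
      fix x
      have "t - expo m 0 - expo m (Suc 0) = expo m 2" using deg by simp
      then show "mpeval (Poly_Mapping.single m (coef f m)) x =
          mpeval (scale (coef f m) (mn t (expo m 0, expo m 1))) x"
        using mono_eval_superset[OF _ sub, of x] by (simp add: mn_eval s3)
    qed
    moreover have "mn t (expo m 0, expo m 1) \<in> mn t ` {(a, b). a + b \<le> t}" using deg by auto
    ultimately show ?thesis by (simp add: mp.span_base mp.span_scale)
  qed
  then have "(\<Sum>m\<in>Poly_Mapping.keys f. Poly_Mapping.single m (coef f m)) \<in>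
      mp.span (mn t ` {(a, b). a + b \<le> t})"
    by (rule mp.span_sum)
  then show "f \<in> mp.span (mn t ` {(a, b). a + b \<le> t})" by (simp flip: mpoly_eq_sum_single)
qed

text \<open>Solving F for the cube of the first variable lowers its exponent below three modulo the
  ideal of the curve.\<close>

lemma mn_reduce:
  assumes "a + 3 + b \<le> t"
  shows "mn t (a + 3, b) = scale (e0 + e1 + e2) (mn t (a + 2, b))
    - scale (e0 * e1 + e0 * e2 + e1 * e2) (mn t (a + 1, b)) + scale (e0 * e1 * e2) (mn t (a, b))
    + scale (1 / A) (mn t (a, b + 2)) - scale (1 / A) (mn (t - 3) (a, b) * F)"
proof (rule mpoly_eqI)
  fix v
  define c where "c = t - (a + 3) - b"
  have t: "t - (a + 3) - b = c" "t - (a + 2) - b = c + 1" "t - (a + 1) - b = c + 2"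
    "t - a - b = c + 3" "t - a - (b + 2) = c + 1" "t - 3 - a - b = c"
    using assms by (auto simp: c_def)
  show "mpeval (mn t (a + 3, b)) v = mpeval (scale (e0 + e1 + e2) (mn t (a + 2, b))
    - scale (e0 * e1 + e0 * e2 + e1 * e2) (mn t (a + 1, b)) + scale (e0 * e1 * e2) (mn t (a, b))
    + scale (1 / A) (mn t (a, b + 2)) - scale (1 / A) (mn (t - 3) (a, b) * F)) v"
  proof -
    let ?p = "v 0 ^ a * v 1 ^ b * v 2 ^ c"
    let ?L = "(v 0 - e0 * v 2) * (v 0 - e1 * v 2) * (v 0 - e2 * v 2)"
    have F: "1 / A * mpeval F v = 1 / A * (v 1 ^ 2 * v 2) - ?L"
      using A by (simp add: F_eval diff_divide_distrib)
    have "v 0 ^ 3 = (e0 + e1 + e2) * (v 0 ^ 2 * v 2) - (e0 * e1 + e0 * e2 + e1 * e2) * (v 0 * v 2 ^ 2)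
        + e0 * e1 * e2 * v 2 ^ 3 + ?L"
      by (simp add: algebra_simps power2_eq_square power3_eq_cube)
    then have "?p * v 0 ^ 3 = (e0 + e1 + e2) * (?p * (v 0 ^ 2 * v 2))
        - (e0 * e1 + e0 * e2 + e1 * e2) * (?p * (v 0 * v 2 ^ 2))
        + e0 * e1 * e2 * (?p * v 2 ^ 3) + ?p * ?L"
      by (simp only: distrib_left right_diff_distrib mult.left_commute)
    also have "?p * ?L = 1 / A * (?p * (v 1 ^ 2 * v 2)) - 1 / A * (?p * mpeval F v)"
    proof -
      have "?p * ?L = ?p * (1 / A * (v 1 ^ 2 * v 2) - 1 / A * mpeval F v)" using F by simp
      then show ?thesis by (simp only: right_diff_distrib mult.left_commute)
    qed
    finally show ?thesis
      unfolding mpeval_diff mpeval_add mpeval_scale mn_eval mpeval_mult t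
      by (simp add: power_add mult_ac numeral_3_eq_3 numeral_2_eq_2)
  qed
qed

lemma three_roots:
  fixes a b c :: complex
  assumes "card {x. poly (D - [:y:]) x = 0} = 3"
    and 0: "\<And>x. poly D x = y \<Longrightarrow> a + x * b + x ^ 2 * c = 0"
  shows "a = 0 \<and> b = 0 \<and> c = 0"
proof (rule ccontr)
  assume "\<not> ?thesis"
  then have nz: "[:a, b, c:] \<noteq> 0" by auto
  have "{x. poly (D - [:y:]) x = 0} \<subseteq> {x. poly [:a, b, c:] x = 0}"
    using 0 by (auto simp: algebra_simps power2_eq_square)
  then have "3 \<le> card {x. poly [:a, b, c:] x = 0}"
    using card_mono[OF poly_roots_finite[OF nz]] assms(1) by metis
  also have "\<dots> \<le> degree [:a, b, c:]" using card_poly_roots_bound[OF nz] .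
  also have "\<dots> \<le> 2" by simp
  finally show False by simp
qed

text \<open>D - y has fewer than three roots only if y is a critical value of D.\<close>

lemma finite_branch: "finite {y. card {x. poly (D - [:y:]) x = 0} \<noteq> 3}"
proof -
  have d: "pderiv D \<noteq> 0" using D_degree by (auto simp: pderiv_eq_0_iff)
  have "{y. card {x. poly (D - [:y:]) x = 0} \<noteq> 3} \<subseteq> poly D ` {x. poly (pderiv D) x = 0}"
  proof (rule subsetI, rule ccontr)
    fix y assume y: "y \<in> {y. card {x. poly (D - [:y:]) x = 0} \<noteq> 3}"
      "y \<notin> poly D ` {x. poly (pderiv D) x = 0}"
    have deg: "degree (D - [:y:]) = 3"
    proof -
      have e: "D - [:y:] = D + [:- y:]" by (simp add: diff_conv_add_uminus del: add_uminus_conv_diff)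
      show ?thesis unfolding e using D_degree degree_add_eq_left[of "[:- y:]" D] by simp
    qed
    have "rsquarefree (D - [:y:])"
      unfolding rsquarefree_roots using y(2) by (auto simp: pderiv_diff)
    then have "D - [:y:] = smult (lead_coeff (D - [:y:])) (\<Prod>z | poly (D - [:y:]) z = 0. [:- z, 1:])"
      by (simp only: complex_poly_decompose_rsquarefree)
    moreover have "lead_coeff (D - [:y:]) \<noteq> 0" using deg by (metis degree_0 leading_coeff_neq_0 zero_neq_numeral)
    ultimately have "degree (D - [:y:]) = degree (\<Prod>z | poly (D - [:y:]) z = 0. [:- z, 1 :: complex:])"
      by (metis degree_smult_eq)
    also have "\<dots> = card {x. poly (D - [:y:]) x = 0}"
      by (subst degree_prod_sum_eq) simp_all
    finally have "card {x. poly (D - [:y:]) x = 0} = degree (D - [:y:])" by simp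
    with y deg show False by simp
  qed
  then show ?thesis using poly_roots_finite[OF d] finite_surj by blast
qed

definition I :: "nat \<Rightarrow> (nat \<times> nat) set" where
  "I t = {(a, b). a \<le> 2 \<and> a + b \<le> t}"

lemma I_eq: "I t = (SIGMA a:{a. a \<le> 2 \<and> a \<le> t}. {..t - a})"
  by (auto simp: I_def)

lemma finite_I: "finite (I t)"
  by (simp add: I_eq)

lemma card_I: "2 \<le> t \<Longrightarrow> card (I t) = 3 * t"
proof -
  assume t: "2 \<le> t"
  then have "{a. a \<le> 2 \<and> a \<le> t} = {0, 1, 2}" by auto
  then have "card (I t) = (\<Sum>a\<in>{0, 1, 2}. Suc (t - a))" unfolding I_eq by (subst card_SigmaI) auto
  then show ?thesis using t by simp
qed

lemma F_ideal: "g \<in> polys 2 \<Longrightarrow> g * F \<in> ideal_of 2 C"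
  using forms_polys[OF F_form] by (auto simp: ideal_of_def C_def vanishes_def intro!: polys_mult)

lemma ideal_subspace: "mp.subspace (forms 2 t \<inter> ideal_of 2 C)"
  using forms_subspace
  by (auto simp: mp.subspace_def ideal_of_def vanishes_def intro: polys_add)
    (simp add: scale_def polys_mult)

lemma mn_in_span:
  "a + b \<le> t \<Longrightarrow> mn t (a, b) \<in> mp.span (mn t ` I t \<union> (forms 2 t \<inter> ideal_of 2 C))"
    (is "_ \<Longrightarrow> _ \<in> ?S")
proof (induction a arbitrary: b rule: less_induct)
  case (less a)
  show ?case
  proof (cases "a \<le> 2")
    case True
    then have "(a, b) \<in> I t" using less.prems by (simp add: I_def)
    then show ?thesis by (intro mp.span_base) blast
  next
    case False
    define c where "c = a - 3"
    have a: "a = c + 3" using False by (simp add: c_def)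
    have t: "c + 3 + b \<le> t" using less.prems a by simp
    have "mn (t - 3) (c, b) \<in> forms 2 (t - 3)" using t by (intro mn_form) simp
    then have "mn (t - 3) (c, b) * F \<in> forms 2 t \<inter> ideal_of 2 C"
      using forms_mult[OF _ F_form, of _ "t - 3"] t by (auto intro: F_ideal forms_polys)
    then have "mn (t - 3) (c, b) * F \<in> ?S" by (intro mp.span_base) blast
    moreover have "mn t (c + 2, b) \<in> ?S" "mn t (c + 1, b) \<in> ?S" "mn t (c, b) \<in> ?S"
      "mn t (c, b + 2) \<in> ?S"
      using t by (intro less.IH; simp add: a)+
    ultimately show ?thesis
      unfolding a mn_reduce[OF t] by (intro mp.span_add mp.span_diff mp.span_scale)
  qed
qed

text \<open>A relation is read as a polynomial of degree at most two in x whose coefficients are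
  polynomials in y. For all but finitely many y three values of x lie on the curve, so these
  coefficients vanish there and hence identically.\<close>

lemma mn_independent:
  assumes "(\<Sum>i\<in>I t. scale (g i) (mn t i)) \<in> ideal_of 2 C"
  shows "\<forall>i\<in>I t. g i = 0"
proof -
  define p where "p a = (\<Sum>b\<le>t - a. monom (g (a, b)) b)" for a
  have coeff_p: "coeff (p a) b = (if b \<le> t - a then g (a, b) else 0)" for a b
    by (simp add: p_def coeff_sum)
  have ev: "(\<Sum>a\<in>{a. a \<le> 2 \<and> a \<le> t}. x ^ a * poly (p a) y) = 0" if y: "y ^ 2 = poly D x" for x y
  proof -
    have "mpeval (\<Sum>i\<in>I t. scale (g i) (mn t i)) (wv x y 1) = 0"
      using assms affine_mem[OF y] pt_self[of "wv x y 1"] unfolding ideal_of_def vanishes_def by blast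
    moreover have "mpeval (\<Sum>i\<in>I t. scale (g i) (mn t i)) (wv x y 1) =
        (\<Sum>(a, b)\<in>I t. g (a, b) * (x ^ a * y ^ b))"
      unfolding mpeval_sum by (rule sum.cong) (auto simp: mn_eval)
    moreover have "\<dots> = (\<Sum>a\<in>{a. a \<le> 2 \<and> a \<le> t}. \<Sum>b\<le>t - a. g (a, b) * (x ^ a * y ^ b))"
      unfolding I_eq by (subst sum.Sigma) auto
    moreover have "\<dots> = (\<Sum>a\<in>{a. a \<le> 2 \<and> a \<le> t}. x ^ a * poly (p a) y)"
      by (simp add: p_def poly_sum poly_monom sum_distrib_left mult_ac)
    ultimately show ?thesis by simp
  qed
  \<comment> \<open>Padding by zero: for t below 2 not all three powers of x occur, while
    \<open>three_roots\<close> expects three coefficients.\<close>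
  define q where "q a = (if a \<le> t then p a else 0)" for a
  have ev': "poly (q 0) y + x * poly (q 1) y + x ^ 2 * poly (q 2) y = 0" if y: "poly D x = y ^ 2" for x y
  proof -
    have "(\<Sum>a\<in>{a. a \<le> 2 \<and> a \<le> t}. x ^ a * poly (p a) y) = (\<Sum>a\<le>2. x ^ a * poly (q a) y)"
      by (rule sum.mono_neutral_cong_left) (auto simp: q_def)
    then show ?thesis using ev[OF y[symmetric]] by (simp add: numeral_2_eq_2)
  qed
  define B where "B = {y. card {x. poly (D - [:y:]) x = 0} \<noteq> 3}"
  have "{y. y ^ 2 \<in> B} \<subseteq> (\<Union>z\<in>B. {y. poly [:- z, 0, 1:] y = 0})"
    by (auto simp: power2_eq_square)
  moreover have "finite (\<Union>z\<in>B. {y. poly [:- z, 0, 1:] y = 0})"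
    using finite_branch unfolding B_def[symmetric] by (intro finite_UN_I poly_roots_finite) auto
  ultimately have fin: "finite {y. y ^ 2 \<in> B}" by (rule finite_subset)
  have q0: "q a = 0" if a: "a \<le> 2" for a
  proof (rule ccontr)
    assume qa: "q a \<noteq> 0"
    have "poly (q a) y = 0" if "y ^ 2 \<notin> B" for y
    proof -
      have "poly (q 0) y = 0 \<and> poly (q 1) y = 0 \<and> poly (q 2) y = 0"
        by (rule three_roots[of "y ^ 2"]) (use that ev' in \<open>auto simp: B_def\<close>)
      moreover have "a = 0 \<or> a = 1 \<or> a = 2" using a by auto
      ultimately show ?thesis by auto
    qed
    then have "UNIV \<subseteq> {y. y ^ 2 \<in> B} \<union> {y. poly (q a) y = 0}" by auto
    then have "finite (UNIV :: complex set)"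
      using fin poly_roots_finite[OF qa] finite_subset by blast
    then show False using infinite_UNIV_char_0 by blast
  qed
  show ?thesis
  proof
    fix i assume "i \<in> I t"
    then obtain a b where ab: "i = (a, b)" "a \<le> 2" "a + b \<le> t" by (auto simp: I_def)
    then have "coeff (q a) b = g (a, b)" by (simp add: q_def coeff_p)
    then show "g i = 0" using q0[OF ab(2)] ab by simp
  qed
qed

text \<open>The monomials with exponent 0, 1, 2 in the first variable number (t + 1) + t + (t - 1).
  Against deg t + 1 - g this means degree 3 and genus 1.\<close>

lemma hilbert_C: "2 \<le> t \<Longrightarrow> hilbert_fun 2 C t = 3 * int t"
proof -
  assume t: "2 \<le> t"
  have "finite {(a, b). a + b \<le> t}"
    by (rule finite_subset[of _ "{..t} \<times> {..t}"]) auto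
  then have "mp.dim (forms 2 t) = card (I t) + mp.dim (forms 2 t \<inter> ideal_of 2 C)"
  proof (intro mp.dim_complement[OF forms_subspace forms_span_mn _ ideal_subspace])
    show "mn t i \<in> forms 2 t" if "i \<in> I t" for i
      using that mn_form by (auto simp: I_def)
    have "mn t ` {(a, b). a + b \<le> t} \<subseteq> mp.span (mn t ` I t \<union> (forms 2 t \<inter> ideal_of 2 C))"
      using mn_in_span by auto
    then show "forms 2 t \<subseteq> mp.span (mn t ` I t \<union> (forms 2 t \<inter> ideal_of 2 C))"
      using forms_span_mn mp.span_minimal[OF _ mp.subspace_span] by blast
    show "\<forall>i\<in>I t. a i = 0" if "(\<Sum>i\<in>I t. scale (a i) (mn t i)) \<in> forms 2 t \<inter> ideal_of 2 C" for a
      using that mn_independent by blast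
  qed (auto simp: finite_I)
  then show ?thesis using card_I[OF t] by (simp add: hilbert_fun_def)
qed

lemma elliptic_scroll: "elliptic_ruled_surface 5 (scroll C)"
proof -
  have "has_genus 2 C 1"
    unfolding has_genus_def by (intro exI[of _ 3] exI[of _ 2]) (simp add: hilbert_C)
  moreover have "ruled_surface 5 (scroll C) 2 C"
    by (rule ruled_scroll[OF variety_C C_def F_form gradient_F])
  ultimately show ?thesis unfolding elliptic_ruled_surface_def by blast
qed

end

section \<open>Toric coordinates on the threefold\<close>

text \<open>
  The coordinates \<open>0, \<dots>, 3\<close> stand for \<open>s\<^sub>0s\<^sub>1s\<^sub>2s\<^sub>3 / s\<^sub>i\<^sup>2\<close> and \<open>4, \<dots>, 13\<close> for the products
  \<open>s\<^sub>i s\<^sub>j\<close> with \<open>i \<le> j\<close>: up to the factor \<open>s\<^sub>0s\<^sub>1s\<^sub>2s\<^sub>3\<close> these are the fourteen sextic monomials.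
\<close>

definition fi :: "nat \<Rightarrow> nat" where
  "fi k = [0, 0, 0, 0, 0, 0, 0, 0, 1, 1, 1, 2, 2, 3] ! k"

definition se :: "nat \<Rightarrow> nat" where
  "se k = [0, 0, 0, 0, 0, 1, 2, 3, 1, 2, 3, 2, 3, 3] ! k"

definition qi :: "nat \<Rightarrow> nat \<Rightarrow> nat" where
  "qi i j = [[4, 5, 6, 7], [5, 8, 9, 10], [6, 9, 11, 12], [7, 10, 12, 13]] ! i ! j"

definition val :: "(nat \<Rightarrow> complex) \<Rightarrow> (nat \<Rightarrow> nat \<Rightarrow> complex) \<Rightarrow> nat \<Rightarrow> complex" where
  "val U Q k = (if k < 4 then U k else Q (fi k) (se k))"

definition tu :: "(nat \<Rightarrow> complex) \<Rightarrow> nat \<Rightarrow> complex" where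
  "tu s i = s 0 * s 1 * s 2 * s 3 / (s i)\<^sup>2"

definition tv :: "(nat \<Rightarrow> complex) \<Rightarrow> nat \<Rightarrow> complex" where
  "tv s = val (tu s) (\<lambda>i j. s i * s j)"

abbreviation torus :: "(nat \<Rightarrow> complex) \<Rightarrow> bool" where
  "torus s \<equiv> \<forall>i\<le>3. s i \<noteq> 0"

text \<open>The coefficients of \<open>\<ell>\<^sub>a\<close> in the fourteen coordinates, from (s_a
  - s_j) (s_a - s_k) (s_a - s_l) / s_a = s_a^2 - s_a (s_j + s_k + s_l) + (s_j s_k + s_j s_l + s_k
  s_l) - s_j s_k s_l / s_a, whose last quotient is \<open>U\<^sub>a\<close>.\<close>

definition lam :: "nat \<Rightarrow> nat \<Rightarrow> complex" where
  "lam a k = (if k < 4 then (if k = a then - 1 else 0)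
     else if fi k = a \<and> se k = a then 1 else if fi k = a \<or> se k = a then - 1
     else if fi k = se k then 0 else 1)"

definition el :: "nat \<Rightarrow> (nat \<Rightarrow> complex) \<Rightarrow> complex" where
  "el a \<xi> = (\<Sum>k\<le>13. lam a k * \<xi> k)"

definition perm4 :: "nat \<Rightarrow> nat \<Rightarrow> nat \<Rightarrow> nat \<Rightarrow> bool" where
  "perm4 i j k l \<longleftrightarrow> i \<le> 3 \<and> j \<le> 3 \<and> k \<le> 3 \<and> l \<le> 3 \<and> distinct [i, j, k, l]"

lemma atMost_3: "{..3 :: nat} = {0, 1, 2, 3}"
  by auto

lemma atMost_13: "{..13 :: nat} = {0, 1, 2, 3, 4, 5, 6, 7, 8, 9, 10, 11, 12, 13}"
  by (rule set_eqI) (simp, arith)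

lemma sum_13: "(\<Sum>k\<le>13. f k) = f 0 + (f 1 + (f 2 + (f 3 + (f 4 + (f 5 + (f 6 + (f 7 + (f 8 +
    (f 9 + (f 10 + (f 11 + (f 12 + f 13))))))))))))" for f :: "nat \<Rightarrow> 'a :: comm_monoid_add"
  unfolding atMost_13 by simp

lemma all_13: "(\<forall>k\<le>13. P k) \<longleftrightarrow> P 0 \<and> P 1 \<and> P 2 \<and> P 3 \<and> P 4 \<and> P 5 \<and> P 6 \<and> P 7 \<and> P 8 \<and>
    P 9 \<and> P 10 \<and> P 11 \<and> P 12 \<and> P (13 :: nat)"
proof -
  have "(\<forall>k\<le>13. P k) \<longleftrightarrow> (\<forall>k\<in>{..13}. P k)" by auto
  then show ?thesis unfolding atMost_13 by simp
qed

lemma all_3: "(\<forall>k\<le>3. P k) \<longleftrightarrow> P 0 \<and> P 1 \<and> P 2 \<and> P (3 :: nat)"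
proof -
  have "(\<forall>k\<le>3. P k) \<longleftrightarrow> (\<forall>k\<in>{..3}. P k)" by auto
  then show ?thesis unfolding atMost_3 by simp
qed

lemma sum_3: "(\<Sum>k\<le>3. f k) = f 0 + (f 1 + (f 2 + f 3))" for f :: "nat \<Rightarrow> 'a :: comm_monoid_add"
  unfolding atMost_3 by simp

lemma le_3_cases: "i \<le> 3 \<Longrightarrow> i = 0 \<or> i = 1 \<or> i = 2 \<or> i = (3 :: nat)"
  by auto

lemmas fi_se = fi_def se_def

lemma qi_le: "i \<le> 3 \<Longrightarrow> j \<le> 3 \<Longrightarrow> qi i j \<le> 13"
  by (drule le_3_cases, drule le_3_cases) (elim disjE; simp add: qi_def)

lemma qi_sym: "i \<le> 3 \<Longrightarrow> j \<le> 3 \<Longrightarrow> qi i j = qi j i"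
  by (drule le_3_cases, drule le_3_cases) (elim disjE; simp add: qi_def)

lemma val_qi: "i \<le> 3 \<Longrightarrow> j \<le> 3 \<Longrightarrow> Q i j = Q j i \<Longrightarrow> val U Q (qi i j) = Q i j"
  by (drule le_3_cases, drule le_3_cases) (elim disjE; simp add: qi_def val_def fi_se)

lemma val_u: "i \<le> 3 \<Longrightarrow> val U Q i = U i"
  by (simp add: val_def)

lemma qi_fi_se: "k \<le> 13 \<Longrightarrow> \<not> k < 4 \<Longrightarrow> qi (fi k) (se k) = k \<and> fi k \<le> 3 \<and> se k \<le> 3"
proof -
  have "\<forall>k\<le>13. \<not> k < 4 \<longrightarrow> qi (fi k) (se k) = k \<and> fi k \<le> 3 \<and> se k \<le> 3"
    unfolding all_13 by (simp add: qi_def fi_se)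
  then show "k \<le> 13 \<Longrightarrow> \<not> k < 4 \<Longrightarrow> qi (fi k) (se k) = k \<and> fi k \<le> 3 \<and> se k \<le> 3" by blast
qed

lemma coords_eqI:
  assumes "\<And>i. i \<le> 3 \<Longrightarrow> \<xi> i = \<eta> i" "\<And>i j. i \<le> 3 \<Longrightarrow> j \<le> 3 \<Longrightarrow> \<xi> (qi i j) = \<eta> (qi i j)" "k \<le> 13"
  shows "\<xi> k = (\<eta> k :: complex)"
  using assms qi_fi_se[OF assms(3)] by (cases "k < 4") (auto, metis)

lemma perm4_prod:
  assumes "perm4 i j k l"
  shows "s 0 * s 1 * s 2 * s 3 = s i * s j * s k * (s l :: complex)"
  using assms unfolding perm4_def
  by (elim conjE, drule_tac le_3_cases, drule_tac le_3_cases, drule_tac le_3_cases, drule_tac le_3_cases)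
    (elim disjE; simp)

lemma perm4_exists:
  assumes "i \<le> 3" "l \<le> 3" "i \<noteq> l"
  obtains j k where "perm4 i j k l"
proof -
  have "\<exists>j\<in>{0, 1, 2, 3}. \<exists>k\<in>{0, 1, 2, 3}. perm4 i j k l"
    using assms(3) le_3_cases[OF assms(1)] le_3_cases[OF assms(2)]
    by (elim disjE) (simp_all add: perm4_def)
  then show ?thesis using that by blast
qed

lemma el_torus:
  assumes "torus s"
  shows "el 0 (tv s) = (s 0 - s 1) * (s 0 - s 2) * (s 0 - s 3) / s 0"
    "el 1 (tv s) = (s 1 - s 0) * (s 1 - s 2) * (s 1 - s 3) / s 1"
    "el 2 (tv s) = (s 2 - s 0) * (s 2 - s 1) * (s 2 - s 3) / s 2"
    "el 3 (tv s) = (s 3 - s 0) * (s 3 - s 1) * (s 3 - s 2) / s 3"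
proof -
  have s: "s 0 \<noteq> 0" "s 1 \<noteq> 0" "s 2 \<noteq> 0" "s 3 \<noteq> 0" using assms by auto
  note defs = el_def sum_13 lam_def fi_se tv_def val_def tu_def
  show "el 0 (tv s) = (s 0 - s 1) * (s 0 - s 2) * (s 0 - s 3) / s 0"
    using s by (simp add: defs) (simp add: field_simps power2_eq_square)
  show "el 1 (tv s) = (s 1 - s 0) * (s 1 - s 2) * (s 1 - s 3) / s 1"
    using s by (simp add: defs) (simp add: field_simps power2_eq_square)
  show "el 2 (tv s) = (s 2 - s 0) * (s 2 - s 1) * (s 2 - s 3) / s 2"
    using s by (simp add: defs) (simp add: field_simps power2_eq_square)
  show "el 3 (tv s) = (s 3 - s 0) * (s 3 - s 1) * (s 3 - s 2) / s 3"
    using s by (simp add: defs) (simp add: field_simps power2_eq_square)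
qed

lemma tv_scale: "torus s \<Longrightarrow> c \<noteq> 0 \<Longrightarrow> tv (\<lambda>i. c * s i) = (\<lambda>k. c\<^sup>2 * tv s k)"
  by (rule ext) (simp add: tv_def val_def tu_def power2_eq_square)

lemma tv_mult: "tv (\<lambda>i. s i * t i) k = tv s k * tv t k"
  by (simp add: tv_def val_def tu_def power_mult_distrib)

lemma tv_nonzero: "torus s \<Longrightarrow> k \<le> 13 \<Longrightarrow> tv s k \<noteq> 0"
  using qi_fi_se[of k] by (auto simp: tv_def val_def tu_def)

lemma tv_one [simp]: "tv (\<lambda>_. 1) k = 1"
  by (simp add: tv_def val_def tu_def)

text \<open>
  A chart of the toric threefold: in it \<open>s\<^sub>l = 1\<close>, \<open>s\<^sub>j = p\<close>, \<open>s\<^sub>k = q\<close> and the \<open>i\<close>-th coordinate is \<open>u\<close>.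
\<close>

definition ch_s :: "nat \<Rightarrow> nat \<Rightarrow> nat \<Rightarrow> complex \<Rightarrow> complex \<Rightarrow> complex \<Rightarrow> nat \<Rightarrow> complex" where
  "ch_s i j l p q u a = (if a = l then 1 else if a = i then p * q / u else if a = j then p else q)"

definition ch_u :: "nat \<Rightarrow> nat \<Rightarrow> nat \<Rightarrow> complex \<Rightarrow> complex \<Rightarrow> complex \<Rightarrow> nat \<Rightarrow> complex" where
  "ch_u i j l p q u a = (if a = l then p\<^sup>2 * q\<^sup>2 / u else if a = i then u
     else if a = j then q\<^sup>2 / u else p\<^sup>2 / u)"

definition ch :: "nat \<Rightarrow> nat \<Rightarrow> nat \<Rightarrow> complex \<Rightarrow> complex \<Rightarrow> complex \<Rightarrow> nat \<Rightarrow> complex" where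
  "ch i j l p q u = val (ch_u i j l p q u) (\<lambda>a b. ch_s i j l p q u a * ch_s i j l p q u b)"

lemma ch_torus:
  assumes "perm4 i j k l" "p \<noteq> 0" "q \<noteq> 0" "u \<noteq> 0" "m \<le> 13"
  shows "torus (ch_s i j l p q u)" "ch i j l p q u m = tv (ch_s i j l p q u) m"
proof -
  show "torus (ch_s i j l p q u)" using assms by (auto simp: ch_s_def)
  have d: "i \<noteq> j" "i \<noteq> k" "i \<noteq> l" "j \<noteq> k" "j \<noteq> l" "k \<noteq> l" using assms(1) by (auto simp: perm4_def)
  have pr: "ch_s i j l p q u 0 * ch_s i j l p q u 1 * ch_s i j l p q u 2 * ch_s i j l p q u 3 = p\<^sup>2 * q\<^sup>2 / u"
    unfolding perm4_prod[OF assms(1)] using d by (simp add: ch_s_def power2_eq_square)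
  have "ch_u i j l p q u a = tu (ch_s i j l p q u) a" for a
    unfolding tu_def pr using assms d
    by (simp add: ch_u_def ch_s_def field_simps power2_eq_square)
  then show "ch i j l p q u m = tv (ch_s i j l p q u) m"
    by (simp add: ch_def tv_def val_def)
qed

text \<open>The hypotheses are binomial equations that hold on the threefold.\<close>

lemma toric_strata:
  assumes R1: "\<And>i j k l. i \<le> 3 \<Longrightarrow> j \<le> 3 \<Longrightarrow> k \<le> 3 \<Longrightarrow> l \<le> 3 \<Longrightarrow> \<xi> (qi i j) * \<xi> (qi k l) = \<xi> (qi i k) * \<xi> (qi j l)"
    and R2: "\<And>i j k l. perm4 i j k l \<Longrightarrow> \<xi> i * \<xi> (qi i l) = \<xi> (qi l j) * \<xi> (qi l k)"
    and R3: "\<And>i j k l. perm4 i j k l \<Longrightarrow> \<xi> i * \<xi> j = \<xi> (qi k k) * \<xi> (qi l l)"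
    and R4: "\<And>i j k l. perm4 i j k l \<Longrightarrow> \<xi> l * \<xi> (qi l l) = \<xi> (qi l i) * \<xi> (qi j k)"
    and nz: "\<exists>k\<le>13. \<xi> k \<noteq> (0 :: complex)"
  obtains (chart) i j k l p q u c where "perm4 i j k l" "u \<noteq> 0" "c \<noteq> 0"
      "\<And>m. m \<le> 13 \<Longrightarrow> \<xi> m = c * ch i j l p q u m"
    | (vertex_u) i where "i \<le> 3" "\<xi> i \<noteq> 0" "\<And>m. m \<le> 13 \<Longrightarrow> m \<noteq> i \<Longrightarrow> \<xi> m = 0"
    | (vertex_q) l where "l \<le> 3" "\<xi> (qi l l) \<noteq> 0" "\<And>m. m \<le> 13 \<Longrightarrow> m \<noteq> qi l l \<Longrightarrow> \<xi> m = 0"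
\<comment> \<open>If all squares vanish, \<open>R1\<close> kills every product and \<open>R3\<close>
  leaves a single \<open>U\<^sub>i\<close>. Otherwise some \<open>Q\<^sub>l\<^sub>l\<close> is
  nonzero and normalises \<open>s\<^sub>l = 1\<close>; a nonzero \<open>U\<^sub>i\<close> with i
  \<noteq> l then gives a chart.\<close>
proof (cases "\<forall>a\<le>3. \<xi> (qi a a) = 0")
  case True
  have Q0: "\<xi> (qi a b) = 0" if "a \<le> 3" "b \<le> 3" for a b
    using R1[of a b a b] that True by simp
  obtain i where i: "i \<le> 3" "\<xi> i \<noteq> 0"
    using nz Q0 coords_eqI[of \<xi> "\<lambda>_. 0"] by blast
  have U0: "\<xi> a = 0" if a: "a \<le> 3" "a \<noteq> i" for a
  proof -
    obtain k l where "perm4 i k l a" using perm4_exists[of i a] i a by metis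
    then have "perm4 i a k l" by (auto simp: perm4_def)
    from R3[OF this] show ?thesis using True i \<open>perm4 i a k l\<close> by (simp add: perm4_def)
  qed
  have "\<xi> m = (if m = i then \<xi> i else 0)" if "m \<le> 13" for m
    using that
  proof (rule coords_eqI[rotated 2])
    fix a b :: nat assume ab: "a \<le> 3" "b \<le> 3"
    have "3 < qi a b" using le_3_cases[OF ab(1)] le_3_cases[OF ab(2)] by (elim disjE) (simp_all add: qi_def)
    then show "\<xi> (qi a b) = (if qi a b = i then \<xi> i else 0)" using i Q0[OF ab] by simp
  qed (use U0 in auto)
  then show ?thesis using vertex_u[OF i] by auto
next
  case False
  then obtain l where l: "l \<le> 3" "\<xi> (qi l l) \<noteq> 0" by blast
  define c where "c = \<xi> (qi l l)"
  have c: "c \<noteq> 0" using l by (simp add: c_def)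
  define s where "s a = \<xi> (qi a l) / c" for a
  have Q: "\<xi> (qi a b) = c * (s a * s b)" if "a \<le> 3" "b \<le> 3" for a b
    using R1[of a b l l] that l c qi_sym[of b l] by (simp add: s_def c_def field_simps)
  have sl: "s l = 1" using c by (simp add: s_def c_def)
  show ?thesis
  proof (cases "\<exists>i\<le>3. i \<noteq> l \<and> \<xi> i \<noteq> 0")
    case True
    then obtain i where i: "i \<le> 3" "i \<noteq> l" "\<xi> i \<noteq> 0" by blast
    obtain j k where p: "perm4 i j k l" using perm4_exists[OF i(1) l(1) i(2)] .
    then have le: "i \<le> 3" "j \<le> 3" "k \<le> 3" "l \<le> 3"
      and d: "i \<noteq> j" "i \<noteq> k" "i \<noteq> l" "j \<noteq> k" "j \<noteq> l" "k \<noteq> l" by (auto simp: perm4_def)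
    have p': "perm4 i k j l" using p by (auto simp: perm4_def)
    define u where "u = \<xi> i / c"
    have u: "u \<noteq> 0" using i c by (simp add: u_def)
    have xi: "\<xi> i = c * u" using c by (simp add: u_def)
    have si: "s i = s j * s k / u"
      using R2[OF p] c u Q[OF le(1,4)] Q[OF le(4,2)] Q[OF le(4,3)] by (simp add: xi sl field_simps)
    have xj: "\<xi> j = c * ((s k)\<^sup>2 / u)"
      using R3[OF p] c u Q[OF le(3,3)] Q[OF le(4,4)] by (simp add: xi sl field_simps power2_eq_square)
    have xk: "\<xi> k = c * ((s j)\<^sup>2 / u)"
      using R3[OF p'] c u Q[OF le(2,2)] Q[OF le(4,4)] by (simp add: xi sl field_simps power2_eq_square)
    have xl: "\<xi> l = c * ((s j)\<^sup>2 * (s k)\<^sup>2 / u)"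
      using R4[OF p] c u Q[OF le(4,4)] Q[OF le(4,1)] Q[OF le(2,3)]
      by (simp add: si sl field_simps power2_eq_square)
    have all: "a = i \<or> a = j \<or> a = k \<or> a = l" if "a \<le> 3" for a
      using le_3_cases[OF that] le_3_cases[OF le(1)] le_3_cases[OF le(2)] le_3_cases[OF le(3)]
        le_3_cases[OF le(4)] d by auto
    have sch: "ch_s i j l (s j) (s k) u a = s a" if "a \<le> 3" for a
      using all[OF that] d by (auto simp: ch_s_def sl si)
    have "\<xi> m = c * ch i j l (s j) (s k) u m" if "m \<le> 13" for m
      using that
    proof (rule coords_eqI[rotated 2])
      fix a :: nat assume "a \<le> 3"
      then show "\<xi> a = c * ch i j l (s j) (s k) u a"
        using all[of a] d by (auto simp: ch_def val_u ch_u_def xi xj xk xl)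
    next
      fix a b :: nat assume ab: "a \<le> 3" "b \<le> 3"
      have "ch i j l (s j) (s k) u (qi a b) = s a * s b"
        unfolding ch_def by (subst val_qi) (simp_all add: ab sch mult.commute)
      then show "\<xi> (qi a b) = c * ch i j l (s j) (s k) u (qi a b)" using Q[OF ab] by simp
    qed
    then show ?thesis using chart[OF p u c] by blast
  next
    \<comment> \<open>With \<open>U\<^sub>i = 0\<close> for all i \<noteq> l, the relation
      \<open>R3\<close> makes every \<open>s\<^sub>k\<close> with k \<noteq> l vanish, and
      \<open>R4\<close> then kills \<open>U\<^sub>l\<close>.\<close>
    case False
    have s0: "s k = 0" if k: "k \<le> 3" "k \<noteq> l" for k
    proof -
      obtain i j where p: "perm4 k i j l" using perm4_exists[OF k(1) l(1) k(2)] .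
      then have p': "perm4 i j k l" by (auto simp: perm4_def)
      then have "\<xi> i = 0" using False by (auto simp: perm4_def)
      then show ?thesis using R3[OF p'] Q[OF k(1) k(1)] l c by simp
    qed
    have U0: "\<xi> a = 0" if a: "a \<le> 3" for a
    proof (cases "a = l")
      case True
      obtain i :: nat where i: "i \<le> 3" "i \<noteq> l" by (metis zero_le one_le_numeral zero_neq_one)
      obtain j k where p: "perm4 i j k l" using perm4_exists[OF i(1) l(1) i(2)] .
      then have "\<xi> (qi l i) = 0" using Q[OF l(1) i(1)] s0[OF i] by simp
      then show ?thesis using R4[OF p] l True by simp
    qed (use False a in blast)
    have "\<xi> m = (if m = qi l l then \<xi> (qi l l) else 0)" if "m \<le> 13" for m
      using that
    proof (rule coords_eqI[rotated 2])
      fix a :: nat assume a: "a \<le> 3"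
      have "3 < qi l l" using le_3_cases[OF l(1)] by (elim disjE) (simp_all add: qi_def)
      then show "\<xi> a = (if a = qi l l then \<xi> (qi l l) else 0)" using U0[OF a] a by simp
    next
      fix a b :: nat assume ab: "a \<le> 3" "b \<le> 3"
      show "\<xi> (qi a b) = (if qi a b = qi l l then \<xi> (qi l l) else 0)"
        using Q[OF ab] s0[OF ab(1)] s0[OF ab(2)] by auto
    qed
    then show ?thesis using vertex_q[OF l] by auto
  qed
qed

section \<open>Linear coordinates on the threefold\<close>

lemma form1_eval:
  assumes "l \<in> forms n 1"
  shows "mpeval l x = (\<Sum>i\<le>n. mpeval l (\<lambda>j. if j = i then 1 else 0) * x i)"
proof -
  let ?e = "\<lambda>i j. if j = i then 1 else (0 :: complex)"
  have 1: "mono_eval m x = (\<Sum>i\<le>n. mono_eval m (?e i) * x i)" if m: "m \<in> Poly_Mapping.keys l" for m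
  proof -
    have deg: "mono_deg m = 1" and sub: "Poly_Mapping.keys m \<subseteq> {..n}"
      using assms m by (auto simp: forms_altdef polys_def)
    then obtain i where i: "i \<in> Poly_Mapping.keys m" unfolding mono_deg_def by fastforce
    have "expo m j = (if j = i then 1 else 0)" for j
    proof -
      have "mono_deg m = expo m i + (\<Sum>k\<in>Poly_Mapping.keys m - {i}. expo m k)"
        unfolding mono_deg_def using i by (simp add: sum.remove)
      moreover have "expo m i \<noteq> 0" using i by (simp add: in_keys_iff)
      ultimately have s: "expo m i = 1" "(\<Sum>k\<in>Poly_Mapping.keys m - {i}. expo m k) = 0"
        using deg by linarith+
      show ?thesis
      proof (cases "j = i \<or> j \<notin> Poly_Mapping.keys m")
        case True
        then show ?thesis using s by (auto simp: in_keys_iff)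
      next
        case False
        then show ?thesis using s(2) by simp
      qed
    qed
    then have m_eq: "m = Poly_Mapping.single i 1"
      by (intro poly_mapping_eqI) (simp add: lookup_single when_def)
    have "i \<le> n" using i sub by auto
    have "(\<Sum>k\<le>n. mono_eval m (?e k) * x k) = (\<Sum>k\<le>n. if k = i then x k else 0)"
      by (rule sum.cong) (auto simp: m_eq)
    then show ?thesis using \<open>i \<le> n\<close> by (simp add: m_eq)
  qed
  have "mpeval l x = (\<Sum>m\<in>Poly_Mapping.keys l. coef l m * (\<Sum>i\<le>n. mono_eval m (?e i) * x i))"
    using 1 by (simp add: mpeval_superset[OF finite_keys order_refl])
  also have "\<dots> = (\<Sum>i\<le>n. (\<Sum>m\<in>Poly_Mapping.keys l. coef l m * mono_eval m (?e i)) * x i)"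
    unfolding sum_distrib_left sum_distrib_right by (subst sum.swap) (simp add: mult.assoc)
  finally show ?thesis by (simp add: mpeval_superset[OF finite_keys order_refl])
qed

text \<open>B passes from the monomial coordinates to those of the given basis of sextics, and B' is
  its inverse. The common factor \<open>s\<^sub>0s\<^sub>1s\<^sub>2s\<^sub>3\<close> of the sextics
  has been divided out, which leaves the toric coordinates \<open>tv\<close>.\<close>

locale frame =
  fixes B B' :: "nat \<Rightarrow> nat \<Rightarrow> complex" and W :: "point set"
  assumes BB': "\<And>i k. i \<le> 13 \<Longrightarrow> k \<le> 13 \<Longrightarrow> (\<Sum>j\<le>13. B i j * B' j k) = (if i = k then 1 else 0)"
    and B'B: "\<And>i k. i \<le> 13 \<Longrightarrow> k \<le> 13 \<Longrightarrow> (\<Sum>j\<le>13. B' i j * B j k) = (if i = k then 1 else 0)"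
    and W: "W = clo 13 {pt (\<lambda>i. if i \<le> 13 then \<Sum>k\<le>13. B i k * tv s k else 0) | s. torus s}"
begin

definition vl :: "(nat \<Rightarrow> complex) \<Rightarrow> nat \<Rightarrow> complex" where
  "vl \<xi> = (\<lambda>i. if i \<le> 13 then \<Sum>k\<le>13. B i k * \<xi> k else 0)"

definition X :: "(nat \<Rightarrow> complex) \<Rightarrow> nat \<Rightarrow> complex" where
  "X x k = (\<Sum>i\<le>13. B' k i * x i)"

lemma W_eq: "W = clo 13 {pt (vl (tv s)) | s. torus s}"
  by (simp add: W vl_def)

lemma X_vl: "k \<le> 13 \<Longrightarrow> X (vl \<xi>) k = \<xi> k"
proof -
  assume k: "k \<le> 13"
  have "X (vl \<xi>) k = (\<Sum>i\<le>13. \<Sum>j\<le>13. B' k i * B i j * \<xi> j)"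
    by (simp add: X_def vl_def sum_distrib_left mult.assoc)
  also have "\<dots> = (\<Sum>j\<le>13. (\<Sum>i\<le>13. B' k i * B i j) * \<xi> j)"
    by (subst sum.swap) (simp add: sum_distrib_right)
  also have "\<dots> = (\<Sum>j\<le>13. if j = k then \<xi> j else 0)"
    by (rule sum.cong) (auto simp: B'B k)
  finally show ?thesis using k by simp
qed

lemma vl_X_le: "i \<le> 13 \<Longrightarrow> vl (X x) i = x i"
proof -
  assume i: "i \<le> 13"
  have "vl (X x) i = (\<Sum>j\<le>13. \<Sum>k\<le>13. B i j * B' j k * x k)"
    using i by (simp add: X_def vl_def sum_distrib_left mult.assoc)
  also have "\<dots> = (\<Sum>k\<le>13. (\<Sum>j\<le>13. B i j * B' j k) * x k)"
    by (subst sum.swap) (simp add: sum_distrib_right)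
  also have "\<dots> = (\<Sum>k\<le>13. if k = i then x k else 0)"
    by (rule sum.cong) (auto simp: BB' i)
  finally show ?thesis using i by simp
qed

lemma vl_X: "vec 13 x \<Longrightarrow> vl (X x) = x"
proof
  fix i assume x: "vec 13 x"
  show "vl (X x) i = x i"
    by (cases "i \<le> 13") (use x vl_X_le in \<open>auto simp: vl_def vec_def\<close>)
qed

lemma vl_scale: "vl (\<lambda>k. c * \<xi> k) = (\<lambda>i. c * vl \<xi> i)"
  by (rule ext) (simp add: vl_def sum_distrib_left mult.left_commute)

lemma vl_cong: "(\<And>k. k \<le> 13 \<Longrightarrow> \<xi> k = \<eta> k) \<Longrightarrow> vl \<xi> = vl \<eta>"
  by (rule ext) (simp add: vl_def)

lemma vec_vl: "\<xi> k \<noteq> 0 \<Longrightarrow> k \<le> 13 \<Longrightarrow> vec 13 (vl \<xi>)"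
proof -
  assume k: "\<xi> k \<noteq> 0" "k \<le> 13"
  have "vl \<xi> \<noteq> (\<lambda>_. 0)"
  proof
    assume "vl \<xi> = (\<lambda>_. 0)"
    then have "X (vl \<xi>) k = 0" by (simp add: X_def)
    then show False using k by (simp add: X_vl)
  qed
  then show ?thesis by (simp add: vec_def vl_def)
qed

lemma X_nonzero: "vec 13 x \<Longrightarrow> \<exists>k\<le>13. X x k \<noteq> 0"
proof (rule ccontr)
  assume x: "vec 13 x" and "\<not> ?thesis"
  then have "vl (X x) = (\<lambda>_. 0)" by (auto simp: vl_def)
  then show False using vl_X[OF x] x by (simp add: vec_def)
qed

lemma vl_tendsto:
  assumes "\<And>k. k \<le> 13 \<Longrightarrow> (\<lambda>n. \<xi> n k) \<longlonglongrightarrow> \<eta> k"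
  shows "(\<lambda>n. vl (\<xi> n) i) \<longlonglongrightarrow> vl \<eta> i"
  unfolding vl_def by (cases "i \<le> 13") (auto intro!: tendsto_intros assms)

lemma hform_X: "hform 13 1 (\<lambda>x. X x k)"
  unfolding X_def by (intro hform_sum hform_cmult hform_var) simp

lemma hform_el: "hform 13 1 (\<lambda>x. el a (X x))"
  unfolding el_def by (intro hform_sum hform_cmult hform_X)

lemma torus_vec: "torus s \<Longrightarrow> vec 13 (vl (tv s))"
  using tv_nonzero[of s 0] by (intro vec_vl[of _ 0]) auto

lemma torus_points: "{pt (vl (tv s)) | s. torus s} \<subseteq> proj 13"
  using torus_vec by auto

lemma torus_in_W: "torus s \<Longrightarrow> pt (vl (tv s)) \<in> W"
  unfolding W_eq using subset_clo[OF torus_points] by blast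

lemma W_subset: "W \<subseteq> proj 13"
  unfolding W_eq by (rule clo_subset_proj)

lemma zclosed_W: "zclosed 13 W"
  unfolding W_eq by (rule zclosed_clo)

text \<open>Equations of W are obtained in this way: an identity between forms is verified on the
  torus and extends to the closure.\<close>

lemma W_hform:
  assumes "hform 13 d \<phi>" "\<And>s. torus s \<Longrightarrow> \<phi> (vl (tv s)) = 0" "pt x \<in> W"
  shows "\<phi> x = 0"
proof (rule clo_hform[OF _ assms(1) _ torus_points])
  show "pt x \<in> clo 13 {pt (vl (tv s)) | s. torus s}" using assms(3) by (simp add: W_eq)
  fix y assume "pt y \<in> {pt (vl (tv s)) | s. torus s}"
  then obtain s where s: "torus s" "pt y = pt (vl (tv s))" by blast
  then have "y \<in> pt (vl (tv s))" by (metis pt_self)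
  then obtain c where "c \<noteq> 0" "y = (\<lambda>i. c * vl (tv s) i)" by (auto simp: mem_pt_iff)
  then show "\<phi> y = 0" using hform_homogeneous[OF assms(1)] assms(2)[OF s(1)] by simp
qed

lemma tv_qi: "i \<le> 3 \<Longrightarrow> j \<le> 3 \<Longrightarrow> tv s (qi i j) = s i * s j"
  by (simp add: tv_def val_qi mult.commute)

lemma tv_u: "i \<le> 3 \<Longrightarrow> tv s i = tu s i"
  by (simp add: tv_def val_u)

lemma X_torus_qi: "i \<le> 3 \<Longrightarrow> j \<le> 3 \<Longrightarrow> X (vl (tv s)) (qi i j) = s i * s j"
  by (simp add: X_vl qi_le tv_qi)

lemma X_torus_u: "i \<le> 3 \<Longrightarrow> X (vl (tv s)) i = tu s i"
  by (simp add: X_vl tv_u)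

lemma hform_XX: "hform 13 2 (\<lambda>x. X x a * X x b - X x c * X x d)"
  by (rule hform_diff; rule hform_mult[OF hform_X hform_X]) simp_all

lemma W_strata:
  assumes x: "pt x \<in> W"
  obtains (chart) i j k l p q u c where "perm4 i j k l" "u \<noteq> 0" "c \<noteq> 0"
      "\<And>m. m \<le> 13 \<Longrightarrow> X x m = c * ch i j l p q u m"
    | (vertex_u) i where "i \<le> 3" "X x i \<noteq> 0" "\<And>m. m \<le> 13 \<Longrightarrow> m \<noteq> i \<Longrightarrow> X x m = 0"
    | (vertex_q) l where "l \<le> 3" "X x (qi l l) \<noteq> 0" "\<And>m. m \<le> 13 \<Longrightarrow> m \<noteq> qi l l \<Longrightarrow> X x m = 0"
proof (rule toric_strata[of "X x"])
  have eq: "X x a * X x b = X x c * X x d"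
    if "\<And>s. torus s \<Longrightarrow> X (vl (tv s)) a * X (vl (tv s)) b = X (vl (tv s)) c * X (vl (tv s)) d" for a b c d
    using W_hform[OF hform_XX _ x, of a b c d] that by simp
  show "X x (qi i j) * X x (qi k l) = X x (qi i k) * X x (qi j l)"
    if "i \<le> 3" "j \<le> 3" "k \<le> 3" "l \<le> 3" for i j k l
    by (rule eq) (simp add: X_torus_qi that)
  fix i j k l assume p: "perm4 i j k l"
  then have le: "i \<le> 3" "j \<le> 3" "k \<le> 3" "l \<le> 3" by (auto simp: perm4_def)
  have tu: "tu s m = s i * s j * s k * s l / (s m)\<^sup>2" for s m
    using perm4_prod[OF p, of s] by (simp add: tu_def)
  show "X x i * X x (qi i l) = X x (qi l j) * X x (qi l k)"
    by (rule eq) (simp add: X_torus_qi X_torus_u le tu power2_eq_square)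
  show "X x i * X x j = X x (qi k k) * X x (qi l l)"
    by (rule eq) (simp add: X_torus_qi X_torus_u le tu power2_eq_square)
  show "X x l * X x (qi l l) = X x (qi l i) * X x (qi j k)"
    by (rule eq) (simp add: X_torus_qi X_torus_u le tu power2_eq_square)
next
  have "vec 13 x" using x W_subset by auto
  then show "\<exists>k\<le>13. X x k \<noteq> 0" by (rule X_nonzero)
qed (use chart vertex_u vertex_q in blast)+

text \<open>A point without zero coordinates lies in a chart, since the vertices have zero
  coordinates, and there the coordinates j and k force p and q to be nonzero.\<close>

lemma W_torus:
  assumes x: "pt x \<in> W" and nz: "\<And>k. k \<le> 13 \<Longrightarrow> X x k \<noteq> 0"
  obtains s c where "torus s" "c \<noteq> 0" "x = (\<lambda>i. c * vl (tv s) i)"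
  using x
proof (cases rule: W_strata)
  case (chart i j k l p q u c)
  have le: "i \<le> 3" "j \<le> 3" "k \<le> 3" "l \<le> 3" and d: "i \<noteq> j" "i \<noteq> l" "j \<noteq> l" "k \<noteq> i" "k \<noteq> j" "k \<noteq> l"
    using chart(1) by (auto simp: perm4_def)
  have "ch i j l p q u j \<noteq> 0" "ch i j l p q u k \<noteq> 0"
    using chart(4)[of j] chart(4)[of k] nz[of j] nz[of k] le by auto
  then have pq: "p \<noteq> 0" "q \<noteq> 0" using le d by (auto simp: ch_def val_u ch_u_def)
  let ?s = "ch_s i j l p q u"
  have vx: "vec 13 x" using x W_subset by auto
  have "x = vl (X x)" using vl_X[OF vx] by simp
  also have "\<dots> = vl (\<lambda>k. c * tv ?s k)"
    using ch_torus(2)[OF chart(1) pq chart(2)] chart(4) by (intro vl_cong) simp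
  finally show ?thesis
    using that[of ?s c] ch_torus(1)[OF chart(1) pq chart(2), of 0] chart(3) by (simp add: vl_scale)
next
  case (vertex_u i)
  then have "X x (qi 0 0) = 0" by (intro vertex_u) (auto simp: qi_def)
  then show ?thesis using nz[of "qi 0 0"] by (simp add: qi_def)
next
  case (vertex_q l)
  then have "X x 0 = 0" using le_3_cases[OF vertex_q(1)] by (intro vertex_q) (auto simp: qi_def)
  then show ?thesis using nz[of 0] by simp
qed

subsection \<open>Hyperplane sections with a triple point\<close>

definition EL :: "nat \<Rightarrow> mpoly" where
  "EL a = (\<Sum>i\<le>13. scale (\<Sum>k\<le>13. lam a k * B' k i) (var i))"

lemma EL_form: "EL a \<in> forms 13 1"
  unfolding EL_def by (intro forms_sum forms_scale forms_var) simp

lemma EL_eval: "mpeval (EL a) x = el a (X x)"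
  unfolding EL_def mpeval_sum el_def X_def sum_distrib_left
  by (subst sum.swap) (simp add: sum_distrib_right mult.assoc)

definition w0 :: point where
  "w0 = pt (vl (\<lambda>_. 1))"

lemma form_eq_on_coords:
  assumes "f \<in> forms 13 d" "g \<in> forms 13 e" "\<And>\<xi>. mpeval f (vl \<xi>) = mpeval g (vl \<xi>)"
  shows "f = g"
proof (rule mpoly_eqI)
  fix x
  have "mpeval f x = mpeval f (vl (X x))" "mpeval g x = mpeval g (vl (X x))"
    using assms(1,2) by (auto intro!: polys_cong forms_polys simp: vl_X_le)
  then show "mpeval f x = mpeval g x" using assms(3) by simp
qed

text \<open>On the torus, \<open>s\<^sub>a\<^sup>4 \<ell>\<^sub>a\<close> is the product over j
  \<noteq> a of \<open>s\<^sub>a\<^sup>2 - s\<^sub>a s\<^sub>j\<close>, three linear forms in the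
  coordinates that vanish at the base point. The multiplier G, the product of the squares of all
  \<open>Q\<^sub>a\<^sub>a\<close>, supplies the fourth powers for every a at once and equals 1 at
  the base point.\<close>

lemma EL_triple: "mult_ge 13 W w0 3 (\<Sum>a\<le>3. scale (c a) (EL a))"
proof -
  define qm where "qm i j = (\<Sum>k\<le>13. scale (B' (qi i j) k) (var k))" for i j
  have qm_form: "qm i j \<in> forms 13 1" for i j
    unfolding qm_def by (intro forms_sum forms_scale forms_var) simp
  have qm_eval: "mpeval (qm i j) x = X x (qi i j)" for i j x
    by (simp add: qm_def X_def mpeval_sum)
  \<comment> \<open>For j = 0, 1, 2 this runs through the indices different from a.\<close>
  define others where "others a j = (if j < a then j else Suc j)" for a j :: nat
  have oth: "others a j \<le> 3" if "a \<le> 3" "j < 3" for a j using that by (auto simp: others_def)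
  define G where "G = (\<Prod>a\<le>3. qm a a ^ 2)"
  define R where "R a = scale (c a) (\<Prod>b\<in>{..3} - {a}. qm b b ^ 2)" for a
  \<comment> \<open>The cofactor is merged into the factor with j = 0, because
    \<open>ideal_power\<close> consists of sums of products of exactly three elements, without
    separate coefficients.\<close>
  define Bf where "Bf a j = (qm a a - qm a (others a j)) * (if j = 0 then R a else 1)" for a j :: nat
  have G: "G \<in> forms 13 8"
  proof -
    have "qm 0 0 ^ 2 * (qm 1 1 ^ 2 * (qm 2 2 ^ 2 * qm 3 3 ^ 2)) \<in>
        forms 13 (1 * 2 + (1 * 2 + (1 * 2 + 1 * 2)))"
      by (intro forms_mult forms_power qm_form)
    then show ?thesis by (simp add: G_def atMost_3)
  qed
  have wv: "vec 13 (vl (\<lambda>_. 1))" by (rule vec_vl[of _ 0]) auto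
  have Gw: "\<not> vanishes G w0"
    using G by (simp add: w0_def G_def mpeval_prod qm_eval X_vl qi_le)
  have R: "R a \<in> polys 13" for a
  proof -
    have "(\<Prod>b\<in>A. qm b b ^ 2) \<in> polys 13" if "finite A" for A
      using that
    proof (induction A rule: finite_induct)
      case empty
      show ?case using polys_cst[of 1] by simp
    next
      case (insert a A)
      then show ?case using forms_polys[OF qm_form]
        by (auto intro!: polys_mult simp: power2_eq_square)
    qed
    then show ?thesis unfolding R_def scale_def by (intro polys_mult polys_cst) auto
  qed
  have Bf: "Bf a j \<in> ideal_of 13 {w0}" if "a < 4" "j < 3" for a j
  proof -
    have d: "qm a a - qm a (others a j) \<in> forms 13 1" by (intro forms_diff qm_form)
    have "mpeval (qm a a - qm a (others a j)) (vl (\<lambda>_. 1)) = 0"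
      using that oth[of a j] by (simp add: qm_eval X_vl qi_le)
    then have v: "vanishes (qm a a - qm a (others a j)) w0" using d by (simp add: w0_def)
    have "(if j = 0 then R a else 1) \<in> polys 13" using R polys_cst[of 1] by simp
    then show ?thesis
      using v d unfolding Bf_def ideal_of_def vanishes_def
      by (auto intro: polys_mult forms_polys)
  qed
  define A where "A = (\<Sum>a<4. \<Prod>j<3. Bf a j)"
  have A: "A \<in> ideal_power (ideal_of 13 {w0}) 3"
    unfolding ideal_power_def A_def using Bf by blast
  let ?F = "\<Sum>a\<le>3. scale (c a) (EL a)"
  have A_eq: "A = (\<Sum>a\<le>3. R a * ((qm a a - qm a (others a 0)) * (qm a a - qm a (others a 1)) * (qm a a - qm a (others a 2))))"
  proof -
    have "{..<4 :: nat} = {..3}" "{..<3 :: nat} = {0, 1, 2}" by auto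
    then show ?thesis by (simp add: A_def Bf_def mult_ac)
  qed
  have Aform: "A \<in> forms 13 9"
  proof -
    have "(\<Prod>b\<in>{..3} - {a}. qm b b ^ 2) \<in> forms 13 6" if "a \<le> 3" for a
    proof -
      have f: "qm i i ^ 2 * (qm j j ^ 2 * qm k k ^ 2) \<in> forms 13 6" for i j k
        using forms_mult[OF forms_power[OF qm_form] forms_mult[OF forms_power[OF qm_form] forms_power[OF qm_form]],
            of i i 2 j j 2 k k 2] by simp
      have "{..3} - {0 :: nat} = {1, 2, 3}" "{..3} - {1 :: nat} = {0, 2, 3}"
        "{..3} - {2 :: nat} = {0, 1, 3}" "{..3} - {3 :: nat} = {0, 1, 2}" by auto
      then show ?thesis using le_3_cases[OF that] f by (elim disjE) simp_all
    qed
    then have r6: "R a \<in> forms 13 6" if "a \<le> 3" for a using that by (simp add: R_def forms_scale)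
    have p3: "(qm a a - qm a i) * (qm a a - qm a j) * (qm a a - qm a k) \<in> forms 13 (1 + 1 + 1)" for a i j k
      by (intro forms_mult forms_diff qm_form)
    have "R a * ((qm a a - qm a i) * (qm a a - qm a j) * (qm a a - qm a k)) \<in> forms 13 (6 + (1 + 1 + 1))"
      if "a \<le> 3" for a i j k by (rule forms_mult[OF r6[OF that] p3])
    then show ?thesis unfolding A_eq by (intro forms_sum) simp
  qed
  have GF: "G * ?F - A \<in> forms 13 9"
  proof -
    have "?F \<in> forms 13 1" by (intro forms_sum forms_scale EL_form)
    then show ?thesis using forms_mult[OF G, of ?F 1] Aform by (intro forms_diff) auto
  qed
  have torus0: "mpeval (G * ?F - A) (vl (tv s)) = 0" if s: "torus s" for s
  proof -
    have s0: "s 0 \<noteq> 0" "s 1 \<noteq> 0" "s 2 \<noteq> 0" "s 3 \<noteq> 0" using s by auto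
    have key: "s a ^ 4 * el a (tv s) = (s a * s a - s a * s (others a 0)) * (s a * s a - s a * s (others a 1)) *
        (s a * s a - s a * s (others a 2))" if a: "a \<le> 3" for a
    proof -
      have d: "t ^ 4 * (x * y * z / t) = (t * t - t * (t - x)) * (t * t - t * (t - y)) * (t * t - t * (t - z))"
        if "t \<noteq> 0" for t x y z :: complex
        using that by (simp add: power4_eq_xxxx algebra_simps)
      show ?thesis
        using le_3_cases[OF a]
      proof (elim disjE)
        assume "a = 0"
        then show ?thesis using d[of "s 0" "s 0 - s 1" "s 0 - s 2" "s 0 - s 3"] s0 el_torus(1)[OF s]
          by (simp add: others_def numeral_3_eq_3 numeral_2_eq_2)
      next
        assume "a = 1"
        then show ?thesis using d[of "s 1" "s 1 - s 0" "s 1 - s 2" "s 1 - s 3"] s0 el_torus(2)[OF s]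
          by (simp add: others_def numeral_3_eq_3 numeral_2_eq_2)
      next
        assume "a = 2"
        then show ?thesis using d[of "s 2" "s 2 - s 0" "s 2 - s 1" "s 2 - s 3"] s0 el_torus(3)[OF s]
          by (simp add: others_def numeral_3_eq_3 numeral_2_eq_2)
      next
        assume "a = 3"
        then show ?thesis using d[of "s 3" "s 3 - s 0" "s 3 - s 1" "s 3 - s 2"] s0 el_torus(4)[OF s]
          by (simp add: others_def numeral_3_eq_3 numeral_2_eq_2)
      qed
    qed
    define H where "H a = (\<Prod>b\<in>{..3} - {a}. (s b * s b) ^ 2)" for a
    have Hq: "mpeval (\<Prod>b\<in>{..3} - {a}. qm b b ^ 2) (vl (tv s)) = H a" for a
      unfolding H_def mpeval_prod by (rule prod.cong) (auto simp: qm_eval X_torus_qi)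
    have Gs: "mpeval G (vl (tv s)) = H a * s a ^ 4" if "a \<le> 3" for a
    proof -
      have "mpeval G (vl (tv s)) = (\<Prod>b\<le>3. (s b * s b) ^ 2)"
        unfolding G_def mpeval_prod by (rule prod.cong) (auto simp: qm_eval X_torus_qi)
      also have "\<dots> = (s a * s a) ^ 2 * H a" unfolding H_def by (rule prod.remove) (use that in auto)
      finally show ?thesis by (simp add: power4_eq_xxxx power2_eq_square)
    qed
    have "mpeval (G * ?F) (vl (tv s)) = (\<Sum>a\<le>3. c a * (mpeval G (vl (tv s)) * el a (tv s)))"
    proof -
      have "el a (X (vl (tv s))) = el a (tv s)" for a
        unfolding el_def by (rule sum.cong) (auto simp: X_vl)
      then show ?thesis by (simp add: mpeval_sum EL_eval sum_distrib_left mult_ac)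
    qed
    also have "\<dots> = (\<Sum>a\<le>3. c a * (H a * (s a ^ 4 * el a (tv s))))"
      by (rule sum.cong) (auto simp: Gs)
    also have "\<dots> = mpeval A (vl (tv s))"
      unfolding A_eq mpeval_sum
    proof (rule sum.cong)
      fix a :: nat assume "a \<in> {..3}"
      then have a: "a \<le> 3" by simp
      then show "c a * (H a * (s a ^ 4 * el a (tv s))) = mpeval (R a * ((qm a a - qm a (others a 0)) *
          (qm a a - qm a (others a 1)) * (qm a a - qm a (others a 2)))) (vl (tv s))"
        using oth[OF a, of 0] oth[OF a, of 1] oth[OF a, of 2]
        by (simp only: key[OF a] mpeval_mult mpeval_diff R_def mpeval_scale Hq qm_eval)
          (simp add: X_torus_qi)
    qed simp
    finally show ?thesis by simp
  qed
  have "G * ?F - A \<in> ideal_of 13 W"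
  proof -
    have "vanishes (G * ?F - A) P" if P: "P \<in> W" for P
    proof -
      obtain x where x: "P = pt x" using subset_projE[OF W_subset P] by metis
      then show ?thesis using W_hform[OF hform_mpeval[OF GF] torus0] P GF by simp
    qed
    then show ?thesis using GF by (auto simp: ideal_of_def forms_polys)
  qed
  then show ?thesis unfolding mult_ge_def using G Gw A by blast
qed

end

section \<open>Bases indexed by numbers and changes of basis\<close>

lemma span_image_atMost:
  "mp.span (b ` {..r}) = range (\<lambda>c. \<Sum>i\<le>r. scale (c i) (b i))" for b :: "nat \<Rightarrow> mpoly"
proof
  have sub: "mp.subspace (range (\<lambda>c. \<Sum>i\<le>r. scale (c i) (b i)))"
  proof (rule mp.subspaceI)
    show "0 \<in> range (\<lambda>c. \<Sum>i\<le>r. scale (c i) (b i))"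
      by (rule range_eqI[of _ _ "\<lambda>_. 0"]) simp
    fix x y assume "x \<in> range (\<lambda>c. \<Sum>i\<le>r. scale (c i) (b i))" "y \<in> range (\<lambda>c. \<Sum>i\<le>r. scale (c i) (b i))"
    then obtain c d where "x = (\<Sum>i\<le>r. scale (c i) (b i))" "y = (\<Sum>i\<le>r. scale (d i) (b i))" by blast
    then show "x + y \<in> range (\<lambda>c. \<Sum>i\<le>r. scale (c i) (b i))"
      by (intro range_eqI[of _ _ "\<lambda>i. c i + d i"]) (simp add: mp.scale_left_distrib sum.distrib)
  next
    fix k x assume "x \<in> range (\<lambda>c. \<Sum>i\<le>r. scale (c i) (b i))"
    then obtain c where "x = (\<Sum>i\<le>r. scale (c i) (b i))" by blast
    then show "scale k x \<in> range (\<lambda>c. \<Sum>i\<le>r. scale (c i) (b i))"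
      by (intro range_eqI[of _ _ "\<lambda>i. k * c i"]) (simp add: mp.scale_sum_right)
  qed
  have "b j \<in> range (\<lambda>c. \<Sum>i\<le>r. scale (c i) (b i))" if "j \<le> r" for j
  proof (rule range_eqI[of _ _ "\<lambda>i. if i = j then 1 else 0"])
    have "(\<Sum>i\<le>r. scale (if i = j then 1 else 0) (b i)) = (\<Sum>i\<le>r. if i = j then b i else 0)"
      by (rule sum.cong) auto
    then show "b j = (\<Sum>i\<le>r. scale (if i = j then 1 else 0) (b i))" using that by simp
  qed
  then show "mp.span (b ` {..r}) \<subseteq> range (\<lambda>c. \<Sum>i\<le>r. scale (c i) (b i))"
    by (intro mp.span_minimal[OF _ sub]) auto
  show "range (\<lambda>c. \<Sum>i\<le>r. scale (c i) (b i)) \<subseteq> mp.span (b ` {..r})"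
  proof (rule image_subsetI)
    fix c
    show "(\<Sum>i\<le>r. scale (c i) (b i)) \<in> mp.span (b ` {..r})"
      by (rule mp.span_sum, rule mp.span_scale, rule mp.span_base) blast
  qed
qed

text \<open>Coefficient families indexed by 0, ..., r replace sets of vectors: injectivity of b and
  independence of its image together say that only the zero family represents 0.\<close>

lemma is_basis_iff:
  "is_basis b r V \<longleftrightarrow> (\<forall>c. (\<Sum>i\<le>r. scale (c i) (b i)) = 0 \<longrightarrow> (\<forall>i\<le>r. c i = 0)) \<and>
     V = range (\<lambda>c. \<Sum>i\<le>r. scale (c i) (b i))" (is "?l \<longleftrightarrow> ?r")
proof
  assume l: ?l
  then have inj: "inj_on b {..r}" and ind: "mp.independent (b ` {..r})" by (auto simp: is_basis_def)
  show ?r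
  proof (intro conjI allI impI)
    show "V = range (\<lambda>c. \<Sum>i\<le>r. scale (c i) (b i))"
      using l span_image_atMost by (simp add: is_basis_def)
    fix c i assume c: "(\<Sum>i\<le>r. scale (c i) (b i)) = 0" and i: "i \<le> r"
    have "(\<Sum>v\<in>b ` {..r}. scale (c (inv_into {..r} b v)) v) = (\<Sum>i\<le>r. scale (c i) (b i))"
      using inj by (simp add: sum.reindex)
    then have "(\<Sum>v\<in>b ` {..r}. scale (c (inv_into {..r} b v)) v) = 0" using c by simp
    then have "\<forall>v\<in>b ` {..r}. c (inv_into {..r} b v) = 0"
      using ind mp.dependent_finite[of "b ` {..r}"] by auto
    then show "c i = 0" using i inj by auto
  qed
next
  assume r: ?r
  then have ind: "\<And>c i. (\<Sum>i\<le>r. scale (c i) (b i)) = 0 \<Longrightarrow> i \<le> r \<Longrightarrow> c i = 0" by blast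
  have single: "(\<Sum>i\<le>r. scale (if i = j then 1 else 0) (b i)) = b j" if "j \<le> r" for j
  proof -
    have "(\<Sum>i\<le>r. scale (if i = j then 1 else 0) (b i)) = (\<Sum>i\<le>r. if i = j then b i else 0)"
      by (rule sum.cong) auto
    then show ?thesis using that by simp
  qed
  have inj: "inj_on b {..r}"
  proof (rule inj_onI, rule ccontr)
    fix i j assume ij: "i \<in> {..r}" "j \<in> {..r}" "b i = b j" "i \<noteq> j"
    have "(\<Sum>k\<le>r. scale ((if k = i then 1 else 0) - (if k = j then 1 else 0)) (b k)) = b i - b j"
      using ij by (simp only: mp.scale_left_diff_distrib sum_subtractf single atMost_iff)
    then show False using ind[of "\<lambda>k. (if k = i then 1 else 0) - (if k = j then 1 else 0)" i] ij by simp
  qed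
  have "mp.independent (b ` {..r})"
  proof
    assume "mp.dependent (b ` {..r})"
    then obtain u i where u: "i \<le> r" "u (b i) \<noteq> 0" "(\<Sum>v\<in>b ` {..r}. scale (u v) v) = 0"
      by (auto simp: mp.dependent_finite)
    then have "(\<Sum>i\<le>r. scale (u (b i)) (b i)) = 0" using inj by (simp add: sum.reindex)
    then show False using ind[of "\<lambda>i. u (b i)"] u by blast
  qed
  then show ?l using inj r span_image_atMost by (simp add: is_basis_def)
qed

lemma is_basis_indep: "is_basis b r V \<Longrightarrow> (\<Sum>i\<le>r. scale (c i) (b i)) = 0 \<Longrightarrow> \<forall>i\<le>r. c i = 0"
  unfolding is_basis_iff by blast

lemma sum_scale_swap:
  "(\<Sum>i\<le>r. scale (c i) (\<Sum>j\<le>r. scale (A i j) (b j))) = (\<Sum>j\<le>r. scale (\<Sum>i\<le>r. c i * A i j) (b j))"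
proof -
  have "(\<Sum>i\<le>r. scale (c i) (\<Sum>j\<le>r. scale (A i j) (b j))) = (\<Sum>i\<le>r. \<Sum>j\<le>r. scale (c i * A i j) (b j))"
    by (simp add: mp.scale_sum_right)
  also have "\<dots> = (\<Sum>j\<le>r. scale (\<Sum>i\<le>r. c i * A i j) (b j))"
    by (subst sum.swap) (simp add: mp.scale_sum_left)
  finally show ?thesis .
qed

lemma is_basis_change:
  assumes b: "is_basis b r V" and b': "is_basis b' r V"
  shows "\<exists>A A'. (\<forall>i\<le>r. b i = (\<Sum>j\<le>r. scale (A i j) (b' j))) \<and>
    (\<forall>i\<le>r. \<forall>k\<le>r. (\<Sum>j\<le>r. A i j * A' j k) = (if i = k then 1 else 0)) \<and>
    (\<forall>i\<le>r. \<forall>k\<le>r. (\<Sum>j\<le>r. A' i j * A j k) = (if i = k then 1 else 0))"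
proof -
  have mem: "c i \<in> V" if "is_basis c r V" "i \<le> r" for c i
    using that mp.span_base[of "c i" "c ` {..r}"] by (auto simp: is_basis_def)
  have "\<forall>i. \<exists>a. i \<le> r \<longrightarrow> b i = (\<Sum>j\<le>r. scale (a j) (b' j))"
    using mem[OF b] b' unfolding is_basis_iff by blast
  then obtain A where A: "\<And>i. i \<le> r \<Longrightarrow> b i = (\<Sum>j\<le>r. scale (A i j) (b' j))" by metis
  have "\<forall>i. \<exists>a. i \<le> r \<longrightarrow> b' i = (\<Sum>j\<le>r. scale (a j) (b j))"
    using mem[OF b'] b unfolding is_basis_iff by blast
  then obtain A' where A': "\<And>i. i \<le> r \<Longrightarrow> b' i = (\<Sum>j\<le>r. scale (A' i j) (b j))" by metis
  have inv: "(\<Sum>j\<le>r. A i j * A' j k) = (if i = k then 1 else 0)"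
    if i: "i \<le> r" and k: "k \<le> r" and b: "is_basis b r V"
      and A: "\<And>i. i \<le> r \<Longrightarrow> b i = (\<Sum>j\<le>r. scale (A i j) (b' j))"
      and A': "\<And>i. i \<le> r \<Longrightarrow> b' i = (\<Sum>j\<le>r. scale (A' i j) (b j))" for i k A A' b b'
  proof -
    have "b i = (\<Sum>j\<le>r. scale (A i j) (\<Sum>k\<le>r. scale (A' j k) (b k)))"
      using A[OF i] A' by (metis (no_types, lifting) atMost_iff sum.cong)
    then have e: "b i = (\<Sum>k\<le>r. scale (\<Sum>j\<le>r. A i j * A' j k) (b k))"
      by (simp only: sum_scale_swap)
    have "(\<Sum>k\<le>r. scale (if k = i then 1 else 0) (b k)) = (\<Sum>k\<le>r. if k = i then b k else 0)"
      by (rule sum.cong) auto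
    then have "(\<Sum>k\<le>r. scale ((\<Sum>j\<le>r. A i j * A' j k) - (if k = i then 1 else 0)) (b k)) = 0"
      using i e by (simp add: mp.scale_left_diff_distrib sum_subtractf)
    moreover have "\<And>c. (\<Sum>k\<le>r. scale (c k) (b k)) = 0 \<Longrightarrow> \<forall>k\<le>r. c k = 0"
      using b unfolding is_basis_iff by blast
    ultimately have "\<forall>k\<le>r. (\<Sum>j\<le>r. A i j * A' j k) - (if k = i then 1 else 0) = 0" by fast
    then show ?thesis using k by auto
  qed
  show ?thesis
    by (intro exI[of _ A] exI[of _ A'] conjI) (use inv[OF _ _ b A A'] inv[OF _ _ b' A' A] A in auto)
qed

lemma matrix_cancel:
  fixes c :: "nat \<Rightarrow> complex"
  assumes "j \<le> r" and inv: "\<And>i k. i \<le> r \<Longrightarrow> k \<le> r \<Longrightarrow> (\<Sum>j\<le>r. M i j * N j k) = (if i = k then 1 else 0)"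
  shows "(\<Sum>i\<le>r. (\<Sum>k\<le>r. c k * M k i) * N i j) = c j"
proof -
  have "(\<Sum>i\<le>r. (\<Sum>k\<le>r. c k * M k i) * N i j) = (\<Sum>i\<le>r. \<Sum>k\<le>r. c k * (M k i * N i j))"
    by (simp add: sum_distrib_right mult.assoc)
  also have "\<dots> = (\<Sum>k\<le>r. c k * (\<Sum>i\<le>r. M k i * N i j))"
    by (subst sum.swap) (simp add: sum_distrib_left)
  also have "\<dots> = (\<Sum>k\<le>r. if k = j then c k else 0)"
    by (rule sum.cong) (use assms in auto)
  finally show ?thesis using assms(1) by simp
qed

lemma is_basis_transform:
  assumes b: "is_basis b r V"
    and inv: "\<And>i k. i \<le> r \<Longrightarrow> k \<le> r \<Longrightarrow> (\<Sum>j\<le>r. A i j * A' j k) = (if i = k then 1 else 0)"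
      "\<And>i k. i \<le> r \<Longrightarrow> k \<le> r \<Longrightarrow> (\<Sum>j\<le>r. A' i j * A j k) = (if i = k then 1 else 0)"
  shows "is_basis (\<lambda>i. \<Sum>j\<le>r. scale (A i j) (b j)) r V"
  unfolding is_basis_iff
proof (intro conjI allI impI)
  fix c i assume c: "(\<Sum>i\<le>r. scale (c i) (\<Sum>j\<le>r. scale (A i j) (b j))) = 0" and i: "i \<le> r"
  from c have "\<forall>j\<le>r. (\<Sum>i\<le>r. c i * A i j) = 0"
    unfolding sum_scale_swap by (rule is_basis_indep[OF b])
  then have "(\<Sum>j\<le>r. (\<Sum>k\<le>r. c k * A k j) * A' j i) = 0" by simp
  then show "c i = 0" using matrix_cancel[OF i inv(1), of c] by simp
next
  have V: "V = range (\<lambda>c. \<Sum>i\<le>r. scale (c i) (b i))" using b by (simp add: is_basis_iff)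
  show "V = range (\<lambda>c. \<Sum>i\<le>r. scale (c i) (\<Sum>j\<le>r. scale (A i j) (b j)))"
    unfolding sum_scale_swap V
  proof (intro set_eqI iffI)
    fix x assume "x \<in> range (\<lambda>c. \<Sum>i\<le>r. scale (c i) (b i))"
    then obtain c where "x = (\<Sum>i\<le>r. scale (c i) (b i))" by blast
    then have "x = (\<Sum>j\<le>r. scale (\<Sum>i\<le>r. (\<Sum>k\<le>r. c k * A' k i) * A i j) (b j))"
      using matrix_cancel[OF _ inv(2)] by simp
    then show "x \<in> range (\<lambda>c. \<Sum>j\<le>r. scale (\<Sum>i\<le>r. c i * A i j) (b j))"
      by (rule range_eqI[of _ _ "\<lambda>i. \<Sum>k\<le>r. c k * A' k i"])
  qed auto
qed

lemma is_basis_dim: "is_basis b r V \<Longrightarrow> mp.dim V = r + 1"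
  unfolding is_basis_def using mp.dim_span_eq_card_independent card_image
  by (metis Suc_eq_plus1 card_atMost)

section \<open>Linear conditions imposed by a triple point\<close>

lemma cube_dvd_cubic:
  fixes p :: "complex poly"
  assumes "[:- 1, 1:] ^ 3 dvd p" "degree p \<le> 3"
  shows "coeff p 2 = - 3 * coeff p 3" "coeff p 1 = 3 * coeff p 3" "coeff p 0 = - coeff p 3"
proof -
  have c: "[:- 1, 1:] ^ 3 = [:- 1, 3, - 3, 1 :: complex:]" by (simp add: numeral_3_eq_3)
  obtain q where q: "p = [:- 1, 3, - 3, 1:] * q" using assms(1) unfolding c by (rule dvdE)
  have "degree q = 0"
  proof (cases "q = 0")
    case False
    then have "degree p = 3 + degree q" unfolding q by (subst degree_mult_eq) auto
    then show ?thesis using assms(2) by simp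
  qed simp
  then obtain k where "q = [:k:]" by (rule degree_eq_zeroE)
  then have p: "p = [:- k, 3 * k, - 3 * k, k:]" by (simp add: q)
  show "coeff p 2 = - 3 * coeff p 3" "coeff p 1 = 3 * coeff p 3" "coeff p 0 = - coeff p 3"
    unfolding p by (simp_all add: numeral_eq_Suc)
qed

text \<open>Exponents of z in the coordinates along the curve with s_i = z for i in T and s_i = 1
  otherwise. The added 1 stands for a common factor z; it clears the exponent -1 of
  \<open>U\<^sub>k\<close> when T = {k}. For T with one or two elements the exponents lie between 0
  and 3.\<close>

definition cexp :: "nat set \<Rightarrow> nat \<Rightarrow> nat" where
  "cexp T k = (if k < 4 then 1 + card T - 2 * of_bool (k \<in> T)
     else 1 + of_bool (fi k \<in> T) + of_bool (se k \<in> T))"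

context frame
begin

lemma curve_in_W:
  assumes T: "(\<exists>a\<le>3. T = {a}) \<or> (\<exists>a\<le>3. \<exists>b\<le>3. a \<noteq> b \<and> T = {a, b})" and z: "z \<noteq> 0"
  shows "pt (vl (\<lambda>k. z ^ cexp T k)) \<in> W"
proof -
  define s where "s = (\<lambda>i. if i \<in> T then z else 1)"
  have s: "torus s" using z by (simp add: s_def)
  have pr: "s 0 * s 1 * s 2 * s 3 = z ^ card T"
    using T
  proof
    assume "\<exists>a\<le>3. T = {a}"
    then obtain a where "a \<le> 3" "T = {a}" by blast
    then show ?thesis using le_3_cases[of a] by (auto simp: s_def)
  next
    assume "\<exists>a\<le>3. \<exists>b\<le>3. a \<noteq> b \<and> T = {a, b}"
    then obtain a b where ab: "a \<le> 3" "b \<le> 3" "a \<noteq> b" "T = {a, b}" by blast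
    then show ?thesis using le_3_cases[of a] le_3_cases[of b] by (auto simp: s_def power2_eq_square)
  qed
  have card: "card T = 1 \<or> card T = 2" using T by auto
  have "z ^ cexp T k = z * tv s k" if k: "k \<le> 13" for k
  proof (cases "k < 4")
    case True
    then have "tv s k = z ^ card T / (s k)\<^sup>2" using pr by (simp add: tv_def val_def tu_def)
    then show ?thesis
      using card True z by (auto simp: cexp_def s_def power2_eq_square numeral_3_eq_3)
  next
    case False
    then show ?thesis by (simp add: tv_def val_def cexp_def s_def)
  qed
  then have "vl (\<lambda>k. z ^ cexp T k) = vl (\<lambda>k. z * tv s k)" by (rule vl_cong)
  then show ?thesis using torus_in_W[OF s] z by (simp add: vl_scale)
qed

definition mu :: "mpoly \<Rightarrow> nat \<Rightarrow> complex" where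
  "mu l k = (\<Sum>i\<le>13. mpeval l (\<lambda>j. if j = i then 1 else 0) * B i k)"

lemma mu_eval: "l \<in> forms 13 1 \<Longrightarrow> mpeval l (vl \<xi>) = (\<Sum>k\<le>13. mu l k * \<xi> k)"
proof -
  assume l: "l \<in> forms 13 1"
  have "mpeval l (vl \<xi>) = (\<Sum>i\<le>13. \<Sum>k\<le>13. mpeval l (\<lambda>j. if j = i then 1 else 0) * B i k * \<xi> k)"
    using form1_eval[OF l, of "vl \<xi>"] by (simp add: vl_def sum_distrib_left mult.assoc)
  also have "\<dots> = (\<Sum>k\<le>13. mu l k * \<xi> k)"
    unfolding mu_def sum_distrib_right by (rule sum.swap)
  finally show ?thesis .
qed

text \<open>Restricting to a curve through \<open>w\<close> turns multiplicity into divisibility of univariate polynomials.\<close>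

lemma triple_curve:
  assumes l: "l \<in> forms 13 1" and m: "mult_ge 13 W w0 3 l"
    and n: "\<And>z. z \<noteq> 0 \<Longrightarrow> pt (vl (\<lambda>k. z ^ n k)) \<in> W"
  shows "[:- 1, 1:] ^ 3 dvd (\<Sum>k\<le>13. monom (mu l k) (n k))"
proof -
  obtain G e A where G: "G \<in> forms 13 e" "\<not> vanishes G w0" and A: "A \<in> ideal_power (ideal_of 13 {w0}) 3"
    and GA: "G * l - A \<in> ideal_of 13 W" using m unfolding mult_ge_def by blast
  define q where "q i = (if i \<le> 13 then \<Sum>k\<le>13. monom (B i k) (n k) else 0)" for i
  have q: "(\<lambda>i. poly (q i) z) = vl (\<lambda>k. z ^ n k)" for z
    by (rule ext) (simp add: q_def vl_def poly_sum poly_monom)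
  have q1: "vl (\<lambda>k. 1 ^ n k) \<in> w0" by (simp add: w0_def)
  obtain PG where PG: "\<And>z. mpeval G (vl (\<lambda>k. z ^ n k)) = poly PG z"
    using mpeval_along_poly[of G q] unfolding q by blast
  obtain PA where PA: "\<And>z. mpeval A (vl (\<lambda>k. z ^ n k)) = poly PA z"
    using mpeval_along_poly[of A q] unfolding q by blast
  define Pl where "Pl = (\<Sum>k\<le>13. monom (mu l k) (n k))"
  have Pl: "mpeval l (vl (\<lambda>k. z ^ n k)) = poly Pl z" for z
    by (simp add: Pl_def mu_eval[OF l] poly_sum poly_monom)
  have "poly (PG * Pl - PA) z = 0" if "z \<noteq> 0" for z
  proof -
    have "mpeval (G * l - A) (vl (\<lambda>k. z ^ n k)) = 0"
      using GA n[OF that] pt_self[of "vl (\<lambda>k. z ^ n k)"] unfolding ideal_of_def vanishes_def by blast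
    then show ?thesis by (simp only: mpeval_diff mpeval_mult PG PA Pl poly_diff poly_mult)
  qed
  then have "UNIV - {0} \<subseteq> {z. poly (PG * Pl - PA) z = 0}" by auto
  moreover have "infinite (UNIV - {0 :: complex})"
    using infinite_UNIV_char_0[where 'a = complex] by (intro infinite_remove)
  ultimately have "infinite {z. poly (PG * Pl - PA) z = 0}" using infinite_super by blast
  \<comment> \<open>The curve is known to lie in W for z \<noteq> 0 only; infinitely many zeros give
    equality of polynomials.\<close>
  then have eq: "PG * Pl = PA" using poly_roots_finite[of "PG * Pl - PA"] by auto
  obtain r and Bf :: "nat \<Rightarrow> nat \<Rightarrow> mpoly" where Bf: "A = (\<Sum>i<r. \<Prod>j<3. Bf i j)" "\<forall>i<r. \<forall>j<3. Bf i j \<in> ideal_of 13 {w0}"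
    using A unfolding ideal_power_def by blast
  define PB where "PB i j = (SOME P. \<forall>z. mpeval (Bf i j) (vl (\<lambda>k. z ^ n k)) = poly P z)" for i j
  have PB: "mpeval (Bf i j) (vl (\<lambda>k. z ^ n k)) = poly (PB i j) z" for i j z
    using someI_ex[OF mpeval_along_poly[of "Bf i j" q]] unfolding q PB_def by blast
  have "poly PA z = poly (\<Sum>i<r. \<Prod>j<3. PB i j) z" for z
    unfolding PA[symmetric] Bf(1) mpeval_sum mpeval_prod PB poly_sum poly_prod ..
  then have "PA = (\<Sum>i<r. \<Prod>j<3. PB i j)" by (simp add: poly_eq_poly_eq_iff[symmetric] fun_eq_iff)
  moreover have "[:- 1, 1:] ^ 3 dvd (\<Prod>j<3. PB i j)" if i: "i < r" for i
  proof -
    have "[:- 1, 1:] dvd PB i j" if "j < 3" for j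
    proof -
      have "mpeval (Bf i j) (vl (\<lambda>k. 1 ^ n k)) = 0"
        using Bf(2) i that q1 unfolding ideal_of_def vanishes_def by blast
      then have "poly (PB i j) 1 = 0" by (simp flip: PB)
      then show ?thesis by (simp add: poly_eq_0_iff_dvd)
    qed
    then have "(\<Prod>j<3 :: nat. [:- 1, 1 :: complex:]) dvd (\<Prod>j<3. PB i j)"
      by (intro prod_dvd_prod) auto
    then show ?thesis by simp
  qed
  ultimately have dvd: "[:- 1, 1:] ^ 3 dvd PG * Pl" unfolding eq by (auto intro: dvd_sum)
  have "poly PG 1 \<noteq> 0"
  proof
    assume "poly PG 1 = 0"
    then have "mpeval G (vl (\<lambda>k. 1)) = 0" using PG[of 1] by simp
    then show False using G by (simp add: w0_def)
  qed
  \<comment> \<open>G does not vanish at the base point, so no factor of the cube can be absorbed by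
    \<open>PG\<close>.\<close>
  then have o: "order 1 PG = 0" by (simp add: order_0I)
  show ?thesis
  proof (cases "Pl = 0")
    case False
    have "PG \<noteq> 0" using \<open>poly PG 1 \<noteq> 0\<close> by auto
    then have "3 \<le> order 1 (PG * Pl)" using dvd False by (simp add: order_divides)
    also have "\<dots> = order 1 Pl" using \<open>PG \<noteq> 0\<close> False o by (simp add: order_mult)
    finally show ?thesis unfolding Pl_def[symmetric] by (simp add: order_divides)
  qed (simp flip: Pl_def)
qed

lemma triple_cubic:
  assumes l: "l \<in> forms 13 1" and m: "mult_ge 13 W w0 3 l"
    and T: "(\<exists>a\<le>3. T = {a}) \<or> (\<exists>a\<le>3. \<exists>b\<le>3. a \<noteq> b \<and> T = {a, b})"
  shows "(\<Sum>k\<le>13. if cexp T k = 1 then mu l k else 0) = 3 * (\<Sum>k\<le>13. if cexp T k = 3 then mu l k else 0)"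
    "(\<Sum>k\<le>13. if cexp T k = 0 then mu l k else 0) = - (\<Sum>k\<le>13. if cexp T k = 3 then mu l k else 0)"
proof -
  let ?p = "\<Sum>k\<le>13. monom (mu l k) (cexp T k)"
  have dvd: "[:- 1, 1:] ^ 3 dvd ?p" by (rule triple_curve[OF l m curve_in_W[OF T]])
  have "card T = 1 \<or> card T = 2" using T by auto
  then have "cexp T k \<le> 3" for k by (auto simp: cexp_def)
  then have deg: "degree ?p \<le> 3"
    by (intro degree_sum_le) (auto intro: order_trans[OF degree_monom_le])
  have co: "coeff ?p d = (\<Sum>k\<le>13. if cexp T k = d then mu l k else 0)" for d
    by (simp add: coeff_sum)
  show "(\<Sum>k\<le>13. if cexp T k = 1 then mu l k else 0) = 3 * (\<Sum>k\<le>13. if cexp T k = 3 then mu l k else 0)"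
    "(\<Sum>k\<le>13. if cexp T k = 0 then mu l k else 0) = - (\<Sum>k\<le>13. if cexp T k = 3 then mu l k else 0)"
    using cube_dvd_cubic[OF dvd deg] unfolding co by auto
qed

text \<open>The four curves with T = {a} give \<open>mu l a = - mu l (qi a a)\<close>, and the six
  with T = {a, b} determine the coefficient of the product s_k s_d for the complementary pair. These
  ten equations leave free the four numbers \<open>mu l (qi a a)\<close>, which are the coefficients
  on the \<open>EL a\<close>.\<close>

lemma triple_EL:
  assumes l: "l \<in> forms 13 1" and m: "mult_ge 13 W w0 3 l"
  shows "l = (\<Sum>a\<le>3. scale (mu l (qi a a)) (EL a))"
proof -
  note c = triple_cubic[OF l m]
  note simps = sum_13 cexp_def fi_se
  have s: "mu l a = - mu l (qi a a)" if "a \<le> 3" for a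
    using c(2)[of "{a}"] that le_3_cases[OF that] by (elim disjE) (simp_all add: simps qi_def)
  have p: "mu l a + mu l b + mu l (qi k k) + mu l (qi d d) + mu l (qi k d) = 0"
    if "perm4 a b k d" "a < b" "k < d" for a b k d
  proof -
    have ab: "a \<le> 3" "b \<le> 3" "a \<noteq> b" "k \<le> 3" "d \<le> 3" using that by (auto simp: perm4_def)
    have "(a, b, k, d) \<in> {(0, 1, 2, 3), (0, 2, 1, 3), (0, 3, 1, 2), (1, 2, 0, 3), (1, 3, 0, 2), (2, 3, 0, 1)}"
      using that le_3_cases[OF ab(1)] le_3_cases[OF ab(2)] le_3_cases[OF ab(4)] le_3_cases[OF ab(5)]
      unfolding perm4_def by auto
    moreover have "(\<exists>a'\<le>3. {a, b} = {a'}) \<or> (\<exists>a'\<le>3. \<exists>b'\<le>3. a' \<noteq> b' \<and> {a, b} = {a', b'})"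
      using ab by blast
    from c[OF this] have "(\<Sum>k\<le>13. if cexp {a, b} k = 1 then mu l k else 0) = 3 * (\<Sum>k\<le>13. if cexp {a, b} k = 3 then mu l k else 0)"
      "(\<Sum>k\<le>13. if cexp {a, b} k = 0 then mu l k else 0) = - (\<Sum>k\<le>13. if cexp {a, b} k = 3 then mu l k else 0)" .
    ultimately show ?thesis using ab(1-3)
      by (simp, elim disjE conjE) (simp_all add: simps qi_def algebra_simps)
  qed
  have lam: "\<forall>k\<le>13. mu l k = (\<Sum>a\<le>3. mu l (qi a a) * lam a k)"
  proof -
    have "mu l 0 = - mu l 4" "mu l 1 = - mu l 8" "mu l 2 = - mu l 11" "mu l 3 = - mu l 13"
      using s[of 0] s[of 1] s[of 2] s[of 3] by (simp_all add: qi_def)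
    moreover have "mu l 0 + mu l 1 + mu l 11 + mu l 13 + mu l 12 = 0"
      "mu l 0 + mu l 2 + mu l 8 + mu l 13 + mu l 10 = 0"
      "mu l 0 + mu l 3 + mu l 8 + mu l 11 + mu l 9 = 0"
      "mu l 1 + mu l 2 + mu l 4 + mu l 13 + mu l 7 = 0"
      "mu l 1 + mu l 3 + mu l 4 + mu l 11 + mu l 6 = 0"
      "mu l 2 + mu l 3 + mu l 4 + mu l 8 + mu l 5 = 0"
      using p[of 0 1 2 3] p[of 0 2 1 3] p[of 0 3 1 2] p[of 1 2 0 3] p[of 1 3 0 2] p[of 2 3 0 1]
      by (simp_all add: qi_def perm4_def)
    ultimately show ?thesis
      unfolding all_13 sum_3 by (simp add: lam_def fi_se qi_def) (simp add: add_eq_0_iff2 algebra_simps)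
  qed
  show ?thesis
  proof (rule form_eq_on_coords[OF l])
    show "(\<Sum>a\<le>3. scale (mu l (qi a a)) (EL a)) \<in> forms 13 1"
      by (intro forms_sum forms_scale EL_form)
    fix \<xi>
    have "mpeval (\<Sum>a\<le>3. scale (mu l (qi a a)) (EL a)) (vl \<xi>) =
        (\<Sum>a\<le>3. mu l (qi a a) * (\<Sum>k\<le>13. lam a k * \<xi> k))"
      by (simp add: mpeval_sum EL_eval el_def X_vl)
    also have "\<dots> = (\<Sum>k\<le>13. (\<Sum>a\<le>3. mu l (qi a a) * lam a k) * \<xi> k)"
      unfolding sum_distrib_left sum_distrib_right by (subst sum.swap) (simp add: mult.assoc)
    also have "\<dots> = mpeval l (vl \<xi>)" using lam by (simp add: mu_eval[OF l])
    finally show "mpeval l (vl \<xi>) = mpeval (\<Sum>a\<le>3. scale (mu l (qi a a)) (EL a)) (vl \<xi>)" by simp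
  qed
qed

lemma triple_basis: "is_basis EL 3 (triple_point_system 13 W w0)"
  unfolding is_basis_iff
proof (intro conjI allI impI)
  fix c i assume c: "(\<Sum>a\<le>3. scale (c a) (EL a)) = 0" and i: "i \<le> (3 :: nat)"
  have "mpeval (\<Sum>a\<le>3. scale (c a) (EL a)) (vl (\<lambda>k. if k = qi i i then 1 else 0)) = (\<Sum>a\<le>3. c a * lam a (qi i i))"
  proof -
    have "(\<Sum>k\<le>13. lam a k * (if k = qi i i then 1 else 0)) = lam a (qi i i)" for a
      using qi_le[OF i i] by (simp add: if_distrib cong: if_cong)
    then show ?thesis by (simp add: mpeval_sum EL_eval el_def X_vl)
  qed
  \<comment> \<open>The square \<open>Q\<^sub>i\<^sub>i\<close> occurs in
    \<open>\<ell>\<^sub>i\<close> and in no other of the four forms.\<close>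
  moreover have "(\<Sum>a\<le>3. c a * lam a (qi i i)) = c i"
    using le_3_cases[OF i] unfolding sum_3 by (elim disjE) (simp_all add: lam_def qi_def fi_se)
  ultimately show "c i = 0" using c by simp
next
  show "triple_point_system 13 W w0 = range (\<lambda>c. \<Sum>a\<le>3. scale (c a) (EL a))"
  proof (intro set_eqI iffI)
    fix l assume "l \<in> triple_point_system 13 W w0"
    then have "l = (\<Sum>a\<le>3. scale (mu l (qi a a)) (EL a))"
      by (intro triple_EL) (auto simp: triple_point_system_def)
    then show "l \<in> range (\<lambda>c. \<Sum>a\<le>3. scale (c a) (EL a))"
      by (rule range_eqI[of _ _ "\<lambda>a. mu l (qi a a)"])
  next
    fix l assume "l \<in> range (\<lambda>c. \<Sum>a\<le>3. scale (c a) (EL a))"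
    then obtain c where "l = (\<Sum>a\<le>3. scale (c a) (EL a))" by blast
    moreover have "(\<Sum>a\<le>3. scale (c a) (EL a)) \<in> forms 13 1"
      by (intro forms_sum forms_scale EL_form)
    ultimately show "l \<in> triple_point_system 13 W w0"
      using EL_triple unfolding triple_point_system_def by blast
  qed
qed

end

lemma clo_limit_eventually:
  assumes A: "eventually (\<lambda>j. pt (y j) \<in> A) sequentially"
    and lim: "\<And>i. (\<lambda>j. y j i) \<longlonglongrightarrow> x i" and x: "vec n x"
  shows "pt x \<in> clo n A"
proof -
  obtain N where N: "\<And>j. j \<ge> N \<Longrightarrow> pt (y j) \<in> A" using A by (auto simp: eventually_sequentially)
  show ?thesis
    by (rule clo_limit[where y = "\<lambda>j. y (j + N)"]) (use N x LIMSEQ_ignore_initial_segment[OF lim] in auto)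
qed

section \<open>Forms as combinations of products of variables\<close>

lemma mono_deg_Suc:
  assumes "mono_deg m = Suc d"
  obtains i m' where "i \<in> Poly_Mapping.keys m" "m = Poly_Mapping.single i 1 + m'" "mono_deg m' = d"
    "Poly_Mapping.keys m' \<subseteq> Poly_Mapping.keys m"
proof -
  have "Poly_Mapping.keys m \<noteq> {}" using assms by (auto simp: mono_deg_def)
  then obtain i where i: "i \<in> Poly_Mapping.keys m" by blast
  define m' where "m' = m - Poly_Mapping.single i 1"
  have m: "m = Poly_Mapping.single i 1 + m'"
    by (rule poly_mapping_eqI)
      (use i in \<open>auto simp: m'_def lookup_add lookup_minus lookup_single when_def in_keys_iff\<close>)
  have "mono_deg m = 1 + mono_deg m'" unfolding m mono_deg_add by simp
  then have "mono_deg m' = d" using assms by simp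
  moreover have "Poly_Mapping.keys m' \<subseteq> Poly_Mapping.keys m"
    by (auto simp: m'_def in_keys_iff lookup_minus)
  ultimately show ?thesis using that i m by blast
qed

lemma single_in_span_vars:
  "mono_deg m = d \<Longrightarrow> Poly_Mapping.keys m \<subseteq> {..n} \<Longrightarrow>
    \<exists>is. length is = d \<and> set is \<subseteq> {..n} \<and> Poly_Mapping.single m 1 = prod_list (map var is)"
proof (induction d arbitrary: m)
  case 0
  then have "m = 0"
    by (intro poly_mapping_eqI) (auto simp: mono_deg_def in_keys_iff)
  then show ?case by (intro exI[of _ "[]"]) simp
next
  case (Suc d)
  obtain i m' where i: "i \<in> Poly_Mapping.keys m" "m = Poly_Mapping.single i 1 + m'" "mono_deg m' = d"
    "Poly_Mapping.keys m' \<subseteq> Poly_Mapping.keys m" using mono_deg_Suc[OF Suc.prems(1)] by metis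
  obtain is' where "length is' = d" "set is' \<subseteq> {..n}" "Poly_Mapping.single m' 1 = prod_list (map var is')"
    using Suc.IH[OF i(3)] i(4) Suc.prems(2) by blast
  moreover have "Poly_Mapping.single m 1 = var i * Poly_Mapping.single m' 1"
    unfolding i(2) var_def by (simp add: mult_single)
  ultimately show ?case using i(1) Suc.prems(2) by (intro exI[of _ "i # is'"]) auto
qed

text \<open>A linear claim about all forms of degree d is thereby reduced to words of d variables;
  it is used for quadrics in four variables and cubics in three.\<close>

lemma forms_span_vars:
  "forms n d \<subseteq> mp.span {prod_list (map var is) | is. length is = d \<and> set is \<subseteq> {..n}}" (is "_ \<subseteq> ?S")
proof
  fix f assume f: "f \<in> forms n d"
  have "Poly_Mapping.single m (coef f m) \<in> ?S" if m: "m \<in> Poly_Mapping.keys f" for m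
  proof -
    have "mono_deg m = d" "Poly_Mapping.keys m \<subseteq> {..n}" using f m by (auto simp: forms_altdef polys_def)
    then have "Poly_Mapping.single m 1 \<in> ?S"
      using single_in_span_vars[of m d n] by (intro mp.span_base) auto
    then have "scale (coef f m) (Poly_Mapping.single m 1) \<in> ?S" by (rule mp.span_scale)
    then show ?thesis by (simp add: scale_def cst_def mult_single)
  qed
  then have "(\<Sum>m\<in>Poly_Mapping.keys f. Poly_Mapping.single m (coef f m)) \<in> ?S" by (rule mp.span_sum)
  then show "f \<in> ?S" by (simp flip: mpoly_eq_sum_single)
qed

subsection \<open>Bases of the system of sextics\<close>

definition sx :: "nat \<Rightarrow> mpoly" where
  "sx k = (if k < 4 then \<Prod>j\<in>{..3} - {k}. var j ^ 2 else (\<Prod>j\<le>3. var j) * (var (fi k) * var (se k)))"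

lemma sx_eval: "torus s \<Longrightarrow> k \<le> 13 \<Longrightarrow> mpeval (sx k) s = s 0 * s 1 * s 2 * s 3 * tv s k"
proof -
  assume s: "torus s" and k: "k \<le> 13"
  have p: "(\<Prod>j\<le>3. s j) = s 0 * s 1 * s 2 * s 3" unfolding atMost_3 by simp
  show ?thesis
  proof (cases "k < 4")
    case True
    have "(\<Prod>j\<le>3. s j ^ 2) = (s k) ^ 2 * (\<Prod>j\<in>{..3} - {k}. s j ^ 2)"
      by (rule prod.remove) (use True in auto)
    moreover have "(\<Prod>j\<le>3. s j ^ 2) = (s 0 * s 1 * s 2 * s 3) ^ 2"
      unfolding p[symmetric] by (simp add: prod_power_distrib)
    ultimately have "(\<Prod>j\<in>{..3} - {k}. s j ^ 2) = (s 0 * s 1 * s 2 * s 3) ^ 2 / (s k) ^ 2"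
      using s True by simp
    then show ?thesis using True
      by (simp add: sx_def mpeval_prod tv_def val_def tu_def power2_eq_square)
  next
    case False
    then show ?thesis by (simp add: sx_def mpeval_prod tv_def val_def p)
  qed
qed

text \<open>Restriction to the one-parameter subgroup (1, t, t^3, t^9) already separates the
  fourteen monomials.\<close>

lemma tv_independent:
  assumes "\<And>s. torus s \<Longrightarrow> (\<Sum>k\<le>13. c k * tv s k) = 0"
  shows "\<forall>k\<le>13. c k = 0"
proof -
  \<comment> \<open>The exponents of t on (1, t, t^3, t^9), all raised by 5 because
    \<open>U\<^sub>3\<close> has exponent -5. They are pairwise distinct.\<close>
  define e :: "nat \<Rightarrow> nat" where
    "e k = [18, 16, 12, 0, 5, 6, 8, 14, 7, 9, 15, 11, 17, 23] ! k" for k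
  define p where "p = (\<Sum>k\<le>13. monom (c k) (e k))"
  have "poly p t = 0" if t: "t \<noteq> 0" for t
  proof -
    define s :: "nat \<Rightarrow> complex" where "s i = t ^ ([0, 1, 3, 9] ! i)" for i
    have s: "torus s" using t by (simp add: s_def)
    have s': "s 0 = 1" "s 1 = t" "s 2 = t ^ 3" "s 3 = t ^ 9" by (simp_all add: s_def)
    have "t ^ 5 * tu s 0 = t ^ 18" "t ^ 5 * tu s 1 = t ^ 16" "t ^ 5 * tu s 2 = t ^ 12" "t ^ 5 * tu s 3 = t ^ 0"
      unfolding tu_def s' using t by (simp_all add: divide_eq_eq numeral_eq_Suc)
    moreover have "s 0 * s 0 * t ^ 5 = t ^ 5" "s 0 * s 1 * t ^ 5 = t ^ 6" "s 0 * s 2 * t ^ 5 = t ^ 8"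
      "s 0 * s 3 * t ^ 5 = t ^ 14" "s 1 * s 1 * t ^ 5 = t ^ 7" "s 1 * s 2 * t ^ 5 = t ^ 9"
      "s 1 * s 3 * t ^ 5 = t ^ 15" "s 2 * s 2 * t ^ 5 = t ^ 11" "s 2 * s 3 * t ^ 5 = t ^ 17"
      "s 3 * s 3 * t ^ 5 = t ^ 23"
      unfolding s' by (simp_all add: numeral_eq_Suc)
    ultimately have "\<forall>k\<le>13. t ^ e k = t ^ 5 * tv s k"
      unfolding all_13 by (simp add: e_def tv_def val_def fi_se mult_ac)
    then have "poly p t = t ^ 5 * (\<Sum>k\<le>13. c k * tv s k)"
      by (simp add: p_def poly_sum poly_monom sum_distrib_left mult_ac)
    then show ?thesis using assms[OF s] by simp
  qed
  then have "UNIV - {0} \<subseteq> {t. poly p t = 0}" by auto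
  moreover have "infinite (UNIV - {0 :: complex})"
    using infinite_UNIV_char_0[where 'a = complex] by (intro infinite_remove)
  ultimately have "infinite {t. poly p t = 0}" using infinite_super by blast
  then have "p = 0" using poly_roots_finite by blast
  then have "coeff p d = 0" for d by simp
  then have co: "(\<Sum>k\<le>13. if e k = d then c k else 0) = 0" for d by (simp add: p_def coeff_sum)
  show ?thesis
    unfolding all_13
    using co[of 18] co[of 16] co[of 12] co[of 0] co[of 5] co[of 6] co[of 8] co[of 14] co[of 7]
      co[of 9] co[of 15] co[of 11] co[of 17] co[of 23]
    by (simp add: sum_13 e_def)
qed

lemma sx_basis: "is_basis sx 13 enriques_sextics"
  unfolding is_basis_iff
proof (intro conjI allI impI)
  fix c i assume c: "(\<Sum>k\<le>13. scale (c k) (sx k)) = 0" and i: "i \<le> (13 :: nat)"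
  have "(\<Sum>k\<le>13. c k * tv s k) = 0" if s: "torus s" for s
  proof -
    have "mpeval (\<Sum>k\<le>13. scale (c k) (sx k)) s = s 0 * s 1 * s 2 * s 3 * (\<Sum>k\<le>13. c k * tv s k)"
      using s by (simp add: mpeval_sum sx_eval sum_distrib_left mult_ac)
    then show ?thesis using c s by simp
  qed
  then show "c i = 0" using tv_independent i by blast
next
  let ?P = "\<Prod>j\<le>3. var j"
  show "enriques_sextics = range (\<lambda>c. \<Sum>k\<le>13. scale (c k) (sx k))"
  proof (intro set_eqI iffI)
    fix f assume "f \<in> enriques_sextics"
    then obtain a Q where f: "f = (\<Sum>i\<le>3. scale (a i) (\<Prod>j\<in>{..3} - {i}. var j ^ 2)) + ?P * Q"
      and Q: "Q \<in> forms 3 2" by (auto simp: enriques_sextics_def)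
    let ?S = "mp.span (sx ` {..13})"
    have v: "?P * (var i * var j) \<in> ?S" if "i \<le> 3" "j \<le> 3" for i j
    proof -
      have "sx (qi i j) = ?P * (var i * var j)"
        using le_3_cases[OF that(1)] le_3_cases[OF that(2)]
        by (elim disjE) (simp_all add: sx_def qi_def fi_se mult.commute)
      then show ?thesis using qi_le[OF that] by (metis atMost_iff imageI mp.span_base)
    qed
    have "Q \<in> {Q. ?P * Q \<in> ?S}"
    proof (rule subsetD[OF _ Q], rule order_trans[OF forms_span_vars], rule mp.span_minimal)
      show "mp.subspace {Q. ?P * Q \<in> ?S}"
      proof (rule mp.subspaceI)
        fix c x assume "x \<in> {Q. ?P * Q \<in> ?S}"
        moreover have "?P * scale c x = scale c (?P * x)" by (simp add: scale_def mult.left_commute)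
        ultimately show "scale c x \<in> {Q. ?P * Q \<in> ?S}" using mp.span_scale by simp
      qed (auto simp: distrib_left mp.span_zero mp.span_add)
      show "{prod_list (map var is) | is. length is = 2 \<and> set is \<subseteq> {..3}} \<subseteq> {Q. ?P * Q \<in> ?S}"
      proof
        fix q assume "q \<in> {prod_list (map var is) | is. length is = 2 \<and> set is \<subseteq> {..3}}"
        then obtain "is" where "q = prod_list (map var is)" "length is = 2" "set is \<subseteq> {..3}" by blast
        moreover from this obtain i j where "is = [i, j]"
          by (auto simp: numeral_2_eq_2 length_Suc_conv)
        ultimately show "q \<in> {Q. ?P * Q \<in> ?S}" using v by auto
      qed
    qed
    moreover have "(\<Sum>i\<le>3. scale (a i) (\<Prod>j\<in>{..3} - {i}. var j ^ 2)) \<in> ?S"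
    proof (intro mp.span_sum mp.span_scale)
      fix i assume i: "i \<in> {..3 :: nat}"
      then have "(\<Prod>j\<in>{..3} - {i}. var j ^ 2) = sx i" by (auto simp: sx_def)
      then show "(\<Prod>j\<in>{..3} - {i}. var j ^ 2) \<in> ?S" using i by (auto intro: mp.span_base)
    qed
    ultimately have "f \<in> ?S" unfolding f by (auto intro: mp.span_add)
    then show "f \<in> range (\<lambda>c. \<Sum>k\<le>13. scale (c k) (sx k))" by (simp add: span_image_atMost)
  next
    fix f assume "f \<in> range (\<lambda>c. \<Sum>k\<le>13. scale (c k) (sx k))"
    then obtain c where f: "f = (\<Sum>k\<le>13. scale (c k) (sx k))" by blast
    define Q where "Q = (\<Sum>k\<in>{4..13}. scale (c k) (var (fi k) * var (se k)))"
    have "var (fi k) * var (se k) \<in> forms 3 2" if "k \<in> {4..13}" for k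
      using qi_fi_se[of k] that forms_mult[OF forms_var[of "fi k" 3] forms_var[of "se k" 3]]
      by (simp add: numeral_2_eq_2)
    then have Q: "Q \<in> forms 3 2" unfolding Q_def by (intro forms_sum forms_scale)
    have "{..13 :: nat} = {..3} \<union> {4..13}" by auto
    then have "f = (\<Sum>k\<le>3. scale (c k) (sx k)) + (\<Sum>k\<in>{4..13}. scale (c k) (sx k))"
      unfolding f by (simp add: sum.union_disjoint disjoint_iff)
    moreover have "(\<Sum>k\<le>3. scale (c k) (sx k)) = (\<Sum>i\<le>3. scale (c i) (\<Prod>j\<in>{..3} - {i}. var j ^ 2))"
      by (rule sum.cong) (auto simp: sx_def)
    moreover have "(\<Sum>k\<in>{4..13}. scale (c k) (sx k)) = ?P * Q"
      unfolding Q_def sum_distrib_left by (rule sum.cong) (auto simp: sx_def scale_def mult_ac)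
    ultimately have "f = (\<Sum>i\<le>3. scale (c i) (\<Prod>j\<in>{..3} - {i}. var j ^ 2)) + ?P * Q" by simp
    then show "f \<in> enriques_sextics" using Q unfolding enriques_sextics_def by fast
  qed
qed

section \<open>Frames for the threefold and the action of the torus\<close>

lemma torus_near: "eventually (\<lambda>n. torus (\<lambda>i. x i + 1 / of_nat (Suc n))) sequentially"
proof -
  have "eventually (\<lambda>n. x i + 1 / of_nat (Suc n) \<noteq> 0) sequentially" for i
  proof (cases "x i = 0")
    case True
    then show ?thesis by (simp del: of_nat_Suc)
  next
    case False
    have "(\<lambda>n. x i + 1 / of_nat (Suc n)) \<longlonglongrightarrow> x i + 0"
      by (intro tendsto_add tendsto_const LIMSEQ_Suc[OF lim_1_over_n])
    then show ?thesis using False tendsto_imp_eventually_ne by fastforce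
  qed
  then have "eventually (\<lambda>n. \<forall>i\<in>{..3}. x i + 1 / of_nat (Suc n) \<noteq> 0) sequentially"
    by (intro eventually_ball_finite) auto
  then show ?thesis by (simp add: Ball_def)
qed

text \<open>The definition of W uses all points at which the sextics do not vanish simultaneously.
  Such a point is a limit of torus points, so its image lies in the closure of the image of the
  torus.\<close>

lemma frame_exists:
  assumes "classical_enriques_fano W"
  obtains B B' where "frame B B' W"
proof -
  obtain b where b: "is_basis b 13 enriques_sextics" and W: "W = rational_image 3 13 (proj 3) b"
    using assms unfolding classical_enriques_fano_def by blast
  obtain B B' where B: "\<forall>i\<le>13. b i = (\<Sum>k\<le>13. scale (B i k) (sx k))"
    and inv: "\<forall>i\<le>13. \<forall>k\<le>13. (\<Sum>j\<le>13. B i j * B' j k) = (if i = k then 1 else 0)"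
      "\<forall>i\<le>13. \<forall>k\<le>13. (\<Sum>j\<le>13. B' i j * B j k) = (if i = k then 1 else 0)"
    using is_basis_change[OF b sx_basis] by blast
  define V where "V s = (\<lambda>i. if i \<le> 13 then \<Sum>k\<le>13. B i k * tv s k else 0)" for s
  have hv: "hvec 13 b s = (\<lambda>i. s 0 * s 1 * s 2 * s 3 * V s i)" if s: "torus s" for s
    by (rule ext) (use s in \<open>auto simp: hvec_def V_def B mpeval_sum sx_eval sum_distrib_left mult_ac\<close>)
  have hv_pt: "pt (hvec 13 b s) = pt (V s)" if s: "torus s" for s
    unfolding hv[OF s] using s by simp
  have V0: "V s \<noteq> (\<lambda>_. 0)" if s: "torus s" for s
  proof
    assume "V s = (\<lambda>_. 0)"
    then have V: "(\<Sum>k\<le>13. B i k * tv s k) = 0" if "i \<le> 13" for i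
    proof -
      have "V s i = 0" using \<open>V s = (\<lambda>_. 0)\<close> by (rule fun_cong)
      then show ?thesis using that by (simp add: V_def)
    qed
    have "(\<Sum>k\<le>13. (\<Sum>i\<le>13. B' 0 i * B i k) * tv s k) = (\<Sum>i\<le>13. B' 0 i * (\<Sum>k\<le>13. B i k * tv s k))"
      unfolding sum_distrib_left sum_distrib_right by (subst sum.swap) (simp add: mult.assoc)
    also have "\<dots> = 0" using V by simp
    finally have "(\<Sum>k\<le>13. (\<Sum>i\<le>13. B' 0 i * B i k) * tv s k) = 0" .
    moreover have "(\<Sum>k\<le>13. (\<Sum>i\<le>13. B' 0 i * B i k) * tv s k) = (\<Sum>k\<le>13. if k = 0 then tv s k else 0)"
      by (rule sum.cong) (auto simp: inv(2))
    ultimately show False using tv_nonzero[OF s, of 0] by simp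
  qed
  let ?I = "{pt (hvec 13 b x) | x P. P \<in> proj 3 \<and> x \<in> P \<and> hvec 13 b x \<noteq> (\<lambda>_. 0)}"
  let ?T = "{pt (V s) | s. torus s}"
  have vec13: "vec 13 (hvec 13 b x)" if "hvec 13 b x \<noteq> (\<lambda>_. 0)" for x
    using that by (auto simp: vec_def hvec_def)
  have Ip: "?I \<subseteq> proj 13" using vec13 by auto
  have TI: "?T \<subseteq> ?I"
  proof
    fix P assume "P \<in> ?T"
    then obtain s where s: "torus s" "P = pt (V s)" by blast
    \<comment> \<open>\<open>torus\<close> leaves the components beyond 3 arbitrary, whereas
      coordinate vectors of \<open>proj 3\<close> have them zero.\<close>
    define s' where "s' i = (if i \<le> 3 then s i else 0)" for i
    have tvs: "tv s' k = tv s k" if "k \<le> 13" for k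
      using qi_fi_se[OF that] that by (auto simp: s'_def tv_def val_def tu_def)
    have s': "torus s'" using s by (simp add: s'_def)
    have "V s' = V s" unfolding V_def by (rule ext) (simp add: tvs)
    note s' = s' this
    have "vec 3 s'" using s by (auto simp: vec_def s'_def fun_eq_iff)
    moreover have "hvec 13 b s' \<noteq> (\<lambda>_. 0)"
      using hv[OF s'(1)] V0[OF s'(1)] s'(1) by (auto simp: fun_eq_iff)
    moreover have "P = pt (hvec 13 b s')" using hv_pt[OF s'(1)] s s' by simp
    ultimately have "P = pt (hvec 13 b s') \<and> pt s' \<in> proj 3 \<and> s' \<in> pt s' \<and> hvec 13 b s' \<noteq> (\<lambda>_. 0)"
      by simp
    then show "P \<in> ?I" by blast
  qed
  have IT: "?I \<subseteq> clo 13 ?T"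
  proof
    fix P assume "P \<in> ?I"
    then obtain x where x: "P = pt (hvec 13 b x)" "hvec 13 b x \<noteq> (\<lambda>_. 0)" by blast
    show "P \<in> clo 13 ?T"
      unfolding x(1)
    proof (rule clo_limit_eventually[OF _ _ vec13[OF x(2)]])
      let ?x = "\<lambda>n i. x i + 1 / of_nat (Suc n)"
      show "eventually (\<lambda>n. pt (hvec 13 b (?x n)) \<in> ?T) sequentially"
        using torus_near[of x]
      proof eventually_elim
        case (elim n)
        from hv_pt[OF elim] elim show ?case by (intro CollectI exI[of _ "?x n"] conjI)
      qed
      have "(\<lambda>n. ?x n i) \<longlonglongrightarrow> x i + 0" for i
        by (intro tendsto_add tendsto_const LIMSEQ_Suc[OF lim_1_over_n])
      then have "(\<lambda>n. mpeval f (?x n)) \<longlonglongrightarrow> mpeval f x" for f by (intro mpeval_tendsto) simp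
      then show "(\<lambda>n. hvec 13 b (?x n) i) \<longlonglongrightarrow> hvec 13 b x i" for i
        unfolding hvec_def by (cases "i \<le> 13") simp_all
    qed
  qed
  have "W = clo 13 ?I" using W Ip by (simp add: rational_image_def zclosure_eq_clo)
  also have "\<dots> = clo 13 ?T" using clo_trans[OF IT] clo_mono[OF TI] by blast
  finally have W: "W = clo 13 ?T" .
  have "frame B B' W"
  proof
    show "W = clo 13 {pt (\<lambda>i. if i \<le> 13 then \<Sum>k\<le>13. B i k * tv s k else 0) | s. torus s}"
      using W unfolding V_def .
  qed (use inv in blast)+
  then show ?thesis by (rule that)
qed

text \<open>The torus acts diagonally on the toric coordinates. Absorbing the scaling by \<sigma>
  into B keeps W and turns the image of \<sigma> into the base point, so that a single base point
  has to be studied.\<close>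

lemma (in frame) frame_rescale:
  assumes s: "torus \<sigma>"
  shows "frame (\<lambda>i k. B i k * tv \<sigma> k) (\<lambda>k i. B' k i / tv \<sigma> k) W"
    "frame.w0 (\<lambda>i k. B i k * tv \<sigma> k) = pt (vl (tv \<sigma>))"
proof -
  have nz: "tv \<sigma> k \<noteq> 0" if "k \<le> 13" for k using tv_nonzero[OF s that] .
  show fr: "frame (\<lambda>i k. B i k * tv \<sigma> k) (\<lambda>k i. B' k i / tv \<sigma> k) W"
  proof
    show "(\<Sum>j\<le>13. B i j * tv \<sigma> j * (B' j k / tv \<sigma> j)) = (if i = k then 1 else 0)"
      if "i \<le> 13" "k \<le> 13" for i k
    proof -
      have "(\<Sum>j\<le>13. B i j * tv \<sigma> j * (B' j k / tv \<sigma> j)) = (\<Sum>j\<le>13. B i j * B' j k)"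
        by (rule sum.cong) (use nz in auto)
      then show ?thesis using BB' that by simp
    qed
    show "(\<Sum>j\<le>13. B' i j / tv \<sigma> i * (B j k * tv \<sigma> k)) = (if i = k then 1 else 0)"
      if "i \<le> 13" "k \<le> 13" for i k
    proof -
      have "(\<Sum>j\<le>13. B' i j / tv \<sigma> i * (B j k * tv \<sigma> k)) = (\<Sum>j\<le>13. B' i j * B j k) * tv \<sigma> k / tv \<sigma> i"
        by (simp add: sum_distrib_right sum_divide_distrib mult.assoc)
      then show ?thesis using B'B that nz by simp
    qed
    have "{pt (\<lambda>i. if i \<le> 13 then \<Sum>k\<le>13. B i k * tv s k else 0) | s. torus s} =
        {pt (\<lambda>i. if i \<le> 13 then \<Sum>k\<le>13. B i k * tv \<sigma> k * tv s k else 0) | s. torus s}"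
      (is "?A = ?B")
    proof (intro set_eqI iffI)
      fix P assume "P \<in> ?A"
      then obtain t where t: "torus t" "P = pt (\<lambda>i. if i \<le> 13 then \<Sum>k\<le>13. B i k * tv t k else 0)" by blast
      define u where "u i = t i / \<sigma> i" for i
      have u: "torus u" using t s by (simp add: u_def)
      have "tv t k = tv (\<lambda>i. \<sigma> i * u i) k" if "k \<le> 13" for k
        using s qi_fi_se[OF that] by (auto simp: u_def tv_def val_def tu_def)
      then have "tv t k = tv \<sigma> k * tv u k" if "k \<le> 13" for k using that tv_mult by simp
      then have "P = pt (\<lambda>i. if i \<le> 13 then \<Sum>k\<le>13. B i k * tv \<sigma> k * tv u k else 0)"
        unfolding t(2) by (intro arg_cong[of _ _ pt] ext) (simp add: mult.assoc)
      then show "P \<in> ?B" using u by blast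
    next
      fix P assume "P \<in> ?B"
      then obtain u where u: "torus u" "P = pt (\<lambda>i. if i \<le> 13 then \<Sum>k\<le>13. B i k * tv \<sigma> k * tv u k else 0)" by blast
      have "torus (\<lambda>i. \<sigma> i * u i)" using u s by simp
      moreover have "P = pt (\<lambda>i. if i \<le> 13 then \<Sum>k\<le>13. B i k * tv (\<lambda>i. \<sigma> i * u i) k else 0)"
        unfolding u(2) by (intro arg_cong[of _ _ pt] ext) (simp add: tv_mult mult.assoc)
      ultimately show "P \<in> ?A" by blast
    qed
    then show "W = clo 13 ?B" using W by simp
  qed
  show "frame.w0 (\<lambda>i k. B i k * tv \<sigma> k) = pt (vl (tv \<sigma>))"
    unfolding frame.w0_def[OF fr] frame.vl_def[OF fr] vl_def by (intro arg_cong[of _ _ pt] ext) simp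
qed

section \<open>The Cayley cubic surface\<close>

text \<open>The third elementary symmetric polynomial, which is
  \<open>y\<^sub>0y\<^sub>1y\<^sub>2y\<^sub>3\<close> times the sum of the reciprocals: the equation
  of the Cayley cubic with its nodes at the coordinate points.\<close>

definition e3 :: "(nat \<Rightarrow> complex) \<Rightarrow> complex" where
  "e3 y = y 1 * y 2 * y 3 + y 0 * y 2 * y 3 + y 0 * y 1 * y 3 + y 0 * y 1 * y 2"

definition lin :: "(nat \<Rightarrow> nat \<Rightarrow> complex) \<Rightarrow> (nat \<Rightarrow> complex) \<Rightarrow> nat \<Rightarrow> complex" where
  "lin A y = (\<lambda>i. if i \<le> 3 then \<Sum>j\<le>3. A i j * y j else 0)"

definition inv4 :: "(nat \<Rightarrow> nat \<Rightarrow> complex) \<Rightarrow> (nat \<Rightarrow> nat \<Rightarrow> complex) \<Rightarrow> bool" where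
  "inv4 A A' \<longleftrightarrow> (\<forall>i\<le>3. \<forall>k\<le>3. (\<Sum>j\<le>3. A i j * A' j k) = (if i = k then 1 else 0)) \<and>
     (\<forall>i\<le>3. \<forall>k\<le>3. (\<Sum>j\<le>3. A' i j * A j k) = (if i = k then 1 else 0))"

text \<open>The condition on y 0 + y 1 reflects the parametrization by \<open>gs\<close>: there all
  \<open>el a\<close> share the factor w 0 + w 1, where w i = 1 / y i.\<close>

definition ygen :: "(nat \<Rightarrow> complex) \<Rightarrow> bool" where
  "ygen y \<longleftrightarrow> (\<forall>i>3. y i = 0) \<and> (\<forall>i\<le>3. y i \<noteq> 0) \<and> y 0 + y 1 \<noteq> 0 \<and> e3 y = 0"

lemma inv4_sym: "inv4 A A' \<Longrightarrow> inv4 A' A"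
  by (auto simp: inv4_def)

lemma lin_lin:
  assumes A: "inv4 A A'" and i: "i \<le> 3"
  shows "lin A (lin A' y) i = y i"
proof -
  have "lin A (lin A' y) i = (\<Sum>j\<le>3. \<Sum>k\<le>3. A i j * A' j k * y k)"
    using i by (simp add: lin_def sum_distrib_left mult.assoc)
  also have "\<dots> = (\<Sum>k\<le>3. (\<Sum>j\<le>3. A i j * A' j k) * y k)"
    by (subst sum.swap) (simp add: sum_distrib_right)
  also have "\<dots> = (\<Sum>k\<le>3. if k = i then y k else 0)"
    by (rule sum.cong) (use A i in \<open>auto simp: inv4_def\<close>)
  finally show ?thesis using i by simp
qed

lemma lin_inverse: "inv4 A A' \<Longrightarrow> (\<And>i. i > 3 \<Longrightarrow> y i = 0) \<Longrightarrow> lin A (lin A' y) = y"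
proof
  fix i assume A: "inv4 A A'" and y: "\<And>i. i > 3 \<Longrightarrow> y i = 0"
  show "lin A (lin A' y) i = y i"
    by (cases "i \<le> 3") (use lin_lin[OF A] y in \<open>auto simp: lin_def\<close>)
qed

lemma lin_scale: "lin A (\<lambda>i. c * y i) = (\<lambda>i. c * lin A y i)"
  by (rule ext) (simp add: lin_def sum_distrib_left mult.left_commute)

lemma lin_add: "lin A (\<lambda>i. x i + t * y i) = (\<lambda>i. lin A x i + t * lin A y i)"
  by (rule ext) (simp add: lin_def sum_distrib_left sum.distrib algebra_simps)

lemma lin_cong: "(\<And>i. i \<le> 3 \<Longrightarrow> x i = y i) \<Longrightarrow> lin A x = lin A y"
  by (rule ext) (simp add: lin_def)

lemma hmap_lin: "hmap n 3 1 (lin A)" if "3 \<le> n"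
  unfolding hmap_def lin_def
  using that by (auto intro!: hform_sum hform_cmult hform_var[unfolded One_nat_def])

lemma vec_lin: "inv4 A A' \<Longrightarrow> vec 3 y \<Longrightarrow> vec 3 (lin A y)"
proof -
  assume A: "inv4 A A'" and y: "vec 3 y"
  have "lin A' (lin A y) = y" using lin_inverse[OF inv4_sym[OF A]] y by (simp add: vec_def)
  moreover have "lin A' (\<lambda>_. 0) = (\<lambda>_. 0)" by (rule ext) (simp add: lin_def)
  ultimately have "lin A y \<noteq> (\<lambda>_. 0)" using y by (auto simp: vec_def)
  then show ?thesis by (simp add: vec_def lin_def)
qed

lemma lin_tendsto: "(\<And>i. i \<le> 3 \<Longrightarrow> (\<lambda>n. y n i) \<longlonglongrightarrow> z i) \<Longrightarrow> (\<lambda>n. lin A (y n) i) \<longlonglongrightarrow> lin A z i"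
  unfolding lin_def by (cases "i \<le> 3") (auto intro!: tendsto_intros)

lemma hform_e3: "hform 3 3 e3"
proof -
  have v: "hform 3 3 (\<lambda>y. y i * y j * y k)" if "i \<le> 3" "j \<le> 3" "k \<le> 3" for i j k
    by (rule hform_mult[OF hform_mult[OF hform_var hform_var refl] hform_var]) (use that in auto)
  show ?thesis unfolding e3_def by (intro hform_add v) auto
qed

lemma e3_cong: "(\<And>i. i \<le> 3 \<Longrightarrow> x i = y i) \<Longrightarrow> e3 x = e3 y"
  by (simp add: e3_def)

lemma e3_perm:
  assumes "perm4 a b c d"
  shows "e3 y = y d * (y a * y b + y a * y c + y b * y c) + y a * y b * y c"
  using assms unfolding perm4_def
  by (elim conjE, drule_tac le_3_cases, drule_tac le_3_cases, drule_tac le_3_cases, drule_tac le_3_cases)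
    (elim disjE; simp add: e3_def algebra_simps)

lemma eventually_not_root:
  assumes "p \<noteq> (0 :: complex poly)"
  shows "eventually (\<lambda>n. poly p (1 / of_nat (Suc n)) \<noteq> 0) sequentially"
proof -
  have inj: "inj (\<lambda>n. 1 / of_nat (Suc n) :: complex)"
    by (rule injI) (simp del: of_nat_Suc add: frac_eq_eq)
  have "finite ((\<lambda>n. 1 / of_nat (Suc n)) -` {x. poly p x = 0})"
    using poly_roots_finite[OF assms] inj by (rule finite_vimageI)
  then have "finite {n. \<not> poly p (1 / of_nat (Suc n)) \<noteq> 0}" by (simp add: vimage_def)
  then show ?thesis unfolding cofinite_eq_sequentially[symmetric] eventually_cofinite .
qed

text \<open>The four quadratic expressions are the partial derivatives of \<open>e3\<close>, so this
  locates the singular points. It serves both the density of generic points and the computation of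
  the singular locus.\<close>

lemma e2_vanish_vertex:
  assumes "y 0 * y 1 + y 0 * y 2 + y 1 * y 2 = (0 :: complex)" "y 0 * y 1 + y 0 * y 3 + y 1 * y 3 = 0"
    "y 0 * y 2 + y 0 * y 3 + y 2 * y 3 = 0" "y 1 * y 2 + y 1 * y 3 + y 2 * y 3 = 0" "e3 y = 0"
  shows "\<exists>d\<le>3. \<forall>a\<le>3. a \<noteq> d \<longrightarrow> y a = 0"
proof -
  have "e3 y = y 3 * (y 0 * y 1 + y 0 * y 2 + y 1 * y 2) + y 0 * y 1 * y 2"
    by (simp add: e3_def algebra_simps)
  then have "y 0 * y 1 * y 2 = 0" using assms by simp
  then consider "y 0 = 0" | "y 1 = 0" | "y 2 = 0" by auto
  then have "y 0 * y 1 = 0 \<and> y 0 * y 2 = 0 \<and> y 0 * y 3 = 0 \<and> y 1 * y 2 = 0 \<and> y 1 * y 3 = 0 \<and> y 2 * y 3 = 0"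
    by cases (use assms in simp_all)
  then consider "y 1 = 0 \<and> y 2 = 0 \<and> y 3 = 0" | "y 0 = 0 \<and> y 2 = 0 \<and> y 3 = 0" |
    "y 0 = 0 \<and> y 1 = 0 \<and> y 3 = 0" | "y 0 = 0 \<and> y 1 = 0 \<and> y 2 = 0" by auto
  then show ?thesis
  proof cases
    case 1
    show ?thesis by (rule exI[of _ 0]) (use 1 in \<open>auto simp: all_3\<close>)
  next
    case 2
    show ?thesis by (rule exI[of _ 1]) (use 2 in \<open>auto simp: all_3\<close>)
  next
    case 3
    show ?thesis by (rule exI[of _ 2]) (use 3 in \<open>auto simp: all_3\<close>)
  next
    case 4
    show ?thesis by (rule exI[of _ 3]) (use 4 in \<open>auto simp: all_3\<close>)
  qed
qed

text \<open>Where the derivative of \<open>e3\<close> in direction d is nonzero, the equation can be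
  solved for the coordinate d. Adding a small h to the other three coordinates then gives points of
  the cubic that are generic for almost all h.\<close>

lemma ygen_clo_e2:
  assumes A: "inv4 A A'" and y: "vec 3 y" "e3 y = 0" and p: "perm4 a b c d"
    and e2: "y a * y b + y a * y c + y b * y c \<noteq> 0"
  shows "pt (lin A y) \<in> clo 3 {pt (lin A y) | y. ygen y}"
proof -
  have le: "a \<le> 3" "b \<le> 3" "c \<le> 3" "d \<le> 3"
    and ne: "a \<noteq> b" "a \<noteq> c" "a \<noteq> d" "b \<noteq> c" "b \<noteq> d" "c \<noteq> d" using p by (auto simp: perm4_def)
  have all: "i = a \<or> i = b \<or> i = c \<or> i = d" if "i \<le> 3" for i
    using le_3_cases[OF that] le_3_cases[OF le(1)] le_3_cases[OF le(2)] le_3_cases[OF le(3)]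
      le_3_cases[OF le(4)] ne by auto
  define h :: "nat \<Rightarrow> complex" where "h n = 1 / of_nat (Suc n)" for n
  have h: "h \<longlonglongrightarrow> 0" unfolding h_def by (rule LIMSEQ_Suc[OF lim_1_over_n])
  define E where "E t = (y a + t) * (y b + t) + (y a + t) * (y c + t) + (y b + t) * (y c + t)" for t
  define P where "P t = (y a + t) * (y b + t) * (y c + t)" for t
  define z where "z n i = (if i = d then - P (h n) / E (h n) else if i \<le> 3 then y i + h n else 0)" for n i
  have yd: "y d = - P 0 / E 0"
    using y(2) e2 unfolding e3_perm[OF p] E_def P_def by (simp add: field_simps add_eq_0_iff)
  have "(\<lambda>n. - P (h n) / E (h n)) \<longlonglongrightarrow> - P 0 / E 0"
    unfolding P_def E_def by (intro tendsto_intros h) (use e2 in simp)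
  moreover have "(\<lambda>n. y i + h n) \<longlonglongrightarrow> y i + 0" for i by (intro tendsto_intros h)
  ultimately have lim: "(\<lambda>n. z n i) \<longlonglongrightarrow> y i" if "i \<le> 3" for i
    using yd that by (cases "i = d") (auto simp: z_def)
  have ev: "eventually (\<lambda>n. poly p (h n) \<noteq> 0) sequentially" if "p \<noteq> 0" for p
    using eventually_not_root[OF that] by (simp add: h_def)
  have evE: "eventually (\<lambda>n. E (h n) \<noteq> 0) sequentially"
  proof (rule tendsto_imp_eventually_ne)
    show "(\<lambda>n. E (h n)) \<longlonglongrightarrow> E 0" unfolding E_def by (intro tendsto_intros h)
    show "E 0 \<noteq> 0" using e2 by (simp add: E_def)
  qed
  \<comment> \<open>Nonvanishing of this product keeps the three shifted coordinates and their
    pairwise sums away from zero.\<close>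
  have "eventually (\<lambda>n. poly ([:y a, 1:] * [:y b, 1:] * [:y c, 1:] * [:y a + y b, 2:] *
      [:y a + y c, 2:] * [:y b + y c, 2:]) (h n) \<noteq> 0) sequentially"
    by (rule ev) simp
  then have "eventually (\<lambda>n. pt (lin A (z n)) \<in> {pt (lin A y) | y. ygen y}) sequentially"
    using evE
  proof eventually_elim
    case (elim n)
    from elim(1) have "poly [:y a, 1:] (h n) \<noteq> 0 \<and> poly [:y b, 1:] (h n) \<noteq> 0 \<and> poly [:y c, 1:] (h n) \<noteq> 0 \<and>
        poly [:y a + y b, 2:] (h n) \<noteq> 0 \<and> poly [:y a + y c, 2:] (h n) \<noteq> 0 \<and> poly [:y b + y c, 2:] (h n) \<noteq> 0"
      unfolding poly_mult by (metis mult_eq_0_iff)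
    with elim(2) have nz: "y a + h n \<noteq> 0" "y b + h n \<noteq> 0" "y c + h n \<noteq> 0" "(y a + h n) + (y b + h n) \<noteq> 0"
      "(y a + h n) + (y c + h n) \<noteq> 0" "(y b + h n) + (y c + h n) \<noteq> 0" "E (h n) \<noteq> 0"
      by (auto simp: algebra_simps)
    have z: "z n a = y a + h n" "z n b = y b + h n" "z n c = y c + h n" "z n d = - P (h n) / E (h n)"
      using le ne by (auto simp: z_def)
    have e3: "e3 (z n) = 0"
      unfolding e3_perm[OF p] z using nz by (simp add: P_def E_def)
    have znz: "z n i \<noteq> 0" if "i \<le> 3" for i
      using all[OF that] nz by (auto simp: z P_def)
    have "z n 0 + z n 1 \<noteq> 0"
    proof
      \<comment> \<open>On the cubic this forces z n 2 + z n 3 = 0 as well, and one of the two pairs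
        does not involve d, so that its sum is among those kept nonzero.\<close>
      assume 0: "z n 0 + z n 1 = 0"
      have "e3 (z n) = z n 0 * z n 1 * (z n 2 + z n 3) + (z n 0 + z n 1) * (z n 2 * z n 3)"
        by (simp add: e3_def algebra_simps)
      then have "z n 2 + z n 3 = 0" using 0 e3 znz by simp
      moreover have "{i, j} \<subseteq> {a, b, c} \<Longrightarrow> i \<noteq> j \<Longrightarrow> z n i + z n j \<noteq> 0" for i j
        using nz(4-6) by (auto simp: z add.commute)
      moreover have "{0, 1} \<subseteq> {a, b, c} \<or> {2, 3} \<subseteq> {a, b, c}"
        using all[of 0] all[of 1] all[of 2] all[of 3] by auto
      ultimately show False using 0
        by (metis numeral_eq_iff semiring_norm(88) zero_neq_one)
    qed
    then have "ygen (z n)" using e3 znz le by (auto simp: ygen_def z_def)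
    then show ?case by blast
  qed
  then show ?thesis
    by (rule clo_limit_eventually[OF _ _ vec_lin[OF A y(1)]]) (intro lin_tendsto lim)
qed

lemma cayley_dense:
  assumes A: "inv4 A A'" and x: "vec 3 x" "e3 (lin A' x) = 0"
  shows "pt x \<in> clo 3 {pt (lin A y) | y. ygen y}"
proof -
  let ?G = "{pt (lin A y) | y. ygen y}"
  define y where "y = lin A' x"
  have xy: "x = lin A y" using lin_inverse[OF A] x by (simp add: y_def vec_def)
  have y: "vec 3 y" "e3 y = 0" using vec_lin[OF inv4_sym[OF A] x(1)] x(2) by (auto simp: y_def)
  note e2 = ygen_clo_e2[OF A]
  have p: "perm4 0 1 2 3" "perm4 0 1 3 2" "perm4 0 2 3 1" "perm4 1 2 3 0" by (auto simp: perm4_def)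
  consider "\<exists>a b c d. perm4 a b c d \<and> y a * y b + y a * y c + y b * y c \<noteq> 0"
    | "\<exists>d\<le>3. \<forall>a\<le>3. a \<noteq> d \<longrightarrow> y a = 0"
    using e2_vanish_vertex[of y] p y(2) by blast
  then show ?thesis
  proof cases
    case 1
    then show ?thesis using e2[OF y] by (auto simp: xy)
  next
    case 2
    then obtain d where d: "d \<le> 3" "\<And>a. a \<le> 3 \<Longrightarrow> a \<noteq> d \<Longrightarrow> y a = 0" by blast
    have yd: "y d \<noteq> 0" using y(1) d unfolding vec_def by (metis linorder_not_le)
    obtain c :: nat where c: "c \<le> 3" "c \<noteq> d" by (metis zero_le one_le_numeral zero_neq_one)
    obtain a b where p: "perm4 c a b d" using perm4_exists[OF c(1) d(1) c(2)] .
    then have p': "perm4 a c d b" and ab: "a \<le> 3" "b \<le> 3" "a \<noteq> b" "a \<noteq> c" "a \<noteq> d" "b \<noteq> c" "b \<noteq> d"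
      by (auto simp: perm4_def)
    define h :: "nat \<Rightarrow> complex" where "h n = 1 / of_nat (Suc n)" for n
    have h: "h \<longlonglongrightarrow> 0" unfolding h_def by (rule LIMSEQ_Suc[OF lim_1_over_n])
    \<comment> \<open>A node is approached along the line to another node. The points strictly
      between lie where a derivative of the cubic is nonzero, so they are limits of generic points,
      and closures are taken twice.\<close>
    define z where "z n = y(c := h n)" for n
    have "pt (lin A (z n)) \<in> clo 3 ?G" for n
    proof (rule e2[OF _ _ p'])
      have zs: "z n a = 0" "z n b = 0" "z n c = h n" "z n d = y d"
        using ab c d(2)[OF ab(1,5)] d(2)[OF ab(2,7)] by (auto simp: z_def)
      have "z n \<noteq> (\<lambda>_. 0)" using zs(4) yd by auto
      then show "vec 3 (z n)" using y(1) c by (auto simp: vec_def z_def)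
      show "e3 (z n) = 0" unfolding e3_perm[OF p'] zs by simp
      show "z n a * z n c + z n a * z n d + z n c * z n d \<noteq> 0"
        unfolding zs using yd by (simp add: h_def del: of_nat_Suc)
    qed
    moreover have "(\<lambda>n. z n i) \<longlonglongrightarrow> y i" for i
      using h d(2)[OF c] by (cases "i = c") (auto simp: z_def)
    then have "(\<lambda>n. lin A (z n) i) \<longlonglongrightarrow> lin A y i" for i by (rule lin_tendsto)
    ultimately have "pt (lin A y) \<in> clo 3 (clo 3 ?G)"
      using vec_lin[OF A y(1)] by (rule clo_limit)
    then show ?thesis using clo_trans[OF order_refl] unfolding xy by blast
  qed
qed

lemma cayley_form:
  obtains F where "F \<in> forms 3 3" "\<And>x. mpeval F x = e3 (lin A' x)"
  using hform_compose[OF hform_e3 hmap_lin[OF order_refl]] hformE by (metis mult_1)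

lemma cayley_image:
  assumes A: "inv4 A A'" and F: "F \<in> forms 3 3" "\<And>x. mpeval F x = e3 (lin A' x)"
    and T: "T \<subseteq> proj 3" "\<And>P. P \<in> T \<Longrightarrow> vanishes F P" "\<And>y. ygen y \<Longrightarrow> pt (lin A y) \<in> T"
  shows "clo 3 T = zero_locus 3 {F}"
proof
  have zc: "zclosed 3 (zero_locus 3 {F})" using zclosed_form[OF F(1)] by (simp add: zero_locus_def)
  show "clo 3 T \<subseteq> zero_locus 3 {F}"
    by (rule clo_minimal[OF zc]) (use T in \<open>auto simp: zero_locus_def\<close>)
  show "zero_locus 3 {F} \<subseteq> clo 3 T"
  proof
    fix P assume P: "P \<in> zero_locus 3 {F}"
    then obtain x where x: "P = pt x" "vec 3 x" by (auto simp: zero_locus_def proj_iff)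
    then have "e3 (lin A' x) = 0" using P F by (auto simp: zero_locus_def)
    then have "P \<in> clo 3 {pt (lin A y) | y. ygen y}" using cayley_dense[OF A] x by simp
    moreover have "clo 3 {pt (lin A y) | y. ygen y} \<subseteq> clo 3 T" using T(3) by (intro clo_mono) blast
    ultimately show "P \<in> clo 3 T" by blast
  qed
qed

text \<open>
  The rational inverse of \<open>s \<mapsto> [\<ell>\<^sub>0(s) : \<dots> : \<ell>\<^sub>3(s)]\<close> together with the coordinate
  \<open>(s\<^sub>0 - s\<^sub>1) / (s\<^sub>2 - s\<^sub>3) = v / u\<close> on its fibres; here \<open>w\<^sub>i = 1 / \<ell>\<^sub>i\<close>.
\<close>

definition gs :: "(nat \<Rightarrow> complex) \<Rightarrow> complex \<Rightarrow> complex \<Rightarrow> nat \<Rightarrow> complex" where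
  "gs w u v i = [w 0 * v * (w 1 * v + w 3 * u) * (w 1 * v - w 2 * u),
     w 1 * v * (w 0 * v - w 3 * u) * (- w 2 * u - w 0 * v),
     - w 2 * u * (w 1 * v + w 3 * u) * (w 0 * v - w 3 * u),
     - w 3 * u * (w 1 * v - w 2 * u) * (- w 2 * u - w 0 * v)] ! i"

text \<open>Because the w i sum to zero, every difference is the quadratic D times one linear factor
  in u and v. In \<open>el a\<close> these factors cancel against those of component a, and the same
  multiple of 1 / w a remains for each a.\<close>

lemma gs_diff:
  fixes w :: "nat \<Rightarrow> complex" and u v :: complex
  assumes w: "w 0 + w 1 + w 2 + w 3 = 0"
  defines "D \<equiv> w 0 * w 1 * v\<^sup>2 - w 2 * w 3 * u\<^sup>2"
  shows "gs w u v 0 - gs w u v 1 = v * (w 0 + w 1) * D"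
    "gs w u v 2 - gs w u v 3 = u * (w 0 + w 1) * D"
    "gs w u v 0 - gs w u v 2 = (w 1 * v + w 3 * u) * D"
    "gs w u v 0 - gs w u v 3 = (w 1 * v - w 2 * u) * D"
    "gs w u v 1 - gs w u v 2 = - (w 0 * v - w 3 * u) * D"
    "gs w u v 1 - gs w u v 3 = (- w 2 * u - w 0 * v) * D"
proof -
  have w3: "w 3 = - (w 0 + w 1 + w 2)" using w by (simp add: add_eq_0_iff2 add_eq_0_iff)
  show "gs w u v 0 - gs w u v 1 = v * (w 0 + w 1) * D"
    "gs w u v 2 - gs w u v 3 = u * (w 0 + w 1) * D"
    "gs w u v 0 - gs w u v 2 = (w 1 * v + w 3 * u) * D"
    "gs w u v 0 - gs w u v 3 = (w 1 * v - w 2 * u) * D"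
    "gs w u v 1 - gs w u v 2 = - (w 0 * v - w 3 * u) * D"
    "gs w u v 1 - gs w u v 3 = (- w 2 * u - w 0 * v) * D"
    unfolding D_def w3 gs_def by (simp_all, algebra+)
qed

lemma gs_torus:
  assumes w: "w 0 + w 1 + w 2 + w 3 = 0" and s: "torus (gs w u v)" and a: "a \<le> 3"
  shows "el a (tv (gs w u v)) = (w 0 + w 1) * (w 0 * w 1 * v\<^sup>2 - w 2 * w 3 * u\<^sup>2) ^ 3 / w a"
proof -
  define D where "D = w 0 * w 1 * v\<^sup>2 - w 2 * w 3 * u\<^sup>2"
  note d = gs_diff[OF w, of u v, folded D_def]
  define s where "s = gs w u v"
  define al be ga de where "al = w 1 * v + w 3 * u" and "be = w 1 * v - w 2 * u"
    and "ga = w 0 * v - w 3 * u" and "de = - w 2 * u - w 0 * v"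
  note d' = d[folded s_def al_def be_def ga_def de_def]
  have s4: "s 0 = w 0 * v * al * be" "s 1 = w 1 * v * ga * de" "s 2 = - w 2 * u * al * ga" "s 3 = - w 3 * u * be * de"
    by (simp_all add: s_def gs_def al_def be_def ga_def de_def)
  have nz: "w 0 \<noteq> 0" "w 1 \<noteq> 0" "w 2 \<noteq> 0" "w 3 \<noteq> 0" "v \<noteq> 0" "u \<noteq> 0" "al \<noteq> 0" "be \<noteq> 0" "ga \<noteq> 0" "de \<noteq> 0"
    using s[folded s_def] unfolding all_3 s4 by auto
  have d2: "s 1 - s 0 = - (v * (w 0 + w 1) * D)" "s 2 - s 0 = - (al * D)" "s 3 - s 0 = - (be * D)"
    "s 2 - s 1 = ga * D" "s 3 - s 1 = - (de * D)" "s 3 - s 2 = - (u * (w 0 + w 1) * D)"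
    using d' by (simp_all add: algebra_simps)
  note e = el_torus[OF s, folded s_def]
  have "el 0 (tv s) = (w 0 + w 1) * D ^ 3 / w 0" unfolding e unfolding d' unfolding s4(1) using nz by (simp add: power3_eq_cube)
  moreover have "el 1 (tv s) = (w 0 + w 1) * D ^ 3 / w 1"
    unfolding e unfolding d' d2 unfolding s4(2) using nz by (simp add: power3_eq_cube)
  moreover have "el 2 (tv s) = (w 0 + w 1) * D ^ 3 / w 2"
    unfolding e unfolding d' d2 unfolding s4(3) using nz by (simp add: power3_eq_cube)
  moreover have "el 3 (tv s) = (w 0 + w 1) * D ^ 3 / w 3"
    unfolding e unfolding d' d2 unfolding s4(4) using nz by (simp add: power3_eq_cube)
  ultimately show ?thesis using le_3_cases[OF a] by (auto simp: s_def D_def)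
qed

lemma ygen_torus:
  assumes y: "ygen y"
  obtains s c where "torus s" "c \<noteq> 0" "\<And>a. a \<le> 3 \<Longrightarrow> el a (tv s) = c * y a"
proof -
  define w where "w i = 1 / y i" for i
  have ynz: "y 0 \<noteq> 0" "y 1 \<noteq> 0" "y 2 \<noteq> 0" "y 3 \<noteq> 0" and y01: "y 0 + y 1 \<noteq> 0" using y by (auto simp: ygen_def)
  have "w 0 + w 1 + w 2 + w 3 = e3 y / (y 0 * y 1 * y 2 * y 3)"
    using ynz by (simp add: w_def e3_def field_simps)
  then have w: "w 0 + w 1 + w 2 + w 3 = 0" using y by (simp add: ygen_def)
  have wnz: "w 0 \<noteq> 0" "w 1 \<noteq> 0" "w 2 \<noteq> 0" "w 3 \<noteq> 0" using ynz by (auto simp: w_def)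
  have w01: "w 0 + w 1 \<noteq> 0" using y01 ynz by (simp add: w_def field_simps add.commute)
  \<comment> \<open>With u = 1, the fibre coordinate v is chosen off the zeros of all linear factors
    of \<open>gs\<close> and of D.\<close>
  define p where "p = [:0, 1:] * [:w 3, w 1:] * [:- w 2, w 1:] * [:- w 3, w 0:] * [:- w 2, - w 0:] *
    [:- w 2 * w 3, 0, w 0 * w 1:]"
  have "p \<noteq> 0" using wnz by (simp add: p_def)
  then obtain v where v: "poly p v \<noteq> 0" using poly_all_0_iff_0 by blast
  then have "poly [:0, 1:] v \<noteq> 0 \<and> poly [:w 3, w 1:] v \<noteq> 0 \<and> poly [:- w 2, w 1:] v \<noteq> 0 \<and>
    poly [:- w 3, w 0:] v \<noteq> 0 \<and> poly [:- w 2, - w 0:] v \<noteq> 0 \<and> poly [:- w 2 * w 3, 0, w 0 * w 1:] v \<noteq> 0"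
    unfolding p_def poly_mult by (metis mult_eq_0_iff)
  moreover have "poly [:0, 1:] v = v" "poly [:w 3, w 1:] v = w 1 * v + w 3 * 1"
    "poly [:- w 2, w 1:] v = w 1 * v - w 2 * 1" "poly [:- w 3, w 0:] v = w 0 * v - w 3 * 1"
    "poly [:- w 2, - w 0:] v = - w 2 * 1 - w 0 * v"
    "poly [:- w 2 * w 3, 0, w 0 * w 1:] v = w 0 * w 1 * v\<^sup>2 - w 2 * w 3 * 1\<^sup>2"
    by (simp_all add: algebra_simps power2_eq_square)
  ultimately have f: "v \<noteq> 0" "w 1 * v + w 3 * 1 \<noteq> 0" "w 1 * v - w 2 * 1 \<noteq> 0" "w 0 * v - w 3 * 1 \<noteq> 0"
    "- w 2 * 1 - w 0 * v \<noteq> 0" and D: "w 0 * w 1 * v\<^sup>2 - w 2 * w 3 * 1\<^sup>2 \<noteq> 0"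
    by argo+
  define s where "s = gs w 1 v"
  have s: "torus s"
    unfolding all_3 s_def gs_def using f wnz by simp
  show ?thesis
  proof (rule that[OF s])
    show "(w 0 + w 1) * (w 0 * w 1 * v\<^sup>2 - w 2 * w 3 * 1\<^sup>2) ^ 3 \<noteq> 0" using w01 D by simp
    show "el a (tv s) = (w 0 + w 1) * (w 0 * w 1 * v\<^sup>2 - w 2 * w 3 * 1\<^sup>2) ^ 3 * y a" if "a \<le> 3" for a
      using gs_torus[OF w s[unfolded s_def] that] by (simp add: s_def w_def)
  qed
qed

lemma e3_torus:
  assumes s: "torus s"
  shows "e3 (\<lambda>a. el a (tv s)) = 0"
proof -
  define d01 d02 d03 d12 d13 d23 where "d01 = s 0 - s 1" and "d02 = s 0 - s 2" and "d03 = s 0 - s 3"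
    and "d12 = s 1 - s 2" and "d13 = s 1 - s 3" and "d23 = s 2 - s 3"
  have n: "s 1 - s 0 = - d01" "s 2 - s 0 = - d02" "s 3 - s 0 = - d03" "s 2 - s 1 = - d12"
    "s 3 - s 1 = - d13" "s 3 - s 2 = - d23"
    by (simp_all add: d01_def d02_def d03_def d12_def d13_def d23_def)
  have nz: "s 0 \<noteq> 0" "s 1 \<noteq> 0" "s 2 \<noteq> 0" "s 3 \<noteq> 0" using s by auto
  note e = el_torus[OF s, unfolded n, folded d01_def d02_def d03_def d12_def d13_def d23_def]
  \<comment> \<open>The expansion of the 4 by 4 determinant with columns s, 1, s, s^2, in which a
    column is repeated.\<close>
  have vdm: "s 0 * (d12 * d13 * d23) - s 1 * (d02 * d03 * d23) + s 2 * (d01 * d03 * d13) - s 3 * (d01 * d02 * d12) = 0"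
    unfolding d01_def d02_def d03_def d12_def d13_def d23_def by algebra
  have "e3 (\<lambda>a. el a (tv s)) * (s 0 * s 1 * s 2 * s 3) =
      d01 * d02 * d03 * d12 * d13 * d23 * (s 0 * (d12 * d13 * d23) - s 1 * (d02 * d03 * d23) +
      s 2 * (d01 * d03 * d13) - s 3 * (d01 * d02 * d12))"
    unfolding e3_def e using nz by (simp add: field_simps)
  then show ?thesis using vdm nz by simp
qed

context frame
begin

text \<open>The image satisfies the cubic by the identity on the torus and contains every generic
  point of the cubic by \<open>ygen_torus\<close>; since these are dense, its closure is the whole
  cubic.\<close>

lemma image_W:
  assumes A: "inv4 A A'" and b: "\<And>i. i \<le> 3 \<Longrightarrow> b i = (\<Sum>j\<le>3. scale (A i j) (EL j))"
    and F: "F \<in> forms 3 3" "\<And>x. mpeval F x = e3 (lin A' x)"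
  shows "rational_image 13 3 W b = zero_locus 3 {F}"
proof -
  define T where "T = {pt (hvec 3 b x) | x P. P \<in> W \<and> x \<in> P \<and> hvec 3 b x \<noteq> (\<lambda>_. 0)}"
  have hv: "hvec 3 b x = lin A (\<lambda>a. el a (X x))" for x
    by (rule ext) (simp add: hvec_def lin_def b mpeval_sum EL_eval)
  have Tp: "T \<subseteq> proj 3" by (auto simp: T_def vec_def hvec_def)
  have e3W: "e3 (\<lambda>a. if a \<le> 3 then el a (X x) else 0) = 0" if "pt x \<in> W" for x
  proof (rule W_hform[OF _ _ that])
    have "hmap 13 3 1 (\<lambda>x a. if a \<le> 3 then el a (X x) else 0)"
      using hform_el by (simp add: hmap_def)
    then show "hform 13 (1 * 3) (\<lambda>x. e3 (\<lambda>a. if a \<le> 3 then el a (X x) else 0))"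
      by (rule hform_compose[OF hform_e3])
    fix s assume s: "torus s"
    have e: "el a (X (vl (tv s))) = el a (tv s)" for a
      unfolding el_def by (rule sum.cong) (auto simp: X_vl)
    show "e3 (\<lambda>a. if a \<le> 3 then el a (X (vl (tv s))) else 0) = 0"
      unfolding e using e3_torus[OF s] e3_cong[of "\<lambda>a. if a \<le> 3 then el a (tv s) else 0" "\<lambda>a. el a (tv s)"] by simp
  qed
  have "clo 3 T = zero_locus 3 {F}"
  proof (rule cayley_image[OF A F Tp])
    fix P assume "P \<in> T"
    then obtain x Q where x: "P = pt (hvec 3 b x)" "Q \<in> W" "x \<in> Q" by (auto simp: T_def)
    then have "pt x \<in> W" using W_subset proj_mem by blast
    have "lin A' (hvec 3 b x) = (\<lambda>a. if a \<le> 3 then el a (X x) else 0)"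
      unfolding hv using lin_inverse[OF inv4_sym[OF A], of "\<lambda>a. if a \<le> 3 then el a (X x) else 0"]
        lin_cong[of "\<lambda>a. el a (X x)" "\<lambda>a. if a \<le> 3 then el a (X x) else 0" A] by simp
    then show "vanishes F P" using e3W[OF \<open>pt x \<in> W\<close>] F by (simp add: x(1))
  next
    fix y assume y: "ygen y"
    obtain s c where s: "torus s" "c \<noteq> 0" "\<And>a. a \<le> 3 \<Longrightarrow> el a (tv s) = c * y a"
      by (rule ygen_torus[OF y]) blast
    have e: "el a (X (vl (tv s))) = el a (tv s)" for a
      unfolding el_def by (rule sum.cong) (auto simp: X_vl)
    have h: "hvec 3 b (vl (tv s)) = (\<lambda>i. c * lin A y i)"
      unfolding hv e lin_scale[symmetric] using s(3) by (intro lin_cong)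
    have "vec 3 y" using y by (auto simp: ygen_def vec_def)
    then have "vec 3 (lin A y)" by (rule vec_lin[OF A])
    then have "hvec 3 b (vl (tv s)) \<noteq> (\<lambda>_. 0)" unfolding h using s(2) by (auto simp: vec_def fun_eq_iff)
    moreover have "pt (lin A y) = pt (hvec 3 b (vl (tv s)))" unfolding h using s(2) by simp
    ultimately show "pt (lin A y) \<in> T"
      using torus_in_W[OF s(1)] pt_self unfolding T_def by blast
  qed
  then show ?thesis unfolding rational_image_def T_def[symmetric] using Tp by (simp add: zclosure_eq_clo)
qed

end

section \<open>Irreducibility of the Cayley cubic\<close>

lemma zero_locus_cayley:
  assumes "F \<in> forms 3 3" "\<And>x. mpeval F x = e3 (lin A' x)"
  shows "pt x \<in> zero_locus 3 {F} \<longleftrightarrow> vec 3 x \<and> e3 (lin A' x) = 0"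
  using assms by (auto simp: zero_locus_def)

text \<open>
  A factorization of a polynomial of degree one in a variable has a factor free of that variable.
  If the factors of \<open>F\<close> split two variables among them, then
  \<open>F(x) F(x + u + v) = F(x + u) F(x + v)\<close>, which fails for the Cayley cubic.
\<close>

lemma diff_product:
  assumes q: "\<And>t. mpeval f (\<lambda>i. x i + t * v i) * mpeval g (\<lambda>i. x i + t * v i) = c + t * d"
  shows "(mpeval f (\<lambda>i. x i + v i) - mpeval f x) * (mpeval g (\<lambda>i. x i + v i) - mpeval g x) = 0"
proof -
  obtain p where p: "\<And>t. mpeval f (\<lambda>i. x i + t * v i) = poly p t" using mpeval_along_line by blast
  obtain r where r: "\<And>t. mpeval g (\<lambda>i. x i + t * v i) = poly r t" using mpeval_along_line by blast
  have "poly (p * r) t = poly [:c, d:] t" for t using q[of t] by (simp add: p r)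
  then have pr: "p * r = [:c, d:]" by (metis poly_eqI2 poly_eq_poly_eq_iff ext)
  have const: "poly s 1 = poly s 0" if "degree s = 0" for s :: "complex poly"
    using that by (auto elim: degree_eq_zeroE)
  have "degree p = 0 \<or> degree r = 0 \<or> p = 0 \<or> r = 0"
  proof (rule ccontr)
    assume n: "\<not> ?thesis"
    then have "degree (p * r) = degree p + degree r" by (simp add: degree_mult_eq)
    moreover have "degree (p * r) \<le> 1" unfolding pr by simp
    ultimately show False using n by simp
  qed
  then have "poly p 1 = poly p 0 \<or> poly r 1 = poly r 0" using const by auto
  then show ?thesis using p[of 1] p[of 0] r[of 1] r[of 0] by auto
qed

text \<open>Invariance under v gives invariance under all natural multiples of v, and a univariate
  polynomial with one value at infinitely many arguments is constant.\<close>

lemma invariant_const: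
  assumes "\<And>x. mpeval f (\<lambda>i. x i + v i) = mpeval f x"
  shows "mpeval f (\<lambda>i. x i + t * v i) = mpeval f x"
proof -
  obtain p where p: "\<And>t. mpeval f (\<lambda>i. x i + t * v i) = poly p t" using mpeval_along_line by blast
  have n: "mpeval f (\<lambda>i. x i + of_nat n * v i) = mpeval f x" for n
  proof (induction n)
    case (Suc n)
    have "mpeval f (\<lambda>i. x i + of_nat (Suc n) * v i) = mpeval f (\<lambda>i. (x i + of_nat n * v i) + v i)"
      by (simp add: algebra_simps)
    then show ?case using Suc assms[of "\<lambda>i. x i + of_nat n * v i"] by simp
  qed simp
  have "range of_nat \<subseteq> {t. poly (p - [:mpeval f x:]) t = 0}" using n by (auto simp: p)
  moreover have "infinite (range (of_nat :: nat \<Rightarrow> complex))"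
    using inj_of_nat range_inj_infinite by blast
  ultimately have "infinite {t. poly (p - [:mpeval f x:]) t = 0}" using infinite_super by blast
  then have "p - [:mpeval f x:] = 0" using poly_roots_finite by blast
  then show ?thesis using p by simp
qed

definition unitv :: "nat \<Rightarrow> nat \<Rightarrow> complex" where
  "unitv a = (\<lambda>i. if i = a then 1 else 0)"

lemma e3_line: "a \<le> 3 \<Longrightarrow> \<exists>c d. \<forall>t. e3 (\<lambda>i. y i + t * unitv a i) = c + t * d"
proof -
  assume a: "a \<le> 3"
  have *: "e3 (\<lambda>i. y i + t * unitv a i) = e3 y + t * (if a = 0 then y 1 * y 2 + y 1 * y 3 + y 2 * y 3
     else if a = 1 then y 0 * y 2 + y 0 * y 3 + y 2 * y 3 else if a = 2 then y 0 * y 1 + y 0 * y 3 + y 1 * y 3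
     else y 0 * y 1 + y 0 * y 2 + y 1 * y 2)" for t
    using le_3_cases[OF a] by (elim disjE) (simp_all add: e3_def unitv_def algebra_simps)
  show ?thesis unfolding * by blast
qed

lemma mpoly_constantI:
  assumes inv: "\<And>a x. mpeval f (\<lambda>i. x i + unitv a i) = mpeval f x"
  shows "f = cst (mpeval f (\<lambda>_. 0))"
proof (rule mpoly_eqI)
  fix x
  obtain n where n: "f \<in> polys n" using mpoly_in_polys by blast
  have "mpeval f (\<lambda>i. if i < k then x i else 0) = mpeval f (\<lambda>_. 0)" for k
  proof (induction k)
    case (Suc k)
    have "mpeval f (\<lambda>i. if i < Suc k then x i else 0) =
        mpeval f (\<lambda>i. (if i < k then x i else 0) + x k * unitv k i)"
      by (rule arg_cong[of _ _ "mpeval f"]) (auto simp: unitv_def less_Suc_eq)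
    also have "\<dots> = mpeval f (\<lambda>i. if i < k then x i else 0)"
      by (rule invariant_const) (rule inv)
    finally show ?case using Suc by simp
  qed simp
  moreover have "mpeval f x = mpeval f (\<lambda>i. if i < Suc n then x i else 0)"
    by (rule polys_cong[OF n]) simp
  ultimately show "mpeval f x = mpeval (cst (mpeval f (\<lambda>_. 0))) x" by simp
qed

lemma mpoly_shift: "\<exists>g. \<forall>x. mpeval g x = mpeval f (\<lambda>i. x i + v i)"
proof -
  obtain n where "f \<in> polys n" using mpoly_in_polys by blast
  then show ?thesis
  proof (induction rule: polys_induct)
    case (cst c)
    show ?case by (rule exI[of _ "cst c"]) simp
  next
    case (var i)
    show ?case by (rule exI[of _ "var i + cst (v i)"]) simp
  next
    case (add p q)
    then obtain g h where "\<forall>x. mpeval g x = mpeval p (\<lambda>i. x i + v i)"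
      "\<forall>x. mpeval h x = mpeval q (\<lambda>i. x i + v i)" by blast
    then show ?case by (intro exI[of _ "g + h"]) simp
  next
    case (mult p q)
    then obtain g h where "\<forall>x. mpeval g x = mpeval p (\<lambda>i. x i + v i)"
      "\<forall>x. mpeval h x = mpeval q (\<lambda>i. x i + v i)" by blast
    then show ?case by (intro exI[of _ "g * h"]) simp
  qed
qed

lemma cayley_irreducible:
  assumes A: "inv4 A A'" and F: "\<And>x. mpeval F x = e3 (lin A' x)"
  shows "irreducible F"
proof -
  \<comment> \<open>The directions of the y-coordinates as seen in x, along each of which F has
    degree at most one; beyond index 3, the directions of the remaining variables.\<close>
  define col where "col a = (if a \<le> 3 then lin A (unitv a) else unitv a)" for a
  have col: "lin A' (col a) = (\<lambda>i. if a \<le> 3 then unitv a i else 0)" for a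
  proof (cases "a \<le> 3")
    case True
    have "lin A' (lin A (unitv a)) = unitv a"
      by (rule lin_inverse[OF inv4_sym[OF A]]) (use True in \<open>auto simp: unitv_def\<close>)
    then show ?thesis using True by (simp add: col_def)
  next
    case False
    have "lin A' (unitv a) = lin A' (\<lambda>_. 0)" by (rule lin_cong) (use False in \<open>auto simp: unitv_def\<close>)
    then show ?thesis using False by (auto simp: col_def lin_def)
  qed
  have lc: "lin A' (\<lambda>i. x i + t * col a i) = (\<lambda>i. lin A' x i + t * (if a \<le> 3 then unitv a i else 0))" for x t a
    unfolding lin_add col ..
  have lc1: "lin A' (\<lambda>i. x i + col a i) = (\<lambda>i. lin A' x i + (if a \<le> 3 then unitv a i else 0))" for x a
    using lc[of x 1 a] by simp
  define y0 where "y0 = lin A (\<lambda>i. if i = 2 \<or> i = 3 then 1 else 0)"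
  have "a = cst (mpeval a (\<lambda>_. 0)) \<or> b = cst (mpeval b (\<lambda>_. 0))" if ab: "F = a * b" for a b
  proof -
    have Fab: "mpeval a x * mpeval b x = e3 (lin A' x)" for x using F[of x] by (simp add: ab)
    define I where "I f k \<longleftrightarrow> (\<forall>x. mpeval f (\<lambda>i. x i + col k i) = mpeval f x)" for f k
    have ID: "mpeval f (\<lambda>i. x i + col k i) = mpeval f x" if "I f k" for f k x
      using that by (simp add: I_def)
    have either: "I a k \<or> I b k" for k
    proof -
      have 0: "(mpeval a (\<lambda>i. x i + col k i) - mpeval a x) * (mpeval b (\<lambda>i. x i + col k i) - mpeval b x) = 0" for x
      proof -
        have "\<exists>c d. \<forall>t. e3 (lin A' (\<lambda>i. x i + t * col k i)) = c + t * d"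
        proof (cases "k \<le> 3")
          case True
          then show ?thesis unfolding lc using e3_line[OF True, of "lin A' x"] by simp
        next
          case False
          then show ?thesis unfolding lc by (intro exI[of _ "e3 (lin A' x)"] exI[of _ 0]) simp
        qed
        then obtain c d where cd: "\<And>t. e3 (lin A' (\<lambda>i. x i + t * col k i)) = c + t * d" by blast
        show ?thesis by (rule diff_product[where c = c and d = d]) (simp only: Fab cd)
      qed
      obtain a' where a': "\<And>x. mpeval a' x = mpeval a (\<lambda>i. x i + col k i)" using mpoly_shift by blast
      obtain b' where b': "\<And>x. mpeval b' x = mpeval b (\<lambda>i. x i + col k i)" using mpoly_shift by blast
      have "(\<forall>x. mpeval (a' - a) x = 0) \<or> (\<forall>x. mpeval (b' - b) x = 0)"
        by (rule mpeval_product_zero) (simp add: a' b' 0)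
      then show ?thesis by (simp add: a' b' I_def)
    qed
    have constI: "f = cst (mpeval f (\<lambda>_. 0))" if "\<And>k. I f k" for f
    proof (rule mpoly_constantI)
      have inv: "mpeval f (\<lambda>i. x i + t * col k i) = mpeval f x" for k x t
        by (rule invariant_const) (rule ID[OF that])
      fix k x
      show "mpeval f (\<lambda>i. x i + unitv k i) = mpeval f x"
      proof (cases "k \<le> 3")
        case True
        have "unitv k = lin A (lin A' (unitv k))"
          by (rule lin_inverse[OF A, symmetric]) (use True in \<open>auto simp: unitv_def\<close>)
        also have "\<dots> = (\<lambda>i. \<Sum>j\<le>3. lin A' (unitv k) j * col j i)"
        proof
          fix i
          have "lin A (unitv j) i = (if i \<le> 3 then A i j else 0)" if "j \<le> 3" for j
          proof -
            have "(\<Sum>k\<le>3. A i k * unitv j k) = (\<Sum>k\<le>3. if k = j then A i k else 0)"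
              by (rule sum.cong) (auto simp: unitv_def)
            then show ?thesis using that by (simp add: lin_def)
          qed
          then show "lin A (lin A' (unitv k)) i = (\<Sum>j\<le>3. lin A' (unitv k) j * col j i)"
            by (simp add: col_def lin_def[of A "lin A' (unitv k)"] mult.commute)
        qed
        finally have u: "unitv k i = (\<Sum>j\<le>3. lin A' (unitv k) j * col j i)" for i by (rule fun_cong)
        let ?c = "lin A' (unitv k)"
        have "(\<lambda>i. x i + unitv k i) =
            (\<lambda>i. (((x i + ?c 0 * col 0 i) + ?c 1 * col 1 i) + ?c 2 * col 2 i) + ?c 3 * col 3 i)"
          by (rule ext, subst u, subst sum_3) (simp only: add.assoc)
        then have "mpeval f (\<lambda>i. x i + unitv k i) =
            mpeval f (\<lambda>i. (((x i + ?c 0 * col 0 i) + ?c 1 * col 1 i) + ?c 2 * col 2 i) + ?c 3 * col 3 i)"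
          by (rule arg_cong)
        also have "\<dots> = mpeval f (\<lambda>i. ((x i + ?c 0 * col 0 i) + ?c 1 * col 1 i) + ?c 2 * col 2 i)" by (rule inv)
        also have "\<dots> = mpeval f (\<lambda>i. (x i + ?c 0 * col 0 i) + ?c 1 * col 1 i)" by (rule inv)
        also have "\<dots> = mpeval f (\<lambda>i. x i + ?c 0 * col 0 i)" by (rule inv)
        also have "\<dots> = mpeval f x" by (rule inv)
        finally show ?thesis .
      next
        case False
        then show ?thesis using ID[OF that, of x k] by (simp add: col_def)
      qed
    qed
    show ?thesis
    proof (rule ccontr)
      assume n: "\<not> ?thesis"
      then obtain k1 where k1: "\<not> I a k1" using constI[of a] by blast
      then have b1: "I b k1" using either by blast
      obtain k2 where k2: "\<not> I b k2" using n constI[of b] by blast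
      then have a2: "I a k2" using either by blast
      have ne: "k1 \<noteq> k2" using k1 a2 by blast
      \<comment> \<open>The polynomial ring has infinitely many variables. If one factor depended on
        a variable beyond 3 and the other did not, independence of F from that variable would force
        the other factor to be zero.\<close>
      have free: "False" if k: "k > 3" "\<not> I f k"
        "\<And>x. mpeval f x * mpeval g x = e3 (lin A' x)" "I g k" for f g k
      proof -
        obtain f' where f': "\<And>x. mpeval f' x = mpeval f (\<lambda>i. x i + col k i)" using mpoly_shift by blast
        define h where "h = f' - f"
        have h: "mpeval h x = mpeval f (\<lambda>i. x i + col k i) - mpeval f x" for x by (simp add: h_def f')
        have "mpeval h x * mpeval g x = 0" for x
        proof -
          have "mpeval f (\<lambda>i. x i + col k i) * mpeval g x = mpeval f (\<lambda>i. x i + col k i) * mpeval g (\<lambda>i. x i + col k i)"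
            by (simp add: ID[OF k(4)])
          also have "\<dots> = e3 (lin A' (\<lambda>i. x i + col k i))" by (rule k(3))
          also have "\<dots> = mpeval f x * mpeval g x" unfolding lc1 using k(1) by (simp add: k(3))
          finally show ?thesis by (simp add: h left_diff_distrib)
        qed
        then have "(\<forall>x. mpeval h x = 0) \<or> (\<forall>x. mpeval g x = 0)" by (rule mpeval_product_zero)
        then have "\<forall>x. mpeval g x = 0" using k(2) h by (auto simp: I_def)
        then have "e3 (lin A' (lin A (\<lambda>i. if i \<le> 3 then 1 else 0))) = 0"
          using k(3)[of "lin A (\<lambda>i. if i \<le> 3 then 1 else 0)"] by simp
        then show False
          using lin_inverse[OF inv4_sym[OF A], of "\<lambda>i. if i \<le> 3 then 1 else 0"] by (simp add: e3_def)
      qed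
      have le: "k1 \<le> 3" "k2 \<le> 3"
      proof -
        have Fba: "mpeval b x * mpeval a x = e3 (lin A' x)" for x using Fab[of x] by (simp add: mult.commute)
        show "k1 \<le> 3" using free[OF _ k1 Fab b1] by (meson not_le)
        show "k2 \<le> 3" using free[OF _ k2 Fba a2] by (meson not_le)
      qed
      obtain k3 k4 where p: "perm4 k1 k3 k4 k2" using perm4_exists[OF le ne] .
      then have p': "perm4 k1 k2 k3 k4" and d: "k1 \<noteq> k3" "k1 \<noteq> k4" "k2 \<noteq> k3" "k2 \<noteq> k4" "k3 \<noteq> k4" "k3 \<le> 3" "k4 \<le> 3"
        by (auto simp: perm4_def)
      \<comment> \<open>At x only the y-coordinates k3 and k4 are nonzero and F is 0, but a step in
        direction k1 or k2 raises F to 1. The factor b ignores k1 and a ignores k2, so neither of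
        them could vanish at x.\<close>
      define x where "x = lin A (\<lambda>i. if i = k3 \<or> i = k4 then 1 else 0)"
      have lx: "lin A' x = (\<lambda>i. if i = k3 \<or> i = k4 then 1 else 0)"
        unfolding x_def by (rule lin_inverse[OF inv4_sym[OF A]]) (use d in auto)
      have f1: "mpeval a x * mpeval b x = 0"
        unfolding Fab lx e3_perm[OF p'] using d ne by simp
      have f2: "mpeval a (\<lambda>i. x i + col k1 i) * mpeval b (\<lambda>i. x i + col k1 i) = 1"
        unfolding Fab lc1 lx e3_perm[OF p'] using d ne le by (simp add: unitv_def)
      have f3: "mpeval a (\<lambda>i. x i + col k2 i) * mpeval b (\<lambda>i. x i + col k2 i) = 1"
        unfolding Fab lc1 lx e3_perm[OF p'] using d ne le by (simp add: unitv_def)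
      show False using f1 f2 f3 ID[OF b1, of x] ID[OF a2, of x] by auto
    qed
  qed note const = this
  show ?thesis
  proof (rule irreducibleI)
    have e1: "e3 (lin A' (lin A (\<lambda>i. if i \<le> 3 then 1 else 0))) = 4"
      using lin_inverse[OF inv4_sym[OF A], of "\<lambda>i. if i \<le> 3 then 1 else 0"] by (simp add: e3_def)
    then show "F \<noteq> 0" using F[of "lin A (\<lambda>i. if i \<le> 3 then 1 else 0)"] by auto
    show "\<not> F dvd 1"
    proof
      assume "F dvd 1"
      then obtain G where "1 = F * G" by (rule dvdE)
      then have "mpeval F (\<lambda>_. 0) * mpeval G (\<lambda>_. 0) = 1" by (metis mpeval_1 mpeval_mult)
      then show False using F[of "\<lambda>_. 0"] by (simp add: e3_def lin_def)
    qed
    fix a b assume ab: "F = a * b"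
    have unit: "f dvd 1" if "f = cst (mpeval f (\<lambda>_. 0))" "f \<noteq> 0" for f
    proof -
      let ?k = "mpeval f (\<lambda>_. 0)"
      have "?k \<noteq> 0" using that by (metis cst_0)
      then have "f * cst (1 / ?k) = 1" by (intro mpoly_eqI) (subst that(1), simp)
      then show ?thesis by (metis dvd_triv_left)
    qed
    have "a \<noteq> 0" "b \<noteq> 0" using ab \<open>F \<noteq> 0\<close> by auto
    then show "a dvd 1 \<or> b dvd 1" using const[OF ab] unit by blast
  qed
qed

section \<open>Singular points and nodes of the Cayley cubic\<close>

definition de3 :: "nat \<Rightarrow> (nat \<Rightarrow> complex) \<Rightarrow> complex" where
  "de3 a y = (if a = 0 then y 1 * y 2 + y 1 * y 3 + y 2 * y 3
     else if a = 1 then y 0 * y 2 + y 0 * y 3 + y 2 * y 3 else if a = 2 then y 0 * y 1 + y 0 * y 3 + y 1 * y 3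
     else y 0 * y 1 + y 0 * y 2 + y 1 * y 2)"

text \<open>\<open>de3 a\<close> and \<open>he3 a b\<close> are the first and second partial
  derivatives of \<open>e3\<close>; the diagonal ones vanish since \<open>e3\<close> has degree one
  in each variable.\<close>

definition he3 :: "nat \<Rightarrow> nat \<Rightarrow> (nat \<Rightarrow> complex) \<Rightarrow> complex" where
  "he3 a b y = (if a = b then 0 else y 0 + y 1 + y 2 + y 3 - y a - y b)"

lemma lin_update:
  assumes "j \<le> 3" "a \<le> 3"
  shows "lin A (x(j := t)) a = lin A x a + A a j * (t - x j)"
proof -
  have "lin A (x(j := t)) a = (\<Sum>k\<le>3. A a k * x k + (if k = j then A a j * (t - x j) else 0))"
    unfolding lin_def using assms by (auto intro!: sum.cong simp: algebra_simps)
  then show ?thesis using assms by (simp add: sum.distrib lin_def)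
qed

lemma deriv_quadratic:
  fixes x :: complex
  assumes "\<And>t. f t = c + (t - x) * d + (t - x)\<^sup>2 * (r + (t - x) * r')"
  shows "(f has_field_derivative d) (at x)"
  unfolding assms by (auto intro!: derivative_eq_intros)

lemma e3_expand:
  "e3 (\<lambda>a. y a + k a * u) = e3 y + u * (\<Sum>a\<le>3. k a * de3 a y) + u\<^sup>2 *
    ((y 0 * (k 1 * k 2 + k 1 * k 3 + k 2 * k 3) + y 1 * (k 0 * k 2 + k 0 * k 3 + k 2 * k 3) +
      y 2 * (k 0 * k 1 + k 0 * k 3 + k 1 * k 3) + y 3 * (k 0 * k 1 + k 0 * k 2 + k 1 * k 2)) + u * e3 k)"
  unfolding e3_def sum_3 de3_def by (simp add: algebra_simps power2_eq_square)

lemma de3_expand: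
  assumes "a \<le> 3"
  shows "de3 a (\<lambda>b. y b + k b * u) = de3 a y + u * (\<Sum>b\<le>3. k b * he3 a b y) + u\<^sup>2 * (de3 a k + u * 0)"
  using le_3_cases[OF assms] unfolding sum_3 he3_def de3_def
  by (elim disjE) (simp_all add: algebra_simps power2_eq_square)

lemma e3_lin_update:
  "j \<le> 3 \<Longrightarrow> e3 (lin A (x(j := t))) = e3 (\<lambda>a. lin A x a + A a j * (t - x j))"
  by (rule e3_cong) (rule lin_update)

lemma de3_lin_update:
  "j \<le> 3 \<Longrightarrow> de3 a (lin A (x(j := t))) = de3 a (\<lambda>a. lin A x a + A a j * (t - x j))"
  by (simp add: de3_def lin_update)

lemma cayley_gradient:
  assumes F: "\<And>x. mpeval F x = e3 (lin A' x)" and j: "j \<le> 3"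
  shows "mpeval (pdiff j F) x = (\<Sum>a\<le>3. A' a j * de3 a (lin A' x))"
  by (rule mpeval_pdiff_eq, rule deriv_quadratic) (simp only: F e3_lin_update[OF j] e3_expand)

lemma cayley_hessian:
  assumes F: "\<And>x. mpeval F x = e3 (lin A' x)" and j: "j \<le> 3" and i: "i \<le> 3"
  shows "mpeval (pdiff i (pdiff j F)) x = (\<Sum>a\<le>3. A' a j * (\<Sum>b\<le>3. A' b i * he3 a b (lin A' x)))"
proof (rule mpeval_pdiff_eq)
  have d: "((\<lambda>t. de3 a (lin A' (x(i := t)))) has_field_derivative (\<Sum>b\<le>3. A' b i * he3 a b (lin A' x))) (at (x i))"
    if "a \<le> 3" for a
    by (rule deriv_quadratic) (simp only: de3_lin_update[OF i] de3_expand[OF that])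
  have "((\<lambda>t. \<Sum>a\<le>3. A' a j * de3 a (lin A' (x(i := t)))) has_field_derivative
     (\<Sum>a\<le>3. A' a j * (\<Sum>b\<le>3. A' b i * he3 a b (lin A' x)))) (at (x i))"
    by (intro DERIV_sum DERIV_cmult d) simp
  then show "((\<lambda>t. mpeval (pdiff j F) (x(i := t))) has_field_derivative
      (\<Sum>a\<le>3. A' a j * (\<Sum>b\<le>3. A' b i * he3 a b (lin A' x)))) (at (x i))"
    by (simp only: cayley_gradient[OF F j])
qed

lemma mpeval_line_deriv:
  assumes "f \<in> polys n"
  shows "((\<lambda>t. mpeval f (\<lambda>i. x i + t * v i)) has_field_derivative (\<Sum>j\<le>n. v j * mpeval (pdiff j f) x)) (at 0)"
  using assms
proof (induction rule: polys_induct)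
  case (var i)
  have "(\<Sum>j\<le>n. v j * mpeval (pdiff j (var i)) x) = (\<Sum>j\<le>n. if j = i then v i else 0)"
    by (rule sum.cong) (auto simp: pdiff_var)
  then have "(\<Sum>j\<le>n. v j * mpeval (pdiff j (var i)) x) = v i" using var by simp
  then show ?case by (auto intro!: derivative_eq_intros)
next
  case (add f g)
  then show ?case
    by (auto intro!: derivative_eq_intros simp: pdiff_add sum.distrib algebra_simps)
next
  case (mult f g)
  then show ?case
    by (auto intro!: derivative_eq_intros simp: pdiff_mult sum.distrib sum_distrib_left sum_distrib_right algebra_simps)
qed simp

text \<open>If a derivative of F survives at a point, F itself shows smoothness there, so singular
  points are coordinate points. Conversely, smoothness may be claimed through any form f of the
  ideal. The lines from a coordinate point to the other three lie on the surface, and their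
  directions together with the point span the space, so the gradient of every such f
  vanishes.\<close>

lemma nodes_singular:
  assumes A: "inv4 A A'" and F: "F \<in> forms 3 3" "\<And>x. mpeval F x = e3 (lin A' x)"
  shows "sing 3 2 (zero_locus 3 {F}) = (\<lambda>d. pt (lin A (unitv d))) ` {..3}" (is "?S = ?N")
proof -
  let ?Y = "zero_locus 3 {F}"
  have vecu: "vec 3 (unitv d)" if "d \<le> 3" for d using that by (auto simp: vec_def unitv_def fun_eq_iff)
  have linu: "lin A' (lin A (unitv d)) = unitv d" if "d \<le> 3" for d
    using that by (intro lin_inverse[OF inv4_sym[OF A]]) (auto simp: unitv_def)
  have grad0: "de3 a y = 0" if "a \<le> 3" "\<And>j. j \<le> 3 \<Longrightarrow> (\<Sum>a\<le>3. A' a j * de3 a y) = 0" for a y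
  proof -
    have "(\<Sum>j\<le>3. (\<Sum>b\<le>3. de3 b y * A' b j) * A j a) = de3 a y"
      by (rule matrix_cancel[OF that(1)]) (use A in \<open>auto simp: inv4_def\<close>)
    moreover have "(\<Sum>b\<le>3. de3 b y * A' b j) = 0" if "j \<le> 3" for j
      using \<open>\<And>j. j \<le> 3 \<Longrightarrow> (\<Sum>a\<le>3. A' a j * de3 a y) = 0\<close>[OF that] by (simp add: mult.commute)
    ultimately show ?thesis by simp
  qed
  have "?S \<subseteq> ?N"
  proof
    fix P assume P: "P \<in> ?S"
    then have PY: "P \<in> ?Y" and ns: "\<not> smooth_at 3 2 ?Y P" by (auto simp: sing_def)
    obtain x where x: "P = pt x" "vec 3 x" using PY by (auto simp: zero_locus_def proj_iff)
    have e0: "e3 (lin A' x) = 0" using PY zero_locus_cayley[OF F] x by simp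
    have sum1: "(\<Sum>i<3 - 2. g i) = g 0" for g :: "nat \<Rightarrow> complex" by simp
    have "\<exists>x\<in>P. \<forall>j\<le>3. mpeval (pdiff j F) x = 0"
    proof (rule ccontr)
      assume n: "\<not> ?thesis"
      have "smooth_at 3 2 ?Y P"
        unfolding smooth_at_def
      proof (intro conjI exI[of _ "\<lambda>_. F"] exI[of _ "{}"] PY)
        show "\<forall>x\<in>P. \<forall>c :: nat \<Rightarrow> complex. (\<forall>j\<le>3. (\<Sum>i<3 - 2. c i * mpeval (pdiff j F) x) = 0) \<longrightarrow> (\<forall>i<3 - 2. c i = 0)"
          using n unfolding sum1 by auto
      qed (use F zclosed_empty in \<open>auto simp: ideal_of_def zero_locus_def intro: forms_polys\<close>)
      then show False using ns by simp
    qed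
    then obtain x' where x': "x' \<in> P" "\<And>j. j \<le> 3 \<Longrightarrow> mpeval (pdiff j F) x' = 0" by blast
    define y where "y = lin A' x'"
    have Px': "P = pt x'" "vec 3 x'" using x' PY proj_mem[of P 3 x'] by (auto simp: zero_locus_def)
    have e0: "e3 y = 0" using PY zero_locus_cayley[OF F] Px' by (simp add: y_def)
    have de: "de3 a y = 0" if "a \<le> 3" for a
      by (rule grad0[OF that]) (use x' cayley_gradient[OF F(2)] in \<open>simp add: y_def\<close>)
    have "\<exists>d\<le>3. \<forall>a\<le>3. a \<noteq> d \<longrightarrow> y a = 0"
      by (rule e2_vanish_vertex) (use de[of 0] de[of 1] de[of 2] de[of 3] e0 in \<open>simp_all add: de3_def\<close>)
    then obtain d where d: "d \<le> 3" "\<And>a. a \<le> 3 \<Longrightarrow> a \<noteq> d \<Longrightarrow> y a = 0" by blast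
    have yv: "vec 3 y" unfolding y_def by (rule vec_lin[OF inv4_sym[OF A] Px'(2)])
    have y_eq: "y = (\<lambda>i. y d * unitv d i)"
      using d yv by (auto simp: fun_eq_iff unitv_def vec_def) (metis not_le)
    then have yd: "y d \<noteq> 0" using yv by (auto simp: vec_def)
    have "x' = lin A y" using lin_inverse[OF A] Px'(2) by (simp add: y_def vec_def)
    also have "\<dots> = (\<lambda>i. y d * lin A (unitv d) i)" by (subst y_eq, rule lin_scale)
    finally have "P = pt (lin A (unitv d))" using Px'(1) yd by simp
    then show "P \<in> ?N" using d by blast
  qed
  moreover have "?N \<subseteq> ?S"
  proof
    fix P assume "P \<in> ?N"
    then obtain d where d: "d \<le> 3" "P = pt (lin A (unitv d))" by blast
    have vx: "vec 3 (lin A (unitv d))" by (rule vec_lin[OF A vecu[OF d(1)]])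
    have line: "e3 (\<lambda>i. unitv d i + t * unitv a i) = 0" if "a \<le> 3" for a t
      using le_3_cases[OF that] le_3_cases[OF d(1)] by (elim disjE) (simp_all add: e3_def unitv_def)
    have PY: "P \<in> ?Y" unfolding d(2) zero_locus_cayley[OF F]
      using vx line[OF d(1), of 0] linu[OF d(1)] by simp
    moreover have "\<not> smooth_at 3 2 ?Y P"
    proof
      assume "smooth_at 3 2 ?Y P"
      then obtain f where f: "f \<in> ideal_of 3 ?Y" and
        g: "\<forall>x\<in>P. \<forall>c :: nat \<Rightarrow> complex. (\<forall>j\<le>3. (\<Sum>i<3 - 2. c i * mpeval (pdiff j (f)) x) = 0) \<longrightarrow> (\<forall>i<3 - 2. c i = 0)"
        unfolding smooth_at_def by (auto simp: less_Suc_eq)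
      let ?x = "lin A (unitv d)"
      have fp: "f \<in> polys 3" using f by (simp add: ideal_of_def)
      have "(\<Sum>j\<le>3. A j a * mpeval (pdiff j f) ?x) = 0" if a: "a \<le> 3" for a
      proof -
        let ?v = "lin A (unitv a)"
        obtain p where p: "\<And>t. mpeval f (\<lambda>i. ?x i + t * ?v i) = poly p t" using mpeval_along_line by blast
        \<comment> \<open>For a = d the value t = -1 produces the zero vector, which is not a
          point.\<close>
        have "poly p t = 0" if t: "t \<noteq> - 1" for t
        proof -
          have l: "(\<lambda>i. ?x i + t * ?v i) = lin A (\<lambda>i. unitv d i + t * unitv a i)" by (simp add: lin_add)
          have "unitv d d + t * unitv a d \<noteq> 0" using t by (auto simp: unitv_def add_eq_0_iff)
          then have "vec 3 (\<lambda>i. unitv d i + t * unitv a i)"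
            using a d by (auto simp: vec_def unitv_def fun_eq_iff)
          then have "pt (\<lambda>i. ?x i + t * ?v i) \<in> ?Y"
            unfolding zero_locus_cayley[OF F] l using vec_lin[OF A] line[OF a]
              lin_inverse[OF inv4_sym[OF A], of "\<lambda>i. unitv d i + t * unitv a i"] by (simp add: vec_def)
          then show ?thesis using f pt_self unfolding p[symmetric] ideal_of_def vanishes_def by blast
        qed
        then have "UNIV - {- 1} \<subseteq> {t. poly p t = 0}" by auto
        moreover have "infinite (UNIV - {- 1 :: complex})"
          using infinite_UNIV_char_0[where 'a = complex] by (intro infinite_remove)
        ultimately have "infinite {t. poly p t = 0}" using infinite_super by blast
        then have "p = 0" using poly_roots_finite by blast
        then have "(\<lambda>t. mpeval f (\<lambda>i. ?x i + t * ?v i)) = (\<lambda>t. 0)" by (simp add: p)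
        then have "((\<lambda>t. 0) has_field_derivative (\<Sum>j\<le>3. ?v j * mpeval (pdiff j f) ?x)) (at 0)"
          using mpeval_line_deriv[OF fp, of ?x ?v] by simp
        then have "(\<Sum>j\<le>3. ?v j * mpeval (pdiff j f) ?x) = 0" using DERIV_unique DERIV_const by blast
        moreover have "?v j = A j a" if "j \<le> 3" for j
        proof -
          have "(\<Sum>k\<le>3. A j k * unitv a k) = (\<Sum>k\<le>3. if k = a then A j k else 0)"
            by (rule sum.cong) (auto simp: unitv_def)
          then show ?thesis using that a by (simp add: lin_def)
        qed
        ultimately show ?thesis by simp
      qed
      then have z: "(\<Sum>k\<le>3. mpeval (pdiff k f) ?x * A k i) = 0" if "i \<le> 3" for i
        using that by (simp add: mult.commute)
      have "mpeval (pdiff j f) ?x = 0" if j: "j \<le> 3" for j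
      proof -
        have "(\<Sum>i\<le>3. (\<Sum>k\<le>3. mpeval (pdiff k f) ?x * A k i) * A' i j) = mpeval (pdiff j f) ?x"
          by (rule matrix_cancel[OF j]) (use A in \<open>auto simp: inv4_def\<close>)
        then show ?thesis using z by simp
      qed
      then have "\<forall>j\<le>3. (\<Sum>i<3 - 2 :: nat. 1 * mpeval (pdiff j f) ?x) = 0" by simp
      then show False using g[THEN bspec, OF pt_self[of ?x, folded d(2)], THEN spec[of _ "\<lambda>_. 1"], THEN mp] by auto
    qed
    ultimately show "P \<in> ?S" by (simp add: sing_def)
  qed
  ultimately show ?thesis by blast
qed

text \<open>In the y-coordinates the Hessian at the node d is zero in row and column d; on the other
  three indices it is a multiple of the matrix with zero diagonal and ones elsewhere. That matrix is
  invertible, so the kernel is the direction of the node.\<close>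

lemma cayley_node:
  assumes A: "inv4 A A'" and F: "\<And>x. mpeval F x = e3 (lin A' x)" and d: "d \<le> 3"
  shows "node F (pt (lin A (unitv d)))"
  unfolding node_def
proof (intro ballI conjI allI impI)
  fix x assume "x \<in> pt (lin A (unitv d))"
  then obtain c where c: "c \<noteq> 0" "x = lin A (\<lambda>i. c * unitv d i)" by (auto simp: mem_pt_iff lin_scale)
  have y: "lin A' x = (\<lambda>i. c * unitv d i)"
    unfolding c(2) by (rule lin_inverse[OF inv4_sym[OF A]]) (use d in \<open>auto simp: unitv_def\<close>)
  have de: "de3 a (\<lambda>i. c * unitv d i) = 0" for a
    using le_3_cases[OF d] by (elim disjE) (simp_all add: de3_def unitv_def)
  show "mpeval (pdiff i F) x = 0" if "i \<le> 3" for i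
    unfolding cayley_gradient[OF F that] y de by simp
  fix v assume v: "(\<forall>i>3. v i = 0) \<and> (\<forall>i\<le>3. (\<Sum>j\<le>3. mpeval (pdiff i (pdiff j F)) x * v j) = 0)"
  define u where "u = lin A' v"
  define H where "H a b = he3 a b (\<lambda>i. c * unitv d i)" for a b
  have vu: "v = lin A u" unfolding u_def using lin_inverse[OF A, of v] v by simp
  define K where "K b = (\<Sum>a\<le>3. H a b * u a)" for b
  have hess: "(\<Sum>b\<le>3. K b * A' b i) = 0" if i: "i \<le> 3" for i
  proof -
    have "(\<Sum>j\<le>3. mpeval (pdiff i (pdiff j F)) x * v j) =
        (\<Sum>j\<le>3. \<Sum>a\<le>3. (\<Sum>b\<le>3. A' b i * H a b) * (A' a j * v j))"
      by (rule sum.cong) (auto simp: cayley_hessian[OF F _ i] y H_def sum_distrib_right sum_distrib_left mult_ac)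
    also have "\<dots> = (\<Sum>a\<le>3. (\<Sum>b\<le>3. A' b i * H a b) * u a)"
      by (subst sum.swap) (simp add: u_def lin_def sum_distrib_left)
    also have "\<dots> = (\<Sum>b\<le>3. K b * A' b i)"
      unfolding K_def sum_distrib_right by (subst sum.swap) (simp add: mult_ac)
    finally show ?thesis using v i by simp
  qed
  have K0: "K b = 0" if b: "b \<le> 3" for b
  proof -
    have "(\<Sum>i\<le>3. (\<Sum>b\<le>3. K b * A' b i) * A i b) = K b"
      by (rule matrix_cancel[OF b]) (use A in \<open>auto simp: inv4_def\<close>)
    then show ?thesis using hess by simp
  qed
  have H: "H a b = (if a = b \<or> a = d \<or> b = d then 0 else c)" if "a \<le> 3" "b \<le> 3" for a b
    using le_3_cases[OF d] le_3_cases[OF that(1)] le_3_cases[OF that(2)]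
    by (elim disjE) (simp_all add: H_def he3_def unitv_def)
  have u0: "u a = 0" if a: "a \<le> 3" "a \<noteq> d" for a
  proof -
    obtain j k where p: "perm4 a j k d" using perm4_exists[OF a(1) d a(2)] .
    then have le: "j \<le> 3" "k \<le> 3" and ne: "a \<noteq> j" "a \<noteq> k" "j \<noteq> k" "j \<noteq> d" "k \<noteq> d" by (auto simp: perm4_def)
    have "{..3} = {a, j, k, d}"
      using le_3_cases[OF a(1)] le_3_cases[OF d] le_3_cases[OF le(1)] le_3_cases[OF le(2)] ne a(2)
      unfolding atMost_3 by auto
    then have S: "(\<Sum>i\<le>3. f i) = f a + (f j + (f k + f d))" for f :: "nat \<Rightarrow> complex"
      using ne a(2) by simp
    have "c * u j + c * u k = 0" "c * u a + c * u k = 0" "c * u a + c * u j = 0"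
      using K0[OF a(1)] K0[OF le(1)] K0[OF le(2)] unfolding K_def S
      using H a le d ne by auto
    then have "u j + u k = 0" "u a + u k = 0" "u a + u j = 0" using c(1) by (auto simp flip: distrib_left)
    moreover have "u a = ((u a + u k) + (u a + u j) - (u j + u k)) / 2" by simp
    ultimately show ?thesis by (simp only:) simp
  qed
  have "lin A u = lin A (\<lambda>i. (u d / c) * (c * unitv d i))"
    by (rule lin_cong) (use u0 c(1) in \<open>auto simp: unitv_def\<close>)
  also have "\<dots> = (\<lambda>i. (u d / c) * x i)" unfolding lin_scale[of A "u d / c"] c(2) ..
  finally show "\<exists>k. v = (\<lambda>i. k * x i)" unfolding vu by blast
qed

lemma four_nodal_cayley:
  assumes A: "inv4 A A'" and F: "F \<in> forms 3 3" "\<And>x. mpeval F x = e3 (lin A' x)"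
  shows "four_nodal_cubic_surface (zero_locus 3 {F})"
  unfolding four_nodal_cubic_surface_def
proof (rule bexI[OF _ F(1)], intro conjI)
  have "inj_on (\<lambda>d. pt (lin A (unitv d))) {..3}"
  proof (rule inj_onI)
    fix a b assume ab: "a \<in> {..3}" "b \<in> {..3 :: nat}" "pt (lin A (unitv a)) = pt (lin A (unitv b))"
    have "lin A (unitv a) \<in> pt (lin A (unitv b))" unfolding ab(3)[symmetric] by (rule pt_self)
    then obtain c where "lin A (unitv a) = (\<lambda>i. c * lin A (unitv b) i)" by (auto simp: mem_pt_iff)
    then have c: "lin A (unitv a) = lin A (\<lambda>i. c * unitv b i)" unfolding lin_scale .
    have l: "lin A' (lin A y) = y" if "\<And>i. i > 3 \<Longrightarrow> y i = 0" for y
      using lin_inverse[OF inv4_sym[OF A] that] .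
    have "unitv a = lin A' (lin A (unitv a))" by (rule sym, rule l) (use ab(1) in \<open>simp add: unitv_def\<close>)
    also have "\<dots> = lin A' (lin A (\<lambda>i. c * unitv b i))" by (rule arg_cong[OF c])
    also have "\<dots> = (\<lambda>i. c * unitv b i)"
      by (rule l) (use ab(2) in \<open>simp add: unitv_def\<close>)
    finally have "unitv a = (\<lambda>i. c * unitv b i)" .
    from fun_cong[OF this, of a] show "a = b" by (simp add: unitv_def split: if_splits)
  qed
  then show "card (sing 3 2 (zero_locus 3 {F})) = 4"
    unfolding nodes_singular[OF A F] by (subst card_image) simp_all
  show "\<forall>P\<in>sing 3 2 (zero_locus 3 {F}). node F P"
    unfolding nodes_singular[OF A F] using cayley_node[OF A F(2)] by auto
  show "irreducible F" by (rule cayley_irreducible[OF A F(2)])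
qed simp

subsection \<open>Plane cubics through the vertices of a quadrilateral\<close>

text \<open>Four lines normalised to have sum zero. The products \<open>qn a\<close> of three of
  them then have reciprocals proportional to the lines, so that their reciprocals sum to zero as on
  the Cayley cubic.\<close>

definition ql :: "nat \<Rightarrow> mpoly" where
  "ql i = (if i < 3 then var i else - (var 0 + var 1 + var 2))"

definition qn :: "nat \<Rightarrow> mpoly" where
  "qn a = (\<Prod>m\<in>{..3} - {a}. ql m)"

lemma ql_form: "ql i \<in> forms 2 1"
proof -
  have "- (var 0 + var 1 + var 2) \<in> forms 2 1" by (intro forms_uminus forms_add forms_var) simp_all
  then show ?thesis using forms_var[of i 2] by (simp only: ql_def split: if_splits) simp
qed

lemma ql_eval: "mpeval (ql 0) z = z 0" "mpeval (ql 1) z = z 1" "mpeval (ql 2) z = z 2"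
    "mpeval (ql 3) z = - (z 0 + z 1 + z 2)"
  by (simp_all add: ql_def)

lemma qn_eq: "qn 0 = ql 1 * (ql 2 * ql 3)" "qn 1 = ql 0 * (ql 2 * ql 3)"
    "qn 2 = ql 0 * (ql 1 * ql 3)" "qn 3 = ql 0 * (ql 1 * ql 2)"
proof -
  have "{..3} - {0 :: nat} = {1, 2, 3}" "{..3} - {1 :: nat} = {0, 2, 3}"
    "{..3} - {2 :: nat} = {0, 1, 3}" "{..3} - {3 :: nat} = {0, 1, 2}" by auto
  then show "qn 0 = ql 1 * (ql 2 * ql 3)" "qn 1 = ql 0 * (ql 2 * ql 3)"
    "qn 2 = ql 0 * (ql 1 * ql 3)" "qn 3 = ql 0 * (ql 1 * ql 2)" by (simp_all add: qn_def)
qed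

lemma qn_form: "a \<le> 3 \<Longrightarrow> qn a \<in> forms 2 3"
proof -
  assume a: "a \<le> 3"
  have "ql i * (ql j * ql k) \<in> forms 2 (1 + (1 + 1))" for i j k by (intro forms_mult ql_form)
  then have f: "ql i * (ql j * ql k) \<in> forms 2 3" for i j k by (simp add: numeral_3_eq_3)
  show ?thesis using le_3_cases[OF a] by (elim disjE) (simp_all only: qn_eq f)
qed

lemma ql_quadrilateral: "complete_quadrilateral ql"
  unfolding complete_quadrilateral_def
proof (intro conjI allI impI)
  fix i j k :: nat assume ijk: "i < j \<and> j < k \<and> k < 4"
  show "zero_locus 2 {ql i, ql j, ql k} = {}"
  proof (rule equals0I)
    fix P assume P: "P \<in> zero_locus 2 {ql i, ql j, ql k}"
    then obtain z where z: "P = pt z" "vec 2 z" by (auto simp: zero_locus_def proj_iff)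
    then have 0: "mpeval (ql i) z = 0" "mpeval (ql j) z = 0" "mpeval (ql k) z = 0"
      using P vanishes_pt[OF ql_form] by (auto simp: zero_locus_def)
    have "(i, j, k) \<in> {(0, 1, 2), (0, 1, 3), (0, 2, 3), (1, 2, 3)}" using ijk by auto
    then have "z 0 = 0 \<and> z 1 = 0 \<and> z 2 = 0" using 0 ql_eval[of z] by auto
    moreover obtain m where "m \<le> 2" "z m \<noteq> 0" using vec_nonzero[OF z(2)] by blast
    moreover from this have "m = 0 \<or> m = 1 \<or> m = 2" by auto
    ultimately show False by auto
  qed
qed (rule ql_form)

lemma cubic_coefficients:
  assumes "f \<in> forms 2 3"
  shows "\<exists>c :: nat \<Rightarrow> complex. \<forall>z. mpeval f z = c 0 * z 0 ^ 3 + c 1 * z 1 ^ 3 + c 2 * z 2 ^ 3 +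
    c 3 * (z 0 ^ 2 * z 1) + c 4 * (z 0 * z 1 ^ 2) + c 5 * (z 0 ^ 2 * z 2) + c 6 * (z 0 * z 2 ^ 2) +
    c 7 * (z 1 ^ 2 * z 2) + c 8 * (z 1 * z 2 ^ 2) + c 9 * (z 0 * z 1 * z 2)" (is "?P f")
proof -
  have "f \<in> {f. ?P f}"
  proof (rule subsetD[OF _ assms], rule order_trans[OF forms_span_vars], rule mp.span_minimal)
    show "mp.subspace {f. ?P f}"
    proof (rule mp.subspaceI)
      show "0 \<in> {f. ?P f}" by (rule CollectI, rule exI[of _ "\<lambda>_. 0"]) simp
      fix f g assume "f \<in> {f. ?P f}" "g \<in> {f. ?P f}"
      then have "?P f" "?P g" by blast+
      then show "f + g \<in> {f. ?P f}"
        apply (elim exE) subgoal for c d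
        by (rule CollectI, rule exI[of _ "\<lambda>i. c i + d i"]) (simp add: distrib_right)
        done
    next
      fix k f assume "f \<in> {f. ?P f}"
      then have "?P f" by blast
      then show "scale k f \<in> {f. ?P f}"
        apply (elim exE) subgoal for c
        by (rule CollectI, rule exI[of _ "\<lambda>i. k * c i"]) (simp add: distrib_left mult.assoc)
        done
    qed
    show "{prod_list (map var is) | is. length is = 3 \<and> set is \<subseteq> {..2}} \<subseteq> {f. ?P f}"
    proof
      fix q assume "q \<in> {prod_list (map var is) | is. length is = 3 \<and> set is \<subseteq> {..2}}"
      then obtain "is" where q: "q = prod_list (map var is)" "length is = 3" "set is \<subseteq> {..2}" by blast
      then obtain i j k where "is = [i, j, k]" by (auto simp: numeral_3_eq_3 length_Suc_conv)
      then have ijk: "q = var i * (var j * var k)" "i \<le> 2" "j \<le> 2" "k \<le> 2" using q by auto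
      define n where "n = (count_list [i, j, k] 0, count_list [i, j, k] 1)"
      define m :: nat where "m = (if n = (3, 0) then 0 else if n = (0, 3) then 1 else if n = (0, 0) then 2
        else if n = (2, 1) then 3 else if n = (1, 2) then 4 else if n = (2, 0) then 5 else if n = (1, 0) then 6
        else if n = (0, 2) then 7 else if n = (0, 1) then 8 else 9)"
      have c3: "a = 0 \<or> a = 1 \<or> a = 2" if "a \<le> 2" for a :: nat using that by auto
      have "\<forall>z. mpeval q z = (if m = 0 then 1 else 0) * z 0 ^ 3 + (if m = 1 then 1 else 0) * z 1 ^ 3 +
        (if m = 2 then 1 else 0) * z 2 ^ 3 +
        (if m = 3 then 1 else 0) * (z 0 ^ 2 * z 1) + (if m = 4 then 1 else 0) * (z 0 * z 1 ^ 2) +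
        (if m = 5 then 1 else 0) * (z 0 ^ 2 * z 2) + (if m = 6 then 1 else 0) * (z 0 * z 2 ^ 2) +
        (if m = 7 then 1 else 0) * (z 1 ^ 2 * z 2) + (if m = 8 then 1 else 0) * (z 1 * z 2 ^ 2) +
        (if m = 9 then 1 else 0) * (z 0 * z 1 * z 2)"
        using c3[OF ijk(2)] c3[OF ijk(3)] c3[OF ijk(4)]
        by (elim disjE) (simp_all add: ijk(1) m_def n_def power2_eq_square power3_eq_cube mult_ac)
      then show "q \<in> {f. ?P f}" by (intro CollectI exI[of _ "\<lambda>i. if m = i then 1 else 0"])
    qed
  qed
  then show ?thesis by blast
qed

lemma qn_basis: "is_basis qn 3 (forms 2 3 \<inter> ideal_of 2 (quadrilateral_vertices ql))"
  unfolding is_basis_iff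
proof (intro conjI allI impI)
  have S: "(\<Sum>a\<le>3. mpeval (scale (c a) (qn a)) z) = c 0 * (z 1 * (z 2 * - (z 0 + z 1 + z 2))) +
     (c 1 * (z 0 * (z 2 * - (z 0 + z 1 + z 2))) + (c 2 * (z 0 * (z 1 * - (z 0 + z 1 + z 2))) +
     c 3 * (z 0 * (z 1 * z 2))))" for c z
    unfolding sum_3 mpeval_scale qn_eq mpeval_mult ql_eval ..
  fix c i assume c: "(\<Sum>a\<le>3. scale (c a) (qn a)) = 0" and i: "i \<le> (3 :: nat)"
  have 0: "(\<Sum>a\<le>3. mpeval (scale (c a) (qn a)) z) = 0" for z
    using c by (metis mpeval_0 mpeval_sum)
  have "c 0 = 0" using 0[of "wv 0 1 1", unfolded S] by simp
  moreover have "c 1 = 0" using 0[of "wv 1 0 1", unfolded S] by simp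
  moreover have "c 2 = 0" using 0[of "wv 1 1 0", unfolded S] by simp
  moreover have "c 3 = 0" using 0[of "wv 1 1 (- 2)", unfolded S] by simp
  ultimately show "c i = 0" using le_3_cases[OF i] by auto
next
  have S: "mpeval (\<Sum>a\<le>3. scale (c a) (qn a)) z = c 0 * (z 1 * (z 2 * - (z 0 + z 1 + z 2))) +
     (c 1 * (z 0 * (z 2 * - (z 0 + z 1 + z 2))) + (c 2 * (z 0 * (z 1 * - (z 0 + z 1 + z 2))) +
     c 3 * (z 0 * (z 1 * z 2))))" for c z
    unfolding mpeval_sum sum_3 mpeval_add mpeval_scale qn_eq mpeval_mult ql_eval by (rule refl)
  let ?V = "quadrilateral_vertices ql"
  show "forms 2 3 \<inter> ideal_of 2 ?V = range (\<lambda>c. \<Sum>a\<le>3. scale (c a) (qn a))"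
  proof (intro set_eqI iffI)
    fix f assume "f \<in> range (\<lambda>c. \<Sum>a\<le>3. scale (c a) (qn a))"
    then obtain c where f: "f = (\<Sum>a\<le>3. scale (c a) (qn a))" by blast
    have ff: "f \<in> forms 2 3" unfolding f by (intro forms_sum forms_scale qn_form) simp
    have "vanishes f P" if P: "P \<in> ?V" for P
    proof -
      obtain i j :: nat where ij: "j < 4" "i < j" "P \<in> zero_locus 2 {ql i, ql j}"
        using P by (auto simp: quadrilateral_vertices_def)
      obtain z where z: "P = pt z" "vec 2 z" using ij(3) by (auto simp: zero_locus_def proj_iff)
      then have 0: "mpeval (ql i) z = 0" "mpeval (ql j) z = 0"
        using ij(3) vanishes_pt[OF ql_form] by (auto simp: zero_locus_def)
      have "(i, j) \<in> {(0, 1), (0, 2), (0, 3), (1, 2), (1, 3), (2, 3)}" using ij by auto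
      then have "mpeval f z = 0" unfolding f S using 0 ql_eval[of z] by auto
      then show ?thesis using ff z by simp
    qed
    then show "f \<in> forms 2 3 \<inter> ideal_of 2 ?V" using ff by (auto simp: ideal_of_def forms_polys)
  next
    fix f assume f: "f \<in> forms 2 3 \<inter> ideal_of 2 ?V"
    obtain c :: "nat \<Rightarrow> complex" where c: "\<And>z. mpeval f z = c 0 * z 0 ^ 3 + c 1 * z 1 ^ 3 + c 2 * z 2 ^ 3 +
      c 3 * (z 0 ^ 2 * z 1) + c 4 * (z 0 * z 1 ^ 2) + c 5 * (z 0 ^ 2 * z 2) + c 6 * (z 0 * z 2 ^ 2) +
      c 7 * (z 1 ^ 2 * z 2) + c 8 * (z 1 * z 2 ^ 2) + c 9 * (z 0 * z 1 * z 2)"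
      using cubic_coefficients[of f] f by blast
    have van: "mpeval f (wv x y z) = 0"
      if "i < j" "j < 4" "mpeval (ql i) (wv x y z) = 0" "mpeval (ql j) (wv x y z) = 0"
        "x \<noteq> 0 \<or> y \<noteq> 0 \<or> z \<noteq> 0" for i j x y z
    proof -
      have "vec 2 (wv x y z)" using that(5) vec_2_wv by blast
      then have "pt (wv x y z) \<in> ?V"
        unfolding quadrilateral_vertices_def zero_locus_def using that vanishes_pt[OF ql_form] by auto
      then show ?thesis using f pt_self unfolding ideal_of_def vanishes_def by blast
    qed
    have "mpeval f (wv 1 0 0) = 0" by (rule van[of 1 2]) (simp_all add: ql_def)
    moreover have "mpeval f (wv 0 1 0) = 0" by (rule van[of 0 2]) (simp_all add: ql_def)
    moreover have "mpeval f (wv 0 0 1) = 0" by (rule van[of 0 1]) (simp_all add: ql_def)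
    moreover have "mpeval f (wv 0 1 (- 1)) = 0" by (rule van[of 0 3]) (simp_all add: ql_def)
    moreover have "mpeval f (wv 1 0 (- 1)) = 0" by (rule van[of 1 3]) (simp_all add: ql_def)
    moreover have "mpeval f (wv 1 (- 1) 0) = 0" by (rule van[of 2 3]) (simp_all add: ql_def)
    ultimately have c': "c 0 = 0" "c 1 = 0" "c 2 = 0" "c 8 = c 7" "c 6 = c 5" "c 4 = c 3"
      unfolding c by (simp_all add: power2_eq_square power3_eq_cube)
    \<comment> \<open>The first three products also contain the monomial z 0 * z 1 * z 2, which is
      corrected at index 3.\<close>
    define k where "k a = (if a = 0 then - c 7 else if a = 1 then - c 5 else if a = 2 then - c 3
      else c 9 - c 3 - c 5 - c 7)" for a :: nat
    have "f = (\<Sum>a\<le>3. scale (k a) (qn a))"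
    proof (rule mpoly_eqI)
      fix z
      show "mpeval f z = mpeval (\<Sum>a\<le>3. scale (k a) (qn a)) z"
        unfolding S c c' by (simp add: k_def algebra_simps power2_eq_square)
    qed
    then show "f \<in> range (\<lambda>c. \<Sum>a\<le>3. scale (c a) (qn a))" by (rule range_eqI[of _ _ k])
  qed
qed

text \<open>A generic y is the image of the plane point (1 / y 0 : 1 / y 1 : 1 / y 2), at which the
  fourth line takes the value 1 / y 3 because of the equation of the cubic.\<close>

lemma cayley_cubic_zero_locus:
  assumes A: "inv4 A A'" and F: "F \<in> forms 3 3" "\<And>x. mpeval F x = e3 (lin A' x)"
  shows "cayley_cubic (zero_locus 3 {F})"
proof -
  define b where "b i = (\<Sum>j\<le>3. scale (A i j) (qn j))" for i
  have b: "is_basis b 3 (forms 2 3 \<inter> ideal_of 2 (quadrilateral_vertices ql))"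
    unfolding b_def by (rule is_basis_transform[OF qn_basis, of A A']) (use A in \<open>auto simp: inv4_def\<close>)
  define N where "N z a = (if a \<le> 3 then mpeval (qn a) z else 0)" for z and a :: nat
  have hv: "hvec 3 b z = lin A (N z)" for z
    by (rule ext) (simp add: hvec_def lin_def b_def mpeval_sum N_def)
  have Nv: "N z 0 = z 1 * (z 2 * - (z 0 + z 1 + z 2))" "N z 1 = z 0 * (z 2 * - (z 0 + z 1 + z 2))"
    "N z 2 = z 0 * (z 1 * - (z 0 + z 1 + z 2))" "N z 3 = z 0 * (z 1 * z 2)" for z
    unfolding N_def qn_eq mpeval_mult ql_eval by simp_all
  define T where "T = {pt (hvec 3 b x) | x P. P \<in> proj 2 \<and> x \<in> P \<and> hvec 3 b x \<noteq> (\<lambda>_. 0)}"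
  have Tp: "T \<subseteq> proj 3" by (auto simp: T_def vec_def hvec_def)
  have "clo 3 T = zero_locus 3 {F}"
  proof (rule cayley_image[OF A F Tp])
    fix P assume "P \<in> T"
    then obtain z where z: "P = pt (hvec 3 b z)" by (auto simp: T_def)
    have "lin A' (hvec 3 b z) = N z"
      unfolding hv by (rule lin_inverse[OF inv4_sym[OF A]]) (simp add: N_def)
    moreover have "e3 (N z) = 0" unfolding e3_def Nv by (simp add: algebra_simps)
    ultimately show "vanishes F P" using F by (simp add: z)
  next
    fix y assume y: "ygen y"
    have ynz: "y 0 \<noteq> 0" "y 1 \<noteq> 0" "y 2 \<noteq> 0" "y 3 \<noteq> 0" and e: "e3 y = 0" and y3: "\<And>i. i > 3 \<Longrightarrow> y i = 0"
      using y by (auto simp: ygen_def)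
    define z where "z = wv (1 / y 0) (1 / y 1) (1 / y 2)"
    have z: "z 0 = 1 / y 0" "z 1 = 1 / y 1" "z 2 = 1 / y 2" by (simp_all add: z_def wv_def)
    have "z 0 + z 1 + z 2 + 1 / y 3 = e3 y / (y 0 * y 1 * y 2 * y 3)"
      using ynz unfolding z e3_def by (simp add: field_simps)
    then have z3: "- (z 0 + z 1 + z 2) = 1 / y 3" using e by (simp add: add_eq_0_iff2)
    define k where "k = 1 / (y 0 * y 1 * y 2 * y 3)"
    have k: "k \<noteq> 0" using ynz by (simp add: k_def)
    have "N z a = k * y a" for a
    proof (cases "a \<le> 3")
      case True
      then show ?thesis using le_3_cases[OF True] Nv[of z, unfolded z3, unfolded z] ynz by (auto simp: k_def)
    next
      case False
      then show ?thesis using y3 by (simp add: N_def)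
    qed
    then have h: "hvec 3 b z = (\<lambda>i. k * lin A y i)" unfolding hv lin_scale[symmetric] by (intro lin_cong)
    have "vec 3 (lin A y)" by (rule vec_lin[OF A]) (use ynz y3 in \<open>auto simp: vec_def\<close>)
    then have "hvec 3 b z \<noteq> (\<lambda>_. 0)" unfolding h using k by (auto simp: vec_def fun_eq_iff)
    moreover have "pt (lin A y) = pt (hvec 3 b z)" unfolding h using k by simp
    moreover have "pt z \<in> proj 2" unfolding pt_in_proj vec_2_wv z_def using ynz(1) by force
    ultimately show "pt (lin A y) \<in> T" using pt_self unfolding T_def by blast
  qed
  then have "zero_locus 3 {F} = rational_image 2 3 (proj 2) b"
    unfolding rational_image_def T_def[symmetric] using Tp by (simp add: zclosure_eq_clo)
  then show ?thesis unfolding cayley_cubic_def using ql_quadrilateral b by blast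
qed

section \<open>The elliptic ruled surface\<close>

text \<open>The product of the distances from r to the d roots is the right-hand side, so the
  smallest distance satisfies the bound.\<close>

lemma root_near:
  fixes p :: "complex poly"
  assumes d: "degree p = d" "d > 0"
  obtains z where "poly p z = 0" "cmod (r - z) ^ d \<le> cmod (poly p r) / cmod (lead_coeff p)"
proof -
  have l: "lead_coeff p \<noteq> 0" using d by auto
  obtain root where p: "smult (lead_coeff p) (\<Prod>i<degree p. [:- root i, 1:]) = p"
    using complex_poly_decompose' by blast
  have ev: "poly p x = lead_coeff p * (\<Prod>i<d. x - root i)" for x
    by (subst p[symmetric]) (simp add: poly_prod d(1))
  define m where "m = Min ((\<lambda>i. cmod (r - root i)) ` {..<d})"
  have mle: "m \<le> cmod (r - root j)" if "j < d" for j
    unfolding m_def by (rule Min_le) (use that in auto)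
  have "m \<in> (\<lambda>i. cmod (r - root i)) ` {..<d}" unfolding m_def using d(2) by (intro Min_in) auto
  then obtain i where i: "i < d" "m = cmod (r - root i)" by auto
  have "m ^ d = (\<Prod>i<d. m)" by simp
  also have "\<dots> \<le> (\<Prod>i<d. cmod (r - root i))"
    by (rule prod_mono) (use mle in \<open>auto simp: i(2)\<close>)
  also have "\<dots> = cmod (poly p r) / cmod (lead_coeff p)"
    unfolding ev using l by (simp add: norm_mult prod_norm)
  finally have "cmod (r - root i) ^ d \<le> cmod (poly p r) / cmod (lead_coeff p)" unfolding i(2) .
  moreover have "poly p (root i) = 0" unfolding ev using i(1) by auto
  ultimately show ?thesis using that by blast
qed

text \<open>Constant degree and a nonzero limit of the leading coefficients prevent roots from
  escaping to infinity, so the root nearest to r converges to it.\<close>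

lemma root_limit:
  fixes p :: "nat \<Rightarrow> complex poly"
  assumes d: "\<And>n. degree (p n) = d" "d > 0" and l: "(\<lambda>n. lead_coeff (p n)) \<longlonglongrightarrow> l" "l \<noteq> 0"
    and r: "(\<lambda>n. poly (p n) r) \<longlonglongrightarrow> 0"
  obtains z where "\<And>n. poly (p n) (z n) = 0" "z \<longlonglongrightarrow> r"
proof -
  have "\<exists>z. poly (p n) z = 0 \<and> cmod (r - z) ^ d \<le> cmod (poly (p n) r) / cmod (lead_coeff (p n))" for n
    by (rule root_near[OF d(1)[of n] d(2), of r]) blast
  then obtain z where z: "\<And>n. poly (p n) (z n) = 0"
    "\<And>n. cmod (r - z n) ^ d \<le> cmod (poly (p n) r) / cmod (lead_coeff (p n))" by metis
  have "(\<lambda>n. cmod (poly (p n) r) / cmod (lead_coeff (p n))) \<longlonglongrightarrow> cmod 0 / cmod l"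
    by (intro tendsto_divide tendsto_norm r l(1)) (use l(2) in simp)
  then have b: "(\<lambda>n. cmod (poly (p n) r) / cmod (lead_coeff (p n))) \<longlonglongrightarrow> 0" by simp
  have "(\<lambda>n. cmod (r - z n) ^ d) \<longlonglongrightarrow> 0"
    by (rule tendsto_sandwich[OF _ _ tendsto_const b]) (use z(2) in auto)
  then have "(\<lambda>n. root d (cmod (r - z n) ^ d)) \<longlonglongrightarrow> root d 0" by (rule tendsto_real_root)
  then have "(\<lambda>n. cmod (r - z n)) \<longlonglongrightarrow> 0" using d(2) by (simp add: real_root_power_cancel)
  then have "(\<lambda>n. r - z n) \<longlonglongrightarrow> 0" by (rule tendsto_norm_zero_cancel)
  then have "(\<lambda>n. r - (r - z n)) \<longlonglongrightarrow> r - 0" by (intro tendsto_diff tendsto_const)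
  then show ?thesis using that[OF z(1)] by simp
qed

section \<open>Sections in the toric charts\<close>

lemma perm4_sum:
  assumes "perm4 i j k l"
  shows "(\<Sum>a\<le>3. f a) = f i + f j + f k + (f l :: complex)"
  using assms unfolding perm4_def sum_3
  by (elim conjE, drule_tac le_3_cases, drule_tac le_3_cases, drule_tac le_3_cases, drule_tac le_3_cases)
    (elim disjE; simp)

lemma el_perm:
  assumes "perm4 a b c d"
  shows "el a \<xi> = \<xi> (qi a a) - \<xi> a - (\<xi> (qi a b) + \<xi> (qi a c) + \<xi> (qi a d))
    + (\<xi> (qi b c) + \<xi> (qi b d) + \<xi> (qi c d))"
  using assms unfolding perm4_def el_def sum_13
  by (elim conjE, drule_tac le_3_cases, drule_tac le_3_cases, drule_tac le_3_cases, drule_tac le_3_cases)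
    (elim disjE; simp add: lam_def fi_se qi_def)

lemma perm4_perms:
  assumes "perm4 i j k l"
  shows "perm4 j i k l" "perm4 k i j l" "perm4 l i j k"
  using assms by (auto simp: perm4_def)

text \<open>The section in a chart, multiplied by u^2 and regarded as a polynomial in u. Its leading
  coefficient \<open>- c i\<close> does not involve p or q, as \<open>root_limit\<close>
  demands.\<close>

definition chart_cubic :: "(nat \<Rightarrow> complex) \<Rightarrow> nat \<Rightarrow> nat \<Rightarrow> nat \<Rightarrow> nat \<Rightarrow> complex \<Rightarrow> complex \<Rightarrow> complex poly" where
  "chart_cubic c i j k l p q = [:c i * p\<^sup>2 * q\<^sup>2,
     - c i * p * q * (p + q + 1) + c j * (p * q\<^sup>2 + p * q - q\<^sup>2 - p\<^sup>2 * q)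
       + c k * (p\<^sup>2 * q + p * q - p\<^sup>2 - p * q\<^sup>2) + c l * (p\<^sup>2 * q + p * q\<^sup>2 - p * q - p\<^sup>2 * q\<^sup>2),
     c i * (p * q + p + q) + c j * (p\<^sup>2 - p * q - p + q) + c k * (q\<^sup>2 - p * q - q + p)
       + c l * (1 - p - q + p * q), - c i:]"

lemma chart_cubic_eval:
  assumes p: "perm4 i j k l" and u: "u \<noteq> 0"
  shows "poly (chart_cubic c i j k l p q) u = u\<^sup>2 * (\<Sum>a\<le>3. c a * el a (ch i j l p q u))"
proof -
  have le: "i \<le> 3" "j \<le> 3" "k \<le> 3" "l \<le> 3" and d: "i \<noteq> j" "i \<noteq> k" "i \<noteq> l" "j \<noteq> k" "j \<noteq> l" "k \<noteq> l"
    using p by (auto simp: perm4_def)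
  have Q: "ch i j l p q u (qi a b) = ch_s i j l p q u a * ch_s i j l p q u b" if "a \<le> 3" "b \<le> 3" for a b
    unfolding ch_def by (subst val_qi) (simp_all add: that mult.commute)
  have U: "ch i j l p q u a = ch_u i j l p q u a" if "a \<le> 3" for a
    unfolding ch_def by (rule val_u[OF that])
  have s: "ch_s i j l p q u i = p * q / u" "ch_s i j l p q u j = p" "ch_s i j l p q u k = q" "ch_s i j l p q u l = 1"
    using d by (auto simp: ch_s_def)
  have u': "ch_u i j l p q u i = u" "ch_u i j l p q u j = q\<^sup>2 / u" "ch_u i j l p q u k = p\<^sup>2 / u"
    "ch_u i j l p q u l = p\<^sup>2 * q\<^sup>2 / u"
    using d by (auto simp: ch_u_def)
  have cancel: "u\<^sup>2 * (x * (y / u\<^sup>2)) = x * y" for x y using u by simp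
  note e = el_perm[OF p] el_perm[OF perm4_perms(1)[OF p]] el_perm[OF perm4_perms(2)[OF p]]
    el_perm[OF perm4_perms(3)[OF p]]
  have "el i (ch i j l p q u) = (p\<^sup>2 * q\<^sup>2 - u ^ 3 - p * q * (p + q + 1) * u + (p * q + p + q) * u\<^sup>2) / u\<^sup>2"
    unfolding e by (simp only: Q[OF le(1) le(1)] Q le U s u')
      (use u in \<open>simp add: field_simps power2_eq_square power3_eq_cube\<close>)
  moreover have "el j (ch i j l p q u) = ((p * q\<^sup>2 + p * q - q\<^sup>2 - p\<^sup>2 * q) * u + (p\<^sup>2 - p * q - p + q) * u\<^sup>2) / u\<^sup>2"
    unfolding e by (simp only: Q[OF le(1) le(1)] Q le U s u')
      (use u in \<open>simp add: field_simps power2_eq_square power3_eq_cube\<close>)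
  moreover have "el k (ch i j l p q u) = ((p\<^sup>2 * q + p * q - p\<^sup>2 - p * q\<^sup>2) * u + (q\<^sup>2 - p * q - q + p) * u\<^sup>2) / u\<^sup>2"
    unfolding e by (simp only: Q[OF le(1) le(1)] Q le U s u')
      (use u in \<open>simp add: field_simps power2_eq_square power3_eq_cube\<close>)
  moreover have "el l (ch i j l p q u) = ((p\<^sup>2 * q + p * q\<^sup>2 - p * q - p\<^sup>2 * q\<^sup>2) * u + (1 - p - q + p * q) * u\<^sup>2) / u\<^sup>2"
    unfolding e by (simp only: Q[OF le(1) le(1)] Q le U s u')
      (use u in \<open>simp add: field_simps power2_eq_square power3_eq_cube\<close>)
  ultimately have "u\<^sup>2 * (\<Sum>a\<le>3. c a * el a (ch i j l p q u)) =
      c i * (p\<^sup>2 * q\<^sup>2 - u ^ 3 - p * q * (p + q + 1) * u + (p * q + p + q) * u\<^sup>2)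
    + c j * ((p * q\<^sup>2 + p * q - q\<^sup>2 - p\<^sup>2 * q) * u + (p\<^sup>2 - p * q - p + q) * u\<^sup>2)
    + c k * ((p\<^sup>2 * q + p * q - p\<^sup>2 - p * q\<^sup>2) * u + (q\<^sup>2 - p * q - q + p) * u\<^sup>2)
    + c l * ((p\<^sup>2 * q + p * q\<^sup>2 - p * q - p\<^sup>2 * q\<^sup>2) * u + (1 - p - q + p * q) * u\<^sup>2)"
    unfolding perm4_sum[OF p] distrib_left[of "u\<^sup>2"] by (simp only: cancel)
  also have "\<dots> = poly (chart_cubic c i j k l p q) u"
    unfolding chart_cubic_def by (simp add: algebra_simps power2_eq_square power3_eq_cube)
  finally show ?thesis by simp
qed

context frame
begin

definition sec :: "(nat \<Rightarrow> complex) \<Rightarrow> point set" where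
  "sec c = hyp_section 13 W (\<Sum>a\<le>3. scale (c a) (EL a))"

definition torus_sec :: "(nat \<Rightarrow> complex) \<Rightarrow> point set" where
  "torus_sec c = {pt (vl (tv s)) | s. torus s \<and> (\<Sum>a\<le>3. c a * el a (tv s)) = 0}"

lemma sec_form: "(\<Sum>a\<le>3. scale (c a) (EL a)) \<in> forms 13 1"
  by (intro forms_sum forms_scale EL_form)

lemma mem_sec: "pt x \<in> sec c \<longleftrightarrow> pt x \<in> W \<and> (\<Sum>a\<le>3. c a * el a (X x)) = 0"
  using vanishes_pt[OF sec_form] by (simp add: sec_def hyp_section_def mpeval_sum EL_eval)

lemma zclosed_sec: "zclosed 13 (sec c)"
proof -
  have "sec c = W \<inter> {P \<in> proj 13. vanishes (\<Sum>a\<le>3. scale (c a) (EL a)) P}"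
    using W_subset by (auto simp: sec_def hyp_section_def)
  then show ?thesis by (simp only: zclosed_Int[OF zclosed_W zclosed_form[OF sec_form]])
qed

lemma el_cong: "(\<And>k. k \<le> 13 \<Longrightarrow> \<xi> k = \<eta> k) \<Longrightarrow> el a \<xi> = el a \<eta>"
  unfolding el_def by (intro sum.cong) auto

lemma el_scale: "el a (\<lambda>k. c * \<xi> k) = c * el a \<xi>"
  by (simp add: el_def sum_distrib_left mult.left_commute)

lemma el_vl: "el a (X (vl \<xi>)) = el a \<xi>"
  by (rule el_cong) (rule X_vl)

lemma torus_sec_subset: "torus_sec c \<subseteq> sec c"
  using torus_in_W by (auto simp: torus_sec_def mem_sec el_vl)

lemma sec_dense:
  assumes c: "torus c"
  shows "sec c \<subseteq> clo 13 (torus_sec c)"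
proof
  fix P assume P: "P \<in> sec c"
  then obtain x where x: "P = pt x" "vec 13 x"
    using subset_projE[OF zclosed_subset_proj[OF zclosed_sec]] by metis
  have xW: "pt x \<in> W" and g0: "(\<Sum>a\<le>3. c a * el a (X x)) = 0" using P x(1) mem_sec by auto
  show "P \<in> clo 13 (torus_sec c)"
    using xW
  proof (cases rule: W_strata)
    case (chart i j k l p q u C)
    have ci: "c i \<noteq> 0" using c chart(1) by (auto simp: perm4_def)
    let ?h = "\<lambda>n. 1 / of_nat (Suc n) :: complex"
    have h0: "?h \<longlonglongrightarrow> 0" using LIMSEQ_inverse_real_of_nat
      by (intro lim_1_over_n[THEN LIMSEQ_Suc])
    \<comment> \<open>The coordinates p and q are moved off zero, and u follows as a root of the
      cubic, so the nearby points remain on the section and lie in the torus.\<close>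
    define pn qn where "pn n = p + ?h n" and "qn n = q + ?h n" for n
    have pq: "pn \<longlonglongrightarrow> p" "qn \<longlonglongrightarrow> q"
      unfolding pn_def qn_def using tendsto_add[OF tendsto_const h0] by auto
    define R where "R n = chart_cubic c i j k l (pn n) (qn n)" for n
    have gx: "(\<Sum>a\<le>3. c a * el a (ch i j l p q u)) = 0"
    proof -
      have "el a (X x) = C * el a (ch i j l p q u)" for a
        unfolding el_scale[symmetric] by (rule el_cong) (rule chart(4))
      then have "C * (\<Sum>a\<le>3. c a * el a (ch i j l p q u)) = 0"
        using g0 by (simp add: sum_distrib_left mult.left_commute)
      then show ?thesis using chart(3) by simp
    qed
    have degR: "degree (R n) = 3" and leadR: "lead_coeff (R n) = - c i" for n
      using ci by (simp_all add: R_def chart_cubic_def)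
    have "(\<lambda>n. poly (R n) u) \<longlonglongrightarrow> poly (chart_cubic c i j k l p q) u"
      unfolding R_def chart_cubic_def poly_pCons poly_0 by (intro tendsto_intros pq)
    then have Ru: "(\<lambda>n. poly (R n) u) \<longlonglongrightarrow> 0"
      unfolding chart_cubic_eval[OF chart(1,2)] gx by simp
    have "(\<lambda>n. lead_coeff (R n)) \<longlonglongrightarrow> - c i" unfolding leadR by simp
    then obtain z where z: "\<And>n. poly (R n) (z n) = 0" "z \<longlonglongrightarrow> u"
      using root_limit[OF degR _ _ _ Ru, of "- c i"] ci by auto
    have "eventually (\<lambda>n. poly [:p, 1:] (?h n) \<noteq> 0) sequentially"
      "eventually (\<lambda>n. poly [:q, 1:] (?h n) \<noteq> 0) sequentially"
      by (rule eventually_not_root; simp)+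
    then have "eventually (\<lambda>n. pn n \<noteq> 0) sequentially" "eventually (\<lambda>n. qn n \<noteq> 0) sequentially"
      by (simp_all add: pn_def qn_def)
    moreover have "eventually (\<lambda>n. z n \<noteq> 0) sequentially"
      by (rule tendsto_imp_eventually_ne[OF z(2) chart(2)])
    ultimately have ev: "eventually (\<lambda>n. pt (vl (ch i j l (pn n) (qn n) (z n))) \<in> torus_sec c) sequentially"
    proof eventually_elim
      case (elim n)
      note t = ch_torus[OF chart(1) elim(1,2,3)]
      have v: "vl (ch i j l (pn n) (qn n) (z n)) = vl (tv (ch_s i j l (pn n) (qn n) (z n)))"
        by (rule vl_cong) (rule t(2))
      have "el a (ch i j l (pn n) (qn n) (z n)) = el a (tv (ch_s i j l (pn n) (qn n) (z n)))" for a
        by (rule el_cong) (rule t(2))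
      then have "(\<Sum>a\<le>3. c a * el a (tv (ch_s i j l (pn n) (qn n) (z n)))) = 0"
        using z(1)[of n] elim(3) unfolding R_def chart_cubic_eval[OF chart(1) elim(3)] by simp
      then show ?case unfolding v torus_sec_def using t(1)[of 0] by auto
    qed
    have lim: "(\<lambda>n. ch i j l (pn n) (qn n) (z n) m) \<longlonglongrightarrow> ch i j l p q u m" for m
    proof -
      have s: "(\<lambda>n. ch_s i j l (pn n) (qn n) (z n) a) \<longlonglongrightarrow> ch_s i j l p q u a" for a
        using chart(2) by (auto simp: ch_s_def intro!: tendsto_intros pq z(2))
      have "(\<lambda>n. ch_u i j l (pn n) (qn n) (z n) a) \<longlonglongrightarrow> ch_u i j l p q u a" for a
        using chart(2) by (auto simp: ch_u_def intro!: tendsto_intros pq z(2))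
      then show ?thesis unfolding ch_def val_def using s by (auto intro!: tendsto_mult)
    qed
    have xeq: "x = (\<lambda>m. C * vl (ch i j l p q u) m)"
      using vl_X[OF x(2)] vl_cong[OF chart(4)] vl_scale[of C "ch i j l p q u"] by simp
    have "vec 13 (vl (ch i j l p q u))"
      using x(2) chart(3) unfolding xeq by (auto simp: vec_def)
    then have "pt (vl (ch i j l p q u)) \<in> clo 13 (torus_sec c)"
      by (rule clo_limit_eventually[OF ev vl_tendsto[OF lim]])
    then show ?thesis unfolding x(1) xeq using chart(3) by simp
  next
    case (vertex_u i)
    obtain l :: nat where "l \<le> 3" "i \<noteq> l" by (metis zero_le one_le_numeral zero_neq_one)
    then obtain j k where p: "perm4 i j k l" using perm4_exists[OF vertex_u(1)] by metis
    then have le: "j \<le> 3" "k \<le> 3" "l \<le> 3" and d: "i \<noteq> j" "i \<noteq> k" "i \<noteq> l" by (auto simp: perm4_def)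
    have q: "X x (qi a b) = 0" if "a \<le> 3" "b \<le> 3" for a b
    proof (rule vertex_u(3))
      show "qi a b \<le> 13" using qi_le that .
      have "3 < qi a b" using le_3_cases[OF that(1)] le_3_cases[OF that(2)] by (elim disjE) (simp_all add: qi_def)
      then show "qi a b \<noteq> i" using vertex_u(1) by simp
    qed
    have o: "X x j = 0" "X x k = 0" "X x l = 0" using vertex_u(3) le d by auto
    \<comment> \<open>Only \<open>U\<^sub>i\<close> is nonzero at this vertex, and it occurs only in
      \<open>\<ell>\<^sub>i\<close>. Since c i \<noteq> 0, the section misses the vertex.\<close>
    have "(\<Sum>a\<le>3. c a * el a (X x)) = - c i * X x i"
      unfolding perm4_sum[OF p] el_perm[OF p] el_perm[OF perm4_perms(1)[OF p]]
        el_perm[OF perm4_perms(2)[OF p]] el_perm[OF perm4_perms(3)[OF p]]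
      by (simp add: q le vertex_u(1) o)
    then show ?thesis using g0 vertex_u(1,2) c by simp
  next
    case (vertex_q l)
    obtain i :: nat where i: "i \<le> 3" "i \<noteq> l" by (metis zero_le one_le_numeral zero_neq_one)
    then obtain j k where p: "perm4 i j k l" using perm4_exists[OF i(1) vertex_q(1)] by metis
    then have le: "j \<le> 3" "k \<le> 3" and d: "j \<noteq> l" "k \<noteq> l" "i \<noteq> j" "i \<noteq> k" "j \<noteq> k" by (auto simp: perm4_def)
    have q: "X x (qi a b) = 0" if "a \<le> 3" "b \<le> 3" "a \<noteq> l \<or> b \<noteq> l" for a b
    proof (rule vertex_q(3))
      show "qi a b \<le> 13" using qi_le that by blast
      show "qi a b \<noteq> qi l l" using le_3_cases[OF that(1)] le_3_cases[OF that(2)] le_3_cases[OF vertex_q(1)] that(3)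
        by (elim disjE) (simp_all add: qi_def)
    qed
    have o: "X x a = 0" if "a \<le> 3" for a
    proof (rule vertex_q(3))
      show "a \<noteq> qi l l" using that le_3_cases[OF vertex_q(1)] by (elim disjE) (simp_all add: qi_def)
    qed (use that in simp)
    \<comment> \<open>Likewise \<open>Q\<^sub>l\<^sub>l\<close> occurs only in
      \<open>\<ell>\<^sub>l\<close>, and the section misses this vertex too.\<close>
    have "(\<Sum>a\<le>3. c a * el a (X x)) = c l * X x (qi l l)"
      unfolding perm4_sum[OF p] el_perm[OF p] el_perm[OF perm4_perms(1)[OF p]]
        el_perm[OF perm4_perms(2)[OF p]] el_perm[OF perm4_perms(3)[OF p]]
      by (simp add: q le i d vertex_q(1) o)
    then show ?thesis using g0 vertex_q(1,2) c by simp
  qed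
qed

end

text \<open>Distinct components make all \<open>el a\<close> nonzero, and the last inequality is
  then equivalent to el 0 + el 1 \<noteq> 0. These are the quantities that the inverse construction
  divides by.\<close>

definition gen :: "(nat \<Rightarrow> complex) \<Rightarrow> bool" where
  "gen s \<longleftrightarrow> torus s \<and> s 0 \<noteq> s 1 \<and> s 0 \<noteq> s 2 \<and> s 0 \<noteq> s 3 \<and> s 1 \<noteq> s 2 \<and> s 1 \<noteq> s 3 \<and> s 2 \<noteq> s 3 \<and>
    s 0 * s 1 \<noteq> s 2 * s 3"

text \<open>The section in terms of \<open>s\<^sub>0\<close>, for \<open>(s\<^sub>1, s\<^sub>2, s\<^sub>3) = (a, b, d)\<close>.\<close>

definition sec_cubic :: "(nat \<Rightarrow> complex) \<Rightarrow> complex \<Rightarrow> complex \<Rightarrow> complex \<Rightarrow> complex poly" where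
  "sec_cubic c a b d = (let E1 = c 1 * (a - b) * (a - d) / a; E2 = c 2 * (b - a) * (b - d) / b;
      E3 = c 3 * (d - a) * (d - b) / d
    in [:- c 0 * a * b * d, c 0 * (a * b + a * d + b * d) + E1 * a + E2 * b + E3 * d,
      - c 0 * (a + b + d) - E1 - E2 - E3, c 0:])"

text \<open>Excludes the \<open>(a, b, d)\<close> for which a root of the cubic violates genericity.\<close>

definition sec_bad :: "(nat \<Rightarrow> complex) \<Rightarrow> complex poly \<Rightarrow> complex poly \<Rightarrow> complex poly \<Rightarrow> complex poly" where
  "sec_bad c a b d = a * b * d * (a - b) * (a - d) * (b - d) *
     (smult (c 2) ((b - a)\<^sup>2 * d) - smult (c 3) ((d - a)\<^sup>2 * b)) *
     (smult (c 1) ((a - b)\<^sup>2 * d) - smult (c 3) ((d - b)\<^sup>2 * a)) *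
     (smult (c 1) ((a - d)\<^sup>2 * b) - smult (c 2) ((b - d)\<^sup>2 * a)) *
     (smult (c 1 - c 0) (a\<^sup>2 - b * d) - smult (c 3 - c 2) ((d - b) * a))"

lemma sec_cubic_eval: "poly (sec_cubic c a b d) t = c 0 * (t - a) * (t - b) * (t - d) +
    t * ((a - t) * (c 1 * (a - b) * (a - d) / a) + (b - t) * (c 2 * (b - a) * (b - d) / b) +
      (d - t) * (c 3 * (d - a) * (d - b) / d))"
proof -
  define E1 E2 E3 where "E1 = c 1 * (a - b) * (a - d) / a" and "E2 = c 2 * (b - a) * (b - d) / b"
    and "E3 = c 3 * (d - a) * (d - b) / d"
  show ?thesis
    unfolding sec_cubic_def Let_def E1_def[symmetric] E2_def[symmetric] E3_def[symmetric]
    by (simp add: algebra_simps)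
qed

lemma sec_cubic_torus:
  assumes "torus s"
  shows "poly (sec_cubic c (s 1) (s 2) (s 3)) (s 0) = s 0 * (\<Sum>a\<le>3. c a * el a (tv s))"
proof -
  have nz: "s 0 \<noteq> 0" "s 1 \<noteq> 0" "s 2 \<noteq> 0" "s 3 \<noteq> 0" using assms by auto
  have e0: "s 0 * (c 0 * el 0 (tv s)) = c 0 * (s 0 - s 1) * (s 0 - s 2) * (s 0 - s 3)"
    unfolding el_torus[OF assms] using nz by simp
  show ?thesis
    unfolding sec_cubic_eval sum_3 distrib_left[of "s 0"] e0 unfolding el_torus[OF assms]
    by (simp add: add.assoc mult_ac)
qed

lemma sec_bad_eval: "poly (sec_bad c a b d) h = poly (sec_bad c [:poly a h:] [:poly b h:] [:poly d h:]) 0"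
  by (simp add: sec_bad_def mult_ac)

text \<open>Substituting a forbidden value of s 0 into the cubic gives, up to nonzero factors, one
  of the last four factors of \<open>sec_bad\<close>.\<close>

lemma sec_generic:
  assumes N: "poly (sec_bad c [:s 1:] [:s 2:] [:s 3:]) 0 \<noteq> 0" and s0: "s 0 \<noteq> 0"
    and r: "poly (sec_cubic c (s 1) (s 2) (s 3)) (s 0) = 0"
  shows "gen s"
proof -
  define a b d where "a = s 1" and "b = s 2" and "d = s 3"
  have nz: "a \<noteq> 0" "b \<noteq> 0" "d \<noteq> 0" "a \<noteq> b" "a \<noteq> d" "b \<noteq> d"
    and n1: "c 2 * ((b - a)\<^sup>2 * d) - c 3 * ((d - a)\<^sup>2 * b) \<noteq> 0"
    and n2: "c 1 * ((a - b)\<^sup>2 * d) - c 3 * ((d - b)\<^sup>2 * a) \<noteq> 0"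
    and n3: "c 1 * ((a - d)\<^sup>2 * b) - c 2 * ((b - d)\<^sup>2 * a) \<noteq> 0"
    and n4: "(c 1 - c 0) * (a\<^sup>2 - b * d) - (c 3 - c 2) * ((d - b) * a) \<noteq> 0"
    using N by (simp_all add: sec_bad_def a_def b_def d_def mult_ac)
  note r' = r[folded a_def b_def d_def]
  have "s 0 \<noteq> a"
  proof
    assume "s 0 = a"
    then have "poly (sec_cubic c a b d) (s 0) * (b * d) =
        a * (b - d) * (c 2 * ((b - a)\<^sup>2 * d) - c 3 * ((d - a)\<^sup>2 * b))"
      unfolding sec_cubic_eval using nz by (simp add: field_simps power2_eq_square)
    then show False using r' nz n1 by simp
  qed
  moreover have "s 0 \<noteq> b"
  proof
    assume "s 0 = b"
    then have "poly (sec_cubic c a b d) (s 0) * (a * d) =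
        b * (a - d) * (c 1 * ((a - b)\<^sup>2 * d) - c 3 * ((d - b)\<^sup>2 * a))"
      unfolding sec_cubic_eval using nz by (simp add: field_simps power2_eq_square)
    then show False using r' nz n2 by simp
  qed
  moreover have "s 0 \<noteq> d"
  proof
    assume "s 0 = d"
    then have "poly (sec_cubic c a b d) (s 0) * (a * b) =
        d * (a - b) * (c 1 * ((a - d)\<^sup>2 * b) - c 2 * ((b - d)\<^sup>2 * a))"
      unfolding sec_cubic_eval using nz by (simp add: field_simps power2_eq_square)
    then show False using r' nz n3 by simp
  qed
  moreover have "s 0 * a \<noteq> b * d"
  proof
    assume e: "s 0 * a = b * d"
    then have t: "s 0 = b * d / a" using nz by (simp add: field_simps)
    have f: "s 0 - a = - (a\<^sup>2 - b * d) / a" "s 0 - b = b * (d - a) / a" "s 0 - d = d * (b - a) / a"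
      "a - s 0 = (a\<^sup>2 - b * d) / a" "b - s 0 = - (b * (d - a) / a)" "d - s 0 = - (d * (b - a) / a)"
      unfolding t using nz by (simp_all add: field_simps power2_eq_square)
    have "poly (sec_cubic c a b d) (s 0) * (a ^ 3) =
        b * d * (a - b) * (a - d) * ((c 1 - c 0) * (a\<^sup>2 - b * d) - (c 3 - c 2) * ((d - b) * a))"
      unfolding sec_cubic_eval f t using nz by (simp add: field_simps) (simp add: algebra_simps power2_eq_square power3_eq_cube)
    then show False using r' nz n4 by simp
  qed
  ultimately show ?thesis
    using nz s0 by (auto simp: gen_def a_def b_def d_def all_3)
qed

text \<open>With first entry 1 and third entry 2, the last four factors of \<open>sec_bad\<close>
  are nonzero polynomials in the second entry, as is seen at 1 or at 2; for the last of them c 0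
  \<noteq> c 1 is used.\<close>

lemma sec_witness:
  assumes c: "torus c" "c 0 \<noteq> c 1"
  obtains x where "poly (sec_bad c [:1:] [:x:] [:2:]) 0 \<noteq> 0"
proof -
  have cn: "c 1 \<noteq> 0" "c 2 \<noteq> 0" "c 3 \<noteq> 0" using c(1) by auto
  have nzI: "p \<noteq> 0" if "poly p x \<noteq> 0" for p :: "complex poly" and x using that by auto
  have "smult (c 2) (([:0, 1:] - [:1:])\<^sup>2 * [:2:]) - smult (c 3) (([:2:] - [:1:])\<^sup>2 * [:0, 1:]) \<noteq> 0"
    by (rule nzI[of _ 1]) (use cn in simp)
  moreover have "smult (c 1) (([:1:] - [:0, 1:])\<^sup>2 * [:2:]) - smult (c 3) (([:2:] - [:0, 1:])\<^sup>2 * [:1:]) \<noteq> 0"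
    by (rule nzI[of _ 1]) (use cn in simp)
  moreover have "smult (c 1) (([:1:] - [:2:])\<^sup>2 * [:0, 1:]) - smult (c 2) (([:0, 1:] - [:2:])\<^sup>2 * [:1:]) \<noteq> 0"
    by (rule nzI[of _ 2]) (use cn in simp)
  moreover have "smult (c 1 - c 0) ([:1:]\<^sup>2 - [:0, 1:] * [:2:]) - smult (c 3 - c 2) (([:2:] - [:0, 1:]) * [:1:]) \<noteq> 0"
    by (rule nzI[of _ 2]) (use c(2) in simp)
  ultimately have "sec_bad c [:1:] [:0, 1:] [:2:] \<noteq> 0"
    unfolding sec_bad_def mult_eq_0_iff by simp
  then obtain x where "poly (sec_bad c [:1:] [:0, 1:] [:2:]) x \<noteq> 0" using poly_all_0_iff_0 by blast
  then show ?thesis using that[of x] unfolding sec_bad_eval[of c "[:1:]"] by simp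
qed

context frame
begin

definition gen_sec :: "(nat \<Rightarrow> complex) \<Rightarrow> point set" where
  "gen_sec c = {pt (vl (tv s)) | s. gen s \<and> (\<Sum>a\<le>3. c a * el a (tv s)) = 0}"

lemma gen_secI:
  assumes "poly (sec_bad c [:s 1:] [:s 2:] [:s 3:]) 0 \<noteq> 0" "s 0 \<noteq> 0"
    "poly (sec_cubic c (s 1) (s 2) (s 3)) (s 0) = 0"
  shows "pt (vl (tv s)) \<in> gen_sec c"
proof -
  have g: "gen s" by (rule sec_generic[OF assms])
  then have t: "torus s" by (simp add: gen_def)
  have "(\<Sum>a\<le>3. c a * el a (tv s)) = 0" using assms(2,3) unfolding sec_cubic_torus[OF t] by simp
  then show ?thesis using g by (auto simp: gen_sec_def)
qed

lemma gen_sec_nonempty: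
  assumes c: "torus c" "c 0 \<noteq> c 1"
  shows "gen_sec c \<noteq> {}"
proof -
  obtain x where x: "poly (sec_bad c [:1:] [:x:] [:2:]) 0 \<noteq> 0" using sec_witness[OF c] .
  then have x0: "x \<noteq> 0" by (auto simp: sec_bad_def)
  have "degree (sec_cubic c 1 x 2) = 3" using c(1) by (simp add: sec_cubic_def Let_def)
  then obtain t where t: "poly (sec_cubic c 1 x 2) t = 0" using root_near[of _ 3] by (metis zero_less_numeral)
  then have "t \<noteq> 0" using c(1) x0 by (auto simp: sec_cubic_eval)
  then have "pt (vl (tv (\<lambda>i. [t, 1, x, 2] ! i))) \<in> gen_sec c"
    by (intro gen_secI) (use x t in simp_all)
  then show ?thesis by blast
qed

lemma torus_sec_dense:
  assumes c: "torus c" "c 0 \<noteq> c 1"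
  shows "torus_sec c \<subseteq> clo 13 (gen_sec c)"
proof
  fix P assume "P \<in> torus_sec c"
  then obtain s where s: "P = pt (vl (tv s))" "torus s" "(\<Sum>a\<le>3. c a * el a (tv s)) = 0"
    by (auto simp: torus_sec_def)
  have nz: "s 0 \<noteq> 0" "s 1 \<noteq> 0" "s 2 \<noteq> 0" "s 3 \<noteq> 0" using s(2) by auto
  obtain x where x: "poly (sec_bad c [:1:] [:x:] [:2:]) 0 \<noteq> 0" using sec_witness[OF c] .
  let ?h = "\<lambda>n. 1 / of_nat (Suc n) :: complex"
  have h0: "?h \<longlonglongrightarrow> 0" by (intro lim_1_over_n[THEN LIMSEQ_Suc])
  \<comment> \<open>The last three components move from s towards the generic triple (1, x, 2). The
    entry 0 is a placeholder, as component 0 will be a root of the cubic.\<close>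
  define y where "y n i = s i + ?h n * ([0, 1, x, 2] ! i - s i)" for n and i :: nat
  have y: "(\<lambda>n. y n i) \<longlonglongrightarrow> s i" for i
    unfolding y_def using tendsto_add[OF tendsto_const tendsto_mult[OF h0 tendsto_const], of "s i"] by simp
  define R where "R n = sec_cubic c (y n 1) (y n 2) (y n 3)" for n
  have degR: "degree (R n) = 3" and leadR: "lead_coeff (R n) = c 0" for n
    using c(1) by (simp_all add: R_def sec_cubic_def Let_def)
  have "(\<lambda>n. poly (R n) (s 0)) \<longlonglongrightarrow> poly (sec_cubic c (s 1) (s 2) (s 3)) (s 0)"
    unfolding R_def sec_cubic_eval by (intro tendsto_intros y nz)
  then have R0: "(\<lambda>n. poly (R n) (s 0)) \<longlonglongrightarrow> 0" unfolding sec_cubic_torus[OF s(2)] s(3) by simp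
  have "(\<lambda>n. lead_coeff (R n)) \<longlonglongrightarrow> c 0" unfolding leadR by simp
  then obtain z where z: "\<And>n. poly (R n) (z n) = 0" "z \<longlonglongrightarrow> s 0"
    using root_limit[OF degR _ _ _ R0, of "c 0"] c(1) by auto
  define t where "t n i = (if i = 0 then z n else y n i)" for n and i :: nat
  have t: "(\<lambda>n. t n i) \<longlonglongrightarrow> s i" for i
    unfolding t_def by (cases "i = 0") (use y z(2) in simp_all)
  \<comment> \<open>Along this motion the bad locus is a polynomial in the parameter, nonzero at
    parameter 1 and therefore nonzero at almost all the parameters tending to 0.\<close>
  define N where "N = sec_bad c [:s 1, 1 - s 1:] [:s 2, x - s 2:] [:s 3, 2 - s 3:]"
  have "poly N 1 \<noteq> 0" unfolding N_def sec_bad_eval[of c "[:s 1, 1 - s 1:]"] using x by simp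
  then have "N \<noteq> 0" by auto
  then have "eventually (\<lambda>n. poly N (?h n) \<noteq> 0) sequentially" by (rule eventually_not_root)
  moreover have "eventually (\<lambda>n. z n \<noteq> 0) sequentially" by (rule tendsto_imp_eventually_ne[OF z(2) nz(1)])
  ultimately have ev: "eventually (\<lambda>n. pt (vl (tv (t n))) \<in> gen_sec c) sequentially"
  proof eventually_elim
    case (elim n)
    show ?case
    proof (rule gen_secI)
      show "poly (sec_bad c [:t n 1:] [:t n 2:] [:t n 3:]) 0 \<noteq> 0"
        using elim(1) unfolding N_def sec_bad_eval[of c "[:s 1, 1 - s 1:]"]
        by (simp add: t_def y_def del: of_nat_Suc)
      show "t n 0 \<noteq> 0" using elim(2) by (simp add: t_def)
      show "poly (sec_cubic c (t n 1) (t n 2) (t n 3)) (t n 0) = 0"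
        using z(1)[of n] by (simp add: t_def R_def)
    qed
  qed
  have "(\<lambda>n. tv (t n) k) \<longlonglongrightarrow> tv s k" if "k \<le> 13" for k
    unfolding tv_def val_def tu_def using that s(2)
    by (auto intro!: tendsto_intros t)
  then have "pt (vl (tv s)) \<in> clo 13 (gen_sec c)"
    by (intro clo_limit_eventually[OF ev vl_tendsto] torus_vec s(2))
  then show "P \<in> clo 13 (gen_sec c)" by (simp add: s(1))
qed

end

section \<open>Recovering s from the cubic and the fibre coordinate\<close>

lemma tv_cong:
  assumes "\<And>i. i \<le> 3 \<Longrightarrow> s i = t i" "k \<le> 13"
  shows "tv s k = tv t k"
  using assms qi_fi_se[of k] by (auto simp: tv_def val_def tu_def)

lemma gs_scale: "gs (\<lambda>i. a * w i) (b * u) (b * v) i = a ^ 3 * b ^ 3 * gs w u v i" if "i \<le> 3"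
  using le_3_cases[OF that] by (elim disjE) (simp_all add: gs_def power3_eq_cube algebra_simps)

lemma gs_cong: "(\<And>i. i \<le> 3 \<Longrightarrow> w i = w' i) \<Longrightarrow> gs w u v = gs w' u v"
  by (rule ext) (simp add: gs_def)

lemma gen_el:
  assumes s: "gen s"
  defines "y \<equiv> \<lambda>a. el a (tv s)"
  shows "\<forall>a\<le>3. y a \<noteq> 0" "e3 y = 0" "y 0 + y 1 \<noteq> 0" "y 2 + y 3 \<noteq> 0"
proof -
  have t: "torus s" using s by (simp add: gen_def)
  then have nz: "s 0 \<noteq> 0" "s 1 \<noteq> 0" "s 2 \<noteq> 0" "s 3 \<noteq> 0" by auto
  show y: "\<forall>a\<le>3. y a \<noteq> 0" using s unfolding all_3 y_def el_torus[OF t] by (auto simp: gen_def)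
  show e: "e3 y = 0" unfolding y_def by (rule e3_torus[OF t])
  have "y 0 + y 1 = (s 0 - s 1)\<^sup>2 * (s 0 * s 1 - s 2 * s 3) / (s 0 * s 1)"
    unfolding y_def el_torus[OF t] using nz by (simp add: field_simps power2_eq_square)
  then show 01: "y 0 + y 1 \<noteq> 0" using s nz by (simp add: gen_def)
  have r: "(y 0 + y 1) * (y 2 * y 3) = - (y 2 + y 3) * (y 0 * y 1)"
    using e unfolding e3_def by algebra
  show "y 2 + y 3 \<noteq> 0"
  proof
    assume "y 2 + y 3 = 0"
    then show False using 01 y r[unfolded \<open>y 2 + y 3 = 0\<close>] unfolding all_3 by simp
  qed
qed

text \<open>Fed with the reciprocals of the \<open>\<ell>\<^sub>a\<close> and the fibre coordinate
  of s, the four nontrivial linear factors of \<open>gs\<close> become, up to sign, \<sigma> over a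
  product of three differences. So \<open>gs\<close> returns s up to the common factor
  \<open>(\<sigma> / \<rho>)\<^sup>2\<close>.\<close>

lemma gs_inverse:
  assumes s: "gen s"
  defines "w \<equiv> \<lambda>a. 1 / el a (tv s)" and "\<sigma> \<equiv> s 0 * s 1 - s 2 * s 3"
    and "\<rho> \<equiv> (s 0 - s 2) * (s 0 - s 3) * (s 1 - s 2) * (s 1 - s 3)"
  shows "\<And>i. i \<le> 3 \<Longrightarrow> gs w (s 2 - s 3) (s 0 - s 1) i = (\<sigma> / \<rho>)\<^sup>2 * s i"
    "w 0 * w 1 * (s 0 - s 1)\<^sup>2 - w 2 * w 3 * (s 2 - s 3)\<^sup>2 = - \<sigma> / \<rho>"
    "\<sigma> / \<rho> \<noteq> 0"
proof -
  have t: "torus s" using s by (simp add: gen_def)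
  then have nz: "s 0 \<noteq> 0" "s 1 \<noteq> 0" "s 2 \<noteq> 0" "s 3 \<noteq> 0" by auto
  define d01 d02 d03 d12 d13 d23 where "d01 = s 0 - s 1" and "d02 = s 0 - s 2" and "d03 = s 0 - s 3"
    and "d12 = s 1 - s 2" and "d13 = s 1 - s 3" and "d23 = s 2 - s 3"
  note D = d01_def d02_def d03_def d12_def d13_def d23_def
  have n: "s 1 - s 0 = - d01" "s 2 - s 0 = - d02" "s 3 - s 0 = - d03" "s 2 - s 1 = - d12"
    "s 3 - s 1 = - d13" "s 3 - s 2 = - d23"
    by (simp_all add: D)
  have d: "d01 \<noteq> 0" "d02 \<noteq> 0" "d03 \<noteq> 0" "d12 \<noteq> 0" "d13 \<noteq> 0" "d23 \<noteq> 0" "\<sigma> \<noteq> 0"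
    using s by (auto simp: gen_def D \<sigma>_def)
  have w: "w 0 = s 0 / (d01 * d02 * d03)" "w 1 = - s 1 / (d01 * d12 * d13)"
    "w 2 = s 2 / (d02 * d12 * d23)" "w 3 = - s 3 / (d03 * d13 * d23)"
    unfolding w_def el_torus[OF t] n D[symmetric] by simp_all
  have \<rho>: "\<rho> = d02 * d03 * d12 * d13" by (simp add: \<rho>_def D)
  have sg: "s 1 * d03 + s 3 * d12 = \<sigma>" "s 1 * d02 + s 2 * d13 = \<sigma>" "s 0 * d13 + s 3 * d02 = \<sigma>"
    "s 2 * d03 + s 0 * d12 = \<sigma>"
    by (simp_all add: D \<sigma>_def algebra_simps)
  have "w 1 * d01 + w 3 * d23 = - (s 1 * d03 + s 3 * d12) / (d03 * d12 * d13)"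
    unfolding w using d by (simp add: field_simps)
  then have al: "w 1 * d01 + w 3 * d23 = - \<sigma> / (d03 * d12 * d13)" unfolding sg .
  have "w 1 * d01 - w 2 * d23 = - (s 1 * d02 + s 2 * d13) / (d02 * d12 * d13)"
    unfolding w using d by (simp add: field_simps)
  then have be: "w 1 * d01 - w 2 * d23 = - \<sigma> / (d02 * d12 * d13)" unfolding sg .
  have "w 0 * d01 - w 3 * d23 = (s 0 * d13 + s 3 * d02) / (d02 * d03 * d13)"
    unfolding w using d by (simp add: field_simps)
  then have ga: "w 0 * d01 - w 3 * d23 = \<sigma> / (d02 * d03 * d13)" unfolding sg .
  have "- w 2 * d23 - w 0 * d01 = - (s 2 * d03 + s 0 * d12) / (d02 * d03 * d12)"
    unfolding w using d by (simp add: field_simps)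
  then have de: "- w 2 * d23 - w 0 * d01 = - \<sigma> / (d02 * d03 * d12)" unfolding sg .
  have g: "gs w d23 d01 0 = w 0 * d01 * (- \<sigma> / (d03 * d12 * d13)) * (- \<sigma> / (d02 * d12 * d13))"
    "gs w d23 d01 1 = w 1 * d01 * (\<sigma> / (d02 * d03 * d13)) * (- \<sigma> / (d02 * d03 * d12))"
    "gs w d23 d01 2 = - w 2 * d23 * (- \<sigma> / (d03 * d12 * d13)) * (\<sigma> / (d02 * d03 * d13))"
    "gs w d23 d01 3 = - w 3 * d23 * (- \<sigma> / (d02 * d12 * d13)) * (- \<sigma> / (d02 * d03 * d12))"
    by (simp_all only: al[symmetric] be[symmetric] ga[symmetric] de[symmetric]) (simp_all add: gs_def)
  have "gs w d23 d01 i = (\<sigma> / \<rho>)\<^sup>2 * s i" if "i \<le> 3" for i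
    using le_3_cases[OF that]
  proof (elim disjE)
    assume "i = 0" then show ?thesis
      using d g(1) unfolding \<rho> w by (simp add: field_simps power2_eq_square)
  next
    assume "i = 1" then show ?thesis
      using d g(2) unfolding \<rho> w by (simp add: field_simps power2_eq_square)
  next
    assume "i = 2" then show ?thesis
      using d g(3) unfolding \<rho> w by (simp add: field_simps power2_eq_square)
  next
    assume "i = 3" then show ?thesis
      using d g(4) unfolding \<rho> w by (simp add: field_simps power2_eq_square)
  qed
  then show "gs w (s 2 - s 3) (s 0 - s 1) i = (\<sigma> / \<rho>)\<^sup>2 * s i" if "i \<le> 3" for i
    using that unfolding D .
  have "w 0 * w 1 * d01\<^sup>2 - w 2 * w 3 * d23\<^sup>2 = - \<sigma> / \<rho>"
    unfolding \<rho> w \<sigma>_def using d by (simp add: field_simps power2_eq_square)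
  then show "w 0 * w 1 * (s 0 - s 1)\<^sup>2 - w 2 * w 3 * (s 2 - s 3)\<^sup>2 = - \<sigma> / \<rho>" unfolding D .
  show "\<sigma> / \<rho> \<noteq> 0" unfolding \<rho> using d by simp
qed

subsection \<open>The elliptic curve\<close>

text \<open>
  On the section, the ratios \<open>k = y\<^sub>0/y\<^sub>1\<close> and \<open>r = y\<^sub>2/y\<^sub>3\<close> of \<open>y\<^sub>a = \<ell>\<^sub>a\<close> satisfy
  \<open>c\<^sub>2 k r\<^sup>2 - q(k, 1) r + c\<^sub>3 k = 0\<close>; the discriminant \<open>q\<^sup>2 - 4 c\<^sub>2 c\<^sub>3 k\<^sup>2\<close> is a quartic in \<open>k\<close>.
\<close>

definition quad :: "(nat \<Rightarrow> complex) \<Rightarrow> complex \<Rightarrow> complex \<Rightarrow> complex" where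
  "quad c K L = c 0 * K\<^sup>2 + (c 0 + c 1 - c 2 - c 3) * K * L + c 1 * L\<^sup>2"

text \<open>The product of the two equations written as (y 0 + y 1) y 2 y 3 = - (y 2 + y 3) y 0 y 1
  and c 0 y 0 + c 1 y 1 = - (c 2 y 2 + c 3 y 3), with the mixed term moved to the left.\<close>

lemma section_relation:
  assumes e: "e3 y = 0" and c: "(\<Sum>a\<le>3. c a * y a) = 0"
  shows "quad c (y 0) (y 1) * (y 2 * y 3) = (c 2 * (y 2)\<^sup>2 + c 3 * (y 3)\<^sup>2) * (y 0 * y 1)"
proof -
  have c': "c 0 * y 0 + c 1 * y 1 + c 2 * y 2 + c 3 * y 3 = 0" using c by (simp add: sum_3 add.assoc)
  show ?thesis using e c' unfolding e3_def quad_def by algebra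
qed

text \<open>Reciprocals of the y_a, up to a common factor, from the ratios K : L = y 0 : y 1 and R :
  M = y 2 : y 3. The relative scale of the two pairs is fixed by making the sum of the reciprocals
  zero.\<close>

definition sv :: "complex \<Rightarrow> complex \<Rightarrow> complex \<Rightarrow> complex \<Rightarrow> nat \<Rightarrow> complex" where
  "sv K L R M i = [L * (R + M), K * (R + M), - M * (K + L), - R * (K + L)] ! i"

lemma sv_sum: "sv K L R M 0 + sv K L R M 1 + sv K L R M 2 + sv K L R M 3 = 0"
  by (simp add: sv_def algebra_simps)

text \<open>The converse of \<open>section_relation\<close>, at the level of reciprocals.\<close>

lemma sv_section:
  assumes q: "c 2 * K * L * R\<^sup>2 - quad c K L * R * M + c 3 * K * L * M\<^sup>2 = 0"
    and nz: "\<forall>a\<le>3. sv K L R M a \<noteq> 0"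
  shows "(\<Sum>a\<le>3. c a / sv K L R M a) = 0"
proof -
  have n: "K \<noteq> 0" "L \<noteq> 0" "R \<noteq> 0" "M \<noteq> 0" "R + M \<noteq> 0" "K + L \<noteq> 0"
    using nz unfolding all_3 by (auto simp: sv_def)
  have "(\<Sum>a\<le>3. c a / sv K L R M a) =
      ((c 0 * K + c 1 * L) * (K + L) * R * M - (c 2 * R + c 3 * M) * (R + M) * K * L) /
      (K * L * R * M * (R + M) * (K + L))"
    unfolding sum_3 sv_def using n
    by (simp add: divide_simps) (simp add: algebra_simps)
  also have "(c 0 * K + c 1 * L) * (K + L) * R * M - (c 2 * R + c 3 * M) * (R + M) * K * L = 0"
    using q unfolding quad_def by algebra
  finally show ?thesis by simp
qed

lemma sv_inverse:
  assumes e: "e3 y = 0" and y: "\<forall>a\<le>3. y a \<noteq> 0" and "i \<le> 3"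
  shows "sv (a * y 0) (a * y 1) (b * y 2) (b * y 3) i = a * b * (y 0 * y 1 * (y 2 + y 3)) * (1 / y i)"
proof -
  have n: "y 0 \<noteq> 0" "y 1 \<noteq> 0" "y 2 \<noteq> 0" "y 3 \<noteq> 0" using y by auto
  have r: "- (y 0 + y 1) * (y 2 * y 3) = y 0 * y 1 * (y 2 + y 3)" using e unfolding e3_def by algebra
  have "sv (a * y 0) (a * y 1) (b * y 2) (b * y 3) 2 = a * b * (- (y 0 + y 1) * (y 2 * y 3)) * (1 / y 2)"
    "sv (a * y 0) (a * y 1) (b * y 2) (b * y 3) 3 = a * b * (- (y 0 + y 1) * (y 2 * y 3)) * (1 / y 3)"
    using n by (simp_all add: sv_def field_simps)
  moreover have "sv (a * y 0) (a * y 1) (b * y 2) (b * y 3) 0 = a * b * (y 0 * y 1 * (y 2 + y 3)) * (1 / y 0)"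
    "sv (a * y 0) (a * y 1) (b * y 2) (b * y 3) 1 = a * b * (y 0 * y 1 * (y 2 + y 3)) * (1 / y 1)"
    using n by (simp_all add: sv_def field_simps)
  ultimately show ?thesis using le_3_cases[OF assms(3)] unfolding r by (elim disjE) simp_all
qed

section \<open>The birational maps between a section and a scroll\<close>

lemma sx_form: "k \<le> 13 \<Longrightarrow> sx k \<in> forms 3 6"
proof -
  assume k: "k \<le> 13"
  have v: "var i * var j \<in> forms 3 2" "var i ^ 2 \<in> forms 3 2" if "i \<le> 3" "j \<le> 3" for i j
    using forms_mult[OF forms_var[OF that(1)] forms_var[OF that(2)]]
      forms_mult[OF forms_var[OF that(1)] forms_var[OF that(1)]] by (simp_all add: power2_eq_square numeral_2_eq_2)
  have m: "a * b * c \<in> forms 3 6" if "a \<in> forms 3 2" "b \<in> forms 3 2" "c \<in> forms 3 2" for a b c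
    using forms_mult[OF forms_mult[OF that(1,2)] that(3)] by simp
  show ?thesis
  proof (cases "k < 4")
    case True
    then have k3: "k \<le> 3" by simp
    have "{..3} - {0 :: nat} = {1, 2, 3}" "{..3} - {1 :: nat} = {0, 2, 3}"
      "{..3} - {2 :: nat} = {0, 1, 3}" "{..3} - {3 :: nat} = {0, 1, 2}" by auto
    moreover have "var i ^ 2 * (var j ^ 2 * var l ^ 2) \<in> forms 3 6" if "i \<le> 3" "j \<le> 3" "l \<le> 3" for i j l
      unfolding mult.assoc[symmetric] by (rule m; rule v; rule that)
    ultimately show ?thesis using le_3_cases[OF k3] True by (elim disjE) (simp_all add: sx_def)
  next
    case False
    have "(\<Prod>j\<le>3. var j) = (var 0 * var 1) * (var 2 * var 3)"
      unfolding atMost_3 by (simp add: mult.assoc)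
    then show ?thesis
      using False qi_fi_se[OF k False] by (auto simp: sx_def intro!: m v)
  qed
qed

lemma sx_eval_gen:
  assumes s: "torus s" and st: "\<And>i. i \<le> 3 \<Longrightarrow> s i = b * t i" and b: "b \<noteq> 0" and k: "k \<le> 13"
  shows "mpeval (sx k) s = s 0 * s 1 * s 2 * s 3 * b\<^sup>2 * tv t k"
proof -
  have "torus t" using s st b by auto
  then have "tv s k = b\<^sup>2 * tv t k"
    using tv_cong[OF st k] tv_scale[of t b] b by simp
  then show ?thesis unfolding sx_eval[OF s k] by simp
qed

lemma genI:
  assumes t: "torus s" and y: "\<forall>a\<le>3. el a (tv s) \<noteq> 0" "el 0 (tv s) + el 1 (tv s) \<noteq> 0"
  shows "gen s"
proof -
  have nz: "s 0 \<noteq> 0" "s 1 \<noteq> 0" "s 2 \<noteq> 0" "s 3 \<noteq> 0" using t by auto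
  have "el 0 (tv s) + el 1 (tv s) = (s 0 - s 1)\<^sup>2 * (s 0 * s 1 - s 2 * s 3) / (s 0 * s 1)"
    unfolding el_torus[OF t] using nz by (simp add: field_simps power2_eq_square)
  then have "s 0 * s 1 \<noteq> s 2 * s 3" using y(2) by auto
  then show ?thesis using t y(1) unfolding gen_def all_3 el_torus[OF t] by auto
qed

text \<open>The numbers k1, ..., k4 are the roots of the discriminant quartic. The substitution x =
  1 / (k - k1) sends k1 to infinity and the other roots to 1 / (k2 - k1), 1 / (k3 - k1), 1 / (k4 -
  k1), and A is the leading coefficient of the resulting cubic.\<close>

locale quad_section =
  frame B B' W + curve: weierstrass "(c 0)\<^sup>2 * (k1 - k2) * (k1 - k3) * (k1 - k4)"
    "1 / (k2 - k1)" "1 / (k3 - k1)" "1 / (k4 - k1)"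
  for B B' :: "nat \<Rightarrow> nat \<Rightarrow> complex" and W :: "point set" and c :: "nat \<Rightarrow> complex" and k1 k2 k3 k4 :: complex +
  assumes c: "torus c" "c 0 \<noteq> c 1"
    and quartic: "\<And>K L. (quad c K L)\<^sup>2 - 4 * c 2 * c 3 * (K * L)\<^sup>2 =
      (c 0)\<^sup>2 * ((K - k1 * L) * (K - k2 * L) * (K - k3 * L) * (K - k4 * L))"
begin

text \<open>With K = k1 * v 0 + v 2 and L = v 0, the factor K - k1 * L of the quartic is v 2.
  Multiplied by v 2, the cubic equation therefore says that v 1 * v 2 is a square root of the
  discriminant.\<close>

lemma curve_quartic:
  "v 2 * mpeval curve.F v =
    (v 1 * v 2)\<^sup>2 - ((quad c (k1 * v 0 + v 2) (v 0))\<^sup>2 - 4 * c 2 * c 3 * ((k1 * v 0 + v 2) * v 0)\<^sup>2)"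
proof -
  have k: "k1 \<noteq> k2" "k1 \<noteq> k3" "k1 \<noteq> k4" using curve.A by auto
  have f: "(k1 - k) * (v 0 - 1 / (k - k1) * v 2) = k1 * v 0 + v 2 - k * v 0" if "k1 \<noteq> k" for k
    using that by (simp add: field_simps)
  have "(c 0)\<^sup>2 * (k1 - k2) * (k1 - k3) * (k1 - k4) * (v 0 - 1 / (k2 - k1) * v 2) *
      (v 0 - 1 / (k3 - k1) * v 2) * (v 0 - 1 / (k4 - k1) * v 2) =
      (c 0)\<^sup>2 * (((k1 - k2) * (v 0 - 1 / (k2 - k1) * v 2)) * ((k1 - k3) * (v 0 - 1 / (k3 - k1) * v 2)) *
      ((k1 - k4) * (v 0 - 1 / (k4 - k1) * v 2)))" by (simp only: mult_ac)
  also have "\<dots> = (c 0)\<^sup>2 * ((k1 * v 0 + v 2 - k2 * v 0) * (k1 * v 0 + v 2 - k3 * v 0) * (k1 * v 0 + v 2 - k4 * v 0))"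
    using f k by simp
  finally have F: "mpeval curve.F v = (v 1)\<^sup>2 * v 2 -
      (c 0)\<^sup>2 * ((k1 * v 0 + v 2 - k2 * v 0) * (k1 * v 0 + v 2 - k3 * v 0) * (k1 * v 0 + v 2 - k4 * v 0))"
    unfolding curve.F_eval by simp
  show ?thesis unfolding quartic F by (simp add: power2_eq_square algebra_simps)
qed

text \<open>The open set on which phi will be inverted: points of the torus with all
  \<open>el a\<close> nonzero and with the ratio k = el 0 / el 1 different from k1, which
  corresponds to infinity on the cubic, and from -1.\<close>

definition hh :: "(nat \<Rightarrow> complex) \<Rightarrow> complex" where
  "hh x = (\<Prod>k\<le>13. X x k) * ((\<Prod>a\<le>3. el a (X x)) *
     ((el 0 (X x) - k1 * el 1 (X x)) * (el 0 (X x) + el 1 (X x))))"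

lemma hform_hh: "hform 13 ((\<Sum>k\<le>13 :: nat. 1) + ((\<Sum>a\<le>3 :: nat. 1) + (1 + 1))) hh"
  unfolding hh_def
  by (intro hform_mult[OF _ _ refl] hform_prod hform_add hform_diff hform_cmult hform_X hform_el)

lemma hh_torus:
  assumes t: "torus s"
  shows "hh (vl (tv s)) \<noteq> 0 \<longleftrightarrow> (\<forall>a\<le>3. el a (tv s) \<noteq> 0) \<and> el 0 (tv s) \<noteq> k1 * el 1 (tv s) \<and>
    el 0 (tv s) + el 1 (tv s) \<noteq> 0"
  unfolding hh_def el_vl using tv_nonzero[OF t] by (auto simp: X_vl)

text \<open>Of the conditions in \<open>hh\<close>, a generic point can violate only k \<noteq> k1.
  The ratio k is perturbed, r follows as a root of the quadratic, and the fibre coordinate is kept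
  fixed; \<open>sv\<close> and \<open>gs\<close> turn these data back into nearby points of the
  section.\<close>

lemma gen_sec_dense: "gen_sec c \<subseteq> clo 13 {pt x | x. pt x \<in> sec c \<and> hh x \<noteq> 0}" (is "_ \<subseteq> clo 13 ?T")
proof
  fix P assume "P \<in> gen_sec c"
  then obtain s where s: "P = pt (vl (tv s))" "gen s" "(\<Sum>a\<le>3. c a * el a (tv s)) = 0"
    by (auto simp: gen_sec_def)
  define y where "y a = el a (tv s)" for a
  note g = gen_el[OF s(2), folded y_def]
  have ts: "torus s" using s(2) by (simp add: gen_def)
  have cn: "c 2 \<noteq> 0" using c by simp
  have yn: "y 0 \<noteq> 0" "y 1 \<noteq> 0" "y 2 \<noteq> 0" "y 3 \<noteq> 0" using g(1) by auto
  define k r where "k = y 0 / y 1" and "r = y 2 / y 3"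
  have kr: "k \<noteq> 0" "r \<noteq> 0" "k + 1 \<noteq> 0" "r + 1 \<noteq> 0"
    using yn g(3,4) by (simp_all add: k_def r_def add_divide_eq_iff add.commute divide_add_eq_iff)
  have rel: "c 2 * k * r\<^sup>2 - quad c k 1 * r + c 3 * k = 0"
  proof -
    have "quad c (y 0) (y 1) * (y 2 * y 3) = (c 2 * (y 2)\<^sup>2 + c 3 * (y 3)\<^sup>2) * (y 0 * y 1)"
      by (rule section_relation) (use g(2) s(3) in \<open>simp_all add: y_def\<close>)
    moreover have "quad c (y 0) (y 1) = quad c k 1 * (y 1)\<^sup>2"
      using yn by (simp add: k_def quad_def field_simps power2_eq_square)
    moreover have "y 0 = k * y 1" "y 2 = r * y 3" using yn by (simp_all add: k_def r_def)
    ultimately have "(y 1)\<^sup>2 * (y 3)\<^sup>2 * (c 2 * k * r\<^sup>2 - quad c k 1 * r + c 3 * k) = 0" by algebra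
    then show ?thesis using yn by simp
  qed
  let ?h = "\<lambda>n. 1 / of_nat (Suc n) :: complex"
  have h0: "?h \<longlonglongrightarrow> 0" by (intro lim_1_over_n[THEN LIMSEQ_Suc])
  \<comment> \<open>A multiplicative perturbation: the new ratio is k (n + 2) / (n + 1), hence
    nonzero for every n, which keeps the degree of the quadratic constant.\<close>
  define kn where "kn n = k + ?h n * k" for n
  have kl: "kn \<longlonglongrightarrow> k"
    unfolding kn_def using tendsto_add[OF tendsto_const tendsto_mult[OF h0 tendsto_const], of k k] by simp
  have kn0: "kn n \<noteq> 0" for n
  proof -
    have "kn n = k * (of_nat (Suc (Suc n)) / of_nat (Suc n))"
      unfolding kn_def by (simp add: field_simps del: of_nat_Suc) (simp add: algebra_simps)
    then show ?thesis using kr(1) by (simp del: of_nat_Suc)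
  qed
  define R where "R n = [:c 3 * kn n, - quad c (kn n) 1, c 2 * kn n:]" for n
  have degR: "degree (R n) = 2" and leadR: "lead_coeff (R n) = c 2 * kn n" for n
    using cn kn0[of n] by (simp_all add: R_def)
  have "(\<lambda>n. poly (R n) r) \<longlonglongrightarrow> c 3 * k + r * (- quad c k 1 + r * (c 2 * k + r * 0))"
    unfolding R_def poly_pCons poly_0 quad_def by (intro tendsto_intros kl)
  then have R0: "(\<lambda>n. poly (R n) r) \<longlonglongrightarrow> 0" using rel by (simp add: algebra_simps power2_eq_square)
  have "(\<lambda>n. lead_coeff (R n)) \<longlonglongrightarrow> c 2 * k" unfolding leadR by (intro tendsto_intros kl)
  then obtain rn where rn: "\<And>n. poly (R n) (rn n) = 0" "rn \<longlonglongrightarrow> r"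
    using root_limit[OF degR _ _ _ R0, of "c 2 * k"] cn kr(1) by auto
  \<comment> \<open>The fibre coordinate v / u is that of s and does not depend on n.\<close>
  define u v where "u = s 2 - s 3" and "v = s 0 - s 1"
  define w where "w n = sv (kn n) 1 (rn n) 1" for n
  define w' where "w' = sv k 1 r 1"
  have wl: "(\<lambda>n. w n i) \<longlonglongrightarrow> w' i" if "i \<le> 3" for i
    using le_3_cases[OF that] by (elim disjE) (simp_all add: w_def w'_def sv_def, (intro tendsto_intros kl rn(2))+)
  define t where "t n = gs (w n) u v" for n
  have tl: "(\<lambda>n. t n i) \<longlonglongrightarrow> gs w' u v i" if "i \<le> 3" for i
    using le_3_cases[OF that] by (elim disjE) (simp_all add: t_def gs_def, (intro tendsto_intros wl; simp)+)
  define b where "b = (1 / y 1) * (1 / y 3) * (y 0 * y 1 * (y 2 + y 3))"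
  have b0: "b \<noteq> 0" using yn g(4) by (simp add: b_def)
  have w'y: "w' i = b * (1 / y i)" if "i \<le> 3" for i
    using sv_inverse[OF g(2,1) that, of "1 / y 1" "1 / y 3"] yn by (simp add: w'_def k_def r_def b_def)
  define \<sigma> \<rho> where "\<sigma> = s 0 * s 1 - s 2 * s 3" and "\<rho> = (s 0 - s 2) * (s 0 - s 3) * (s 1 - s 2) * (s 1 - s 3)"
  note inv = gs_inverse[OF s(2), folded y_def \<sigma>_def \<rho>_def u_def v_def]
  define z where "z = b ^ 3 * (\<sigma> / \<rho>)\<^sup>2"
  have z0: "z \<noteq> 0" using b0 inv(3) by (simp add: z_def)
  have gz: "gs w' u v i = z * s i" if "i \<le> 3" for i
  proof -
    have "gs w' u v i = gs (\<lambda>i. b * (1 / y i)) (1 * u) (1 * v) i"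
      using gs_cong[of w' "\<lambda>i. b * (1 / y i)"] w'y by simp
    also have "\<dots> = z * s i" unfolding gs_scale[OF that] inv(1)[OF that] z_def by simp
    finally show ?thesis .
  qed
  define D where "D n = w n 0 * w n 1 * v\<^sup>2 - w n 2 * w n 3 * u\<^sup>2" for n
  have "D \<longlonglongrightarrow> w' 0 * w' 1 * v\<^sup>2 - w' 2 * w' 3 * u\<^sup>2"
    unfolding D_def by (intro tendsto_intros wl) simp_all
  moreover have "w' 0 * w' 1 * v\<^sup>2 - w' 2 * w' 3 * u\<^sup>2 = b\<^sup>2 * (- \<sigma> / \<rho>)"
    unfolding inv(2)[symmetric] by (simp add: w'y power2_eq_square algebra_simps)
  ultimately have Dl: "D \<longlonglongrightarrow> b\<^sup>2 * (- \<sigma> / \<rho>)" by simp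
  have ev_t: "eventually (\<lambda>n. t n i \<noteq> 0) sequentially" if "i \<le> 3" for i
    by (rule tendsto_imp_eventually_ne[OF tl[OF that]]) (use gz[OF that] z0 ts that in simp)
  have ev_D: "eventually (\<lambda>n. D n \<noteq> 0) sequentially"
    by (rule tendsto_imp_eventually_ne[OF Dl]) (use b0 inv(3) in simp)
  have ev_w: "eventually (\<lambda>n. w n i \<noteq> 0) sequentially" if "i \<le> 3" for i
    by (rule tendsto_imp_eventually_ne[OF wl[OF that]]) (use w'y[OF that] b0 g(1) that in simp)
  have "(\<lambda>n. w n 0 + w n 1) \<longlonglongrightarrow> w' 0 + w' 1" by (intro tendsto_intros wl) simp_all
  moreover have "w' 0 + w' 1 = (k + 1) * (r + 1)" by (simp add: w'_def sv_def algebra_simps)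
  ultimately have "(\<lambda>n. w n 0 + w n 1) \<longlonglongrightarrow> (k + 1) * (r + 1)" by simp
  then have ev_01: "eventually (\<lambda>n. w n 0 + w n 1 \<noteq> 0) sequentially"
    by (rule tendsto_imp_eventually_ne) (use kr in simp)
  have "[:k - k1, k:] \<noteq> 0" using kr(1) by simp
  from eventually_not_root[OF this] have ev_k: "eventually (\<lambda>n. kn n \<noteq> k1) sequentially"
    by eventually_elim (auto simp: kn_def algebra_simps)
  have "eventually (\<lambda>n. (t n 0 \<noteq> 0 \<and> t n 1 \<noteq> 0 \<and> t n 2 \<noteq> 0 \<and> t n 3 \<noteq> 0) \<and>
      (w n 0 \<noteq> 0 \<and> w n 1 \<noteq> 0 \<and> w n 2 \<noteq> 0 \<and> w n 3 \<noteq> 0) \<and> D n \<noteq> 0 \<and> w n 0 + w n 1 \<noteq> 0 \<and> kn n \<noteq> k1) sequentially"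
    by (intro eventually_conj ev_t ev_w ev_D ev_01 ev_k) simp_all
  then have ev: "eventually (\<lambda>n. pt (vl (tv (t n))) \<in> ?T) sequentially"
  proof eventually_elim
    case (elim n)
    have tt: "torus (t n)" and ww: "\<forall>a\<le>3. w n a \<noteq> 0" using elim unfolding all_3 by auto
    have wsum: "w n 0 + w n 1 + w n 2 + w n 3 = 0" unfolding w_def by (rule sv_sum)
    have el: "el a (tv (t n)) = (w n 0 + w n 1) * D n ^ 3 / w n a" if "a \<le> 3" for a
      unfolding t_def D_def by (rule gs_torus[OF wsum]) (use tt that in \<open>simp_all add: t_def\<close>)
    have "(\<Sum>a\<le>3. c a / w n a) = 0"
      unfolding w_def
    proof (rule sv_section)
      show "\<forall>a\<le>3. sv (kn n) 1 (rn n) 1 a \<noteq> 0" using ww by (simp add: w_def)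
      show "c 2 * kn n * 1 * (rn n)\<^sup>2 - quad c (kn n) 1 * rn n * 1 + c 3 * kn n * 1 * 1\<^sup>2 = 0"
        using rn(1)[of n] by (simp add: R_def algebra_simps power2_eq_square)
    qed
    then have "(w n 0 + w n 1) * D n ^ 3 * (\<Sum>a\<le>3. c a / w n a) = 0" by simp
    then have "(\<Sum>a\<le>3. c a * el a (tv (t n))) = 0"
      by (simp add: el sum_distrib_left mult_ac)
    then have "pt (vl (tv (t n))) \<in> sec c" using tt torus_sec_subset by (auto simp: torus_sec_def)
    moreover have "hh (vl (tv (t n))) \<noteq> 0"
    proof -
      define m where "m = (w n 0 + w n 1) * D n ^ 3"
      have m0: "m \<noteq> 0" using elim by (simp add: m_def)
      have elm: "el a (tv (t n)) = m / w n a" if "a \<le> 3" for a unfolding m_def by (rule el[OF that])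
      have "w n 1 = kn n * w n 0" by (simp add: w_def sv_def)
      then have "m / w n 0 \<noteq> k1 * (m / w n 1)" using elim m0 kn0[of n] by (simp add: field_simps)
      moreover have "m / w n 0 + m / w n 1 \<noteq> 0"
      proof -
        have "m / w n 0 + m / w n 1 = m * (w n 0 + w n 1) / (w n 0 * w n 1)"
          using elim by (simp add: field_simps)
        then show ?thesis using elim m0 by simp
      qed
      ultimately show ?thesis
        unfolding hh_torus[OF tt] using elm ww m0 by auto
    qed
    ultimately show ?case by blast
  qed
  have gst: "torus (gs w' u v)" using gz z0 ts by simp
  have "(\<lambda>n. tv (t n) j) \<longlonglongrightarrow> tv (gs w' u v) j" if j: "j \<le> 13" for j
    unfolding tv_def val_def tu_def using qi_fi_se[OF j] gst
    by (auto intro!: tendsto_intros tl)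
  then have "pt (vl (tv (gs w' u v))) \<in> clo 13 ?T"
    by (intro clo_limit_eventually[OF ev vl_tendsto] torus_vec gst)
  moreover have "vl (tv (gs w' u v)) = (\<lambda>i. z\<^sup>2 * vl (tv s) i)"
  proof -
    have "vl (tv (gs w' u v)) = vl (tv (\<lambda>i. z * s i))" by (intro vl_cong tv_cong gz)
    then show ?thesis unfolding tv_scale[OF ts z0] vl_scale .
  qed
  ultimately show "P \<in> clo 13 ?T" using z0 by (simp add: s(1))
qed

text \<open>The product of the curve of the ratio \<open>k\<close> with the line of the ratio \<open>(s\<^sub>0 - s\<^sub>1) : (s\<^sub>2 - s\<^sub>3)\<close>.\<close>

definition phi :: "(nat \<Rightarrow> complex) \<Rightarrow> nat \<Rightarrow> complex" where
  "phi x = (let y = \<lambda>a. el a (X x); t = y 0 - k1 * y 1 in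
     seg (X x (qi 0 2) - X x (qi 0 3)) (X x (qi 0 0) - X x (qi 0 1))
       (wv (y 1 * y 2 * y 3 * t) (y 0 * y 1 * (c 2 * (y 2)\<^sup>2 - c 3 * (y 3)\<^sup>2)) (y 2 * y 3 * t\<^sup>2)))"

text \<open>The pieces of the inverse of phi: \<open>zk z\<close> : z 0 is the ratio y 0 : y 1, and
  \<open>zr z\<close> : \<open>zm z\<close> is the ratio y 2 : y 3, given by the quadratic formula
  for r with z 1 * z 2 as the square root of the discriminant. Then \<open>zw\<close> holds the
  reciprocals, and in \<open>zs\<close> the fibre coordinate is z 3 : z 0, the ratio of the two
  Segre blocks.\<close>

definition zk :: "(nat \<Rightarrow> complex) \<Rightarrow> complex" where
  "zk z = k1 * z 0 + z 2"

definition zr :: "(nat \<Rightarrow> complex) \<Rightarrow> complex" where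
  "zr z = quad c (zk z) (z 0) + z 1 * z 2"

definition zm :: "(nat \<Rightarrow> complex) \<Rightarrow> complex" where
  "zm z = 2 * c 2 * zk z * z 0"

definition zw :: "(nat \<Rightarrow> complex) \<Rightarrow> nat \<Rightarrow> complex" where
  "zw z = sv (zk z) (z 0) (zr z) (zm z)"

definition zs :: "(nat \<Rightarrow> complex) \<Rightarrow> nat \<Rightarrow> complex" where
  "zs z i = (if i \<le> 3 then gs (zw z) (z 0) (z 3) i else 0)"

text \<open>The sextics are evaluated instead of \<open>tv\<close>, which has denominators, so that
  psi is given by forms, of degree 12 times 6.\<close>

definition psi :: "(nat \<Rightarrow> complex) \<Rightarrow> nat \<Rightarrow> complex" where
  "psi z = vl (\<lambda>k. mpeval (sx k) (zs z))"

definition zd :: "(nat \<Rightarrow> complex) \<Rightarrow> complex" where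
  "zd z = zw z 0 * zw z 1 * (z 3)\<^sup>2 - zw z 2 * zw z 3 * (z 0)\<^sup>2"

text \<open>The factors are quantities that have to be invertible on the scroll side. The last four
  put the image in the torus; the others are denominators in the comparison of phi with psi.\<close>

definition hz :: "(nat \<Rightarrow> complex) \<Rightarrow> complex" where
  "hz z = z 0 * (z 2 * (zk z * (zr z * ((zr z + zm z) * ((zk z + z 0) * (zd z *
     (zs z 0 * (zs z 1 * (zs z 2 * zs z 3)))))))))"

lemma hform_z: "hform 5 1 zk" "hform 5 2 zr" "hform 5 2 zm"
proof -
  have v: "hform 5 1 (\<lambda>z. z i)" if "i \<le> 5" for i by (rule hform_var[OF that])
  show k: "hform 5 1 zk" unfolding zk_def by (intro hform_add hform_cmult v) simp_all
  have m: "hform 5 2 (\<lambda>z. \<phi> z * \<psi> z)" if "hform 5 1 \<phi>" "hform 5 1 \<psi>" for \<phi> \<psi>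
    by (rule hform_mult[OF that]) simp
  show "hform 5 2 zr" unfolding zr_def quad_def power2_eq_square mult.assoc
    by (intro hform_add hform_cmult m v k) simp_all
  show "hform 5 2 zm" unfolding zm_def mult.assoc by (intro hform_cmult m v k) simp
qed

lemma hform_zw: "i \<le> 3 \<Longrightarrow> hform 5 3 (\<lambda>z. zw z i)"
proof -
  assume i: "i \<le> 3"
  have v: "hform 5 1 (\<lambda>z. z 0)" by (rule hform_var) simp
  have m: "hform 5 3 (\<lambda>z. \<phi> z * \<psi> z)" "hform 5 3 (\<lambda>z. - \<psi> z * \<phi> z)"
    if "hform 5 1 \<phi>" "hform 5 2 \<psi>" for \<phi> \<psi>
    by (rule hform_mult[OF that], simp, rule hform_mult[OF hform_uminus[OF that(2)] that(1)], simp)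
  have s: "hform 5 1 (\<lambda>z. zk z + z 0)" "hform 5 2 (\<lambda>z. zr z + zm z)" by (intro hform_add hform_z v)+
  have "zw z = sv (zk z) (z 0) (zr z) (zm z)" for z by (simp add: zw_def)
  then have w: "zw z 0 = z 0 * (zr z + zm z)" "zw z 1 = zk z * (zr z + zm z)"
    "zw z 2 = - zm z * (zk z + z 0)" "zw z 3 = - zr z * (zk z + z 0)" for z
    by (simp_all add: sv_def)
  show ?thesis using le_3_cases[OF i]
    by (elim disjE; simp only: w; intro m s hform_z v)
qed

lemma hform_zs: "hform 5 12 (\<lambda>z. zs z i)"
proof (cases "i \<le> 3")
  case True
  have v: "hform 5 1 (\<lambda>z. z i)" if "i \<le> 5" for i by (rule hform_var[OF that])
  have wz: "hform 5 4 (\<lambda>z. zw z i * z j)" if "i \<le> 3" "j \<le> 5" for i j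
    by (rule hform_mult[OF hform_zw[OF that(1)] v[OF that(2)]]) simp
  have m: "hform 5 12 (\<lambda>z. \<phi> z * \<psi> z * \<chi> z)" if "hform 5 4 \<phi>" "hform 5 4 \<psi>" "hform 5 4 \<chi>" for \<phi> \<psi> \<chi>
    by (rule hform_mult[OF hform_mult[OF that(1,2) refl] that(3)]) simp
  show ?thesis
    using le_3_cases[OF True]
    by (elim disjE) (simp_all only: zs_def gs_def, simp_all,
      (intro m hform_add hform_diff hform_uminus wz; simp)+)
next
  case False
  then show ?thesis by (simp add: zs_def hform_zero)
qed

lemma hmap_psi: "hmap 5 13 72 psi"
proof -
  have zs: "hmap 5 3 12 zs" unfolding hmap_def by (intro conjI allI impI hform_zs) (simp add: zs_def)
  have "hform 5 72 (\<lambda>z. mpeval (sx k) (zs z))" if "k \<le> 13" for k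
    using hform_compose[OF hform_mpeval[OF sx_form[OF that]] zs] by simp
  then show ?thesis by (auto simp: hmap_def psi_def vl_def intro!: hform_sum hform_cmult)
qed

lemma hform_hz: "hform 5 (1 + (1 + (1 + (2 + (2 + (1 + (8 + (12 + (12 + (12 + 12)))))))))) hz"
proof -
  have v: "hform 5 1 (\<lambda>z. z i)" if "i \<le> 5" for i by (rule hform_var[OF that])
  have "hform 5 8 zd"
    unfolding zd_def power2_eq_square
    by (intro hform_diff; rule hform_mult[OF hform_mult[OF hform_zw hform_zw refl] hform_mult[OF v v refl]]; simp)
  then show ?thesis
    unfolding hz_def by (intro hform_mult[OF _ _ refl] hform_add hform_z v hform_zs) simp_all
qed

lemma hmap_phi: "hmap 13 5 5 phi"
proof -
  define y where "y a x = el a (X x)" for a x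
  define t where "t x = y 0 x - k1 * y 1 x" for x
  have e: "hform 13 1 (y a)" for a unfolding y_def by (rule hform_el)
  have t: "hform 13 1 t" unfolding t_def by (intro hform_diff hform_cmult e)
  have m: "hform 13 2 (\<lambda>z. \<phi> z * \<psi> z)" if "hform 13 1 \<phi>" "hform 13 1 \<psi>" for \<phi> \<psi>
    by (rule hform_mult[OF that]) simp
  have m4: "hform 13 4 (\<lambda>z. \<phi> z * \<psi> z)" if "hform 13 2 \<phi>" "hform 13 2 \<psi>" for \<phi> \<psi>
    by (rule hform_mult[OF that]) simp
  define b0 b1 b2 where "b0 x = y 1 x * y 2 x * (y 3 x * t x)"
    and "b1 x = y 0 x * y 1 x * (c 2 * (y 2 x * y 2 x) - c 3 * (y 3 x * y 3 x))"
    and "b2 x = y 2 x * y 3 x * (t x * t x)" for x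
  have "hform 13 4 b0" "hform 13 4 b1" "hform 13 4 b2"
    unfolding b0_def b1_def b2_def by (intro m m4 e t hform_diff hform_cmult)+
  then have b: "hform 13 4 (\<lambda>x. wv (b0 x) (b1 x) (b2 x) i)" for i
    unfolding wv_def by (cases "i = 0"; cases "i = 1"; cases "i = 2") (simp_all add: hform_zero)
  have phi: "phi x = seg (X x (qi 0 2) - X x (qi 0 3)) (X x (qi 0 0) - X x (qi 0 1)) (wv (b0 x) (b1 x) (b2 x))" for x
    by (simp add: phi_def Let_def b0_def b1_def b2_def y_def t_def power2_eq_square mult_ac)
  have p: "hform 13 5 (\<lambda>x. (X x i - X x j) * wv (b0 x) (b1 x) (b2 x) l)" for i j l
    by (rule hform_mult[OF hform_diff[OF hform_X hform_X] b]) simp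
  have "hform 13 5 (\<lambda>x. phi x i)" if "i \<le> 5" for i
    unfolding phi seg_def by (cases "i \<le> 2") (use p that in simp_all)
  then show ?thesis by (simp add: hmap_def phi seg_def)
qed

lemma phi_torus:
  "phi (vl (tv s)) = (let y = \<lambda>a. el a (tv s); t = y 0 - k1 * y 1 in
     seg (s 0 * (s 2 - s 3)) (s 0 * (s 0 - s 1))
       (wv (y 1 * y 2 * y 3 * t) (y 0 * y 1 * (c 2 * (y 2)\<^sup>2 - c 3 * (y 3)\<^sup>2)) (y 2 * y 3 * t\<^sup>2)))"
  by (simp add: phi_def el_vl X_torus_qi right_diff_distrib)

lemma psi_torus:
  assumes "torus (zs z)" "\<And>i. i \<le> 3 \<Longrightarrow> zs z i = b * t i" "b \<noteq> 0"
  shows "psi z = (\<lambda>i. (zs z 0 * zs z 1 * zs z 2 * zs z 3 * b\<^sup>2) * vl (tv t) i)"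
  unfolding psi_def vl_scale[symmetric] by (rule vl_cong, rule sx_eval_gen[OF assms])

text \<open>In affine terms the point on the cubic has x = y 1 / t = 1 / (k - k1), and its ordinate
  is 2 c2 k r - q, a square root of the discriminant, divided by (k - k1)^2; the form used in phi
  comes from eliminating q by the quadratic relation. Feeding this back through \<open>zk\<close>,
  \<open>zr\<close>, \<open>zm\<close> recovers both ratios up to nonzero factors.\<close>

lemma phi_gen:
  assumes s: "gen s" and sec: "(\<Sum>a\<le>3. c a * el a (tv s)) = 0" and ne: "el 0 (tv s) \<noteq> k1 * el 1 (tv s)"
  defines "z \<equiv> phi (vl (tv s))"
  shows "pt z \<in> scroll curve.C" "hz z \<noteq> 0" "\<exists>e. e \<noteq> 0 \<and> psi z = (\<lambda>i. e * vl (tv s) i)"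
proof -
  define y where "y a = el a (tv s)" for a
  note g = gen_el[OF s, folded y_def]
  have ts: "torus s" using s by (simp add: gen_def)
  have yn: "y 0 \<noteq> 0" "y 1 \<noteq> 0" "y 2 \<noteq> 0" "y 3 \<noteq> 0" using g(1) by auto
  have sd: "s 0 \<noteq> 0" "s 2 - s 3 \<noteq> 0" "s 0 - s 1 \<noteq> 0" using s by (auto simp: gen_def)
  have cn: "c 2 \<noteq> 0" using c by simp
  define t where "t = y 0 - k1 * y 1"
  have t0: "t \<noteq> 0" using ne by (simp add: t_def y_def)
  define a b where "a = s 0 * (s 2 - s 3)" and "b = s 0 * (s 0 - s 1)"
  have ab: "a \<noteq> 0" "b \<noteq> 0" using sd by (simp_all add: a_def b_def)
  define b0 b1 b2 where "b0 = y 1 * y 2 * y 3 * t"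
    and "b1 = y 0 * y 1 * (c 2 * (y 2)\<^sup>2 - c 3 * (y 3)\<^sup>2)" and "b2 = y 2 * y 3 * t\<^sup>2"
  have z: "z = seg a b (wv b0 b1 b2)"
    by (simp add: z_def phi_torus Let_def y_def t_def a_def b_def b0_def b1_def b2_def)
  have bn: "b0 \<noteq> 0" "b2 \<noteq> 0" using yn t0 by (simp_all add: b0_def b2_def)
  have zc: "z 0 = a * b0" "z 1 = a * b1" "z 2 = a * b2" "z 3 = b * b0"
    by (simp_all add: z seg_def)
  have rel: "quad c (y 0) (y 1) * (y 2 * y 3) = (c 2 * (y 2)\<^sup>2 + c 3 * (y 3)\<^sup>2) * (y 0 * y 1)"
    by (rule section_relation) (use g(2) sec in \<open>simp_all add: y_def\<close>)
  define m where "m = y 2 * y 3 * t"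
  have K: "k1 * b0 + b2 = m * y 0" "b0 = m * y 1"
    by (simp_all add: b0_def b2_def m_def t_def algebra_simps power2_eq_square)
  have qs: "quad c (d * y 0) (d * y 1) = d\<^sup>2 * quad c (y 0) (y 1)" for d
    by (simp add: quad_def algebra_simps power2_eq_square)
  have q: "quad c (y 0) (y 1) = (c 2 * (y 2)\<^sup>2 + c 3 * (y 3)\<^sup>2) * (y 0 * y 1) / (y 2 * y 3)"
    using rel yn by (simp add: field_simps)
  have b12: "b1 * b2 = m\<^sup>2 * ((c 2 * (y 2)\<^sup>2 - c 3 * (y 3)\<^sup>2) * (y 0 * y 1) / (y 2 * y 3))"
    using yn by (simp add: b1_def b2_def m_def power2_eq_square)
  show "pt z \<in> scroll curve.C"
  proof -
    have "mpeval curve.F (wv b0 b1 b2) = 0"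
    proof -
      have "b2 * mpeval curve.F (wv b0 b1 b2) = (b1 * b2)\<^sup>2
          - ((quad c (k1 * b0 + b2) b0)\<^sup>2 - 4 * c 2 * c 3 * ((k1 * b0 + b2) * b0)\<^sup>2)"
        using curve_quartic[of "wv b0 b1 b2"] by simp
      also have "\<dots> = m ^ 4 * (((c 2 * (y 2)\<^sup>2 - c 3 * (y 3)\<^sup>2) * (y 0 * y 1) / (y 2 * y 3))\<^sup>2
          - ((c 2 * (y 2)\<^sup>2 + c 3 * (y 3)\<^sup>2) * (y 0 * y 1) / (y 2 * y 3))\<^sup>2 + 4 * c 2 * c 3 * (y 0 * y 1)\<^sup>2)"
        unfolding K(1) unfolding K(2) qs b12 q by algebra
      also have "\<dots> = 0"
        using yn by (simp add: field_simps) (simp add: algebra_simps power2_eq_square)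
      finally show ?thesis using bn by simp
    qed
    moreover have "vec 2 (wv b0 b1 b2)" unfolding vec_2_wv using bn by blast
    ultimately have "pt (wv b0 b1 b2) \<in> curve.C" by (simp add: curve.mem_C)
    then show ?thesis unfolding scroll_def z using ab by blast
  qed
  define n where "n = 2 * c 2 * (a * m)\<^sup>2 * (y 0 * y 1) / y 3"
  have amn: "a * m \<noteq> 0" "n \<noteq> 0" using ab yn t0 cn by (simp_all add: m_def n_def)
  have "zk z = a * (k1 * b0 + b2)" by (simp add: zk_def zc algebra_simps)
  then have zk: "zk z = a * m * y 0" "z 0 = a * m * y 1"
    unfolding K(1) unfolding zc K(2) by simp_all
  have zm: "zm z = n * y 3" unfolding zm_def zk n_def using yn by (simp add: power2_eq_square)
  have "zr z = (a * m)\<^sup>2 * quad c (y 0) (y 1) + a\<^sup>2 * (b1 * b2)"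
    unfolding zr_def zk(1) zk(2) qs zc by (simp add: power2_eq_square)
  also have "\<dots> = n * y 2"
    unfolding q b12 n_def using yn by (simp add: field_simps) (simp add: algebra_simps power2_eq_square)
  finally have zr: "zr z = n * y 2" .
  define w where "w = a * m * n * (y 0 * y 1 * (y 2 + y 3))"
  have w0: "w \<noteq> 0" using amn yn g(4) by (simp add: w_def)
  have zw: "zw z i = w * (1 / y i)" if "i \<le> 3" for i
    unfolding zw_def zk zr zm w_def by (rule sv_inverse[OF g(2,1) that])
  define \<sigma> \<rho> where "\<sigma> = s 0 * s 1 - s 2 * s 3" and "\<rho> = (s 0 - s 2) * (s 0 - s 3) * (s 1 - s 2) * (s 1 - s 3)"
  note inv = gs_inverse[OF s, folded y_def \<sigma>_def \<rho>_def]
  define e where "e = w ^ 3 * (s 0 * b0) ^ 3 * (\<sigma> / \<rho>)\<^sup>2"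
  have e0: "e \<noteq> 0" using w0 sd bn inv(3) by (simp add: e_def)
  have z03: "z 0 = s 0 * b0 * (s 2 - s 3)" "z 3 = s 0 * b0 * (s 0 - s 1)"
    by (simp_all add: zc a_def b_def)
  have zs: "zs z i = e * s i" if "i \<le> 3" for i
  proof -
    have "zs z i = gs (\<lambda>i. w * (1 / y i)) (z 0) (z 3) i"
      using gs_cong[of "zw z" "\<lambda>i. w * (1 / y i)"] zw that by (simp add: zs_def)
    also have "\<dots> = e * s i" unfolding z03 gs_scale[OF that] inv(1)[OF that] e_def by simp
    finally show ?thesis .
  qed
  have ts': "torus (zs z)" using zs e0 ts by simp
  have "zd z = w\<^sup>2 * (s 0 * b0)\<^sup>2 * (- \<sigma> / \<rho>)"
    unfolding inv(2)[symmetric] by (simp add: zd_def zw z03 power2_eq_square algebra_simps)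
  then have zd: "zd z \<noteq> 0" using w0 sd bn inv(3) by simp
  have "zr z + zm z = n * (y 2 + y 3)" "zk z + z 0 = a * m * (y 0 + y 1)"
    unfolding zr zm zk by (simp_all add: distrib_left)
  then have "zr z + zm z \<noteq> 0" "zk z + z 0 \<noteq> 0" using amn g(3,4) by simp_all
  moreover have "z 0 \<noteq> 0" "z 2 \<noteq> 0" unfolding zc using ab bn by simp_all
  moreover have "zk z \<noteq> 0" "zr z \<noteq> 0" unfolding zk zr using amn yn by simp_all
  moreover have "zs z 0 \<noteq> 0" "zs z 1 \<noteq> 0" "zs z 2 \<noteq> 0" "zs z 3 \<noteq> 0" using ts' by auto
  ultimately show "hz z \<noteq> 0" unfolding hz_def using zd by simp
  have "zs z 0 * zs z 1 * zs z 2 * zs z 3 * e\<^sup>2 \<noteq> 0" using ts' e0 by simp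
  then show "\<exists>e. e \<noteq> 0 \<and> psi z = (\<lambda>i. e * vl (tv s) i)" using psi_torus[OF ts' zs e0] by blast
qed

text \<open>\<open>hh\<close> contains all fourteen coordinates as factors, so x is a multiple of a
  torus point, where \<open>phi_gen\<close> applies; homogeneity carries the result back to
  x.\<close>

lemma phi_sec:
  assumes x: "pt x \<in> sec c" "hh x \<noteq> 0"
  shows "pt (phi x) \<in> scroll curve.C \<and> hz (phi x) \<noteq> 0 \<and> (\<exists>e. e \<noteq> 0 \<and> psi (phi x) = (\<lambda>i. e * x i))"
proof -
  have "pt x \<in> W" using x(1) by (simp add: mem_sec)
  moreover have "X x k \<noteq> 0" if "k \<le> 13" for k using x(2) that by (auto simp: hh_def)
  ultimately obtain s g where s: "torus s" "g \<noteq> 0" "x = (\<lambda>i. g * vl (tv s) i)" using W_torus by metis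
  let ?x = "vl (tv s)" and ?z = "phi (vl (tv s))"
  have "hh ?x \<noteq> 0" using x(2) unfolding s(3) hform_homogeneous[OF hform_hh] by simp
  then have h: "\<forall>a\<le>3. el a (tv s) \<noteq> 0" "el 0 (tv s) \<noteq> k1 * el 1 (tv s)" "el 0 (tv s) + el 1 (tv s) \<noteq> 0"
    unfolding hh_torus[OF s(1)] by simp_all
  have "pt ?x \<in> sec c" using x(1) s(2) by (simp add: s(3))
  then have sum: "(\<Sum>a\<le>3. c a * el a (tv s)) = 0" by (simp add: mem_sec el_vl)
  note p = phi_gen[OF genI[OF s(1) h(1,3)] sum h(2)]
  have px: "phi x = (\<lambda>i. g ^ 5 * ?z i)" unfolding s(3) by (rule hmap_homogeneous[OF hmap_phi])
  have g5: "g ^ 5 \<noteq> 0" using s(2) by simp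
  have 1: "pt (phi x) \<in> scroll curve.C" unfolding px using p(1) g5 by simp
  have 2: "hz (phi x) \<noteq> 0" unfolding px hform_homogeneous[OF hform_hz] using p(2) g5 by simp
  obtain e where e: "e \<noteq> 0" "psi ?z = (\<lambda>i. e * ?x i)" using p(3) by blast
  have "psi (phi x) = (\<lambda>i. (g ^ 5) ^ 72 * (e * ?x i))"
    unfolding px hmap_homogeneous[OF hmap_psi] e(2) ..
  then have "psi (phi x) = (\<lambda>i. ((g ^ 5) ^ 72 * e / g) * x i)"
    unfolding s(3) using s(2) by (simp add: fun_eq_iff)
  then show ?thesis using 1 2 e(1) s(2) by (intro conjI exI[of _ "(g ^ 5) ^ 72 * e / g"]) simp_all
qed

lemma psi_scroll:
  assumes z: "pt z \<in> scroll curve.C" "hz z \<noteq> 0"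
  shows "pt (psi z) \<in> sec c" "\<exists>e. e \<noteq> 0 \<and> phi (psi z) = (\<lambda>i. e * z i)"
proof -
  have nz: "z 0 \<noteq> 0" "z 2 \<noteq> 0" "zk z \<noteq> 0" "zr z \<noteq> 0" "zr z + zm z \<noteq> 0" "zk z + z 0 \<noteq> 0" "zd z \<noteq> 0"
    "zs z 0 \<noteq> 0" "zs z 1 \<noteq> 0" "zs z 2 \<noteq> 0" "zs z 3 \<noteq> 0"
    using z(2) unfolding hz_def by (simp_all only: mult_eq_0_iff de_Morgan_disj simp_thms)
  have cn: "c 2 \<noteq> 0" using c by simp
  have m0: "zm z \<noteq> 0" using cn nz by (simp add: zm_def)
  define K L R M where "K = zk z" and "L = z 0" and "R = zr z" and "M = zm z"
  note KLRM = K_def[symmetric] L_def[symmetric] R_def[symmetric] M_def[symmetric]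
  note n = nz(1-6)[unfolded KLRM] m0[unfolded KLRM]
  define q where "q = quad c K L"
  have R: "R = q + z 1 * z 2" by (simp add: R_def zr_def q_def K_def L_def)
  have M: "M = 2 * c 2 * K * L" by (simp add: M_def zm_def K_def L_def)
  have "part 0 z 0 = z 0" "part 0 z 1 = z 1" "part 0 z 2 = z 2" by (simp_all add: part_def)
  note p = this
  have "part 0 z \<noteq> (\<lambda>_. 0)" using p(1) nz(1) by metis
  then have "pt (part 0 z) \<in> curve.C"
    using scroll_part[OF curve.C_subset z(1), of 0] by simp
  then have "mpeval curve.F (part 0 z) = 0" by (simp add: curve.mem_C)
  then have "(z 1 * z 2)\<^sup>2 - ((quad c (k1 * z 0 + z 2) (z 0))\<^sup>2 - 4 * c 2 * c 3 * ((k1 * z 0 + z 2) * z 0)\<^sup>2) = 0"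
    using curve_quartic[of "part 0 z"] unfolding p by simp
  then have eq: "(z 1 * z 2)\<^sup>2 = q\<^sup>2 - 4 * c 2 * c 3 * (K * L)\<^sup>2"
    by (simp add: q_def K_def L_def zk_def)
  \<comment> \<open>R / M is the root of the quadratic for which z 1 * z 2 is the chosen square root
    of the discriminant.\<close>
  have conic: "c 2 * K * L * R\<^sup>2 - q * R * M + c 3 * K * L * M\<^sup>2 = 0"
    using eq R M by algebra
  \<comment> \<open>This recovers the middle coordinate of the curve point from the two
    ratios.\<close>
  have diff: "c 2 * R\<^sup>2 - c 3 * M\<^sup>2 = 2 * c 2 * (z 1 * z 2) * R"
    using eq R M by algebra
  define w where "w = zw z"
  have w: "w 0 = L * (R + M)" "w 1 = K * (R + M)" "w 2 = - M * (K + L)" "w 3 = - R * (K + L)"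
    by (simp_all add: w_def zw_def sv_def K_def L_def R_def M_def)
  have wn: "\<forall>a\<le>3. w a \<noteq> 0" unfolding all_3 w using n by simp
  have wsum: "w 0 + w 1 + w 2 + w 3 = 0" unfolding w by (simp add: algebra_simps)
  define s where "s = gs w (z 0) (z 3)"
  have zs: "zs z i = 1 * s i" if "i \<le> 3" for i using that by (simp add: zs_def s_def w_def)
  have tz: "torus (zs z)" using nz unfolding all_3 by simp
  have ts: "torus s" using tz zs by simp
  define D where "D = w 0 * w 1 * (z 3)\<^sup>2 - w 2 * w 3 * (z 0)\<^sup>2"
  have D0: "D \<noteq> 0" using nz(7) by (simp add: D_def zd_def w_def)
  define k where "k = (w 0 + w 1) * D ^ 3"
  have "w 0 + w 1 = (K + L) * (R + M)" unfolding w by (simp add: algebra_simps)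
  then have w01: "w 0 + w 1 \<noteq> 0" using n by simp
  have k0: "k \<noteq> 0" using w01 D0 by (simp add: k_def)
  have el: "el a (tv s) = k / w a" if "a \<le> 3" for a
    unfolding s_def k_def D_def by (rule gs_torus[OF wsum _ that]) (use ts in \<open>simp add: s_def\<close>)
  define e where "e = zs z 0 * zs z 1 * zs z 2 * zs z 3 * 1\<^sup>2"
  have e0: "e \<noteq> 0" using tz by (simp add: e_def)
  have psi: "psi z = (\<lambda>i. e * vl (tv s) i)" unfolding e_def by (rule psi_torus[OF tz zs one_neq_zero])
  have "(\<Sum>a\<le>3. c a / w a) = 0"
    unfolding w_def zw_def KLRM
  proof (rule sv_section)
    show "\<forall>a\<le>3. sv K L R M a \<noteq> 0" using wn by (simp add: w_def zw_def K_def L_def R_def M_def)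
  qed (use conic in \<open>simp add: q_def\<close>)
  then have "k * (\<Sum>a\<le>3. c a / w a) = 0" by simp
  then have "(\<Sum>a\<le>3. c a * el a (tv s)) = 0" by (simp add: el sum_distrib_left mult_ac)
  then have "pt (vl (tv s)) \<in> sec c" using ts torus_sec_subset by (auto simp: torus_sec_def)
  then show "pt (psi z) \<in> sec c" unfolding psi using e0 by simp
  define y where "y a = el a (tv s)" for a
  have y: "y 0 = k / (L * (R + M))" "y 1 = k / (K * (R + M))" "y 2 = - k / (M * (K + L))" "y 3 = - k / (R * (K + L))"
    using el[of 0, unfolded w] el[of 1, unfolded w] el[of 2, unfolded w] el[of 3, unfolded w]
    by (simp_all add: y_def)
  define T S where "T = R + M" and "S = K + L"
  note TS = T_def[symmetric] S_def[symmetric]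
  note n' = n[unfolded TS]
  define t where "t = y 0 - k1 * y 1"
  have "K - k1 * L = z 2" by (simp add: K_def L_def zk_def)
  moreover have "t = k * (K - k1 * L) / (K * L * (R + M))" unfolding t_def y TS using n' by (simp add: field_simps)
  ultimately have t: "t = k * z 2 / (K * L * (R + M))" by simp
  define u where "u = k ^ 4 * z 2 / (K\<^sup>2 * L\<^sup>2 * (R + M)\<^sup>2 * M * R * (K + L)\<^sup>2)"
  have u0: "u \<noteq> 0" using k0 nz n by (simp add: u_def)
  have b0: "y 1 * y 2 * y 3 * t = u * z 0"
    unfolding t y u_def L_def[symmetric] TS using n' by (simp add: field_simps power2_eq_square eval_nat_numeral)
  have b2: "y 2 * y 3 * t\<^sup>2 = u * z 2"
    unfolding t y u_def TS using n' by (simp add: field_simps power2_eq_square eval_nat_numeral)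
  have b1: "y 0 * y 1 * (c 2 * (y 2)\<^sup>2 - c 3 * (y 3)\<^sup>2) = u * z 1"
  proof -
    have "y 0 * y 1 * (c 2 * (y 2)\<^sup>2 - c 3 * (y 3)\<^sup>2) = k ^ 4 * (c 2 * R\<^sup>2 - c 3 * M\<^sup>2) / (K * L * T\<^sup>2 * S\<^sup>2 * M\<^sup>2 * R\<^sup>2)"
      unfolding y TS using n' by (simp add: field_simps power2_eq_square eval_nat_numeral)
    also have "\<dots> = k ^ 4 * (2 * c 2 * K * L) * (z 1 * z 2) / (K\<^sup>2 * L\<^sup>2 * T\<^sup>2 * S\<^sup>2 * M\<^sup>2 * R)"
      unfolding diff using n' by (simp add: field_simps power2_eq_square)
    also have "\<dots> = u * z 1"
      unfolding M[symmetric] u_def TS using n' by (simp add: field_simps power2_eq_square)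
    finally show ?thesis .
  qed
  note d = gs_diff[OF wsum, of "z 0" "z 3", folded s_def D_def]
  define A where "A = s 0 * ((w 0 + w 1) * D)"
  have A0: "A \<noteq> 0" using ts w01 D0 by (simp add: A_def)
  have "s 0 * (s 2 - s 3) = A * z 0" "s 0 * (s 0 - s 1) = A * z 3"
    unfolding d A_def by simp_all
  then have phi: "phi (vl (tv s)) = seg (A * z 0) (A * z 3) (wv (u * z 0) (u * z 1) (u * z 2))"
    unfolding phi_torus Let_def y_def[symmetric] t_def[symmetric] b0 b1 b2 by simp
  have vz: "vec 5 z" using z(1) scroll_subset_proj[OF curve.C_subset] by auto
  \<comment> \<open>phi returns z 3 * z j in the second block where z 0 * z (j + 3) is wanted; the
    minors of the Segre embedding identify them.\<close>
  have minor: "z 3 * z j = z 0 * z (j + 3)" if "j \<le> 2" for j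
    using scroll_minors[OF curve.C_subset z(1), of 0 j 0 3] that by (simp add: mult.commute)
  have phi': "phi (vl (tv s)) = (\<lambda>i. (A * u * z 0) * z i)"
  proof (rule ext)
    fix i :: nat
    consider "i = 0" | "i = 1" | "i = 2" | "i = 3" | "i = 4" | "i = 5" | "i > 5" by linarith
    then show "phi (vl (tv s)) i = (A * u * z 0) * z i"
    proof cases
      case 5 then show ?thesis using minor[of 1] by (simp add: phi seg_def)
    next
      case 6 then show ?thesis using minor[of 2] by (simp add: phi seg_def)
    next
      case 7 then show ?thesis using vz by (simp add: phi seg_def vec_def)
    qed (simp_all add: phi seg_def)
  qed
  have "phi (psi z) = (\<lambda>i. (e ^ 5 * (A * u * z 0)) * z i)"
    unfolding psi hmap_homogeneous[OF hmap_phi] phi' by (simp add: mult.assoc)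
  then show "\<exists>e. e \<noteq> 0 \<and> phi (psi z) = (\<lambda>i. e * z i)"
    using e0 A0 u0 nz(1) by (intro exI[of _ "e ^ 5 * (A * u * z 0)"]) simp
qed

text \<open>The points with \<open>hh x \<noteq> 0\<close> are dense in the section, through generic
  points and torus points, and all of them are images under psi. So irreducibility of the section is
  inherited from the scroll, and then phi and psi are inverse to each other on open subsets of two
  varieties.\<close>

lemma section_birational: "birational 13 (sec c) 5 (scroll curve.C)"
proof -
  let ?T = "{pt x | x. pt x \<in> sec c \<and> hh x \<noteq> 0}"
  have "gen_sec c \<subseteq> clo 13 ?T" by (rule gen_sec_dense)
  then have "torus_sec c \<subseteq> clo 13 ?T" using torus_sec_dense[OF c] clo_trans by blast
  then have dense: "sec c \<subseteq> clo 13 ?T" using sec_dense[OF c(1)] clo_trans by blast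
  have "clo 13 {} = {}" using clo_minimal[OF zclosed_empty, of "{}" 13] by blast
  have "?T \<noteq> {}"
  proof
    assume T: "?T = {}"
    have "gen_sec c \<subseteq> {}" using gen_sec_dense unfolding T \<open>clo 13 {} = {}\<close> .
    then show False using gen_sec_nonempty[OF c] by blast
  qed
  then obtain x0 where x0: "pt x0 \<in> sec c" "hh x0 \<noteq> 0" by blast
  have T: "?T \<subseteq> {pt (psi z) | z. pt z \<in> scroll curve.C \<and> hz z \<noteq> 0}"
  proof
    fix P assume "P \<in> ?T"
    then obtain x where x: "P = pt x" "pt x \<in> sec c" "hh x \<noteq> 0" by blast
    note p = phi_sec[OF x(2,3)]
    then have "pt (psi (phi x)) = P" using x(1) by auto
    then show "P \<in> {pt (psi z) | z. pt z \<in> scroll curve.C \<and> hz z \<noteq> 0}" using p by blast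
  qed
  have Y: "variety 5 (scroll curve.C)" by (rule variety_scroll[OF curve.variety_C])
  have X: "variety 13 (sec c)"
  proof (rule variety_imageI[OF Y hmap_psi hform_hz zclosed_sec])
    show "sec c \<subseteq> clo 13 {pt (psi z) | z. pt z \<in> scroll curve.C \<and> hz z \<noteq> 0}"
      using dense clo_mono[OF T] by blast
  qed (use phi_sec[OF x0] psi_scroll(1) in blast)+
  show ?thesis
    by (rule birationalI[OF X Y hmap_phi hmap_psi hform_hh hform_hz phi_sec psi_scroll(1) psi_scroll(2) x0])
qed

end

text \<open>Nonvanishing makes the four roots of the quartic distinct.\<close>

definition sec_disc :: "(nat \<Rightarrow> complex) \<Rightarrow> complex" where
  "sec_disc c = ((c 0 + c 1 - c 2 - c 3)\<^sup>2 + 4 * (c 2 * c 3) - 4 * (c 0 * c 1))\<^sup>2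
     - 16 * ((c 0 + c 1 - c 2 - c 3)\<^sup>2 * (c 2 * c 3))"

lemma quadratic_roots:
  fixes a b d :: complex
  assumes "a \<noteq> 0"
  obtains x y where "\<And>K L. a * K\<^sup>2 + b * K * L + d * L\<^sup>2 = a * ((K - x * L) * (K - y * L))"
    "b\<^sup>2 - 4 * a * d = a\<^sup>2 * (x - y)\<^sup>2"
proof -
  define r where "r = csqrt (b\<^sup>2 - 4 * a * d)"
  have r: "r\<^sup>2 = b\<^sup>2 - 4 * a * d" by (simp add: r_def)
  define x y where "x = (- b + r) / (2 * a)" and "y = (- b - r) / (2 * a)"
  have xy: "a * (x + y) = - b" "a * (x - y) = r" "a * (x * y) = d"
  proof -
    show "a * (x + y) = - b" "a * (x - y) = r" using assms by (simp_all add: x_def y_def field_simps)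
    have "x * y = (b\<^sup>2 - r\<^sup>2) / (4 * a\<^sup>2)" by (simp add: x_def y_def power2_eq_square algebra_simps)
    then show "a * (x * y) = d" unfolding r using assms by (simp add: field_simps power2_eq_square)
  qed
  show ?thesis
  proof (rule that[of x y])
    show "a * K\<^sup>2 + b * K * L + d * L\<^sup>2 = a * ((K - x * L) * (K - y * L))" for K L
      using xy(1,3) by algebra
    show "b\<^sup>2 - 4 * a * d = a\<^sup>2 * (x - y)\<^sup>2" using r xy(2) by algebra
  qed
qed

text \<open>With p a square root of 4 c2 c3, the quartic splits into the two quadratics q - p K L
  and q + p K L. The product of their discriminants is \<open>sec_disc c\<close>, so each has
  distinct roots; a common root would have to be k = 0, which is excluded by c 1 \<noteq> 0.\<close>

lemma (in frame) section_elliptic: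
  assumes c: "torus c" "c 0 \<noteq> c 1" "sec_disc c \<noteq> 0"
  shows "\<exists>n R. elliptic_ruled_surface n R \<and> birational 13 (sec c) n R"
proof -
  have cn: "c 0 \<noteq> 0" "c 1 \<noteq> 0" "c 2 \<noteq> 0" "c 3 \<noteq> 0" using c(1) by auto
  define e where "e = c 0 + c 1 - c 2 - c 3"
  define p where "p = csqrt (4 * (c 2 * c 3))"
  have p: "p\<^sup>2 = 4 * (c 2 * c 3)" by (simp add: p_def)
  then have p0: "p \<noteq> 0" using cn by auto
  obtain k1 k2 where k12: "\<And>K L. c 0 * K\<^sup>2 + (e - p) * K * L + c 1 * L\<^sup>2 = c 0 * ((K - k1 * L) * (K - k2 * L))"
    "(e - p)\<^sup>2 - 4 * c 0 * c 1 = (c 0)\<^sup>2 * (k1 - k2)\<^sup>2"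
    by (rule quadratic_roots[where b = "e - p" and d = "c 1", OF cn(1)], rule that)
  obtain k3 k4 where k34: "\<And>K L. c 0 * K\<^sup>2 + (e + p) * K * L + c 1 * L\<^sup>2 = c 0 * ((K - k3 * L) * (K - k4 * L))"
    "(e + p)\<^sup>2 - 4 * c 0 * c 1 = (c 0)\<^sup>2 * (k3 - k4)\<^sup>2"
    by (rule quadratic_roots[where b = "e + p" and d = "c 1", OF cn(1)], rule that)
  have "sec_disc c = ((e - p)\<^sup>2 - 4 * c 0 * c 1) * ((e + p)\<^sup>2 - 4 * c 0 * c 1)"
    unfolding sec_disc_def e_def[symmetric] using p by algebra
  then have ne: "k1 \<noteq> k2" "k3 \<noteq> k4" using c(3) unfolding k12(2) k34(2) by auto
  have cross: False if "k = k1 \<or> k = k2" "k = k3 \<or> k = k4" for k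
  proof -
    have m: "c 0 * k\<^sup>2 + (e - p) * k + c 1 = 0" using k12(1)[of k 1] that(1) by auto
    moreover have "c 0 * k\<^sup>2 + (e + p) * k + c 1 = 0" using k34(1)[of k 1] that(2) by auto
    ultimately have "2 * p * k = 0" by algebra
    then have "k = 0" using p0 by simp
    then show False using m cn by simp
  qed
  then have ne': "k1 \<noteq> k3" "k1 \<noteq> k4" "k2 \<noteq> k3" "k2 \<noteq> k4" by blast+
  have "quad_section B B' W c k1 k2 k3 k4"
  proof unfold_locales
    show "(c 0)\<^sup>2 * (k1 - k2) * (k1 - k3) * (k1 - k4) \<noteq> 0" using cn ne ne' by simp
    show "1 / (k2 - k1) \<noteq> 1 / (k3 - k1)" "1 / (k2 - k1) \<noteq> 1 / (k4 - k1)" "1 / (k3 - k1) \<noteq> 1 / (k4 - k1)"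
      using ne ne' by (simp_all add: divide_simps)
    show "(quad c K L)\<^sup>2 - 4 * c 2 * c 3 * (K * L)\<^sup>2 =
      (c 0)\<^sup>2 * ((K - k1 * L) * (K - k2 * L) * (K - k3 * L) * (K - k4 * L))" for K L
    proof -
      have "(quad c K L)\<^sup>2 - 4 * c 2 * c 3 * (K * L)\<^sup>2 =
        (c 0 * K\<^sup>2 + (e - p) * K * L + c 1 * L\<^sup>2) * (c 0 * K\<^sup>2 + (e + p) * K * L + c 1 * L\<^sup>2)"
        unfolding quad_def e_def[symmetric] using p by algebra
      then show ?thesis unfolding k12(1) k34(1) by (simp add: power2_eq_square mult_ac)
    qed
  qed (use c in auto)
  then interpret quad_section B B' W c k1 k2 k3 k4 .
  show ?thesis using section_birational curve.elliptic_scroll by blast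
qed

section \<open>General members of the triple point system and the general point\<close>

context frame
begin

text \<open>A member with coefficients x on the basis given by A has coefficients
  \<open>dual A x\<close> on the \<open>EL a\<close>.\<close>

definition dual :: "(nat \<Rightarrow> nat \<Rightarrow> complex) \<Rightarrow> (nat \<Rightarrow> complex) \<Rightarrow> nat \<Rightarrow> complex" where
  "dual A x = (\<lambda>a. \<Sum>i\<le>3. x i * A i a)"

lemma sections_elliptic:
  assumes A: "inv4 A A'" and b: "\<And>i. i \<le> 3 \<Longrightarrow> b i = (\<Sum>j\<le>3. scale (A i j) (EL j))"
  shows "generally 3 (proj 3) (\<lambda>C. \<forall>c\<in>C. \<exists>n R. elliptic_ruled_surface n R \<and>
    birational 13 (hyp_section 13 W (\<Sum>i\<le>3. scale (c i) (b i))) n R)"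
proof -
  define h where "h y = (\<Prod>a\<le>3. y a) * ((y 0 - y 1) * sec_disc y)" for y
  have d: "hform 3 1 (\<lambda>x. dual A x a)" for a
    unfolding dual_def
    by (rule hform_sum) (auto simp: mult.commute[of _ "A _ _"] intro!: hform_cmult hform_var[unfolded One_nat_def])
  have m: "hform 3 2 (\<lambda>z. \<phi> z * \<psi> z)" if "hform 3 1 \<phi>" "hform 3 1 \<psi>" for \<phi> \<psi>
    by (rule hform_mult[OF that]) simp
  have m4: "hform 3 4 (\<lambda>z. \<phi> z * \<psi> z)" if "hform 3 2 \<phi>" "hform 3 2 \<psi>" for \<phi> \<psi>
    by (rule hform_mult[OF that]) simp
  have "hform 3 4 (\<lambda>x. sec_disc (dual A x))"
    unfolding sec_disc_def power2_eq_square
    by (intro hform_diff m4 m hform_add hform_cmult d)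
  then have hh: "hform 3 ((\<Sum>a\<le>3 :: nat. 1) + (1 + 4)) (\<lambda>x. h (dual A x))"
    unfolding h_def by (intro hform_mult[OF _ _ refl] hform_prod hform_diff d)
  have hE: "\<exists>n R. elliptic_ruled_surface n R \<and>
      birational 13 (hyp_section 13 W (\<Sum>i\<le>3. scale (x i) (b i))) n R" if "h (dual A x) \<noteq> 0" for x
  proof -
    have "(\<Sum>i\<le>3. scale (x i) (b i)) = (\<Sum>a\<le>3. scale (dual A x a) (EL a))"
      unfolding dual_def sum_scale_swap[symmetric] by (rule sum.cong) (simp_all add: b)
    then have s: "hyp_section 13 W (\<Sum>i\<le>3. scale (x i) (b i)) = sec (dual A x)" by (simp add: sec_def)
    show ?thesis unfolding s by (rule section_elliptic) (use that in \<open>auto simp: h_def\<close>)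
  qed
  \<comment> \<open>The coefficients (1, 2, 1, 1) show that the open condition is not empty: all are
    nonzero, the first two differ, and \<open>sec_disc\<close> has the value 9 - 16 = -7.\<close>
  define y :: "nat \<Rightarrow> complex" where "y a = (if a = 1 then 2 else 1)" for a
  define x0 where "x0 i = (if i \<le> 3 then \<Sum>a\<le>3. y a * A' a i else 0)" for i
  have "dual A x0 a = y a" if a: "a \<le> 3" for a
  proof -
    have "dual A x0 a = (\<Sum>i\<le>3. (\<Sum>k\<le>3. y k * A' k i) * A i a)" unfolding dual_def x0_def by simp
    also have "\<dots> = y a" by (rule matrix_cancel[OF a]) (use A in \<open>auto simp: inv4_def\<close>)
    finally show ?thesis .
  qed
  then have y: "dual A x0 0 = 1" "dual A x0 1 = 2" "dual A x0 2 = 1" "dual A x0 3 = 1"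
    by (simp_all add: y_def)
  have h0: "h (dual A x0) \<noteq> 0" unfolding h_def sec_disc_def atMost_3 using y by simp
  have "x0 \<noteq> (\<lambda>_. 0)"
  proof
    assume "x0 = (\<lambda>_. 0)"
    then show False using y(1) by (simp add: dual_def)
  qed
  then have "vec 3 x0" by (auto simp: vec_def x0_def)
  then show ?thesis
  proof (intro generallyI[OF hh])
    fix x assume x: "h (dual A x) \<noteq> 0"
    show "\<forall>c\<in>pt x. \<exists>n R. elliptic_ruled_surface n R \<and>
      birational 13 (hyp_section 13 W (\<Sum>i\<le>3. scale (c i) (b i))) n R"
    proof
      fix c assume "c \<in> pt x"
      then obtain g where g: "g \<noteq> 0" "c = (\<lambda>i. g * x i)" by (auto simp: mem_pt_iff)
      show "\<exists>n R. elliptic_ruled_surface n R \<and>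
          birational 13 (hyp_section 13 W (\<Sum>i\<le>3. scale (c i) (b i))) n R"
        by (rule hE) (use x g in \<open>simp add: hform_homogeneous[OF hh]\<close>)
    qed
  qed (use h0 in auto)
qed

lemma triple_point_at_origin:
  shows "mp.dim (triple_point_system 13 W w0) = 3 + 1"
    "is_basis b 3 (triple_point_system 13 W w0) \<Longrightarrow>
       generally 3 (proj 3) (\<lambda>C. \<forall>c\<in>C. \<exists>n R. elliptic_ruled_surface n R \<and>
         birational 13 (hyp_section 13 W (\<Sum>i\<le>3. scale (c i) (b i))) n R) \<and>
       cayley_cubic (rational_image 13 3 W b) \<and> four_nodal_cubic_surface (rational_image 13 3 W b)"
proof -
  show "mp.dim (triple_point_system 13 W w0) = 3 + 1" by (rule is_basis_dim[OF triple_basis])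
  assume "is_basis b 3 (triple_point_system 13 W w0)"
  from is_basis_change[OF this triple_basis] obtain A A' where
    b: "\<And>i. i \<le> 3 \<Longrightarrow> b i = (\<Sum>j\<le>3. scale (A i j) (EL j))" and A: "inv4 A A'"
    unfolding inv4_def by blast
  obtain F where F: "F \<in> forms 3 3" "\<And>x. mpeval F x = e3 (lin A' x)" by (rule cayley_form[of A'], rule that)
  have im: "rational_image 13 3 W b = zero_locus 3 {F}" by (rule image_W[OF A _ F]) (rule b)
  show "generally 3 (proj 3) (\<lambda>C. \<forall>c\<in>C. \<exists>n R. elliptic_ruled_surface n R \<and>
         birational 13 (hyp_section 13 W (\<Sum>i\<le>3. scale (c i) (b i))) n R) \<and>
       cayley_cubic (rational_image 13 3 W b) \<and> four_nodal_cubic_surface (rational_image 13 3 W b)"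
    unfolding im
    by (intro conjI sections_elliptic[OF A] cayley_cubic_zero_locus[OF A F] four_nodal_cayley[OF A F]) (rule b)
qed

end

theorem theorem1p1:
  fixes W :: "point set"
  assumes "classical_enriques_fano W"
  shows "generally 13 W (\<lambda>w.
    mp.dim (triple_point_system 13 W w) = 3 + 1 \<and>
    (\<forall>b. is_basis b 3 (triple_point_system 13 W w) \<longrightarrow>
       generally 3 (proj 3) (\<lambda>C. \<forall>c\<in>C. \<exists>n R.
         elliptic_ruled_surface n R \<and>
         birational 13 (hyp_section 13 W (\<Sum>i\<le>3. scale (c i) (b i))) n R) \<and>
       cayley_cubic (rational_image 13 3 W b) \<and>
       four_nodal_cubic_surface (rational_image 13 3 W b)))"
proof -
  obtain B B' where "frame B B' W" using frame_exists[OF assms] .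
  then interpret frame B B' W .
  \<comment> \<open>The general point is one with all fourteen toric coordinates nonzero, that is, a
    point of the torus of W.\<close>
  have h: "hform 13 (\<Sum>k\<le>13 :: nat. 1) (\<lambda>x. \<Prod>k\<le>13. X x k)" by (intro hform_prod hform_X)
  show ?thesis
  proof (rule generallyI[OF h _ _ W_subset])
    show "pt (vl (tv (\<lambda>_. 1))) \<in> W" by (rule torus_in_W) simp
    show "(\<Prod>k\<le>13. X (vl (tv (\<lambda>_. 1))) k) \<noteq> 0" by (simp add: X_vl)
    fix x assume x: "pt x \<in> W" "(\<Prod>k\<le>13. X x k) \<noteq> 0"
    then have "X x k \<noteq> 0" if "k \<le> 13" for k using that by auto
    then obtain s g where s: "torus s" "g \<noteq> 0" "x = (\<lambda>i. g * vl (tv s) i)" using W_torus[OF x(1)] by metis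
    then have w: "pt x = pt (vl (tv s))" by simp
    \<comment> \<open>A second frame for the same W, rescaled by s, in which the given point is the
      base point.\<close>
    interpret w: frame "\<lambda>i k. B i k * tv s k" "\<lambda>k i. B' k i / tv s k" W by (rule frame_rescale(1)[OF s(1)])
    note t = w.triple_point_at_origin[unfolded frame_rescale(2)[OF s(1)]]
    show "mp.dim (triple_point_system 13 W (pt x)) = 3 + 1 \<and>
      (\<forall>b. is_basis b 3 (triple_point_system 13 W (pt x)) \<longrightarrow>
       generally 3 (proj 3) (\<lambda>C. \<forall>c\<in>C. \<exists>n R.
         elliptic_ruled_surface n R \<and>
         birational 13 (hyp_section 13 W (\<Sum>i\<le>3. scale (c i) (b i))) n R) \<and>
       cayley_cubic (rational_image 13 3 W b) \<and>
       four_nodal_cubic_surface (rational_image 13 3 W b))"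
      unfolding w by (intro conjI allI impI t)
  qed
qed

end
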